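(* Let $B_R(0)\subset\mathbb{R}^2$ be the disk of radius $R$ centred at the origin, let $k$ be the wave number, let $\alpha>0$ be a constant impedance parameter, and let $x_0\in B_R(0)$. The Robin Green's function for the Helmholtz equation on the disk $B_R(0)$, i.e. the function $G$ satisfying $$\begin{cases}\Delta G(x,x_0)+k^2G(x,x_0)=-\delta(x-x_0), & x\in B_R(0),\\[4pt] \dfrac{\partial G(x,x_0)}{\partial n}+\alpha G(x,x_0)=0, & x\in\partial B_R(0),\end{cases}$$ is given, in polar coordinates $x=(r,\theta)$, $x_0=(r_0,\theta_0)$, by $$G(x,x_{0}) =\frac{i}{4}H_{0}^{(1)}(k|x-x_{0}|)-\frac{i}{4}\sum_{n=-\infty}^{\infty} \frac{\mathcal{B}[H_{n}^{(1)}(kr)]}{\mathcal{B}[J_{n}(kr)]}\, J_{n}(kr_{0})\,J_{n}(kr)\,e^{in(\theta-\theta_{0})},$$ where $$\mathcal{B}[J_{n}(kr)] = \left(\alpha + \frac{n}{R}\right)J_{n}(kR) - kJ_{n+1}(kR),\qquad \mathcal{B}[H_{n}^{(1)}(kr)] = \left(\alpha + \frac{n}{R}\right)H_{n}^{(1)}(kR) - kH_{n+1}^{(1)}(kR).$$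
   Context: $J_n$ and $H_n^{(1)}$ denote the Bessel function of the first kind and the Hankel function of the first kind of order $n$. $\delta$ is the Dirac delta function and $x_0$ is the fixed source point. $\partial/\partial n$ is the derivative in $x$ along the unit outer normal to $\partial B_R(0)$ (elsewhere $n$ is the integer summation index). $\mathcal{B}=\partial_r+\alpha$, evaluated at $r=|x|=R$, is the Robin boundary operator, so $\mathcal{B}[J_n(kr)]$ and $\mathcal{B}[H_n^{(1)}(kr)]$ are constants: the Robin traces at $r=R$ of $r\mapsto J_n(kr)$ and $r\mapsto H_n^{(1)}(kr)$.
   Formalization: The formal statement adds the hypothesis that B[J_n(kr)] is nonzero for every integer n, i.e. k^2 is not a Robin eigenvalue of the disk; otherwise the quotient in the series is undefined and the Green's function fails to exist or to be unique. *)

theory Defs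
  imports "HOL-Analysis.Analysis"
begin

definition bessel_J_nat :: "nat \<Rightarrow> real \<Rightarrow> real" where
  "bessel_J_nat n x =
     (\<Sum>p. (-1) ^ p / (fact p * fact (n + p)) * (x / 2) ^ (n + 2 * p))"

text \<open>Bessel function of the second kind for \<open>x > 0\<close>, in the classical normalisation
  \<open>Y\<^sub>n(x) = lim\<^bsub>\<nu>\<rightarrow>n\<^esub> (J\<^sub>\<nu>(x) cos \<nu>\<pi> - J\<^sub>-\<^sub>\<nu>(x)) / sin \<nu>\<pi>\<close>.
  Here \<open>harm p = 1 + 1/2 + \<dots> + 1/p\<close>, and \<open>(2/x)^n * (x/2)^(2p)\<close> is \<open>(2/x)\<close> to the
  possibly negative power \<open>n - 2p\<close>.\<close>

definition bessel_Y_nat :: "nat \<Rightarrow> real \<Rightarrow> real" where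
  "bessel_Y_nat n x =
     2 / pi * (ln (x / 2) + euler_mascheroni) * bessel_J_nat n x
     - 1 / pi * (\<Sum>p<n. fact (n - 1 - p) / fact p * ((2 / x) ^ n * (x / 2) ^ (2 * p)))
     - 1 / pi * (\<Sum>p. (-1) ^ p / (fact p * fact (n + p)) * (x / 2) ^ (n + 2 * p)
                        * (harm (n + p) + harm p))"

definition bessel_J :: "int \<Rightarrow> real \<Rightarrow> real" where
  "bessel_J n x =
     (if n \<ge> 0 then bessel_J_nat (nat n) x else (-1) ^ nat (- n) * bessel_J_nat (nat (- n)) x)"

definition bessel_Y :: "int \<Rightarrow> real \<Rightarrow> real" where
  "bessel_Y n x =
     (if n \<ge> 0 then bessel_Y_nat (nat n) x else (-1) ^ nat (- n) * bessel_Y_nat (nat (- n)) x)"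

definition hankel1 :: "int \<Rightarrow> real \<Rightarrow> complex" where
  "hankel1 n x = Complex (bessel_J n x) (bessel_Y n x)"

definition partial_deriv :: "'n \<Rightarrow> (real ^ 'n \<Rightarrow> complex) \<Rightarrow> real ^ 'n \<Rightarrow> complex" where
  "partial_deriv i f x = frechet_derivative f (at x) (axis i 1)"

definition laplacian :: "(real ^ 'n \<Rightarrow> complex) \<Rightarrow> real ^ 'n \<Rightarrow> complex" where
  "laplacian f x = (\<Sum>i\<in>UNIV. partial_deriv i (partial_deriv i f) x)"

text \<open>Total differentiability makes each iterated partial derivative continuous, so this is \<open>C\<^sup>\<infinity>\<close>.\<close>

definition smooth :: "(real ^ 'n \<Rightarrow> complex) \<Rightarrow> bool" where
  "smooth f \<longleftrightarrow> (\<forall>is. foldr partial_deriv is f differentiable_on UNIV)"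

definition test_function :: "(real ^ 'n) set \<Rightarrow> (real ^ 'n \<Rightarrow> complex) \<Rightarrow> bool" where
  "test_function \<Omega> \<phi> \<longleftrightarrow>
     smooth \<phi> \<and> compact (closure {x. \<phi> x \<noteq> 0}) \<and> closure {x. \<phi> x \<noteq> 0} \<subseteq> \<Omega>"

definition locally_integrable_on ::
    "(real ^ 'n \<Rightarrow> complex) \<Rightarrow> (real ^ 'n) set \<Rightarrow> bool" (infixr "locally'_integrable'_on" 46) where
  "u locally_integrable_on \<Omega> \<longleftrightarrow> (\<forall>K. compact K \<and> K \<subseteq> \<Omega> \<longrightarrow> u absolutely_integrable_on K)"

text \<open>\<open>\<Delta>u + k\<^sup>2 u = -\<delta>(\<cdot> - x\<^sub>0)\<close> as distributions on \<open>\<Omega>\<close>, for the regular distribution given by \<open>u\<close>.\<close>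

definition helmholtz_point_source ::
    "(real ^ 'n) set \<Rightarrow> real \<Rightarrow> real ^ 'n \<Rightarrow> (real ^ 'n \<Rightarrow> complex) \<Rightarrow> bool" where
  "helmholtz_point_source \<Omega> k x\<^sub>0 u \<longleftrightarrow>
     u locally_integrable_on \<Omega> \<and>
     (\<forall>\<phi>. test_function \<Omega> \<phi> \<longrightarrow>
        (LINT x:\<Omega>|lebesgue. u x * (laplacian \<phi> x + of_real (k\<^sup>2) * \<phi> x)) = - \<phi> x\<^sub>0)"

text \<open>On a set such as a punctured closed disk, whose points are all limits of interior points in
  two independent directions, this says that \<open>f\<close> is \<open>C\<^sup>1\<close> up to the boundary.\<close>

definition C1_on :: "'a set \<Rightarrow> ('a::real_normed_vector \<Rightarrow> 'b::real_normed_vector) \<Rightarrow> bool" where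
  "C1_on S f \<longleftrightarrow>
     (\<exists>D :: 'a \<Rightarrow> 'a \<Rightarrow>\<^sub>L 'b. continuous_on S D \<and>
        (\<forall>x\<in>S. (f has_derivative blinfun_apply (D x)) (at x within S)))"

text \<open>For \<open>x\<close> on the circle of radius \<open>R\<close> about the origin the outer unit normal is \<open>x / R\<close>; the
  derivative along it is one-sided, as \<open>u\<close> only matters on the closed disk.\<close>

definition disk_normal_derivative :: "real \<Rightarrow> (real ^ 2 \<Rightarrow> complex) \<Rightarrow> real ^ 2 \<Rightarrow> complex" where
  "disk_normal_derivative R u x =
     vector_derivative (\<lambda>s. u (x + s *\<^sub>R (x /\<^sub>R R))) (at 0 within {..0})"

definition robin_green_function ::
    "real \<Rightarrow> real \<Rightarrow> real \<Rightarrow> real ^ 2 \<Rightarrow> (real ^ 2 \<Rightarrow> complex) \<Rightarrow> bool" where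
  "robin_green_function R k \<alpha> x\<^sub>0 G \<longleftrightarrow>
     C1_on (cball 0 R - {x\<^sub>0}) G \<and>
     helmholtz_point_source (ball 0 R) k x\<^sub>0 G \<and>
     (\<forall>x\<in>sphere 0 R. disk_normal_derivative R G x + of_real \<alpha> * G x = 0)"

definition robin_trace :: "real \<Rightarrow> real \<Rightarrow> (real \<Rightarrow> complex) \<Rightarrow> complex" where
  "robin_trace \<alpha> R f = vector_derivative f (at R) + of_real \<alpha> * f R"

definition polar :: "real \<Rightarrow> real \<Rightarrow> real ^ 2" where
  "polar r \<theta> = vector [r * cos \<theta>, r * sin \<theta>]"

end

theory Submission
  imports Defs
begin

text \<open>Write \<open>G\<^sub>0\<close> for the right-hand side of the formula. The free source \<open>i/4 H\<^sub>0(k|x - x\<^sub>0|)\<close> satisfies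
  the equation with \<open>-\<delta>\<close> because of the logarithm in \<open>Y\<^sub>0\<close>, and its Fourier coefficients on circles
  about the origin are the products \<open>J\<^sub>n(k r\<^sub>0) H\<^sub>n(k r)\<close> (Graf's addition theorem). The ratios
  \<open>B[H\<^sub>n] / B[J\<^sub>n]\<close> grow at most like \<open>(n + 1) (n!)\<^sup>2 (2/(kR))\<^sup>2\<^sup>n\<close>, so the series converges in \<open>C\<^sup>1\<close> on the
  closed disk like a geometric series with ratio \<open>r\<^sub>0 / R\<close>; its terms are entire solutions. On the boundary
  each Fourier coefficient of \<open>G\<^sub>0\<close> satisfies the Robin condition, since
  \<open>B[H\<^sub>n] - (B[H\<^sub>n] / B[J\<^sub>n]) B[J\<^sub>n] = 0\<close>.

  For uniqueness, let \<open>w\<close> be the difference of two solutions. Testing the weak equation with a radial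
  solution times a smooth step shows that the Wronskian, in \<open>r\<close>, of its \<open>n\<close>-th circle mean with \<open>J\<^sub>n\<close> vanishes
  (\<open>J\<^sub>n\<close> is regular, so the step may be 1 near the origin), and that the Wronskian with \<open>Y\<^sub>n\<close> agrees at any two
  radii (take the difference of two steps), even across the circle through \<open>x\<^sub>0\<close>. So the circle mean is a multiple
  \<open>c J\<^sub>n(k r)\<close>, and the Robin condition gives \<open>c B[J\<^sub>n] = 0\<close>.\<close>

subsection \<open>Bessel--Clifford functions\<close>

text \<open>The obstacle is regularity: a competing solution is only \<open>C1_on\<close> the
  punctured closed disk and solves the equation against test functions, so the Bessel equation for
  its circle means cannot be found by differentiating twice. A Wronskian in the radius needs one
  derivative of the mean only; testing yields it averaged against the derivative of a step, and
  shrinking the step yields it at a point. The same argument gives the addition theorem: inside the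
  circle through the source the free source is itself source-free, so its mean is a multiple of
  \<open>J\<^sub>n(k r)\<close>, and a Taylor expansion on small circles finds the multiple. The
  \<open>-\<delta>\<close> arises from \<open>\<i>/4 * \<i> * (2\<pi> * 2/\<pi>) = -1\<close>: the
  flux \<open>r f'(r)\<close> of \<open>Y\<^sub>0(k r)\<close> tends to \<open>2/\<pi>\<close>. Of
  the two factorials in the bound for the ratios one comes from the trace of
  \<open>Y\<^sub>n\<close>, the other from the reciprocal trace of \<open>J\<^sub>n\<close>; the
  product \<open>J\<^sub>n(k r\<^sub>0) J\<^sub>n(k r)\<close> supplies
  \<open>1/(n!)\<^sup>2\<close> against them. Functions of \<open>x\<^sup>2/4\<close> keep regular
  solutions smooth at the origin, where polar coordinates degenerate.\<close>

text \<open>The Bessel functions of order \<open>n\<close> are \<open>(x / 2)^n\<close> times the functions \<open>clifford_J n\<close>,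
  \<open>clifford_Y n\<close> of \<open>x\<^sup>2 / 4\<close>. In this normalisation the recurrences lose their signs and powers.\<close>

definition clifford_J :: "nat \<Rightarrow> real \<Rightarrow> real" where
  "clifford_J n t = (\<Sum>p. (-1) ^ p / (fact p * fact (n + p)) * t ^ p)"

definition clifford_H :: "nat \<Rightarrow> real \<Rightarrow> real" where
  "clifford_H n t = (\<Sum>p. (-1) ^ p / (fact p * fact (n + p)) * (harm (n + p) + harm p) * t ^ p)"

definition clifford_P :: "nat \<Rightarrow> real \<Rightarrow> real" where
  "clifford_P n t = (\<Sum>p<n. fact (n - 1 - p) / fact p * t ^ p / t ^ n)"

text \<open>With \<open>t = x\<^sup>2/4\<close> one has \<open>ln t = 2 ln (x/2)\<close>, hence the
  doubled Euler constant. \<open>clifford_P\<close> is the principal part at \<open>0\<close>,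
  \<open>clifford_H\<close> the harmonic-number series; separately each violates the recurrences by
  a correction term, and the corrections cancel in this combination.\<close>

definition clifford_Y :: "nat \<Rightarrow> real \<Rightarrow> real" where
  "clifford_Y n t =
     ((ln t + 2 * euler_mascheroni) * clifford_J n t - clifford_P n t - clifford_H n t) / pi"

lemma harm_le_real: "harm n \<le> real n"
proof (induction n)
  case (Suc n)
  have "inverse (real (Suc n)) \<le> 1"
    by (simp add: field_simps)
  with Suc show ?case
    unfolding harm_Suc by simp
qed (simp add: harm_def)

text \<open>The crude bounds \<open>harm m \<le> m \<le> m!\<close> cancel
  \<open>fact (n + p)\<close>. The result does not decay in \<open>n\<close>, which is enough: in
  \<open>clifford_Y\<close> the part \<open>clifford_P\<close> grows factorially anyway.\<close>

lemma clifford_coeff_bound: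
  "\<bar>(-1) ^ p / (fact p * fact (n + p)) * (harm (n + p) + harm p)\<bar> \<le> 2 / (fact p :: real)"
proof -
  have h: "harm (n + p) + harm p \<le> 2 * real (n + p)"
    using harm_le_real[of "n + p"] harm_le_real[of p] by simp
  have "real (n + p) \<le> fact (n + p)"
    using fact_ge_self[of "n + p"] by (metis of_nat_fact of_nat_le_iff)
  then have "harm (n + p) + harm p \<le> 2 * (fact (n + p) :: real)"
    using h by (smt (verit))
  then have "(harm (n + p) + harm p) / (fact p * fact (n + p)) \<le> 2 * fact (n + p) / (fact p * fact (n + p) :: real)"
    by (intro divide_right_mono) auto
  then show ?thesis
    by (simp add: abs_mult abs_divide harm_nonneg)
qed

lemma summable_exp_bound:
  fixes c :: "nat \<Rightarrow> real"
  assumes "\<And>p. \<bar>c p\<bar> \<le> C / fact p"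
  shows "summable (\<lambda>p. c p * t ^ p)" and "\<bar>\<Sum>p. c p * t ^ p\<bar> \<le> C * exp \<bar>t\<bar>"
proof -
  have s: "(\<lambda>p. C * (\<bar>t\<bar> ^ p /\<^sub>R fact p)) sums (C * exp \<bar>t\<bar>)"
    by (intro sums_mult exp_converges)
  have b: "norm (c p * t ^ p) \<le> C * (\<bar>t\<bar> ^ p /\<^sub>R fact p)" for p
    using mult_right_mono[OF assms[of p], of "\<bar>t\<bar> ^ p"]
    by (simp add: abs_mult power_abs field_simps)
  show "summable (\<lambda>p. c p * t ^ p)"
    by (rule summable_comparison_test'[OF sums_summable[OF s] b])
  show "\<bar>\<Sum>p. c p * t ^ p\<bar> \<le> C * exp \<bar>t\<bar>"
    using norm_suminf_le[OF b sums_summable[OF s]] s by (simp add: sums_iff)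
qed

text \<open>The factor \<open>1 / fact n\<close> is kept, unlike for \<open>clifford_H\<close>: it
  is what makes the series over the orders converge.\<close>

lemma clifford_J_coeff_bound: "\<bar>(-1) ^ p / (fact p * fact (n + p))\<bar> \<le> (1 / fact n) / (fact p :: real)"
proof -
  have "(fact n :: real) \<le> fact (n + p)"
    by (rule fact_mono) simp
  then show ?thesis
    by (simp add: abs_divide abs_mult field_simps)
qed

lemmas summable_clifford_J = summable_exp_bound(1)[OF clifford_J_coeff_bound]
lemmas summable_clifford_H = summable_exp_bound(1)[OF clifford_coeff_bound]

lemma clifford_J_bound: "\<bar>clifford_J n t\<bar> \<le> exp \<bar>t\<bar> / fact n"
  using summable_exp_bound(2)[OF clifford_J_coeff_bound] by (simp add: clifford_J_def)

lemma clifford_H_bound: "\<bar>clifford_H n t\<bar> \<le> 2 * exp \<bar>t\<bar>"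
  using summable_exp_bound(2)[OF clifford_coeff_bound] by (simp add: clifford_H_def)

lemma clifford_J_0: "clifford_J n 0 = 1 / fact n"
  unfolding clifford_J_def by (subst suminf_finite[of "{0}"]) auto

text \<open>Valid for every real \<open>t\<close>, also for \<open>t \<le> 0\<close>; this is what
  lets solutions of the first kind enter test functions that do not vanish near the origin.\<close>

lemma clifford_J_deriv: "(clifford_J n has_real_derivative - clifford_J (Suc n) t) (at t)"
proof -
  let ?c = "\<lambda>n p. (-1) ^ p / (fact p * fact (n + p)) :: real"
  have "((\<lambda>t. \<Sum>p. ?c n p * t ^ p) has_real_derivative (\<Sum>p. diffs (?c n) p * t ^ p)) (at t)"
    by (intro termdiffs_strong_converges_everywhere summable_clifford_J)
  moreover have "diffs (?c n) p = - ?c (Suc n) p" for p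
  proof -
    have "diffs (?c n) p = real (Suc p) * (- ((-1) ^ p) / ((real (Suc p) * fact p) * fact (Suc n + p)))"
      unfolding diffs_def fact_Suc[of p] by (simp del: fact_Suc of_nat_Suc)
    also have "\<dots> = - ?c (Suc n) p"
      by (simp del: fact_Suc of_nat_Suc)
    finally show ?thesis .
  qed
  ultimately show ?thesis
    unfolding clifford_J_def[abs_def]
    using summable_clifford_J[of "Suc n" t] by (simp add: suminf_minus del: fact_Suc)
qed

text \<open>Rests on \<open>(n + 1 + p) / (n + 1 + p)! = 1 / (n + p)!\<close>: the summand
  \<open>n + 1\<close> gives the first term, and the summand \<open>p\<close>, cancelled against
  \<open>p!\<close> and followed by an index shift, gives the second.\<close>

lemma clifford_J_rec: "clifford_J n t = (real n + 1) * clifford_J (Suc n) t - t * clifford_J (Suc (Suc n)) t"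
proof -
  let ?c = "\<lambda>n p. (-1) ^ p / (fact p * fact (n + p)) :: real"
  have s1: "(\<lambda>p. ?c (Suc n) p * t ^ p) sums clifford_J (Suc n) t"
    unfolding clifford_J_def by (intro summable_sums summable_clifford_J)
  have s2: "(\<lambda>p. ?c (Suc (Suc n)) p * t ^ p) sums clifford_J (Suc (Suc n)) t"
    unfolding clifford_J_def by (intro summable_sums summable_clifford_J)
  have "(\<lambda>p. real (Suc p) * ?c (Suc n) (Suc p) * t ^ Suc p) sums (- t * clifford_J (Suc (Suc n)) t)"
  proof -
    have "real (Suc p) * ?c (Suc n) (Suc p) * t ^ Suc p = - t * (?c (Suc (Suc n)) p * t ^ p)" for p
      by (subst fact_Suc[of p]) (simp del: fact_Suc of_nat_Suc)
    then show ?thesis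
      using sums_mult[OF s2, of "- t"] by (simp del: fact_Suc of_nat_Suc)
  qed
  then have "(\<lambda>p. real p * ?c (Suc n) p * t ^ p) sums (- t * clifford_J (Suc (Suc n)) t)"
    by (subst (asm) sums_Suc_iff) simp
  from sums_add[OF sums_mult[OF s1, of "real n + 1"] this]
  have "(\<lambda>p. (real n + 1 + real p) * ?c (Suc n) p * t ^ p) sums
      ((real n + 1) * clifford_J (Suc n) t - t * clifford_J (Suc (Suc n)) t)"
    by (simp only: mult.assoc distrib_right[symmetric]) simp
  moreover have "(real n + 1 + real p) * ?c (Suc n) p = ?c n p" for p
  proof -
    have e: "(real n + 1 + real p) = real (Suc (n + p))" by simp
    show ?thesis unfolding e by (simp del: of_nat_Suc)
  qed
  ultimately have "(\<lambda>p. ?c n p * t ^ p) sums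
      ((real n + 1) * clifford_J (Suc n) t - t * clifford_J (Suc (Suc n)) t)"
    by (simp only:)
  then show ?thesis
    unfolding clifford_J_def[of n] by (rule sums_unique[symmetric])
qed

text \<open>Differentiating \<open>t ^ p / t ^ n\<close> turns \<open>(n - 1 - p)!\<close> into
  \<open>- (n - p)!\<close>, so the result is \<open>- clifford_P (Suc n)\<close> without its last
  term \<open>p = n\<close>. That term is \<open>1 / (n! t)\<close>; it cancels later against the
  correction in \<open>clifford_H_deriv\<close>.\<close>

lemma clifford_P_deriv:
  assumes "t > 0"
  shows "(clifford_P n has_real_derivative 1 / (fact n * t) - clifford_P (Suc n) t) (at t)"
proof -
  have eq: "clifford_P n = (\<lambda>t. \<Sum>p<n. fact (n - 1 - p) / fact p * t ^ p / t ^ n)"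
    by (rule ext) (simp add: clifford_P_def)
  have "((\<lambda>t. \<Sum>p<n. fact (n - 1 - p) / fact p * t ^ p / t ^ n) has_real_derivative
     (\<Sum>p<n. - fact (n - p) / fact p * t ^ p / t ^ Suc n)) (at t)"
  proof (rule DERIV_sum)
    fix p assume "p \<in> {..<n}"
    then have p: "p < n" by simp
    then obtain m where m: "n = Suc (p + m)"
      using less_iff_Suc_add by auto
    have d: "((\<lambda>t. fact m / fact p * (1 / t ^ Suc m)) has_real_derivative
        fact m / fact p * (- real (Suc m) / t ^ Suc (Suc m))) (at t)"
      unfolding inverse_eq_divide[symmetric]
      by (rule DERIV_cong[OF DERIV_cmult[OF DERIV_inverse_fun[OF DERIV_pow]]]) (use assms in \<open>auto simp: field_simps\<close>)
    have e: "fact m / fact p * (- real (Suc m) / t ^ Suc (Suc m)) =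
        - fact (n - p) / fact p * t ^ p / t ^ Suc n"
      using assms by (simp add: m power_add field_simps)
    have ev: "\<forall>\<^sub>F t in nhds t. fact m / fact p * (1 / t ^ Suc m) = fact (n - 1 - p) / fact p * t ^ p / t ^ n"
      using eventually_nhds_in_open[of "{0<..}" t] assms
      by (auto elim!: eventually_mono simp: m power_add field_simps)
    show "((\<lambda>t. fact (n - 1 - p) / fact p * t ^ p / t ^ n) has_real_derivative
        - fact (n - p) / fact p * t ^ p / t ^ Suc n) (at t)"
      by (rule iffD1[OF DERIV_cong_ev[OF refl ev e] d])
  qed
  moreover have "(\<Sum>p<n. - fact (n - p) / fact p * t ^ p / t ^ Suc n) = 1 / (fact n * t) - clifford_P (Suc n) t"
    using assms by (simp add: clifford_P_def sum_negf)
  ultimately show ?thesis by (simp add: eq)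
qed

text \<open>The sums combine by \<open>(n + 1) (n - p)! - (n + 1 - p)! = p (n - p)!\<close>; the
  factor \<open>p\<close> kills the term \<open>p = 0\<close>, and an index shift gives
  \<open>clifford_P n\<close>. The extra \<open>1 / (n + 1)!\<close> is the last term of
  \<open>t * clifford_P (n + 2)\<close>, whose range is longer by one.\<close>

lemma clifford_P_rec:
  assumes "t > 0"
  shows "clifford_P n t = (real n + 1) * clifford_P (Suc n) t - t * clifford_P (Suc (Suc n)) t + 1 / fact (Suc n)"
proof -
  have P2: "t * clifford_P (Suc (Suc n)) t = (\<Sum>p<Suc n. fact (Suc n - p) / fact p * t ^ p / t ^ Suc n) + 1 / fact (Suc n)"
  proof -
    have "t * clifford_P (Suc (Suc n)) t = (\<Sum>p<Suc (Suc n). fact (Suc n - p) / fact p * t ^ p / t ^ Suc n)"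
      unfolding clifford_P_def sum_distrib_left using assms by (intro sum.cong refl) simp
    then show ?thesis
      using assms by (simp only: sum.lessThan_Suc[of _ "Suc n"]) simp
  qed
  have "(real n + 1) * clifford_P (Suc n) t - (t * clifford_P (Suc (Suc n)) t - 1 / fact (Suc n))
     = (\<Sum>p<Suc n. (real n + 1) * (fact (n - p) / fact p * t ^ p / t ^ Suc n)) -
       (\<Sum>p<Suc n. fact (Suc n - p) / fact p * t ^ p / t ^ Suc n)"
    unfolding P2 sum_distrib_left[symmetric] by (simp add: clifford_P_def)
  also have "\<dots> = (\<Sum>p<Suc n. real p * (fact (n - p) / fact p * t ^ p / t ^ Suc n))"
    unfolding sum_subtractf[symmetric]
  proof (rule sum.cong)
    fix p assume "p \<in> {..<Suc n}"
    then obtain m where m: "n = p + m"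
      using le_Suc_ex by (auto simp: less_Suc_eq_le)
    show "(real n + 1) * (fact (n - p) / fact p * t ^ p / t ^ Suc n) - fact (Suc n - p) / fact p * t ^ p / t ^ Suc n
        = real p * (fact (n - p) / fact p * t ^ p / t ^ Suc n)"
      using assms by (simp add: m field_simps)
  qed simp
  also have "\<dots> = (\<Sum>p<n. real (Suc p) * (fact (n - Suc p) / fact (Suc p) * t ^ Suc p / t ^ Suc n))"
    by (simp add: sum.lessThan_Suc_shift del: of_nat_Suc power_Suc sum.lessThan_Suc)
  also have "\<dots> = clifford_P n t"
    unfolding clifford_P_def using assms
    unfolding fact_Suc by (intro sum.cong refl) (simp del: of_nat_Suc)
  finally show ?thesis by simp
qed

text \<open>\<open>harm (p + 1) = harm p + 1 / (p + 1)\<close>: the first part reproduces the series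
  for \<open>n + 1\<close>, the second is the series of \<open>clifford_J n\<close> without its
  constant term, divided by \<open>t\<close>.\<close>

lemma clifford_H_deriv:
  assumes "t > 0"
  shows "(clifford_H n has_real_derivative - clifford_H (Suc n) t + (clifford_J n t - 1 / fact n) / t) (at t)"
proof -
  let ?c = "\<lambda>n p. (-1) ^ p / (fact p * fact (n + p)) :: real"
  let ?h = "\<lambda>n p. ?c n p * (harm (n + p) + harm p) :: real"
  have "((\<lambda>t. \<Sum>p. ?h n p * t ^ p) has_real_derivative (\<Sum>p. diffs (?h n) p * t ^ p)) (at t)"
    by (intro termdiffs_strong_converges_everywhere summable_clifford_H)
  moreover have "(\<lambda>p. diffs (?h n) p * t ^ p) sums (- clifford_H (Suc n) t + (clifford_J n t - 1 / fact n) / t)"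
  proof -
    have d: "diffs (?h n) p * t ^ p = - (?h (Suc n) p * t ^ p) + (?c n (Suc p) * t ^ Suc p) / t" for p
    proof -
      have "diffs (?h n) p = real (Suc p) * (- ((-1) ^ p) / ((real (Suc p) * fact p) * fact (Suc n + p)) *
          (harm (Suc n + p) + (harm p + 1 / real (Suc p))))"
        unfolding diffs_def fact_Suc[of p] by (simp add: harm_Suc inverse_eq_divide field_simps del: fact_Suc of_nat_Suc)
      also have "\<dots> = - ?h (Suc n) p - ((-1) ^ p) / ((real (Suc p) * fact p) * fact (Suc n + p))"
        by (simp add: field_simps del: fact_Suc of_nat_Suc)
      also have "((-1) ^ p) / ((real (Suc p) * fact p) * fact (Suc n + p)) = - ?c n (Suc p)"
        by (simp del: fact_Suc of_nat_Suc) (simp only: fact_Suc[of p])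
      finally have e: "diffs (?h n) p = - ?h (Suc n) p - - ?c n (Suc p)" .
      have "(- h - - c) * t ^ p = - (h * t ^ p) + (c * t ^ Suc p) / t" for h c :: real
        using assms by (simp add: field_simps)
      then show ?thesis
        unfolding e by this
    qed
    have s1: "(\<lambda>p. ?h (Suc n) p * t ^ p) sums clifford_H (Suc n) t"
      unfolding clifford_H_def by (intro summable_sums summable_clifford_H)
    have "(\<lambda>p. ?c n p * t ^ p) sums clifford_J n t"
      unfolding clifford_J_def by (intro summable_sums summable_clifford_J)
    then have s2: "(\<lambda>p. ?c n (Suc p) * t ^ Suc p) sums (clifford_J n t - 1 / fact n)"
      by (subst sums_Suc_iff) simp
    show ?thesis
      unfolding d by (intro sums_add sums_minus s1 sums_divide s2)
  qed
  ultimately show ?thesis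
    unfolding clifford_H_def[abs_def] by (simp add: sums_iff)
qed

text \<open>Left unsimplified so that the two corrections stay visible: shifting
  \<open>harm p\<close> to \<open>harm (p + 1)\<close> contributes the bracket, and
  \<open>harm (n + 1 + p)\<close> in place of \<open>harm (n + p)\<close> the last term. Their sum
  \<open>- 1 / (n + 1)!\<close> cancels the correction in \<open>clifford_P_rec\<close>.\<close>

lemma clifford_H_rec:
  "clifford_H n t = (real n + 1) * clifford_H (Suc n) t - t * clifford_H (Suc (Suc n)) t
     + (clifford_J (Suc n) t - 1 / fact (Suc n)) - clifford_J (Suc n) t"
  if "t > 0"
proof -
  let ?c = "\<lambda>n p. (-1) ^ p / (fact p * fact (n + p)) :: real"
  let ?h = "\<lambda>n p. ?c n p * (harm (n + p) + harm p) :: real"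
  have s0: "(\<lambda>p. ?h n p * t ^ p) sums clifford_H n t" for n
    unfolding clifford_H_def by (intro summable_sums summable_clifford_H)
  have sJ: "(\<lambda>p. ?c n p * t ^ p) sums clifford_J n t" for n
    unfolding clifford_J_def by (intro summable_sums summable_clifford_J)
  have "(\<lambda>p. real (Suc p) * ?h (Suc n) (Suc p) * t ^ Suc p) sums
      (- t * clifford_H (Suc (Suc n)) t + (clifford_J (Suc n) t - 1 / fact (Suc n)))"
  proof -
    have *: "real (Suc p) * ?h (Suc n) (Suc p) * t ^ Suc p
        = - t * (?h (Suc (Suc n)) p * t ^ p) + ?c (Suc n) (Suc p) * t ^ Suc p" for p
    proof -
      have "real (Suc p) * ?h (Suc n) (Suc p) = real (Suc p) * (- ((-1) ^ p) / ((real (Suc p) * fact p) * fact (Suc (Suc n) + p)) *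
          (harm (Suc (Suc n) + p) + (harm p + 1 / real (Suc p))))"
        unfolding fact_Suc[of p] by (simp add: harm_Suc inverse_eq_divide field_simps del: fact_Suc of_nat_Suc)
      also have "\<dots> = - ?h (Suc (Suc n)) p - ((-1) ^ p) / ((real (Suc p) * fact p) * fact (Suc (Suc n) + p))"
        by (simp add: field_simps del: fact_Suc of_nat_Suc)
      also have "((-1) ^ p) / ((real (Suc p) * fact p) * fact (Suc (Suc n) + p)) = - ?c (Suc n) (Suc p)"
        by (simp del: fact_Suc of_nat_Suc) (simp only: fact_Suc[of p])
      finally have e: "real (Suc p) * ?h (Suc n) (Suc p) = - ?h (Suc (Suc n)) p - - ?c (Suc n) (Suc p)" .
      have "(- h - - c) * t ^ Suc p = - t * (h * t ^ p) + c * t ^ Suc p" for h c :: real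
        by (simp add: field_simps)
      then show ?thesis
        unfolding e by this
    qed
    have s2: "(\<lambda>p. ?c (Suc n) (Suc p) * t ^ Suc p) sums (clifford_J (Suc n) t - 1 / fact (Suc n))"
      using sJ[of "Suc n"] by (subst sums_Suc_iff) simp
    show ?thesis
      unfolding * by (intro sums_add sums_mult s0 s2)
  qed
  then have "(\<lambda>p. real p * ?h (Suc n) p * t ^ p) sums
      (- t * clifford_H (Suc (Suc n)) t + (clifford_J (Suc n) t - 1 / fact (Suc n)))"
    by (subst (asm) sums_Suc_iff) simp
  from sums_add[OF sums_mult[OF s0[of "Suc n"], of "real n + 1"] this]
  have "(\<lambda>p. (real n + 1 + real p) * ?h (Suc n) p * t ^ p) sums
      ((real n + 1) * clifford_H (Suc n) t + (- t * clifford_H (Suc (Suc n)) t + (clifford_J (Suc n) t - 1 / fact (Suc n))))"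
    by (simp only: mult.assoc distrib_right[symmetric])
  moreover have "(real n + 1 + real p) * ?h (Suc n) p * t ^ p = ?h n p * t ^ p + ?c (Suc n) p * t ^ p" for p
  proof -
    have e: "(real n + 1 + real p) = real (Suc (n + p))" by simp
    have "(real n + 1 + real p) * ?h (Suc n) p = (- 1) ^ p / (fact p * fact (n + p)) * (harm (n + p) + 1 / real (Suc (n + p)) + harm p)"
      unfolding e by (simp add: harm_Suc inverse_eq_divide del: of_nat_Suc)
    also have "\<dots> = ?h n p + ?c (Suc n) p"
      by (simp add: field_simps del: of_nat_Suc)
    finally show ?thesis by (simp add: algebra_simps)
  qed
  ultimately have "(\<lambda>p. ?h n p * t ^ p + ?c (Suc n) p * t ^ p) sums
      ((real n + 1) * clifford_H (Suc n) t + (- t * clifford_H (Suc (Suc n)) t + (clifford_J (Suc n) t - 1 / fact (Suc n))))"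
    by simp
  from sums_unique2[OF sums_add[OF s0[of n] sJ[of "Suc n"]] this] show ?thesis
    by simp
qed

lemma clifford_Y_deriv:
  assumes "t > 0"
  shows "(clifford_Y n has_real_derivative - clifford_Y (Suc n) t) (at t)"
proof -
  have eq: "clifford_Y n = (\<lambda>t. ((ln t + 2 * euler_mascheroni) * clifford_J n t - clifford_P n t - clifford_H n t) / pi)"
    by (rule ext) (simp add: clifford_Y_def)
  show ?thesis
    unfolding eq clifford_Y_def[of "Suc n"] using assms
    by (auto intro!: derivative_eq_intros clifford_J_deriv clifford_P_deriv clifford_H_deriv simp: field_simps)
qed

lemma clifford_Y_rec:
  assumes "t > 0"
  shows "clifford_Y n t = (real n + 1) * clifford_Y (Suc n) t - t * clifford_Y (Suc (Suc n)) t"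
proof -
  \<comment> \<open>The recurrence is pointwise in \<open>t\<close>, so the logarithmic factor may
    be any constant \<open>L\<close>.\<close>
  have "(L * clifford_J n t - clifford_P n t - clifford_H n t) =
      (real n + 1) * (L * clifford_J (Suc n) t - clifford_P (Suc n) t - clifford_H (Suc n) t) -
      t * (L * clifford_J (Suc (Suc n)) t - clifford_P (Suc (Suc n)) t - clifford_H (Suc (Suc n)) t)" for L
    unfolding clifford_J_rec[of n] clifford_P_rec[OF assms, of n] clifford_H_rec[OF assms, of n]
    by (simp add: algebra_simps del: fact_Suc)
  moreover have "A = b * B - c * C \<Longrightarrow> A / pi = b * (B / pi) - c * (C / pi)" for A B C b c :: real
    by (simp add: diff_divide_distrib)
  ultimately show ?thesis
    unfolding clifford_Y_def by blast
qed

text \<open>What the first and the second kind have in common. For \<open>z = z n\<close> the two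
  conditions together say \<open>t z'' + (n + 1) z' + z = 0\<close>, the Bessel equation in the
  variable \<open>t = x\<^sup>2/4\<close>. Only \<open>0 < t\<close> is asked for, as
  \<open>clifford_Y\<close> is singular at \<open>0\<close>.\<close>

definition clifford_seq :: "(nat \<Rightarrow> real \<Rightarrow> real) \<Rightarrow> bool" where
  "clifford_seq z \<longleftrightarrow> (\<forall>n t. 0 < t \<longrightarrow>
     (z n has_real_derivative - z (Suc n) t) (at t) \<and>
     z n t = (real n + 1) * z (Suc n) t - t * z (Suc (Suc n)) t)"

lemma clifford_seq_J: "clifford_seq clifford_J"
  unfolding clifford_seq_def by (intro allI impI conjI clifford_J_deriv clifford_J_rec)

lemma clifford_seq_Y: "clifford_seq clifford_Y"
  unfolding clifford_seq_def by (intro allI impI conjI clifford_Y_deriv clifford_Y_rec)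

lemma clifford_seq_deriv:
  assumes "clifford_seq z" "0 < t"
  shows "(z n has_real_derivative - z (Suc n) t) (at t)"
  by (rule conjunct1[OF assms(1)[unfolded clifford_seq_def, rule_format, OF assms(2)]])

lemma clifford_seq_rec:
  assumes "clifford_seq z" "0 < t"
  shows "z n t = (real n + 1) * z (Suc n) t - t * z (Suc (Suc n)) t"
  by (rule conjunct2[OF assms(1)[unfolded clifford_seq_def, rule_format, OF assms(2)]])

lemma clifford_seq_continuous: "clifford_seq z \<Longrightarrow> 0 < t \<Longrightarrow> isCont (z n) t"
  by (rule DERIV_isCont[OF clifford_seq_deriv])

lemma clifford_J_continuous: "isCont (clifford_J n) t"
  by (rule DERIV_isCont[OF clifford_J_deriv])

lemma clifford_H_continuous: "isCont (clifford_H n) t"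
  unfolding clifford_H_def[abs_def] by (intro isCont_powser_converges_everywhere summable_clifford_H)

lemma tendsto_mult_ln_at_right_0: "((\<lambda>t::real. t * ln t) \<longlongrightarrow> 0) (at_right 0)"
proof -
  have "((\<lambda>x::real. - (ln x / x)) \<longlongrightarrow> - 0) at_top"
    by (intro tendsto_minus ln_x_over_x_tendsto_0)
  then have "((\<lambda>t::real. - (ln (inverse t) / inverse t)) \<longlongrightarrow> 0) (at_right 0)"
    using filterlim_compose[OF _ filterlim_inverse_at_top_right] by fastforce
  moreover have "\<forall>\<^sub>F t::real in at_right 0. - (ln (inverse t) / inverse t) = t * ln t"
    using eventually_at_right_less[of "0::real"] by eventually_elim (simp add: ln_inverse ln_div field_simps)
  ultimately show ?thesis
    by (rule Lim_transform_eventually)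
qed

lemma tendsto_mult_clifford_JH:
  "((\<lambda>t. (t * (ln t + 2 * euler_mascheroni)) * clifford_J n t - t * clifford_H n t) \<longlongrightarrow> 0) (at_right 0)"
proof -
  have J: "(clifford_J n \<longlongrightarrow> clifford_J n 0) (at_right 0)" for n
    using clifford_J_continuous[of 0 n] by (auto simp: isCont_def filterlim_at_split)
  have H: "(clifford_H n \<longlongrightarrow> clifford_H n 0) (at_right 0)" for n
    using clifford_H_continuous[of 0 n] by (auto simp: isCont_def filterlim_at_split)
  have t: "((\<lambda>t::real. t) \<longlongrightarrow> 0) (at_right 0)"
    by (simp add: tendsto_ident_at)
  have "((\<lambda>t. (t * ln t + t * (2 * euler_mascheroni)) * clifford_J n t - t * clifford_H n t) \<longlongrightarrow>
     (0 + 0 * (2 * euler_mascheroni)) * clifford_J n 0 - 0 * clifford_H n 0) (at_right 0)"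
    by (intro tendsto_intros tendsto_mult_ln_at_right_0 J H t)
  then show ?thesis by (simp add: distrib_left)
qed

lemma tendsto_mult_clifford_Y_0: "((\<lambda>t. t * clifford_Y 0 t) \<longlongrightarrow> 0) (at_right 0)"
  using tendsto_divide[OF tendsto_mult_clifford_JH[of 0] tendsto_const[of pi]]
  by (simp add: clifford_Y_def clifford_P_def algebra_simps)

text \<open>The limit comes from \<open>clifford_P 1 t = 1 / t\<close>; multiplied by
  \<open>t\<close>, all other parts vanish at \<open>0\<close>.\<close>

lemma tendsto_mult_clifford_Y_1: "((\<lambda>t. t * clifford_Y 1 t) \<longlongrightarrow> - 1 / pi) (at_right 0)"
proof -
  have "((\<lambda>t. ((t * (ln t + 2 * euler_mascheroni)) * clifford_J 1 t - t * clifford_H 1 t - 1) / pi) \<longlongrightarrow> (0 - 1) / pi)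
     (at_right 0)"
    by (intro tendsto_intros tendsto_mult_clifford_JH) auto
  moreover have "\<forall>\<^sub>F t::real in at_right 0.
      ((t * (ln t + 2 * euler_mascheroni)) * clifford_J 1 t - t * clifford_H 1 t - 1) / pi = t * clifford_Y 1 t"
    using eventually_at_right_less[of "0::real"]
    by eventually_elim (simp add: clifford_Y_def clifford_P_def algebra_simps diff_divide_distrib add_divide_distrib)
  ultimately show ?thesis
    by (auto intro: Lim_transform_eventually)
qed

text \<open>Substituting the recurrence for order \<open>n\<close>, the terms with the factor
  \<open>n + 1\<close> cancel by antisymmetry. Hence the weighted Wronskian is the same for all
  orders.\<close>

lemma clifford_wronskian_Suc:
  assumes "clifford_seq y" "clifford_seq z" "t > 0"
  shows "t ^ Suc n * (y (Suc n) t * z n t - y n t * z (Suc n) t) =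
    t ^ Suc (Suc n) * (y (Suc (Suc n)) t * z (Suc n) t - y (Suc n) t * z (Suc (Suc n)) t)"
  unfolding clifford_seq_rec[OF assms(1,3), of n] clifford_seq_rec[OF assms(2,3), of n]
  by (simp add: algebra_simps)

text \<open>Independent of \<open>n\<close> by the previous lemma, and of \<open>t\<close> because
  its derivative vanishes; so it equals its limit at \<open>0\<close> in order \<open>0\<close>,
  where \<open>clifford_J 0 0 = 1\<close> meets the limit \<open>- 1 / pi\<close> of
  \<open>t * clifford_Y 1 t\<close>.\<close>

lemma clifford_wronskian:
  assumes "t > 0"
  shows "t ^ Suc n * (clifford_J (Suc n) t * clifford_Y n t - clifford_J n t * clifford_Y (Suc n) t) = 1 / pi"
proof -
  define W where "W t = t * (clifford_J 1 t * clifford_Y 0 t - clifford_J 0 t * clifford_Y 1 t)" for t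
  have n: "t ^ Suc n * (clifford_J (Suc n) t * clifford_Y n t - clifford_J n t * clifford_Y (Suc n) t) = W t"
  proof (induction n)
    case (Suc n)
    then show ?case
      using clifford_wronskian_Suc[OF clifford_seq_J clifford_seq_Y assms, of n] by (simp only:)
  qed (simp add: W_def)
  have der: "(W has_real_derivative 0) (at s)" if "s > 0" for s
  proof -
    have "(W has_real_derivative
        (1 * (clifford_J 1 s * clifford_Y 0 s - clifford_J 0 s * clifford_Y 1 s) +
        s * ((- clifford_J 2 s) * clifford_Y 0 s + clifford_J 1 s * (- clifford_Y 1 s)
          - ((- clifford_J 1 s) * clifford_Y 1 s + clifford_J 0 s * (- clifford_Y 2 s))))) (at s)"
      unfolding W_def[abs_def] using that
      by (auto intro!: derivative_eq_intros clifford_J_deriv clifford_Y_deriv simp: eval_nat_numeral)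
    moreover have "clifford_J 0 s = clifford_J 1 s - s * clifford_J 2 s"
      using clifford_J_rec[of 0 s] by (simp add: eval_nat_numeral)
    moreover have "clifford_Y 0 s = clifford_Y 1 s - s * clifford_Y 2 s"
      using clifford_Y_rec[OF that, of 0] by (simp add: eval_nat_numeral)
    ultimately show ?thesis
      by (simp add: algebra_simps)
  qed
  have const: "W s = W t" if "s > 0" for s
  proof -
    have "\<exists>c. \<forall>x\<in>{0<..}. W x = c"
      by (rule has_field_derivative_zero_constant) (auto intro: der has_field_derivative_at_within)
    then show ?thesis using that assms by force
  qed
  have J: "(clifford_J n \<longlongrightarrow> clifford_J n 0) (at_right 0)" for n
    using clifford_J_continuous[of 0 n] by (auto simp: isCont_def filterlim_at_split)
  have "((\<lambda>t. clifford_J 1 t * (t * clifford_Y 0 t) - clifford_J 0 t * (t * clifford_Y 1 t)) \<longlongrightarrow>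
      clifford_J 1 0 * 0 - clifford_J 0 0 * (- 1 / pi)) (at_right 0)"
    by (intro tendsto_intros J tendsto_mult_clifford_Y_0 tendsto_mult_clifford_Y_1)
  then have "(W \<longlongrightarrow> 1 / pi) (at_right 0)"
    by (simp add: W_def[abs_def] clifford_J_0 algebra_simps)
  moreover have "(W \<longlongrightarrow> W t) (at_right 0)"
    by (rule tendsto_eventually, rule eventually_mono[OF eventually_at_right_less[of 0]]) (rule const)
  ultimately have "W t = 1 / pi"
    using tendsto_unique trivial_limit_at_right_real by blast
  with n show ?thesis by simp
qed

section \<open>Bessel functions of integer order in the Clifford normalisation\<close>

definition cyl :: "(nat \<Rightarrow> real \<Rightarrow> real) \<Rightarrow> int \<Rightarrow> real \<Rightarrow> real" where
  "cyl z n x = (if n \<ge> 0 then 1 else (-1) ^ nat \<bar>n\<bar>) * ((x / 2) ^ nat \<bar>n\<bar> * z (nat \<bar>n\<bar>) (x\<^sup>2 / 4))"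

lemma bessel_J_nat_eq: "bessel_J_nat n x = (x / 2) ^ n * clifford_J n (x\<^sup>2 / 4)"
proof -
  have "(-1) ^ p / (fact p * fact (n + p)) * (x / 2) ^ (n + 2 * p) =
      (x / 2) ^ n * ((-1) ^ p / (fact p * fact (n + p)) * (x\<^sup>2 / 4) ^ p)" for p
    using power_mult[of "x / 2" 2 p] by (simp add: power_add power_divide[of x 2 2] mult_ac)
  then show ?thesis
    by (simp only: bessel_J_nat_def clifford_J_def suminf_mult[OF summable_clifford_J])
qed

lemma bessel_Y_nat_eq:
  assumes "x > 0"
  shows "bessel_Y_nat n x = (x / 2) ^ n * clifford_Y n (x\<^sup>2 / 4)"
proof -
  have "(-1) ^ p / (fact p * fact (n + p)) * (x / 2) ^ (n + 2 * p) * (harm (n + p) + harm p) =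
      (x / 2) ^ n * ((-1) ^ p / (fact p * fact (n + p)) * (harm (n + p) + harm p) * (x\<^sup>2 / 4) ^ p)" for p
    using power_mult[of "x / 2" 2 p] by (simp add: power_add power_divide[of x 2 2] mult_ac)
  then have H: "(\<Sum>p. (-1) ^ p / (fact p * fact (n + p)) * (x / 2) ^ (n + 2 * p) * (harm (n + p) + harm p))
      = (x / 2) ^ n * clifford_H n (x\<^sup>2 / 4)"
    by (simp only: clifford_H_def suminf_mult[OF summable_clifford_H])
  have P: "(\<Sum>p<n. fact (n - 1 - p) / fact p * ((2 / x) ^ n * (x / 2) ^ (2 * p))) = (x / 2) ^ n * clifford_P n (x\<^sup>2 / 4)"
    unfolding clifford_P_def sum_distrib_left
  proof (rule sum.cong)
    fix p
    have "(x\<^sup>2 / 4) ^ n = (x / 2) ^ n * (x / 2) ^ n" "(x\<^sup>2 / 4) ^ p = (x / 2) ^ (2 * p)"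
      by (simp_all add: power_mult power2_eq_square power_mult_distrib[symmetric] power_divide)
    then show "fact (n - 1 - p) / fact p * ((2 / x) ^ n * (x / 2) ^ (2 * p)) =
         (x / 2) ^ n * (fact (n - 1 - p) / fact p * (x\<^sup>2 / 4) ^ p / (x\<^sup>2 / 4) ^ n)"
      using assms by (simp add: power_divide mult_ac)
  qed simp
  have "ln (x\<^sup>2 / 4) = 2 * ln (x / 2)"
    using assms ln_realpow[of "x / 2" 2] by (simp add: power_divide)
  then show ?thesis
    unfolding bessel_Y_nat_def clifford_Y_def H P bessel_J_nat_eq by (simp add: field_simps)
qed

lemma bessel_J_eq: "bessel_J n x = cyl clifford_J n x"
  by (auto simp: bessel_J_def cyl_def bessel_J_nat_eq)

lemma bessel_Y_eq: "x > 0 \<Longrightarrow> bessel_Y n x = cyl clifford_Y n x"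
  by (auto simp: bessel_Y_def cyl_def bessel_Y_nat_eq)

text \<open>For \<open>n \<ge> 0\<close> this is the derivative rule of \<open>clifford_seq\<close>.
  For \<open>n < 0\<close> the order \<open>n + 1\<close> is smaller in absolute value, so that rule
  produces the wrong neighbour, and the three-term recurrence \<open>rec\<close> exchanges it for
  the right one.\<close>

lemma cyl_deriv:
  assumes z: "clifford_seq z" and x: "x > 0"
  shows "(cyl z n has_real_derivative of_int n / x * cyl z n x - cyl z (n + 1) x) (at x)"
proof -
  define Z where "Z m x = (x / 2) ^ m * z m (x\<^sup>2 / 4)" for m x
  have t: "x\<^sup>2 / 4 > 0" using x by simp
  have der: "(Z m has_real_derivative real m / x * Z m x - Z (Suc m) x) (at x)" for m
  proof -
    have 1: "((\<lambda>x. z m (x\<^sup>2 / 4)) has_real_derivative - z (Suc m) (x\<^sup>2 / 4) * (x / 2)) (at x)"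
      by (rule DERIV_chain2[where f = "z m" and g = "\<lambda>x. x\<^sup>2 / 4" and x = x, OF clifford_seq_deriv[OF z t]]) (auto intro!: derivative_eq_intros)
    have 2: "((\<lambda>x. (x / 2) ^ m) has_real_derivative real m / x * (x / 2) ^ m) (at x)"
      by (rule DERIV_cong[OF DERIV_power[OF DERIV_cdivide[OF DERIV_ident]]])
        (use x in \<open>cases m; auto simp: field_simps\<close>)
    show ?thesis
      unfolding Z_def[abs_def] by (rule DERIV_cong[OF DERIV_mult[OF 2 1]]) (simp add: algebra_simps)
  qed
  have rec: "Z (Suc (Suc m)) x + Z m x = 2 * (real m + 1) / x * Z (Suc m) x" for m
    unfolding Z_def clifford_seq_rec[OF z t, of m]
    using x by (simp add: field_simps power2_eq_square)
  show ?thesis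
  proof (cases "n \<ge> 0")
    case True
    then have "cyl z n = Z (nat n)" "cyl z (n + 1) = Z (Suc (nat n))" "of_int n = real (nat n)"
      by (auto simp: cyl_def[abs_def] Z_def[abs_def] Suc_nat_eq_nat_zadd1 add.commute fun_eq_iff)
    then show ?thesis
      using der[of "nat n"] by (simp only:)
  next
    case False
    define m where "m = nat (- n) - 1"
    with False have m: "n = - int (Suc m)"
      by simp
    have c: "cyl z n = (\<lambda>x. (-1) ^ Suc m * Z (Suc m) x)" "cyl z (n + 1) = (\<lambda>x. (-1) ^ m * Z m x)"
      by (auto simp: cyl_def[abs_def] Z_def[abs_def] m fun_eq_iff nat_add_distrib)
    have "((\<lambda>x. (-1) ^ Suc m * Z (Suc m) x) has_real_derivative
        (-1) ^ Suc m * (real (Suc m) / x * Z (Suc m) x - Z (Suc (Suc m)) x)) (at x)"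
      by (intro DERIV_cmult der)
    moreover have "(-1) ^ Suc m * (real (Suc m) / x * Z (Suc m) x - Z (Suc (Suc m)) x) =
        of_int n / x * ((-1) ^ Suc m * Z (Suc m) x) - (-1) ^ m * Z m x"
    proof -
      have "Z (Suc (Suc m)) x = 2 * (real m + 1) / x * Z (Suc m) x - Z m x"
        using rec[of m] by simp
      then show ?thesis unfolding m by (simp only:) (simp add: algebra_simps)
    qed
    ultimately show ?thesis by (simp only: c)
  qed
qed

subsection \<open>Polar coordinates\<close>

lemma polar_nth [simp]: "polar r \<theta> $ 1 = r * cos \<theta>" "polar r \<theta> $ 2 = r * sin \<theta>"
  by (simp_all add: polar_def)

lemma power2_norm_vec2: "(norm (v :: real^2))\<^sup>2 = (v $ 1)\<^sup>2 + (v $ 2)\<^sup>2"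
  by (simp add: norm_vec_def L2_set_def sum_2)

lemma norm_polar [simp]: "norm (polar r \<theta>) = \<bar>r\<bar>"
proof -
  have "(norm (polar r \<theta>))\<^sup>2 = r\<^sup>2 * ((cos \<theta>)\<^sup>2 + (sin \<theta>)\<^sup>2)"
    unfolding power2_norm_vec2 polar_nth by (simp only: power_mult_distrib distrib_left)
  then show ?thesis
    by (metis abs_norm_cancel mult.right_neutral power2_eq_iff_nonneg sin_cos_squared_add2 abs_ge_zero norm_ge_zero power2_abs)
qed

lemma polar_eq_axis: "polar r \<theta> = (r * cos \<theta>) *\<^sub>R axis 1 1 + (r * sin \<theta>) *\<^sub>R axis 2 1"
  by (simp add: vec_eq_iff forall_2 axis_def)

lemma continuous_on_polar [continuous_intros]:
  fixes f g :: "'a::t2_space \<Rightarrow> real"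
  assumes "continuous_on S f" "continuous_on S g"
  shows "continuous_on S (\<lambda>x. polar (f x) (g x))"
  unfolding polar_eq_axis
  by (intro continuous_on_add continuous_on_scaleR continuous_on_mult continuous_on_const assms(1)
      continuous_on_cos[OF assms(2)] continuous_on_sin[OF assms(2)])

lemma polar_cases:
  obtains \<theta> where "0 \<le> \<theta>" "\<theta> < 2 * pi" "x = polar (norm x) \<theta>"
proof (cases "x = 0")
  case True
  then have "x = polar (norm x) 0" by (simp add: vec_eq_iff forall_2)
  then show ?thesis using that[of 0] by simp
next
  case False
  have "(x $ 1 / norm x)\<^sup>2 + (x $ 2 / norm x)\<^sup>2 = 1"
    using False by (simp add: power_divide add_divide_distrib[symmetric] flip: power2_norm_vec2)
  then obtain t where t: "0 \<le> t" "t < 2 * pi" "x $ 1 / norm x = cos t" "x $ 2 / norm x = sin t"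
    by (rule sincos_total_2pi)
  have "x $ 1 = norm x * cos t" "x $ 2 = norm x * sin t"
    using False unfolding t(3,4)[symmetric] by auto
  then have "x = polar (norm x) t"
    unfolding vec_eq_iff forall_2 polar_nth by (rule conjI)
  then show ?thesis by (rule that[OF t(1,2)])
qed

text \<open>Equal sines and cosines leave a multiple of \<open>2 * pi\<close> between the angles;
  both lie strictly inside one period, so the multiple is zero.\<close>

lemma polar_inj:
  assumes "polar r \<theta> = polar r' \<theta>'" "0 < r" "0 < r'" "0 < \<theta>" "\<theta> < 2 * pi" "0 < \<theta>'" "\<theta>' < 2 * pi"
  shows "r = r'" "\<theta> = \<theta>'"
proof -
  from arg_cong[OF assms(1), of norm] show r: "r = r'"
    using assms(2,3) by simp
  have "cos \<theta> = cos \<theta>'" "sin \<theta> = sin \<theta>'"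
    using arg_cong[OF assms(1), of "\<lambda>v. v $ 1"] arg_cong[OF assms(1), of "\<lambda>v. v $ 2"] assms(2) r
    by auto
  then obtain n :: int where n: "\<theta> = \<theta>' + 2 * pi * n"
    using sin_cos_eq_iff by blast
  have "n = 0"
  proof (rule ccontr)
    assume "n \<noteq> 0"
    then have "\<bar>of_int n :: real\<bar> \<ge> 1" by linarith
    then have "\<bar>2 * pi * n\<bar> \<ge> 2 * pi"
      by (simp add: abs_mult)
    moreover have "\<bar>2 * pi * n\<bar> < 2 * pi"
      using n assms by linarith
    ultimately show False by simp
  qed
  with n show "\<theta> = \<theta>'" by simp
qed

section \<open>Integration in polar coordinates\<close>

lemma ex_2: "(\<exists>i::2. P i) \<longleftrightarrow> P 1 \<or> P 2"
  using forall_2[of "\<lambda>i. \<not> P i"] by blast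

text \<open>Fubini is applied on pairs; the bijection between \<open>real^2\<close> and
  \<open>real \<times> real\<close> maps boxes to boxes of the same content, hence the scaling
  factor \<open>1\<close> in \<open>has_integral_twiddle\<close>.\<close>

lemma integral_cbox_vec2:
  fixes g :: "real \<times> real \<Rightarrow> 'a::euclidean_space"
  assumes "continuous_on (cbox (a, c) (b, d)) g"
  shows "((\<lambda>v::real^2. g (v $ 1, v $ 2)) has_integral integral {a..b} (\<lambda>x. integral {c..d} (\<lambda>y. g (x, y))))
    (cbox (vector [a, c]) (vector [b, d]))"
proof -
  have "((\<lambda>v::real^2. g (v $ 1, v $ 2)) has_integral (1 / 1) *\<^sub>R integral (cbox (a, c) (b, d)) g)
     ((\<lambda>p. vector [fst p, snd p]) ` cbox (a, c) (b, d))"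
  proof (rule has_integral_twiddle)
    fix u v :: "real^2"
    have im: "(\<lambda>v. (v $ 1, v $ 2)) ` cbox u v = cbox (u $ 1, u $ 2) (v $ 1, v $ 2)"
    proof -
      have "p \<in> (\<lambda>v. (v $ 1, v $ 2)) ` cbox u v" if "p \<in> cbox (u $ 1, u $ 2) (v $ 1, v $ 2)" for p
        using that by (intro image_eqI[where x = "vector [fst p, snd p]"])
          (auto simp: mem_box_cart forall_2 cbox_Pair_eq)
      then show ?thesis by (auto simp: mem_box_cart forall_2 cbox_Pair_eq)
    qed
    then show "\<exists>w z. (\<lambda>v. (v $ 1, v $ 2)) ` cbox u v = cbox w z" by blast
    show "measure lborel ((\<lambda>v. (v $ 1, v $ 2)) ` cbox u v) = 1 * measure lborel (cbox u v)"
      unfolding im content_Pair content_cbox_if_cart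
      by (auto simp: prod_2 UNIV_2 interval_eq_empty_cart ex_2 content_real_if)
  next
    fix u v :: "real \<times> real"
    have "(\<lambda>p. vector [fst p, snd p]) ` cbox u v = cbox (vector [fst u, snd u] :: real^2) (vector [fst v, snd v])"
    proof -
      have "x \<in> (\<lambda>p. vector [fst p, snd p]) ` cbox u v" if "x \<in> cbox (vector [fst u, snd u] :: real^2) (vector [fst v, snd v])" for x
        using that by (intro image_eqI[where x = "(x $ 1, x $ 2)"])
          (cases u; cases v; auto simp: mem_box_cart forall_2 cbox_Pair_eq vec_eq_iff)+
      then show ?thesis by (cases u; cases v; auto simp: mem_box_cart forall_2 cbox_Pair_eq)
    qed
    then show "\<exists>w z. (\<lambda>p. vector [fst p, snd p]) ` cbox u v = cbox w (z :: real^2)" by blast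
  next
    show "(g has_integral integral (cbox (a, c) (b, d)) g) (cbox (a, c) (b, d))"
      by (intro integrable_integral integrable_continuous assms)
  next
    show "continuous (at x) (\<lambda>v::real^2. (v $ 1, v $ 2))" for x
      by (intro continuous_intros)
  qed (auto simp: vec_eq_iff forall_2)
  moreover have "(\<lambda>p. vector [fst p, snd p]) ` cbox (a, c) (b, d) = cbox (vector [a, c] :: real^2) (vector [b, d])"
  proof -
    have "x \<in> (\<lambda>p. vector [fst p, snd p]) ` cbox (a, c) (b, d)" if "x \<in> cbox (vector [a, c] :: real^2) (vector [b, d])" for x
      using that by (intro image_eqI[where x = "(x $ 1, x $ 2)"])
        (auto simp: mem_box_cart forall_2 cbox_Pair_eq vec_eq_iff)+
    then show ?thesis by (auto simp: mem_box_cart forall_2 cbox_Pair_eq)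
  qed
  ultimately show ?thesis
    using integral_prod_continuous[OF assms] by simp
qed

lemma polar_has_derivative:
  "((\<lambda>v::real^2. polar (v $ 1) (v $ 2)) has_derivative
    (\<lambda>h. (h $ 1 * cos (v $ 2) - h $ 2 * (v $ 1 * sin (v $ 2))) *\<^sub>R axis 1 1
       + (h $ 1 * sin (v $ 2) + h $ 2 * (v $ 1 * cos (v $ 2))) *\<^sub>R axis 2 1)) (at v within S)"
proof -
  have n: "((\<lambda>v::real^2. v $ i) has_derivative (\<lambda>h. h $ i)) (at v within S)" for i
    by (rule bounded_linear.has_derivative[OF bounded_linear_vec_nth has_derivative_ident])
  show ?thesis
    unfolding polar_eq_axis
    by (rule derivative_eq_intros n refl ext | simp add: algebra_simps)+
qed

text \<open>The change of variables theorem that is applied takes values in \<open>real^'n\<close>,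
  so complex values travel through the mutually inverse linear maps \<open>T\<close> and
  \<open>U\<close> between \<open>complex\<close> and \<open>real^2\<close>.\<close>

lemma change_of_variables_complex:
  fixes f :: "real^'m::{finite,wellorder} \<Rightarrow> complex" and g :: "real^'m::_ \<Rightarrow> real^'m::_"
  assumes "S \<in> sets lebesgue"
    and "\<And>x. x \<in> S \<Longrightarrow> (g has_derivative g' x) (at x within S)"
    and "inj_on g S"
    and int: "(\<lambda>x. \<bar>det (matrix (g' x))\<bar> *\<^sub>R f (g x)) absolutely_integrable_on S"
  shows "f absolutely_integrable_on (g ` S)"
    and "integral (g ` S) f = integral S (\<lambda>x. \<bar>det (matrix (g' x))\<bar> *\<^sub>R f (g x))"
proof -
  define T :: "complex \<Rightarrow> real^2" where "T z = Re z *\<^sub>R axis 1 1 + Im z *\<^sub>R axis 2 1" for z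
  define U :: "real^2 \<Rightarrow> complex" where "U v = (v $ 1) *\<^sub>R 1 + (v $ 2) *\<^sub>R \<i>" for v
  have T: "bounded_linear T"
    unfolding T_def[abs_def]
    by (intro bounded_linear_add bounded_linear_compose[OF bounded_linear_scaleR_left] bounded_linear_Re bounded_linear_Im)
  have U: "bounded_linear U"
    unfolding U_def[abs_def]
    by (intro bounded_linear_add bounded_linear_compose[OF bounded_linear_scaleR_left] bounded_linear_vec_nth)
  have UT: "U (T z) = z" for z
    by (simp add: U_def T_def axis_def complex_eq_iff)
  have TS: "T (c *\<^sub>R z) = c *\<^sub>R T z" for c z
    by (simp add: T_def scaleR_add_right)
  let ?D = "\<lambda>x. \<bar>det (matrix (g' x))\<bar>"
  have 1: "(\<lambda>x. ?D x *\<^sub>R (T \<circ> f) (g x)) absolutely_integrable_on S"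
    using absolutely_integrable_linear[OF int T] by (simp add: o_def TS)
  from absolutely_integrable_change_of_variables[OF assms(1-3), of "T \<circ> f"] 1
  have 2: "(T \<circ> f) absolutely_integrable_on (g ` S)" by blast
  from absolutely_integrable_linear[OF this U] show 3: "f absolutely_integrable_on (g ` S)"
    by (simp add: o_def UT)
  have "integral (g ` S) (T \<circ> f) = integral S (\<lambda>x. ?D x *\<^sub>R (T \<circ> f) (g x))"
    by (rule integral_change_of_variables[OF assms(1-3)]) (assumption, rule disjI1, rule 2)
  moreover have "integral (g ` S) (T \<circ> f) = T (integral (g ` S) f)"
    using integral_linear[OF set_lebesgue_integral_eq_integral(1)[OF 3] T] by simp
  moreover have "integral S (\<lambda>x. ?D x *\<^sub>R (T \<circ> f) (g x)) = T (integral S (\<lambda>x. ?D x *\<^sub>R f (g x)))"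
    using integral_linear[OF set_lebesgue_integral_eq_integral(1)[OF int] T] by (simp add: o_def TS)
  ultimately have "T (integral (g ` S) f) = T (integral S (\<lambda>x. ?D x *\<^sub>R f (g x)))"
    by simp
  from arg_cong[OF this, of U] show "integral (g ` S) f = integral S (\<lambda>x. ?D x *\<^sub>R f (g x))"
    by (simp only: UT)
qed

text \<open>\<open>g\<close> stands for the integrand including the Jacobian \<open>r\<close>.
  Asking for continuity of \<open>g\<close> on the closed rectangle, and for its link to
  \<open>f\<close> only when \<open>a < r < b\<close>, admits an \<open>f\<close> with a singularity
  at the origin that the factor \<open>r\<close> removes.\<close>

lemma polar_integral:
  fixes f :: "real^2 \<Rightarrow> complex" and g :: "real \<times> real \<Rightarrow> complex"
  assumes ab: "0 \<le> a" and cont: "continuous_on (cbox (a, 0) (b, 2 * pi)) g"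
    and eq: "\<And>r \<theta>. a < r \<Longrightarrow> r < b \<Longrightarrow> g (r, \<theta>) = r *\<^sub>R f (polar r \<theta>)"
  shows "f absolutely_integrable_on {x. a < norm x \<and> norm x < b}"
    and "integral {x. a < norm x \<and> norm x < b} f = integral {a..b} (\<lambda>r. integral {0..2 * pi} (\<lambda>\<theta>. g (r, \<theta>)))"
proof -
  define A where "A = {x::real^2. a < norm x \<and> norm x < b}"
  define S where "S = box (vector [a, 0]) (vector [b, 2 * pi] :: real^2)"
  define P where "P = (\<lambda>v::real^2. polar (v $ 1) (v $ 2))"
  define P' where "P' = (\<lambda>(v :: real^2) (h :: real^2). (h $ 1 * cos (v $ 2) - h $ 2 * (v $ 1 * sin (v $ 2))) *\<^sub>R axis 1 1
       + (h $ 1 * sin (v $ 2) + h $ 2 * (v $ 1 * cos (v $ 2))) *\<^sub>R axis 2 (1::real) :: real^2)"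
  have S: "v \<in> S \<longleftrightarrow> a < v $ 1 \<and> v $ 1 < b \<and> 0 < v $ 2 \<and> v $ 2 < 2 * pi" for v
    by (auto simp: S_def mem_box_cart forall_2)
  have det: "det (matrix (P' v)) = v $ 1" for v
  proof -
    have "det (matrix (P' v)) = v $ 1 * ((cos (v $ 2))\<^sup>2 + (sin (v $ 2))\<^sup>2)"
      unfolding det_2 matrix_def P'_def by (simp add: axis_def algebra_simps power2_eq_square del: sin_cos_squared_add sin_cos_squared_add2 sin_cos_squared_add3)
    then show ?thesis by simp
  qed
  have meas: "S \<in> sets lebesgue"
    unfolding S_def by (intro borel_open open_box sets_completionI_sets) auto
  have der: "(P has_derivative P' v) (at v within S)" for v
      unfolding P_def P'_def by (rule polar_has_derivative)
  have inj: "inj_on P S"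
  proof (rule inj_onI)
    fix v w assume vw: "v \<in> S" "w \<in> S" "P v = P w"
    then have "v $ 1 = w $ 1" "v $ 2 = w $ 2"
      using polar_inj[of "v $ 1" "v $ 2" "w $ 1" "w $ 2"] ab by (auto simp: S P_def)
    then show "v = w" by (simp add: vec_eq_iff forall_2)
  qed
  let ?g = "\<lambda>v::real^2. g (v $ 1, v $ 2)"
  have gi: "(?g has_integral integral {a..b} (\<lambda>r. integral {0..2 * pi} (\<lambda>\<theta>. g (r, \<theta>))))
      (cbox (vector [a, 0]) (vector [b, 2 * pi]))"
    by (rule integral_cbox_vec2[OF cont])
  have gc: "continuous_on (cbox (vector [a, 0]) (vector [b, 2 * pi])) ?g"
    by (rule continuous_on_compose2[OF cont]) (auto intro!: continuous_intros simp: mem_box_cart forall_2 cbox_Pair_eq)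
  have gS: "?g absolutely_integrable_on S"
    by (rule set_integrable_subset[OF absolutely_integrable_continuous[OF gc]])
      (use meas in \<open>auto simp: S_def box_subset_cbox\<close>)
  have eqS: "?g v = \<bar>det (matrix (P' v))\<bar> *\<^sub>R f (P v)" if "v \<in> S" for v
    using that ab by (simp add: det S P_def eq)
  have int: "(\<lambda>v. \<bar>det (matrix (P' v))\<bar> *\<^sub>R f (P v)) absolutely_integrable_on S"
    using gS by (subst set_integrable_cong[OF refl refl eqS[symmetric]]) auto
  have cv: "f absolutely_integrable_on (P ` S)" "integral (P ` S) f = integral S ?g"
    using change_of_variables_complex[OF meas der inj int]
      integral_cong[of S ?g "\<lambda>v. \<bar>det (matrix (P' v))\<bar> *\<^sub>R f (P v)", OF eqS]
    by (simp_all only:)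
  \<comment> \<open>The open parameter rectangle misses the ray of angle \<open>0\<close>, which
    lies in a line of measure zero.\<close>
  have neg: "negligible {x\<in>P ` S - A. f x \<noteq> 0}" "negligible {x\<in>A - P ` S. f x \<noteq> 0}"
  proof -
    have "P ` S \<subseteq> A"
      using ab by (auto simp: A_def P_def S)
    then have "{x\<in>P ` S - A. f x \<noteq> 0} = {}" by blast
    then show "negligible {x\<in>P ` S - A. f x \<noteq> 0}" by (simp only: negligible_empty)
    have "x $ 2 = 0" if x: "x \<in> A" "x \<notin> P ` S" for x
    proof (rule ccontr)
      assume 2: "x $ 2 \<noteq> 0"
      obtain \<theta> where \<theta>: "0 \<le> \<theta>" "\<theta> < 2 * pi" "x = polar (norm x) \<theta>"
        by (rule polar_cases)
      from 2 \<theta>(3) have "\<theta> \<noteq> 0"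
        by (metis mult_zero_right polar_nth(2) sin_zero)
      then have "vector [norm x, \<theta>] \<in> S"
        using \<theta> x(1) by (simp add: S A_def)
      moreover have "x = P (vector [norm x, \<theta>])"
        using \<theta>(3) by (simp add: P_def)
      ultimately show False using x(2) by blast
    qed
    then have "{x\<in>A - P ` S. f x \<noteq> 0} \<subseteq> {x. x $ 2 = 0}" by blast
    then show "negligible {x\<in>A - P ` S. f x \<noteq> 0}"
      by (rule negligible_subset[OF negligible_standard_hyperplane_cart])
  qed
  show "f absolutely_integrable_on {x. a < norm x \<and> norm x < b}"
    using cv(1) absolutely_integrable_spike_set_eq[OF neg] by (simp add: A_def)
  have "integral A f = integral S ?g"
    using cv(2) integral_spike_set[OF neg] by simp
  also have "\<dots> = integral (cbox (vector [a, 0]) (vector [b, 2 * pi])) ?g"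
    unfolding S_def by (rule integral_open_interval)
  also have "\<dots> = integral {a..b} (\<lambda>r. integral {0..2 * pi} (\<lambda>\<theta>. g (r, \<theta>)))"
    using gi by (rule integral_unique)
  finally show "integral {x. a < norm x \<and> norm x < b} f = integral {a..b} (\<lambda>r. integral {0..2 * pi} (\<lambda>\<theta>. g (r, \<theta>)))"
    by (simp add: A_def)
qed

subsection \<open>Smooth cut-off functions\<close>

text \<open>Recursion through \<open>deriv\<close> avoids naming the successive derivatives. On an
  open set only the values of the function inside that set matter (\<open>diffn_cong\<close>), so
  smoothness can be glued along open covers.\<close>

primrec diffn :: "nat \<Rightarrow> real set \<Rightarrow> (real \<Rightarrow> real) \<Rightarrow> bool" where
  "diffn 0 S f \<longleftrightarrow> True"
| "diffn (Suc n) S f \<longleftrightarrow> (\<forall>t\<in>S. (f has_real_derivative deriv f t) (at t)) \<and> diffn n S (deriv f)"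

definition smooth_real :: "(real \<Rightarrow> real) \<Rightarrow> bool" where
  "smooth_real f \<longleftrightarrow> (\<forall>n. diffn n UNIV f)"

lemma diffn_cong:
  assumes "open S" "\<And>t. t \<in> S \<Longrightarrow> f t = g t" "diffn n S f"
  shows "diffn n S g"
  using assms
proof (induction n arbitrary: f g)
  case (Suc n)
  have eq: "deriv g t = deriv f t" if "t \<in> S" for t
    using Suc.prems(1,2) that by (intro deriv_cong_ev) (auto simp: eventually_nhds)
  have "(g has_real_derivative deriv g t) (at t)" if "t \<in> S" for t
  proof -
    have "(f has_real_derivative deriv g t) (at t)"
      using Suc.prems(3) that eq by auto
    then show ?thesis
      by (rule has_field_derivative_transform_within_open[OF _ Suc.prems(1) that]) (use Suc.prems(2) in auto)
  qed
  moreover have "diffn n S (deriv g)"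
    by (rule Suc.IH[OF Suc.prems(1), of "deriv f"]) (use eq Suc.prems(3) in auto)
  ultimately show ?case by simp
qed simp

lemma diffn_SucI:
  assumes "open S" "\<And>t. t \<in> S \<Longrightarrow> (f has_real_derivative f' t) (at t)" "diffn n S f'"
  shows "diffn (Suc n) S f"
proof -
  have "deriv f t = f' t" if "t \<in> S" for t
    using assms(2)[OF that] by (rule DERIV_imp_deriv)
  then show ?thesis
    using assms diffn_cong[of S f' "deriv f" n] by auto
qed

lemma diffn_Un: "diffn n S f \<Longrightarrow> diffn n T f \<Longrightarrow> diffn n (S \<union> T) f"
  by (induction n arbitrary: f) auto

lemma diffn_subset: "diffn n T f \<Longrightarrow> S \<subseteq> T \<Longrightarrow> diffn n S f"
  by (induction n arbitrary: f) auto

lemma diffn_lower: "diffn (Suc n) S f \<Longrightarrow> diffn n S f"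
  by (induction n arbitrary: f) auto

lemma diffn_const: "open S \<Longrightarrow> diffn n S (\<lambda>t. c)"
proof (induction n arbitrary: c)
  case (Suc n)
  then show ?case by (intro diffn_SucI[where f' = "\<lambda>t. 0"]) auto
qed simp

lemma diffn_add: "open S \<Longrightarrow> diffn n S f \<Longrightarrow> diffn n S g \<Longrightarrow> diffn n S (\<lambda>t. f t + g t)"
proof (induction n arbitrary: f g)
  case (Suc n)
  show ?case
    by (rule diffn_SucI[where f' = "\<lambda>t. deriv f t + deriv g t"])
      (use Suc in \<open>auto intro!: derivative_eq_intros\<close>)
qed simp

lemma diffn_mult: "open S \<Longrightarrow> diffn n S f \<Longrightarrow> diffn n S g \<Longrightarrow> diffn n S (\<lambda>t. f t * g t)"
proof (induction n arbitrary: f g)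
  case (Suc n)
  show ?case
  proof (rule diffn_SucI[where f' = "\<lambda>t. deriv f t * g t + f t * deriv g t"])
    show "diffn n S (\<lambda>t. deriv f t * g t + f t * deriv g t)"
      using Suc.prems by (intro diffn_add Suc.IH diffn_lower[OF Suc.prems(2)] diffn_lower[OF Suc.prems(3)]) auto
  qed (use Suc.prems in \<open>auto intro!: derivative_eq_intros\<close>)
qed simp

lemma diffn_affine:
  assumes "open S" "\<And>t. t \<in> S \<Longrightarrow> c + d * t \<in> T" "diffn n T f"
  shows "diffn n S (\<lambda>t. f (c + d * t))"
  using assms(3)
proof (induction n arbitrary: f)
  case (Suc n)
  show ?case
  proof (rule diffn_SucI[OF assms(1), where f' = "\<lambda>t. deriv f (c + d * t) * d"])
    show "((\<lambda>t. f (c + d * t)) has_real_derivative deriv f (c + d * t) * d) (at t)" if "t \<in> S" for t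
      using that assms(2) Suc.prems by (intro DERIV_chain2[where f = f]) (auto intro!: derivative_eq_intros)
    show "diffn n S (\<lambda>t. deriv f (c + d * t) * d)"
      using Suc by (intro diffn_mult diffn_const assms(1)) auto
  qed
qed simp

text \<open>The induction needs an arbitrary factor \<open>c\<close>, because each differentiation
  changes the sign.\<close>

lemma diffn_seq:
  assumes "open S" "\<And>m t. t \<in> S \<Longrightarrow> (z m has_real_derivative - z (Suc m) t) (at t)"
  shows "diffn n S (z m)"
proof -
  have "diffn n S (\<lambda>t. c * z m t)" for c
  proof (induction n arbitrary: m c)
    case (Suc n)
    have "diffn n S (\<lambda>t. - c * z (Suc m) t)" by (rule Suc.IH)
    then show ?case
      using assms by (intro diffn_SucI[where f' = "\<lambda>t. - c * z (Suc m) t"]) (auto intro!: derivative_eq_intros)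
  qed simp
  from this[of 1] show ?thesis by simp
qed

lemma smooth_real_deriv:
  assumes "smooth_real f"
  shows "(f has_real_derivative deriv f t) (at t)" "smooth_real (deriv f)"
proof -
  have "diffn (Suc n) UNIV f" for n
    using assms by (simp add: smooth_real_def del: diffn.simps)
  then have *: "(f has_real_derivative deriv f t) (at t)" "diffn n UNIV (deriv f)" for n t
    by (metis diffn.simps(2) UNIV_I)+
  show "(f has_real_derivative deriv f t) (at t)" "smooth_real (deriv f)"
    unfolding smooth_real_def by (intro allI *)+
qed

text \<open>Polynomial factors make the class of functions flat at \<open>0\<close> closed under
  differentiation: \<open>p\<close> becomes \<open>X\<^sup>2 (p - p')\<close>. Derivatives of all
  orders at \<open>0\<close> are then handled by one induction with \<open>p\<close>
  arbitrary.\<close>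

definition flat :: "real poly \<Rightarrow> real \<Rightarrow> real" where
  "flat p t = (if t > 0 then poly p (inverse t) * exp (- inverse t) else 0)"

lemma flat_tendsto_0: "(flat p \<longlongrightarrow> 0) (at_right 0)"
proof -
  have eq: "poly p x * exp (- x) = (\<Sum>i\<le>degree p. coeff p i * (x ^ i / exp x))" for x :: real
    by (simp add: poly_altdef sum_distrib_right sum_distrib_left exp_minus divide_inverse mult_ac)
  have "((\<lambda>x. poly p x * exp (- x)) \<longlongrightarrow> (\<Sum>i\<le>degree p. coeff p i * 0)) at_top"
    unfolding eq by (intro tendsto_sum tendsto_mult tendsto_const tendsto_power_div_exp_0)
  then have "((\<lambda>t. poly p (inverse t) * exp (- inverse t)) \<longlongrightarrow> 0) (at_right 0)"
    using filterlim_compose[OF _ filterlim_inverse_at_top_right] by fastforce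
  moreover have "\<forall>\<^sub>F t::real in at_right 0. poly p (inverse t) * exp (- inverse t) = flat p t"
    using eventually_at_right_less[of "0::real"] by eventually_elim (simp add: flat_def)
  ultimately show ?thesis by (rule Lim_transform_eventually)
qed

lemma flat_deriv: "(flat p has_real_derivative flat (monom 1 2 * (p - pderiv p)) t) (at t)"
proof (cases "t = 0")
  case True
  \<comment> \<open>Dividing by \<open>h\<close> multiplies the polynomial by its variable, so the
    difference quotient is again of the flat form.\<close>
  have "((\<lambda>h. flat p h / h) \<longlongrightarrow> 0) (at_right 0)"
  proof (rule Lim_transform_eventually[OF flat_tendsto_0[of "[:0, 1:] * p"]])
    show "\<forall>\<^sub>F h in at_right 0. flat ([:0, 1:] * p) h = flat p h / h"
      using eventually_at_right_less[of "0::real"] by eventually_elim (simp add: flat_def field_simps)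
  qed
  moreover have "((\<lambda>h. flat p h / h) \<longlongrightarrow> 0) (at_left 0)"
    by (rule tendsto_eventually, rule eventually_mono[OF eventually_at_left_real[of "-1" 0]]) (auto simp: flat_def)
  ultimately have "((\<lambda>h. flat p h / h) \<longlongrightarrow> 0) (at 0)"
    by (simp add: filterlim_split_at)
  then show ?thesis
    using True by (simp add: DERIV_def flat_def)
next
  case False
  then consider "t > 0" | "t < 0" by linarith
  then show ?thesis
  proof cases
    case 1
    have "((\<lambda>t. poly p (inverse t) * exp (- inverse t)) has_real_derivative
        flat (monom 1 2 * (p - pderiv p)) t) (at t)"
      using 1 by (auto intro!: derivative_eq_intros DERIV_chain2[OF poly_DERIV]
          simp: flat_def poly_monom power2_eq_square algebra_simps)
    then show ?thesis
      by (rule has_field_derivative_transform_within_open[of _ _ _ "{0<..}"]) (use 1 in \<open>auto simp: flat_def\<close>)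
  next
    case 2
    have "((\<lambda>t. 0) has_real_derivative flat (monom 1 2 * (p - pderiv p)) t) (at t)"
      using 2 by (simp add: flat_def)
    then show ?thesis
      by (rule has_field_derivative_transform_within_open[of _ _ _ "{..<0}"]) (use 2 in \<open>auto simp: flat_def\<close>)
  qed
qed

lemma diffn_flat: "diffn n UNIV (flat p)"
proof (induction n arbitrary: p)
  case (Suc n)
  show ?case by (rule diffn_SucI[OF _ flat_deriv Suc]) simp
qed simp

text \<open>\<open>B\<close> is a bump positive exactly between \<open>a\<close> and
  \<open>b\<close>, \<open>I\<close> its primitive, and \<open>1 - I t / I b\<close> the step. The
  sign of the derivative is recorded because it later serves as a weight in an average.\<close>

lemma smooth_step_exists:
  fixes a b :: real
  assumes "a < b"
  obtains \<eta> where "smooth_real \<eta>" "\<forall>t\<le>a. \<eta> t = 1" "\<forall>t\<ge>b. \<eta> t = 0"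
    "\<forall>t. deriv \<eta> t \<le> 0" "\<forall>t. t \<le> a \<or> t \<ge> b \<longrightarrow> deriv \<eta> t = 0"
proof -
  define B where "B t = flat [:1:] (- a + 1 * t) * flat [:1:] (b + (- 1) * t)" for t
  have B: "diffn n UNIV B" for n
    unfolding B_def[abs_def] by (intro diffn_mult diffn_affine[where T = UNIV] diffn_flat) auto
  have B0: "B t = 0" if "t \<le> a \<or> t \<ge> b" for t
    using that by (auto simp: B_def flat_def)
  have Bnn: "B t \<ge> 0" for t
    by (auto simp: B_def flat_def)
  have Bc: "continuous_on S B" for S
  proof -
    have "diffn (Suc 0) UNIV B" by (rule B)
    then show ?thesis
      by (intro continuous_at_imp_continuous_on) (auto intro: DERIV_isCont)
  qed
  \<comment> \<open>Starting at \<open>a - 1\<close>, where \<open>B\<close> is already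
    \<open>0\<close>, puts \<open>a\<close> into the interior of the interval on which the
    fundamental theorem is used.\<close>
  define I where "I t = integral {a - 1..t} B" for t
  have I0: "I t = 0" if "t \<le> a" for t
    unfolding I_def using that using integral_cong[of "{a - 1..t}" B "\<lambda>_. 0"] B0 by auto
  have I1: "I t = I b" if "t \<ge> b" for t
  proof -
    have "integral {a - 1..b} B + integral {b..t} B = integral {a - 1..t} B"
      using that assms by (intro Henstock_Kurzweil_Integration.integral_combine integrable_continuous_real Bc) auto
    moreover have "integral {b..t} B = 0"
      using integral_cong[of "{b..t}" B "\<lambda>_. 0"] B0 by auto
    ultimately show ?thesis by (simp add: I_def)
  qed
  have Ider: "(I has_real_derivative B t) (at t)" for t
  proof (cases "t < a")
    case True
    have "((\<lambda>t. 0) has_real_derivative B t) (at t)"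
      using True B0[of t] by simp
    then show ?thesis
      by (rule has_field_derivative_transform_within_open[of _ _ _ "{..<a}"]) (use True I0 in auto)
  next
    case False
    have "(I has_real_derivative B t) (at t within {a - 1..t + 1})"
      unfolding I_def by (intro integral_has_real_derivative Bc) (use False in auto)
    then show ?thesis
      using False at_within_interior[of t "{a - 1..t + 1}"] by simp
  qed
  have Ib: "I b > 0"
  proof -
    have "I b \<noteq> 0"
    proof
      assume "I b = 0"
      then have "\<forall>x\<in>cbox (a - 1) b. B x = 0"
        unfolding I_def using integral_cbox_eq_0_iff[of "a - 1" b B] assms Bc Bnn by auto
      then have "B ((a + b) / 2) = 0" using assms by auto
      moreover have "B t > 0" if "a < t" "t < b" for t
        using that by (simp add: B_def flat_def)
      ultimately show False
        using gt_half_sum[OF assms] less_half_sum[OF assms] by fastforce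
    qed
    moreover have "I b \<ge> 0"
      unfolding I_def by (intro integral_nonneg integrable_continuous_real Bc) (simp add: Bnn)
    ultimately show ?thesis by simp
  qed
  define \<eta> where "\<eta> t = 1 + (- 1 / I b) * I t" for t
  have der: "(\<eta> has_real_derivative (- 1 / I b) * B t) (at t)" for t
    unfolding \<eta>_def[abs_def] by (rule derivative_eq_intros Ider refl | simp)+
  have "diffn n UNIV \<eta>" for n
  proof (cases n)
    case (Suc m)
    show ?thesis
      unfolding Suc by (rule diffn_SucI[OF open_UNIV der diffn_mult[OF open_UNIV diffn_const[OF open_UNIV] B]])
  qed simp
  moreover have "deriv \<eta> t \<le> 0" for t
    using DERIV_imp_deriv[OF der, of t] Ib Bnn[of t] by (simp add: divide_nonneg_pos)
  moreover have "deriv \<eta> t = 0" if "t \<le> a \<or> t \<ge> b" for t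
    using DERIV_imp_deriv[OF der, of t] B0[OF that] by simp
  ultimately show thesis
  proof (intro that[of \<eta>])
    show "\<forall>t\<le>a. \<eta> t = 1"
      by (simp add: \<eta>_def I0)
    have "\<eta> t = 0" if "t \<ge> b" for t
      unfolding \<eta>_def I1[OF that] using Ib by simp
    then show "\<forall>t\<ge>b. \<eta> t = 0" by blast
  qed (simp_all add: smooth_real_def)
qed

section \<open>Test functions built from radial factors and harmonic polynomials\<close>

inductive smooth_fun :: "(real^2 \<Rightarrow> complex) \<Rightarrow> bool" where
  radial: "smooth_real g \<Longrightarrow> smooth_fun (\<lambda>x. of_real (g (x \<bullet> x)))"
| coord: "smooth_fun (\<lambda>x. of_real (x $ i))"
| const: "smooth_fun (\<lambda>x. c)"
| add: "smooth_fun f \<Longrightarrow> smooth_fun g \<Longrightarrow> smooth_fun (\<lambda>x. f x + g x)"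
| mult: "smooth_fun f \<Longrightarrow> smooth_fun g \<Longrightarrow> smooth_fun (\<lambda>x. f x * g x)"

lemma partial_deriv_eq: "(f has_derivative D) (at x) \<Longrightarrow> partial_deriv i f x = D (axis i 1)"
  unfolding partial_deriv_def by (drule frechet_derivative_at) (rule fun_cong[OF sym])

lemma radial_has_derivative:
  assumes "\<And>t. (g has_real_derivative g' t) (at t)"
  shows "((\<lambda>x::real^2. complex_of_real (g (x \<bullet> x))) has_derivative
    (\<lambda>h. of_real (g' (x \<bullet> x) * (2 * (x \<bullet> h))))) (at x)"
proof -
  have "((\<lambda>x::real^2. g (x \<bullet> x)) has_derivative (\<lambda>h. (x \<bullet> h + h \<bullet> x) * g' (x \<bullet> x))) (at x)"
    by (rule DERIV_compose_FDERIV[OF assms]) (auto intro!: derivative_eq_intros)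
  then have "((\<lambda>x::real^2. complex_of_real (g (x \<bullet> x))) has_derivative
      (\<lambda>h. of_real ((x \<bullet> h + h \<bullet> x) * g' (x \<bullet> x)))) (at x)"
    by (rule has_derivative_of_real)
  then show ?thesis
    by (simp add: inner_commute mult_ac)
qed

lemma coord_has_derivative:
  "((\<lambda>x::real^2. complex_of_real (x $ i)) has_derivative (\<lambda>h. of_real (h $ i))) (at x)"
  by (intro has_derivative_of_real bounded_linear.has_derivative[OF bounded_linear_vec_nth has_derivative_ident])

text \<open>Closure of the class under partial derivatives reduces \<open>smooth\<close> to an
  induction over the list of indices. The origin is no exception, since the radial generators are
  functions of \<open>x \<bullet> x\<close> and not of the norm.\<close>

lemma smooth_fun_partial:
  assumes "smooth_fun f"
  shows "f differentiable (at x) \<and> smooth_fun (partial_deriv i f)"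
  using assms
proof (induction arbitrary: x i)
  case (radial g)
  note d = radial_has_derivative[OF smooth_real_deriv(1)[OF radial]]
  have "partial_deriv i (\<lambda>x. of_real (g (x \<bullet> x))) = (\<lambda>x. of_real (deriv g (x \<bullet> x)) * (2 * of_real (x $ i)))"
    by (rule ext) (simp add: partial_deriv_eq[OF d] cart_eq_inner_axis inner_commute)
  moreover have "smooth_fun (\<lambda>x. of_real (deriv g (x \<bullet> x)) * (2 * of_real (x $ i)))"
    by (intro smooth_fun.intros smooth_real_deriv radial)
  ultimately show ?case
    using d[of x] by (auto simp: differentiable_def)
next
  case (coord j)
  have "partial_deriv i (\<lambda>x. of_real (x $ j)) = (\<lambda>x. of_real (axis i 1 $ j))"
    by (rule ext) (simp add: partial_deriv_eq[OF coord_has_derivative])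
  then show ?case
    using coord_has_derivative[of j x] by (auto simp: differentiable_def intro: smooth_fun.const)
next
  case (const c)
  have "partial_deriv i (\<lambda>x. c) = (\<lambda>x. 0)"
    by (rule ext) (simp add: partial_deriv_eq[OF has_derivative_const])
  then show ?case by (auto intro: smooth_fun.const)
next
  case (add f g)
  have d: "(f has_derivative frechet_derivative f (at x)) (at x)" "(g has_derivative frechet_derivative g (at x)) (at x)" for x
    using add.IH by (auto simp: frechet_derivative_works)
  have "partial_deriv i (\<lambda>x. f x + g x) = (\<lambda>x. partial_deriv i f x + partial_deriv i g x)"
    by (rule ext) (simp add: partial_deriv_eq[OF has_derivative_add[OF d]] partial_deriv_def)
  then show ?case
    using add.IH by (auto intro: smooth_fun.add)
next
  case (mult f g)
  have d: "(f has_derivative frechet_derivative f (at x)) (at x)" "(g has_derivative frechet_derivative g (at x)) (at x)" for x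
    using mult.IH by (auto simp: frechet_derivative_works)
  have "partial_deriv i (\<lambda>x. f x * g x) = (\<lambda>x. f x * partial_deriv i g x + partial_deriv i f x * g x)"
    by (rule ext) (simp add: partial_deriv_eq[OF has_derivative_mult[OF d]] partial_deriv_def)
  then show ?case
    using mult by (simp add: smooth_fun.add smooth_fun.mult)
qed

lemma smooth_fun_smooth: "smooth_fun f \<Longrightarrow> smooth f"
proof -
  assume f: "smooth_fun f"
  have "smooth_fun (foldr partial_deriv is f)" for "is"
    by (induction "is") (use f smooth_fun_partial in auto)
  then show ?thesis
    unfolding smooth_def differentiable_on_def
    using smooth_fun_partial by blast
qed

text \<open>For \<open>s = \<plusminus>1\<close> the complex coordinate or its conjugate. Its powers
  are the harmonic polynomials equal to \<open>r ^ n\<close> times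
  \<open>cis (s * n * \<theta>)\<close>, so an angular factor enters a test function without a
  singularity at the origin.\<close>

definition zeta :: "real \<Rightarrow> real^2 \<Rightarrow> complex" where
  "zeta s x = of_real (x $ 1) + \<i> * of_real s * of_real (x $ 2)"

lemma zeta_axis [simp]: "zeta s (axis 1 1) = 1" "zeta s (axis 2 1) = \<i> * of_real s"
  by (simp_all add: zeta_def axis_def)

lemma smooth_fun_zeta_power: "smooth_fun (\<lambda>x. zeta s x ^ n)"
proof (induction n)
  case (Suc n)
  have "smooth_fun (zeta s)"
    unfolding zeta_def[abs_def] by (intro smooth_fun.intros)
  from smooth_fun.mult[OF this Suc] show ?case by simp
qed (simp add: smooth_fun.const)

lemma zeta_has_derivative: "(zeta s has_derivative zeta s) (at x)"
  unfolding zeta_def[abs_def]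
  by (rule derivative_eq_intros coord_has_derivative refl | simp)+

lemma zeta_power_has_derivative:
  "((\<lambda>x. zeta s x ^ n) has_derivative (\<lambda>h. of_nat n * zeta s x ^ (n - 1) * zeta s h)) (at x)"
  by (rule has_derivative_eq_rhs[OF has_derivative_power[OF zeta_has_derivative]]) (simp add: mult_ac)

lemma zeta_radial_has_derivative:
  assumes "\<And>t. (g has_real_derivative g' t) (at t)"
  shows "((\<lambda>x. zeta s x ^ n * of_real (g (x \<bullet> x))) has_derivative
    (\<lambda>h. of_nat n * zeta s x ^ (n - 1) * zeta s h * of_real (g (x \<bullet> x))
       + zeta s x ^ n * of_real (2 * (x \<bullet> h)) * of_real (g' (x \<bullet> x)))) (at x)"
  by (rule has_derivative_eq_rhs[OF has_derivative_mult[OF zeta_power_has_derivative radial_has_derivative[OF assms]]])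
    (simp add: algebra_simps)

text \<open>\<open>zeta s x ^ n\<close> is harmonic and homogeneous of degree \<open>n\<close>:
  harmonicity removes the term with undifferentiated \<open>g\<close>, and Euler's identity puts the
  \<open>n\<close> into the coefficient of \<open>g'\<close>. The \<open>1\<close> in
  \<open>n + 1\<close> is the contribution of a purely radial function in the plane.\<close>

lemma laplacian_zeta_radial:
  assumes g: "smooth_real g" and s: "s\<^sup>2 = 1"
  shows "laplacian (\<lambda>x. zeta s x ^ n * of_real (g (x \<bullet> x))) x =
    zeta s x ^ n * of_real (4 * (x \<bullet> x) * deriv (deriv g) (x \<bullet> x) + 4 * (real n + 1) * deriv g (x \<bullet> x))"
proof -
  note d1 = zeta_radial_has_derivative[OF smooth_real_deriv(1)[OF g]]
  note d2 = zeta_radial_has_derivative[OF smooth_real_deriv(1)[OF smooth_real_deriv(2)[OF g]]]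
  let ?G = "\<lambda>x. complex_of_real (g (x \<bullet> x))" and ?G' = "\<lambda>x. complex_of_real (deriv g (x \<bullet> x))"
  let ?G2 = "\<lambda>x. complex_of_real (deriv (deriv g) (x \<bullet> x))"
  have p1: "partial_deriv i (\<lambda>x. zeta s x ^ n * ?G x) =
      (\<lambda>x. (of_nat n * zeta s (axis i 1)) * (zeta s x ^ (n - 1) * ?G x) + 2 * of_real (x $ i) * (zeta s x ^ n * ?G' x))" for i
    by (rule ext) (simp add: partial_deriv_eq[OF d1] cart_eq_inner_axis mult_ac)
  have p2: "partial_deriv i (partial_deriv i (\<lambda>x. zeta s x ^ n * ?G x)) x =
      (of_nat n * zeta s (axis i 1)) * (of_nat (n - 1) * zeta s x ^ (n - 1 - 1) * zeta s (axis i 1) * ?G x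
         + zeta s x ^ (n - 1) * (2 * of_real (x $ i)) * ?G' x)
      + (2 * of_real (x $ i) * (of_nat n * zeta s x ^ (n - 1) * zeta s (axis i 1) * ?G' x
         + zeta s x ^ n * (2 * of_real (x $ i)) * ?G2 x)
      + 2 * (zeta s x ^ n * ?G' x))" for i
  proof -
    have "((\<lambda>x. (of_nat n * zeta s (axis i 1)) * (zeta s x ^ (n - 1) * ?G x) + 2 * of_real (x $ i) * (zeta s x ^ n * ?G' x))
      has_derivative (\<lambda>h. (of_nat n * zeta s (axis i 1)) *
        (of_nat (n - 1) * zeta s x ^ (n - 1 - 1) * zeta s h * ?G x
         + zeta s x ^ (n - 1) * of_real (2 * (x \<bullet> h)) * ?G' x)
      + (2 * of_real (x $ i) * (of_nat n * zeta s x ^ (n - 1) * zeta s h * ?G' x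
         + zeta s x ^ n * of_real (2 * (x \<bullet> h)) * ?G2 x)
      + 2 * of_real (h $ i) * (zeta s x ^ n * ?G' x)))) (at x)"
      by (intro has_derivative_add has_derivative_mult_right has_derivative_mult d1 d2 coord_has_derivative)
    from partial_deriv_eq[OF this, of i] show ?thesis
      unfolding p1 by (simp add: cart_eq_inner_axis inner_axis_axis)
  qed
  have xx: "complex_of_real (x \<bullet> x) = of_real (x $ 1) * of_real (x $ 1) + of_real (x $ 2) * of_real (x $ 2)"
    by (simp add: inner_vec_def sum_2)
  have ss: "complex_of_real s * of_real s = 1"
    using s by (metis of_real_1 of_real_mult power2_eq_square)
  \<comment> \<open>Prepares Euler's identity; for \<open>n = 0\<close> the truncated exponent
    \<open>n - 1\<close> is harmless because of the factor \<open>n\<close>.\<close>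
  have zn: "of_nat n * zeta s x ^ n = of_nat n * zeta s x ^ (n - 1) * (of_real (x $ 1) + \<i> * of_real s * of_real (x $ 2))"
    by (cases n) (simp_all add: zeta_def)
  have "laplacian (\<lambda>x. zeta s x ^ n * ?G x) x =
     4 * (of_nat n * zeta s x ^ (n - 1) * (of_real (x $ 1) + \<i> * of_real s * of_real (x $ 2))) * ?G' x
     + 4 * zeta s x ^ n * ?G' x + 4 * (of_real (x $ 1) * of_real (x $ 1) + of_real (x $ 2) * of_real (x $ 2)) * zeta s x ^ n * ?G2 x"
  proof -
    \<comment> \<open>A polynomial identity in free variables. The number \<open>w = \<i> s\<close>
      enters only through \<open>w * w = - 1\<close>, which is the harmonicity.\<close>
    have alg: "N * 1 * (M * Z2 * 1 * G + Z1 * (2 * X) * G1) + (2 * X * (N * Z1 * 1 * G1 + Z0 * (2 * X) * G2) + 2 * (Z0 * G1))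
      + (N * w * (M * Z2 * w * G + Z1 * (2 * Y) * G1) + (2 * Y * (N * Z1 * w * G1 + Z0 * (2 * Y) * G2) + 2 * (Z0 * G1)))
      = 4 * (N * Z1 * (X + w * Y)) * G1 + 4 * Z0 * G1 + 4 * (X * X + Y * Y) * Z0 * G2"
      if "w * w = - 1" for N M Z0 Z1 Z2 G G1 G2 X Y w :: complex
      using that by algebra
    have "(\<i> * complex_of_real s) * (\<i> * complex_of_real s) = - 1"
      using ss by (simp add: mult_ac)
    from alg[OF this] show ?thesis
      unfolding laplacian_def sum_2 p2 zeta_axis by this
  qed
  also have "\<dots> = zeta s x ^ n * of_real (4 * (x \<bullet> x) * deriv (deriv g) (x \<bullet> x) + 4 * (real n + 1) * deriv g (x \<bullet> x))"
    unfolding zn[symmetric] of_real_add of_real_mult xx by (simp add: algebra_simps)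
  finally show ?thesis .
qed

lemma test_function_zeta_radial:
  assumes g: "smooth_real g" and b: "\<And>t. t \<ge> b\<^sup>2 \<Longrightarrow> g t = 0" "0 \<le> b" "cball 0 b \<subseteq> \<Omega>"
  shows "test_function \<Omega> (\<lambda>x. zeta s x ^ n * of_real (g (x \<bullet> x)))"
proof -
  have "smooth_fun (\<lambda>x. zeta s x ^ n * of_real (g (x \<bullet> x)))"
    by (intro smooth_fun.intros smooth_fun_zeta_power g)
  then have "smooth (\<lambda>x. zeta s x ^ n * of_real (g (x \<bullet> x)))"
    by (rule smooth_fun_smooth)
  moreover have sub: "{x. zeta s x ^ n * of_real (g (x \<bullet> x)) \<noteq> 0} \<subseteq> cball 0 b"
  proof
    fix x assume "x \<in> {x. zeta s x ^ n * of_real (g (x \<bullet> x)) \<noteq> 0}"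
    then have "g (x \<bullet> x) \<noteq> 0" by simp
    then have "(norm x)\<^sup>2 < b\<^sup>2"
      using b(1)[of "x \<bullet> x"] unfolding power2_norm_eq_inner by (meson not_le)
    then show "x \<in> cball 0 b"
      using b(2) by (simp add: power2_less_imp_less less_imp_le)
  qed
  moreover have "closure {x. zeta s x ^ n * of_real (g (x \<bullet> x)) \<noteq> 0} \<subseteq> cball 0 b"
    by (rule closure_minimal[OF sub closed_cball])
  moreover have "compact (closure {x. zeta s x ^ n * of_real (g (x \<bullet> x)) \<noteq> 0})"
    unfolding compact_closure by (rule bounded_subset[OF bounded_cball sub])
  ultimately show ?thesis
    unfolding test_function_def using b(3) by (intro conjI) (assumption | rule subset_trans)+
qed

subsection \<open>Circle means of weak solutions\<close>

text \<open>The Fourier coefficient of order \<open>- m\<close> on the circle, without the factor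
  \<open>1 / (2 * pi)\<close>. The index is real so that \<open>s * real n\<close> with
  \<open>s = \<plusminus>1\<close> can be inserted.\<close>

definition circle_mean :: "real \<Rightarrow> (real^2 \<Rightarrow> complex) \<Rightarrow> real \<Rightarrow> complex" where
  "circle_mean m u r = integral {0..2 * pi} (\<lambda>\<theta>. u (polar r \<theta>) * cis (m * \<theta>))"

text \<open>Taking the derivative field \<open>D\<close> as an argument keeps the quantity
  meaningful on the boundary circle, where only the derivative within the disk exists.\<close>

definition circle_mean' :: "real \<Rightarrow> (real^2 \<Rightarrow> ((real^2) \<Rightarrow>\<^sub>L complex)) \<Rightarrow> real \<Rightarrow> complex" where
  "circle_mean' m D r = integral {0..2 * pi} (\<lambda>\<theta>. D (polar r \<theta>) (polar 1 \<theta>) * cis (m * \<theta>))"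

lemma continuous_on_blinfun_apply2:
  assumes "continuous_on S f" "continuous_on S g"
  shows "continuous_on S (\<lambda>x. blinfun_apply (f x) (g x))"
  by (rule bounded_bilinear.continuous_on[OF bounded_bilinear_blinfun_apply assms])

lemma continuous_on_circle_mean:
  assumes "continuous_on S u" "\<And>r \<theta>. r \<in> T \<Longrightarrow> polar r \<theta> \<in> S"
  shows "continuous_on T (circle_mean m u)"
proof -
  have "continuous_on (T \<times> cbox 0 (2 * pi)) (\<lambda>p. u (polar (fst p) (snd p)) * cis (m * snd p))"
    using assms(2) by (intro continuous_intros continuous_on_compose2[OF assms(1)]) auto
  then show ?thesis
    unfolding circle_mean_def[abs_def] cbox_interval[symmetric]
    by (intro integral_continuous_on_param) (simp add: case_prod_unfold)
qed

lemma continuous_on_circle_mean':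
  assumes "continuous_on S D" "\<And>r \<theta>. r \<in> T \<Longrightarrow> polar r \<theta> \<in> S"
  shows "continuous_on T (circle_mean' m D)"
proof -
  have "continuous_on (T \<times> cbox 0 (2 * pi)) (\<lambda>p. D (polar (fst p) (snd p)) (polar 1 (snd p)) * cis (m * snd p))"
    using assms(2) by (intro continuous_intros continuous_on_blinfun_apply2 continuous_on_compose2[OF assms(1)]) auto
  then show ?thesis
    unfolding circle_mean'_def[abs_def] cbox_interval[symmetric]
    by (intro integral_continuous_on_param) (simp add: case_prod_unfold)
qed

lemma polar_has_vector_derivative:
  "((\<lambda>r. polar r \<theta>) has_vector_derivative polar 1 \<theta>) (at r within T)"
  unfolding polar_eq_axis by (auto intro!: derivative_eq_intros simp: has_vector_derivative_def algebra_simps)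

text \<open>Differentiation under the integral. Derivatives are taken within \<open>S\<close> and
  \<open>T\<close>, so that \<open>r\<close> may be an endpoint and the circle may be the boundary
  of the disk.\<close>

lemma circle_mean_has_vector_derivative:
  assumes D: "\<And>x. x \<in> S \<Longrightarrow> (u has_derivative blinfun_apply (D x)) (at x within S)" "continuous_on S D"
    and T: "\<And>r \<theta>. r \<in> T \<Longrightarrow> polar r \<theta> \<in> S" "convex T" "r \<in> T"
  shows "(circle_mean m u has_vector_derivative circle_mean' m D r) (at r within T)"
proof -
  have u: "continuous_on S u"
    by (rule has_derivative_continuous_on[OF D(1)])
  have "((\<lambda>r. integral (cbox 0 (2 * pi)) (\<lambda>\<theta>. u (polar r \<theta>) * cis (m * \<theta>))) has_vector_derivative
     integral (cbox 0 (2 * pi)) (\<lambda>\<theta>. D (polar r \<theta>) (polar 1 \<theta>) * cis (m * \<theta>))) (at r within T)"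
  proof (rule leibniz_rule_vector_derivative[OF _ _ _ T(3,2)])
    fix r \<theta> assume r: "r \<in> T"
    have "(u has_derivative D (polar r \<theta>)) (at (polar r \<theta>) within (\<lambda>r. polar r \<theta>) ` T)"
      by (rule has_derivative_subset[OF D(1)]) (use T(1) r in auto)
    from vector_derivative_diff_chain_within[OF polar_has_vector_derivative this]
    have "((\<lambda>r. u (polar r \<theta>)) has_vector_derivative D (polar r \<theta>) (polar 1 \<theta>)) (at r within T)"
      by (simp add: o_def)
    then show "((\<lambda>r. u (polar r \<theta>) * cis (m * \<theta>)) has_vector_derivative D (polar r \<theta>) (polar 1 \<theta>) * cis (m * \<theta>)) (at r within T)"
      by (rule has_vector_derivative_mult_left)
  next
    fix r assume r: "r \<in> T"
    show "(\<lambda>\<theta>. u (polar r \<theta>) * cis (m * \<theta>)) integrable_on cbox 0 (2 * pi)"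
      using T(1)[OF r] by (intro integrable_continuous continuous_intros continuous_on_compose2[OF u]) auto
  next
    show "continuous_on (T \<times> cbox 0 (2 * pi)) (\<lambda>(r, \<theta>). D (polar r \<theta>) (polar 1 \<theta>) * cis (m * \<theta>))"
      unfolding case_prod_unfold using T(1)
      by (intro continuous_intros continuous_on_blinfun_apply2 continuous_on_compose2[OF D(2)]) auto
  qed
  then show ?thesis
    by (simp add: circle_mean_def[abs_def] circle_mean'_def)
qed

lemma zeta_polar:
  assumes "s\<^sup>2 = 1"
  shows "zeta s (polar r \<theta>) ^ n = of_real (r ^ n) * cis (s * real n * \<theta>)"
proof -
  have "s = 1 \<or> s = - 1"
    using assms by (simp add: power2_eq_1_iff)
  then have "zeta s (polar r \<theta>) = of_real r * cis (s * \<theta>)"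
    by (auto simp: zeta_def complex_eq_iff)
  moreover have "cis (s * \<theta>) ^ n = cis (s * real n * \<theta>)"
    unfolding Complex.DeMoivre by (simp only: mult_ac)
  ultimately show ?thesis
    by (simp add: power_mult_distrib)
qed

lemma absolutely_integrable_extend_zero:
  fixes f :: "'a::euclidean_space \<Rightarrow> 'b::euclidean_space"
  assumes "f absolutely_integrable_on A" "A \<subseteq> B" "negligible N" "\<And>x. x \<in> B - A - N \<Longrightarrow> f x = 0"
  shows "f absolutely_integrable_on B" "integral B f = integral A f"
proof -
  have "{x \<in> A - B. f x \<noteq> 0} = {}" using assms(2) by blast
  then have 1: "negligible {x \<in> A - B. f x \<noteq> 0}" by (simp only: negligible_empty)
  have 2: "negligible {x \<in> B - A. f x \<noteq> 0}"
    by (rule negligible_subset[OF assms(3)]) (use assms(4) in blast)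
  show "f absolutely_integrable_on B"
    using assms(1) absolutely_integrable_spike_set_eq[OF 1 2] by blast
  show "integral B f = integral A f"
    using integral_spike_set[OF 1 2] by simp
qed

text \<open>What the Helmholtz operator leaves of
  \<open>zeta s x ^ n * \<eta> t * z n (\<kappa> * t)\<close>, with \<open>t\<close> the squared
  norm, after the equation for \<open>z\<close> has removed the terms with undifferentiated
  \<open>\<eta>\<close>; so it lives only where \<open>\<eta>\<close> varies.\<close>

definition cutoff_op :: "real \<Rightarrow> nat \<Rightarrow> (nat \<Rightarrow> real \<Rightarrow> real) \<Rightarrow> (real \<Rightarrow> real) \<Rightarrow> real \<Rightarrow> real" where
  "cutoff_op \<kappa> n z \<eta> t = 4 * t * deriv (deriv \<eta>) t * z n (\<kappa> * t)
     - 8 * t * \<kappa> * deriv \<eta> t * z (Suc n) (\<kappa> * t) + 4 * (real n + 1) * deriv \<eta> t * z n (\<kappa> * t)"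

text \<open>For the first kind the product is smooth on the whole line. Otherwise the cut-off
  vanishes near \<open>0\<close>, and the open pieces \<open>{0<..}\<close> and
  \<open>{..<\<delta>}\<close> cover the line.\<close>

lemma cutoff_smooth:
  assumes z: "clifford_seq z" and \<kappa>: "\<kappa> > 0" and \<eta>: "smooth_real \<eta>"
    and c: "z = clifford_J \<or> (\<exists>\<delta>>0. \<forall>t\<le>\<delta>. \<eta> t = 0)"
  shows "smooth_real (\<lambda>t. \<eta> t * z n (\<kappa> * t))"
proof -
  let ?g = "\<lambda>t. \<eta> t * z n (\<kappa> * t)"
  have prod: "diffn m S ?g" if S: "open S" "\<And>t. t \<in> S \<Longrightarrow> \<kappa> * t \<in> T" and zT: "diffn m T (z n)" for m S T
    using \<eta> zT S diffn_affine[of S 0 \<kappa> T m "z n"] diffn_subset[of m UNIV \<eta> S]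
    by (intro diffn_mult) (auto simp: smooth_real_def)
  show ?thesis
    using c
  proof
    assume "z = clifford_J"
    then have "diffn m UNIV (z n)" for m
      by (simp add: diffn_seq clifford_J_deriv)
    then show ?thesis
      unfolding smooth_real_def using prod[of UNIV UNIV] by blast
  next
    assume "\<exists>\<delta>>0. \<forall>t\<le>\<delta>. \<eta> t = 0"
    then obtain \<delta> where \<delta>: "\<delta> > 0" "\<And>t. t \<le> \<delta> \<Longrightarrow> \<eta> t = 0" by blast
    have "diffn m ({0<..} \<union> {..<\<delta>}) ?g" for m
    proof (rule diffn_Un)
      have "diffn m {0<..} (z n)"
        by (rule diffn_seq) (use clifford_seq_deriv[OF z] in auto)
      then show "diffn m {0<..} ?g"
        by (intro prod) (use \<kappa> in auto)
      show "diffn m {..<\<delta>} ?g"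
        by (rule diffn_cong[OF _ _ diffn_const[of _ _ 0]]) (use \<delta> in auto)
    qed
    moreover have "{0<..} \<union> {..<\<delta>} = UNIV"
      using \<delta>(1) by auto
    ultimately show ?thesis by (simp add: smooth_real_def)
  qed
qed

text \<open>The terms without a derivative of \<open>\<eta>\<close> add up to
  \<open>4 * \<kappa> * \<eta>\<close> times the equation for \<open>z n\<close>. The factor is
  \<open>4 * \<kappa>\<close> because the argument of \<open>z n\<close> is
  \<open>\<kappa> * (x \<bullet> x)\<close> with \<open>\<kappa> = k\<^sup>2/4\<close>.\<close>

lemma cutoff_helmholtz:
  fixes n :: nat
  assumes z: "clifford_seq z" and \<kappa>: "\<kappa> > 0" and \<eta>: "smooth_real \<eta>"
    and c: "z = clifford_J \<or> (\<exists>\<delta>>0. \<forall>t\<le>\<delta>. \<eta> t = 0)" and s: "s\<^sup>2 = 1" and x: "x \<noteq> 0"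
  defines "\<phi> \<equiv> \<lambda>x. zeta s x ^ n * of_real (\<eta> (x \<bullet> x) * z n (\<kappa> * (x \<bullet> x)))"
  shows "laplacian \<phi> x + of_real (4 * \<kappa>) * \<phi> x = zeta s x ^ n * of_real (cutoff_op \<kappa> n z \<eta> (x \<bullet> x))"
proof -
  define g where "g t = \<eta> t * z n (\<kappa> * t)" for t
  define t where "t = x \<bullet> x"
  have t: "t > 0" using x by (simp add: t_def)
  have zd: "((\<lambda>t. z m (\<kappa> * t)) has_real_derivative - z (Suc m) (\<kappa> * t) * \<kappa>) (at t)" if "t > 0" for m t
    by (rule DERIV_chain2[where f = "z m" and g = "\<lambda>t. \<kappa> * t" and x = t, OF clifford_seq_deriv[OF z]])
      (use \<kappa> that in \<open>auto intro!: derivative_eq_intros\<close>)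
  note \<eta>1 = smooth_real_deriv(1)[OF \<eta>]
  note \<eta>2 = smooth_real_deriv(1)[OF smooth_real_deriv(2)[OF \<eta>]]
  have g1: "deriv g t = deriv \<eta> t * z n (\<kappa> * t) - \<kappa> * \<eta> t * z (Suc n) (\<kappa> * t)" if "t > 0" for t
    unfolding g_def[abs_def]
    by (rule DERIV_imp_deriv, rule DERIV_cong[OF DERIV_mult[OF \<eta>1 zd[OF that]]]) simp
  have "((\<lambda>t. deriv \<eta> t * z n (\<kappa> * t) - \<kappa> * \<eta> t * z (Suc n) (\<kappa> * t)) has_real_derivative
     (deriv (deriv \<eta>) t * z n (\<kappa> * t) - 2 * \<kappa> * deriv \<eta> t * z (Suc n) (\<kappa> * t) + \<kappa>\<^sup>2 * \<eta> t * z (Suc (Suc n)) (\<kappa> * t))) (at t)"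
    by (rule DERIV_cong[OF DERIV_diff[OF DERIV_mult[OF \<eta>2 zd[OF t]] DERIV_mult[OF DERIV_cmult[OF \<eta>1] zd[OF t]]]])
      (simp add: algebra_simps power2_eq_square)
  then have "(deriv g has_real_derivative
     (deriv (deriv \<eta>) t * z n (\<kappa> * t) - 2 * \<kappa> * deriv \<eta> t * z (Suc n) (\<kappa> * t) + \<kappa>\<^sup>2 * \<eta> t * z (Suc (Suc n)) (\<kappa> * t))) (at t)"
    by (rule has_field_derivative_transform_within_open[of _ _ _ "{0<..}"]) (use t g1 in auto)
  then have g2: "deriv (deriv g) t = deriv (deriv \<eta>) t * z n (\<kappa> * t) - 2 * \<kappa> * deriv \<eta> t * z (Suc n) (\<kappa> * t) + \<kappa>\<^sup>2 * \<eta> t * z (Suc (Suc n)) (\<kappa> * t)"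
    by (rule DERIV_imp_deriv)
  have "smooth_real g"
    unfolding g_def[abs_def] by (rule cutoff_smooth[OF z \<kappa> \<eta> c])
  from laplacian_zeta_radial[OF this s, of n x]
  have "laplacian \<phi> x = zeta s x ^ n * of_real (4 * t * deriv (deriv g) t + 4 * (real n + 1) * deriv g t)"
    by (simp add: \<phi>_def g_def t_def)
  then have "laplacian \<phi> x + of_real (4 * \<kappa>) * \<phi> x =
      zeta s x ^ n * of_real (4 * t * deriv (deriv g) t + 4 * (real n + 1) * deriv g t + 4 * \<kappa> * g t)"
    by (simp add: \<phi>_def g_def t_def algebra_simps)
  also have "4 * t * deriv (deriv g) t + 4 * (real n + 1) * deriv g t + 4 * \<kappa> * g t = cutoff_op \<kappa> n z \<eta> t"
  proof -
    have "z n (\<kappa> * t) = (real n + 1) * z (Suc n) (\<kappa> * t) - (\<kappa> * t) * z (Suc (Suc n)) (\<kappa> * t)"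
      using \<kappa> t by (intro clifford_seq_rec[OF z]) simp
    then have "4 * \<kappa> * \<eta> t * (\<kappa> * t * z (Suc (Suc n)) (\<kappa> * t) - (real n + 1) * z (Suc n) (\<kappa> * t) + z n (\<kappa> * t)) = 0"
      by simp
    then show ?thesis
      unfolding g1[OF t] g2 g_def cutoff_op_def by (simp add: algebra_simps power2_eq_square)
  qed
  finally show ?thesis by (simp add: t_def)
qed

text \<open>Source-free weak solutions with one exceptional point \<open>x\<^sub>0\<close>. It need
  not lie in the ball: the addition theorem has it on the bounding circle, uniqueness has it
  inside.\<close>

locale weak_solution =
  fixes \<rho> \<kappa> :: real and x\<^sub>0 :: "real^2" and u :: "real^2 \<Rightarrow> complex" and D :: "real^2 \<Rightarrow> ((real^2) \<Rightarrow>\<^sub>L complex)"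
  assumes \<kappa>_pos: "\<kappa> > 0"
    and C1: "continuous_on (ball 0 \<rho> - {x\<^sub>0}) D"
      "\<And>x. x \<in> ball 0 \<rho> - {x\<^sub>0} \<Longrightarrow> (u has_derivative blinfun_apply (D x)) (at x within ball 0 \<rho> - {x\<^sub>0})"
    and weak: "\<And>\<phi>. test_function (ball 0 \<rho>) \<phi> \<Longrightarrow>
      (LINT x:ball 0 \<rho>|lebesgue. u x * (laplacian \<phi> x + of_real (4 * \<kappa>) * \<phi> x)) = 0"
begin

text \<open>The conserved quantity: the Wronskian, in the radius, of a circle mean of \<open>u\<close> and a radial solution
  of the same order. The sign \<open>s = \<plusminus>1\<close> lets \<open>n :: nat\<close> cover the orders \<open>n\<close> and \<open>-n\<close>.\<close>

definition bracket :: "real \<Rightarrow> nat \<Rightarrow> (nat \<Rightarrow> real \<Rightarrow> real) \<Rightarrow> real \<Rightarrow> complex" where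
  "bracket s n z r = of_real (r ^ n) *
     (of_real (- \<kappa> * r\<^sup>2 * z (Suc n) (\<kappa> * r\<^sup>2)) * circle_mean (s * real n) u r
      + of_real (real n / 2 * z n (\<kappa> * r\<^sup>2)) * circle_mean (s * real n) u r
      - of_real (r / 2 * z n (\<kappa> * r\<^sup>2)) * circle_mean' (s * real n) D r)"

lemma u_continuous: "continuous_on (ball 0 \<rho> - {x\<^sub>0}) u"
  using C1(2) by (rule has_derivative_continuous_on)

lemma z_continuous:
  assumes "clifford_seq z" "0 < a"
  shows "continuous_on {a..b} (\<lambda>r. z n (\<kappa> * r\<^sup>2))"
proof (rule continuous_on_compose2[of "{0<..}" "z n"])
  show "continuous_on {0<..} (z n)"
    by (intro continuous_at_imp_continuous_on ballI clifford_seq_continuous[OF assms(1)]) auto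
qed (use assms \<kappa>_pos in \<open>auto intro!: continuous_intros\<close>)

lemma annulus_polar:
  assumes "0 < a" "b < \<rho>" "norm x\<^sub>0 \<notin> {a..b}" "r \<in> {a..b}"
  shows "polar r \<theta> \<in> ball 0 \<rho> - {x\<^sub>0}"
  using assms by auto

lemma bracket_continuous:
  assumes z: "clifford_seq z" and ab: "0 < a" "b < \<rho>" "norm x\<^sub>0 \<notin> {a..b}"
  shows "continuous_on {a..b} (bracket s n z)"
  unfolding bracket_def[abs_def]
  by (intro continuous_intros z_continuous[OF z ab(1)] continuous_on_circle_mean[OF u_continuous]
      continuous_on_circle_mean'[OF C1(1)] annulus_polar[OF ab]) auto

text \<open>In polar coordinates the integrand contains \<open>\<eta>''\<close> times the circle
  mean. Integrating by parts in the radius moves that derivative onto the mean and leaves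
  \<open>\<eta>'\<close> times the bracket; the boundary terms vanish because
  \<open>\<eta>' = 0\<close> at both radii.\<close>

lemma annulus_integral:
  fixes n :: nat
  assumes z: "clifford_seq z" and s: "s\<^sup>2 = 1" and ab: "0 < a" "a < b" "b < \<rho>" "norm x\<^sub>0 \<notin> {a..b}"
    and \<eta>: "smooth_real \<eta>" "\<And>t. t \<le> a\<^sup>2 \<Longrightarrow> \<eta> t = 1" "\<And>t. t \<ge> b\<^sup>2 \<Longrightarrow> \<eta> t = 0"
      "\<And>t. t \<le> a\<^sup>2 \<or> t \<ge> b\<^sup>2 \<Longrightarrow> deriv \<eta> t = 0"
  defines "F \<equiv> \<lambda>x. u x * (zeta s x ^ n * of_real (cutoff_op \<kappa> n z \<eta> (x \<bullet> x)))"
  shows "F absolutely_integrable_on ball 0 \<rho>"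
    and "integral (ball 0 \<rho>) F = integral {a..b} (\<lambda>r. of_real (4 * r * deriv \<eta> (r\<^sup>2)) * bracket s n z r)"
proof -
  define m where "m = circle_mean (s * real n) u"
  define m' where "m' = circle_mean' (s * real n) D"
  define Q where "Q = cutoff_op \<kappa> n z \<eta>"
  note \<eta>1 = smooth_real_deriv(1)[OF \<eta>(1)]
  note \<eta>2 = smooth_real_deriv(1)[OF smooth_real_deriv(2)[OF \<eta>(1)]]
  note \<eta>3 = smooth_real_deriv(1)[OF smooth_real_deriv(2)[OF smooth_real_deriv(2)[OF \<eta>(1)]]]
  have \<eta>c: "continuous_on S (deriv \<eta>)" "continuous_on S (deriv (deriv \<eta>))" for S
    using DERIV_isCont[OF \<eta>2] DERIV_isCont[OF \<eta>3] by (auto intro: continuous_at_imp_continuous_on)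
  have Qc: "continuous_on {a..b} (\<lambda>r. Q (r\<^sup>2))"
    unfolding Q_def cutoff_op_def
    by (intro continuous_intros z_continuous[OF z ab(1)] continuous_on_compose2[OF \<eta>c(1)[of UNIV]]
        continuous_on_compose2[OF \<eta>c(2)[of UNIV]]) auto
  \<comment> \<open>One power of the radius more than in \<open>zeta s x ^ n\<close>: the
    Jacobian.\<close>
  define g where "g = (\<lambda>p. of_real (fst p ^ Suc n * Q ((fst p)\<^sup>2)) * (u (polar (fst p) (snd p)) * cis (s * real n * snd p)))"
  have gc: "continuous_on (cbox (a, 0) (b, 2 * pi)) g"
  proof -
    have "polar (fst p) (snd p) \<in> ball 0 \<rho> - {x\<^sub>0}" if "p \<in> cbox (a, 0) (b, 2 * pi)" for p
      by (rule annulus_polar[OF ab(1,3,4)]) (use that in \<open>auto simp: cbox_Pair_eq\<close>)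
    then have "continuous_on (cbox (a, 0) (b, 2 * pi)) (\<lambda>p. u (polar (fst p) (snd p)))"
      by (intro continuous_on_compose2[OF u_continuous] continuous_intros) blast
    moreover have "continuous_on (cbox (a, 0) (b, 2 * pi)) (\<lambda>p. Q ((fst p)\<^sup>2))"
      by (rule continuous_on_compose2[OF Qc]) (auto intro!: continuous_intros simp: cbox_Pair_eq)
    ultimately show ?thesis
      unfolding g_def by (intro continuous_intros)
  qed
  have ge: "g (r, \<theta>) = r *\<^sub>R F (polar r \<theta>)" if "a < r" "r < b" for r \<theta>
  proof -
    have "polar r \<theta> \<bullet> polar r \<theta> = r\<^sup>2"
      by (simp add: power2_norm_eq_inner[symmetric])
    then show ?thesis
      by (simp add: g_def F_def zeta_polar[OF s] Q_def scaleR_conv_of_real)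
  qed
  note pol = polar_integral[OF less_imp_le[OF ab(1)] gc ge]
  let ?A = "{x::real^2. a < norm x \<and> norm x < b}"
  \<comment> \<open>The two circles are left out because \<open>deriv (deriv \<eta>) = 0\<close> is
    derived from \<open>deriv \<eta> = 0\<close> on an open set; they have measure zero.\<close>
  have Fz: "F x = 0" if x: "x \<in> ball 0 \<rho> - ?A - (sphere 0 a \<union> sphere 0 b)" for x
  proof -
    have "norm x < a \<or> norm x > b" using x by auto
    then have 1: "x \<bullet> x < a\<^sup>2 \<or> x \<bullet> x > b\<^sup>2"
      using ab unfolding power2_norm_eq_inner[symmetric]
      by (auto intro: power_strict_mono)
    have d1: "deriv \<eta> (x \<bullet> x) = 0"
      using 1 by (intro \<eta>(4)) auto
    have "deriv (deriv \<eta>) (x \<bullet> x) = 0"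
    proof (rule DERIV_imp_deriv, rule has_field_derivative_transform_within_open[of "\<lambda>_. 0"])
      show "open ({..<a\<^sup>2} \<union> {b\<^sup>2<..})" by (intro open_Un) auto
      show "x \<bullet> x \<in> {..<a\<^sup>2} \<union> {b\<^sup>2<..}" using 1 by auto
      show "0 = deriv \<eta> t" if "t \<in> {..<a\<^sup>2} \<union> {b\<^sup>2<..}" for t
        using that by (subst \<eta>(4)) auto
    qed simp
    with d1 show "F x = 0" by (simp add: F_def cutoff_op_def)
  qed
  have sub: "?A \<subseteq> ball 0 \<rho>" using ab by auto
  have neg: "negligible (sphere (0::real^2) a \<union> sphere 0 b)"
    by (intro negligible_Un negligible_sphere)
  show "F absolutely_integrable_on ball 0 \<rho>"
    by (rule absolutely_integrable_extend_zero(1)[OF pol(1) sub neg Fz])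
  have "integral (ball 0 \<rho>) F = integral ?A F"
    by (rule absolutely_integrable_extend_zero(2)[OF pol(1) sub neg Fz])
  also have "\<dots> = integral {a..b} (\<lambda>r. integral {0..2 * pi} (\<lambda>\<theta>. g (r, \<theta>)))"
    by (rule pol(2))
  also have "\<dots> = integral {a..b} (\<lambda>r. of_real (r ^ Suc n * Q (r\<^sup>2)) * m r)"
    by (simp add: g_def m_def circle_mean_def)
  also have "\<dots> = integral {a..b} (\<lambda>r. of_real (4 * r * deriv \<eta> (r\<^sup>2)) * bracket s n z r)"
  proof -
    \<comment> \<open>The boundary expression of the integration by parts: its derivative is the
      difference \<open>p\<close> of the two integrands.\<close>
    define P where "P r = of_real (2 * r ^ (n + 2) * z n (\<kappa> * r\<^sup>2) * deriv \<eta> (r\<^sup>2)) * m r" for r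
    define p where "p r = of_real (r ^ Suc n * Q (r\<^sup>2)) * m r - of_real (4 * r * deriv \<eta> (r\<^sup>2)) * bracket s n z r" for r
    have "(p has_integral (P b - P a)) {a..b}"
    proof (rule fundamental_theorem_of_calculus)
      fix r assume r: "r \<in> {a..b}"
      then have r0: "r > 0" using ab by auto
      have zd: "((\<lambda>r. z n (\<kappa> * r\<^sup>2)) has_real_derivative - z (Suc n) (\<kappa> * r\<^sup>2) * (\<kappa> * (2 * r))) (at r within {a..b})"
        by (rule DERIV_chain2[where f = "z n" and g = "\<lambda>r. \<kappa> * r\<^sup>2" and x = r, OF clifford_seq_deriv[OF z]])
          (use \<kappa>_pos r0 in \<open>auto intro!: derivative_eq_intros\<close>)
      have \<eta>d: "((\<lambda>r. deriv \<eta> (r\<^sup>2)) has_real_derivative deriv (deriv \<eta>) (r\<^sup>2) * (2 * r)) (at r within {a..b})"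
        by (rule DERIV_chain2[where f = "deriv \<eta>" and g = "\<lambda>r. r\<^sup>2" and x = r, OF \<eta>2]) (auto intro!: derivative_eq_intros)
      have pd: "((\<lambda>r. 2 * r ^ (n + 2)) has_real_derivative 2 * (real n + 2) * r ^ Suc n) (at r within {a..b})"
        by (rule DERIV_cong[OF DERIV_cmult[OF has_field_derivative_at_within[OF DERIV_pow]]]) simp
      define c where "c = (2 * (real n + 2) * r ^ Suc n) * z n (\<kappa> * r\<^sup>2) * deriv \<eta> (r\<^sup>2)
        + 2 * r ^ (n + 2) * (- z (Suc n) (\<kappa> * r\<^sup>2) * (\<kappa> * (2 * r))) * deriv \<eta> (r\<^sup>2)
        + 2 * r ^ (n + 2) * z n (\<kappa> * r\<^sup>2) * (deriv (deriv \<eta>) (r\<^sup>2) * (2 * r))"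
      have rd: "((\<lambda>r. 2 * r ^ (n + 2) * z n (\<kappa> * r\<^sup>2) * deriv \<eta> (r\<^sup>2)) has_real_derivative c) (at r within {a..b})"
        by (rule DERIV_cong[OF DERIV_mult[OF DERIV_mult[OF pd zd] \<eta>d]]) (simp add: c_def algebra_simps)
      have md: "(m has_vector_derivative m' r) (at r within {a..b})"
        unfolding m_def m'_def
        by (rule circle_mean_has_vector_derivative[OF C1(2) C1(1) annulus_polar[OF ab(1,3,4)]]) (use r in auto)
      have "(P has_vector_derivative of_real (2 * r ^ (n + 2) * z n (\<kappa> * r\<^sup>2) * deriv \<eta> (r\<^sup>2)) * m' r + of_real c * m r) (at r within {a..b})"
        unfolding P_def[abs_def]
        by (rule has_vector_derivative_mult[OF has_vector_derivative_of_real[OF rd] md])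
      moreover have "of_real (2 * r ^ (n + 2) * z n (\<kappa> * r\<^sup>2) * deriv \<eta> (r\<^sup>2)) * m' r + of_real c * m r = p r"
        unfolding p_def c_def bracket_def m_def[symmetric] m'_def[symmetric] Q_def cutoff_op_def
        by (simp add: algebra_simps power2_eq_square)
      ultimately show "(P has_vector_derivative p r) (at r within {a..b})" by simp
    qed (use ab in simp)
    moreover have "P a = 0" "P b = 0"
      unfolding P_def by (simp_all add: \<eta>(4))
    ultimately have "integral {a..b} p = 0"
      by (simp add: integral_unique)
    moreover have "integral {a..b} p = integral {a..b} (\<lambda>r. of_real (r ^ Suc n * Q (r\<^sup>2)) * m r)
        - integral {a..b} (\<lambda>r. of_real (4 * r * deriv \<eta> (r\<^sup>2)) * bracket s n z r)"
      unfolding p_def[abs_def]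
    proof (rule integral_diff)
      have "continuous_on {a..b} m"
        unfolding m_def by (rule continuous_on_circle_mean[OF u_continuous annulus_polar[OF ab(1,3,4)]])
      then show "(\<lambda>r. of_real (r ^ Suc n * Q (r\<^sup>2)) * m r) integrable_on {a..b}"
        by (intro integrable_continuous_real continuous_intros Qc)
      show "(\<lambda>r. of_real (4 * r * deriv \<eta> (r\<^sup>2)) * bracket s n z r) integrable_on {a..b}"
        by (intro integrable_continuous_real continuous_intros bracket_continuous[OF z ab(1,3,4)]
            continuous_on_compose2[OF \<eta>c(1)[of UNIV]]) auto
    qed
    ultimately show ?thesis by simp
  qed
  finally show "integral (ball 0 \<rho>) F = integral {a..b} (\<lambda>r. of_real (4 * r * deriv \<eta> (r\<^sup>2)) * bracket s n z r)" .
qed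

end

text \<open>A weight of constant sign acts as an average. The mass \<open>- 2\<close> is the total
  change of \<open>2 * \<eta> (r\<^sup>2)\<close> for a step falling from \<open>1\<close> to
  \<open>0\<close>.\<close>

lemma norm_weighted_integral_le:
  fixes V :: "real \<Rightarrow> complex" and w :: "real \<Rightarrow> real"
  assumes ab: "a \<le> b" and V: "continuous_on {a..b} V" and w: "continuous_on {a..b} w"
    and w_neg: "\<And>r. r \<in> {a..b} \<Longrightarrow> w r \<le> 0" and wI: "integral {a..b} w = - 2"
    and Ve: "\<And>r. r \<in> {a..b} \<Longrightarrow> norm (V r - c) \<le> e"
  shows "norm (integral {a..b} (\<lambda>r. of_real (w r) * V r) + 2 * c) \<le> 2 * e"
proof -
  have i1: "(\<lambda>r. of_real (w r) * V r) integrable_on {a..b}"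
    by (intro integrable_continuous_real continuous_intros V w)
  have i2: "(\<lambda>r. of_real (w r) * c) integrable_on {a..b}"
    by (intro integrable_continuous_real continuous_intros w)
  have "integral {a..b} (\<lambda>r. of_real (w r) * c) = of_real (integral {a..b} w) * c"
    using integral_linear[OF integrable_continuous_real[OF w] bounded_linear_of_real[where ?'a = complex]]
    by (simp add: o_def)
  then have "integral {a..b} (\<lambda>r. of_real (w r) * V r) + 2 * c = integral {a..b} (\<lambda>r. of_real (w r) * (V r - c))"
    using integral_diff[OF i1 i2] wI by (simp add: algebra_simps)
  also have "norm \<dots> \<le> integral {a..b} (\<lambda>r. - w r * e)"
  proof (rule Henstock_Kurzweil_Integration.integral_norm_bound_integral)
    show "(\<lambda>r. of_real (w r) * (V r - c)) integrable_on {a..b}"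
      by (intro integrable_continuous_real continuous_intros V w)
    show "(\<lambda>r. - w r * e) integrable_on {a..b}"
      by (intro integrable_continuous_real continuous_intros w)
    show "norm (of_real (w r) * (V r - c)) \<le> - w r * e" if "r \<in> {a..b}" for r
      using w_neg[OF that] mult_left_mono[OF Ve[OF that], of "- w r"] by (simp add: norm_mult)
  qed
  also have "integral {a..b} (\<lambda>r. - w r * e) = 2 * e"
    using wI by simp
  finally show ?thesis .
qed

context weak_solution
begin

lemma bracket_cutoff:
  assumes z: "clifford_seq z" and p: "0 < p" "p < \<rho>" "p \<noteq> norm x\<^sub>0" and e: "0 < e"
  obtains a b where "0 < a" "a < p" "p < b" "b < \<rho>" "norm x\<^sub>0 \<notin> {a..b}"
    "\<forall>r\<in>{a..b}. norm (bracket s n z r - bracket s n z p) \<le> e"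
proof -
  \<comment> \<open>Half the distance from \<open>p\<close> to each of \<open>0\<close>,
    \<open>\<rho>\<close> and \<open>norm x\<^sub>0\<close>, so that the closed interval avoids all
    three.\<close>
  define \<delta>0 where "\<delta>0 = min (p / 2) (min ((\<rho> - p) / 2) (\<bar>p - norm x\<^sub>0\<bar> / 2))"
  have \<delta>0: "0 < \<delta>0" "\<delta>0 \<le> p / 2" "\<delta>0 \<le> (\<rho> - p) / 2" "\<delta>0 \<le> \<bar>p - norm x\<^sub>0\<bar> / 2"
    using p unfolding \<delta>0_def by (auto simp: min_def)
  have 1: "0 < p - \<delta>0" "p + \<delta>0 < \<rho>" using \<delta>0 p by auto
  have 2: "norm x\<^sub>0 \<notin> {p - \<delta>0..p + \<delta>0}"
  proof
    assume "norm x\<^sub>0 \<in> {p - \<delta>0..p + \<delta>0}"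
    then have "\<bar>p - norm x\<^sub>0\<bar> \<le> \<delta>0" by auto
    moreover have "\<not> (\<delta>0 \<le> d / 2 \<and> d \<le> \<delta>0)" for d
      using \<delta>0(1) by linarith
    ultimately show False using \<delta>0(4) by blast
  qed
  have "continuous_on {p - \<delta>0..p + \<delta>0} (bracket s n z)"
    by (rule bracket_continuous[OF z 1 2])
  then obtain d where d: "d > 0"
    "\<And>r. r \<in> {p - \<delta>0..p + \<delta>0} \<Longrightarrow> dist r p < d \<Longrightarrow> dist (bracket s n z r) (bracket s n z p) < e"
    unfolding continuous_on_iff using e \<delta>0(1) by fastforce
  define \<delta> where "\<delta> = min \<delta>0 (d / 2)"
  have \<delta>: "0 < \<delta>" "\<delta> \<le> \<delta>0" "\<delta> < d" using d(1) \<delta>0(1) by (auto simp: \<delta>_def)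
  show ?thesis
  proof (rule that[of "p - \<delta>" "p + \<delta>"])
    show "\<forall>r\<in>{p - \<delta>..p + \<delta>}. norm (bracket s n z r - bracket s n z p) \<le> e"
    proof
      fix r assume that: "r \<in> {p - \<delta>..p + \<delta>}"
      have "r \<in> {p - \<delta>0..p + \<delta>0}" "dist r p < d"
        using that \<delta> by (auto simp: dist_real_def)
      from d(2)[OF this] show "norm (bracket s n z r - bracket s n z p) \<le> e" by (simp add: dist_norm)
    qed
  qed (use \<delta> 1 2 in auto)
qed

text \<open>A smooth step placed near \<open>p\<close> turns the weak equation into an average of the bracket around \<open>p\<close>.\<close>

lemma bracket_step:
  assumes z: "clifford_seq z" and s: "s\<^sup>2 = 1" and p: "0 < p" "p < \<rho>" "p \<noteq> norm x\<^sub>0" and e: "0 < e"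
  obtains a b \<eta> where "smooth_real \<eta>" "0 < a" "a < b" "b < \<rho>" "\<forall>t\<le>a\<^sup>2. \<eta> t = 1" "\<forall>t\<ge>b\<^sup>2. \<eta> t = 0"
    "(\<lambda>x. u x * (zeta s x ^ n * of_real (cutoff_op \<kappa> n z \<eta> (x \<bullet> x)))) absolutely_integrable_on ball 0 \<rho>"
    "norm (integral (ball 0 \<rho>) (\<lambda>x. u x * (zeta s x ^ n * of_real (cutoff_op \<kappa> n z \<eta> (x \<bullet> x))))
        + 2 * bracket s n z p) \<le> 2 * e"
proof -
  obtain a b where ab: "0 < a" "a < p" "p < b" "b < \<rho>" "norm x\<^sub>0 \<notin> {a..b}"
    "\<forall>r\<in>{a..b}. norm (bracket s n z r - bracket s n z p) \<le> e"
    by (rule bracket_cutoff[OF z p e, where s = s and n = n])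
  have lt: "a < b" using ab by simp
  have "a\<^sup>2 < b\<^sup>2" using ab by (intro power_strict_mono) auto
  then obtain \<eta> where "smooth_real \<eta>" "\<forall>t\<le>a\<^sup>2. \<eta> t = 1" "\<forall>t\<ge>b\<^sup>2. \<eta> t = 0"
    "\<forall>t. deriv \<eta> t \<le> 0" "\<forall>t. t \<le> a\<^sup>2 \<or> t \<ge> b\<^sup>2 \<longrightarrow> deriv \<eta> t = 0"
    by (rule smooth_step_exists)
  note \<eta> = this(1) this(2-5)[rule_format]
  note ai = annulus_integral[OF z s ab(1) lt ab(4,5) \<eta>(1-3,5), where n = n]
  have wI: "((\<lambda>r. 4 * r * deriv \<eta> (r\<^sup>2)) has_integral (2 * \<eta> (b\<^sup>2) - 2 * \<eta> (a\<^sup>2))) {a..b}"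
  proof (rule fundamental_theorem_of_calculus)
    fix r
    have "((\<lambda>r. 2 * \<eta> (r\<^sup>2)) has_real_derivative 2 * (deriv \<eta> (r\<^sup>2) * (2 * r))) (at r within {a..b})"
      by (intro DERIV_cmult DERIV_chain2[where f = \<eta> and g = "\<lambda>r. r\<^sup>2" and x = r, OF smooth_real_deriv(1)[OF \<eta>(1)]])
        (auto intro!: derivative_eq_intros)
    then show "((\<lambda>r. 2 * \<eta> (r\<^sup>2)) has_vector_derivative 4 * r * deriv \<eta> (r\<^sup>2)) (at r within {a..b})"
      by (simp add: has_real_derivative_iff_has_vector_derivative[symmetric] mult_ac)
  qed (use lt in simp)
  have dc: "continuous_on UNIV (deriv \<eta>)"
    using DERIV_isCont[OF smooth_real_deriv(1)[OF smooth_real_deriv(2)[OF \<eta>(1)]]]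
    by (auto intro: continuous_at_imp_continuous_on)
  have "norm (integral {a..b} (\<lambda>r. of_real (4 * r * deriv \<eta> (r\<^sup>2)) * bracket s n z r) + 2 * bracket s n z p) \<le> 2 * e"
  proof (rule norm_weighted_integral_le)
    show "continuous_on {a..b} (bracket s n z)"
      by (rule bracket_continuous[OF z ab(1,4,5)])
    show "continuous_on {a..b} (\<lambda>r. 4 * r * deriv \<eta> (r\<^sup>2))"
      by (intro continuous_intros continuous_on_compose2[OF dc]) auto
    show "4 * r * deriv \<eta> (r\<^sup>2) \<le> 0" if "r \<in> {a..b}" for r
      using that ab(1) \<eta>(4)[of "r\<^sup>2"] by (simp add: mult_nonneg_nonpos)
    show "integral {a..b} (\<lambda>r. 4 * r * deriv \<eta> (r\<^sup>2)) = - 2"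
      using integral_unique[OF wI] \<eta>(2,3) by simp
  qed (use lt ab(6) in auto)
  then show ?thesis
    using ai \<eta>(2,3) by (intro that[OF \<eta>(1) ab(1) lt ab(4)]) simp_all
qed

text \<open>\<open>F\<close> is the integrand of the weak equation for the cut-off solution except
  at the origin, which \<open>cutoff_helmholtz\<close> leaves out; a single point does not change
  the integral.\<close>

lemma weak_cutoff:
  fixes n :: nat
  assumes z: "clifford_seq z" and s: "s\<^sup>2 = 1" and \<eta>: "smooth_real \<eta>" "\<And>t. t \<ge> b\<^sup>2 \<Longrightarrow> \<eta> t = 0"
    and b: "0 \<le> b" "b < \<rho>" and c: "z = clifford_J \<or> (\<exists>\<delta>>0. \<forall>t\<le>\<delta>. \<eta> t = 0)"
  defines "F \<equiv> \<lambda>x. u x * (zeta s x ^ n * of_real (cutoff_op \<kappa> n z \<eta> (x \<bullet> x)))"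
  assumes F: "F absolutely_integrable_on ball 0 \<rho>"
  shows "integral (ball 0 \<rho>) F = 0"
proof -
  define \<phi> where "\<phi> = (\<lambda>x. zeta s x ^ n * of_real (\<eta> (x \<bullet> x) * z n (\<kappa> * (x \<bullet> x))))"
  have "test_function (ball 0 \<rho>) \<phi>"
    unfolding \<phi>_def
    by (rule test_function_zeta_radial[OF cutoff_smooth[OF z \<kappa>_pos \<eta>(1) c], where b = b])
      (use \<eta>(2) b in auto)
  note w = weak[OF this]
  have eq: "u x * (laplacian \<phi> x + of_real (4 * \<kappa>) * \<phi> x) = F x" if "x \<in> ball 0 \<rho> - {0}" for x
    using that cutoff_helmholtz[OF z \<kappa>_pos \<eta>(1) c s, of x n] by (simp add: F_def \<phi>_def)
  have neg: "negligible {0::real^2}" by simp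
  have "(\<lambda>x. u x * (laplacian \<phi> x + of_real (4 * \<kappa>) * \<phi> x)) absolutely_integrable_on ball 0 \<rho>"
    by (rule absolutely_integrable_spike[OF F neg eq])
  from set_lebesgue_integral_eq_integral(2)[OF this] w
  have "integral (ball 0 \<rho>) (\<lambda>x. u x * (laplacian \<phi> x + of_real (4 * \<kappa>) * \<phi> x)) = 0"
    by simp
  moreover have "integral (ball 0 \<rho>) F = integral (ball 0 \<rho>) (\<lambda>x. u x * (laplacian \<phi> x + of_real (4 * \<kappa>) * \<phi> x))"
    by (rule integral_spike[OF neg eq])
  ultimately show ?thesis by simp
qed

lemma bracket_J:
  assumes s: "s\<^sup>2 = 1" and p: "0 < p" "p < \<rho>" "p \<noteq> norm x\<^sub>0"
  shows "bracket s n clifford_J p = 0"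
proof -
  have "norm (bracket s n clifford_J p) \<le> e" if e: "e > 0" for e
  proof -
    obtain a b \<eta> where *: "smooth_real \<eta>" "0 < a" "a < b" "b < \<rho>" "\<forall>t\<le>a\<^sup>2. \<eta> t = 1" "\<forall>t\<ge>b\<^sup>2. \<eta> t = 0"
      and F: "(\<lambda>x. u x * (zeta s x ^ n * of_real (cutoff_op \<kappa> n clifford_J \<eta> (x \<bullet> x)))) absolutely_integrable_on ball 0 \<rho>"
      "norm (integral (ball 0 \<rho>) (\<lambda>x. u x * (zeta s x ^ n * of_real (cutoff_op \<kappa> n clifford_J \<eta> (x \<bullet> x))))
        + 2 * bracket s n clifford_J p) \<le> 2 * e"
      by (rule bracket_step[OF clifford_seq_J s p e, where n = n])
    have "integral (ball 0 \<rho>) (\<lambda>x. u x * (zeta s x ^ n * of_real (cutoff_op \<kappa> n clifford_J \<eta> (x \<bullet> x)))) = 0"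
      by (rule weak_cutoff[OF clifford_seq_J s *(1) *(6)[rule_format] _ *(4)]) (use * F in auto)
    with F(2) show ?thesis by (simp add: norm_mult)
  qed
  then have "norm (bracket s n clifford_J p) \<le> 0"
    by (rule field_le_epsilon[of _ 0, simplified])
  then show ?thesis by simp
qed

lemma bracket_Y:
  assumes s: "s\<^sup>2 = 1" and p: "0 < p" "p < \<rho>" "p \<noteq> norm x\<^sub>0" and q: "0 < q" "q < \<rho>" "q \<noteq> norm x\<^sub>0"
  shows "bracket s n clifford_Y p = bracket s n clifford_Y q"
proof -
  have "norm (bracket s n clifford_Y p - bracket s n clifford_Y q) \<le> e" if e: "e > 0" for e
  proof -
    have e2: "e / 2 > 0" using e by simp
    let ?F = "\<lambda>\<eta> x. u x * (zeta s x ^ n * of_real (cutoff_op \<kappa> n clifford_Y \<eta> (x \<bullet> x)))"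
    obtain a b \<eta> where 1: "smooth_real \<eta>" "0 < a" "a < b" "b < \<rho>" "\<forall>t\<le>a\<^sup>2. \<eta> t = 1" "\<forall>t\<ge>b\<^sup>2. \<eta> t = 0"
      and F1: "?F \<eta> absolutely_integrable_on ball 0 \<rho>"
      "norm (integral (ball 0 \<rho>) (?F \<eta>) + 2 * bracket s n clifford_Y p) \<le> 2 * (e / 2)"
      by (rule bracket_step[OF clifford_seq_Y s p e2, where n = n])
    obtain c d \<eta>' where 2: "smooth_real \<eta>'" "0 < c" "c < d" "d < \<rho>" "\<forall>t\<le>c\<^sup>2. \<eta>' t = 1" "\<forall>t\<ge>d\<^sup>2. \<eta>' t = 0"
      and F2: "?F \<eta>' absolutely_integrable_on ball 0 \<rho>"
      "norm (integral (ball 0 \<rho>) (?F \<eta>') + 2 * bracket s n clifford_Y q) \<le> 2 * (e / 2)"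
      by (rule bracket_step[OF clifford_seq_Y s q e2, where n = n])
    define \<mu> where "\<mu> t = \<eta> t + (- 1) * \<eta>' t" for t
    have \<mu>: "smooth_real \<mu>"
      using 1(1) 2(1) unfolding smooth_real_def \<mu>_def[abs_def]
      by (intro allI diffn_add diffn_mult diffn_const) auto
    note d1 = smooth_real_deriv[OF 1(1)] smooth_real_deriv[OF 2(1)]
    have \<mu>1: "deriv \<mu> = (\<lambda>t. deriv \<eta> t - deriv \<eta>' t)"
      unfolding \<mu>_def[abs_def] by (rule ext, rule DERIV_imp_deriv) (auto intro!: derivative_eq_intros d1(1,3))
    have \<mu>2: "deriv (deriv \<mu>) = (\<lambda>t. deriv (deriv \<eta>) t - deriv (deriv \<eta>') t)"
      unfolding \<mu>1 by (rule ext, rule DERIV_imp_deriv) (intro DERIV_diff smooth_real_deriv(1)[OF d1(2)] smooth_real_deriv(1)[OF d1(4)])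
    \<comment> \<open>\<open>cutoff_op\<close> is linear in the cut-off, so testing with
      \<open>\<mu>\<close> compares the two averages.\<close>
    have F: "?F \<mu> = (\<lambda>x. ?F \<eta> x - ?F \<eta>' x)"
      unfolding cutoff_op_def \<mu>2 unfolding \<mu>1 by (rule ext) (simp add: algebra_simps)
    have "integral (ball 0 \<rho>) (?F \<mu>) = 0"
    proof (rule weak_cutoff[OF clifford_seq_Y s \<mu>, of "max b d"])
      show "\<mu> t = 0" if "t \<ge> (max b d)\<^sup>2" for t
      proof -
        have "b\<^sup>2 \<le> (max b d)\<^sup>2" "d\<^sup>2 \<le> (max b d)\<^sup>2"
          using 1 2 by (auto intro!: power_mono)
        then show ?thesis using that 1(6) 2(6) by (simp add: \<mu>_def)
      qed
      show "clifford_Y = clifford_J \<or> (\<exists>\<delta>>0. \<forall>t\<le>\<delta>. \<mu> t = 0)"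
        using 1(2,5) 2(2,5) by (intro disjI2 exI[of _ "min (a\<^sup>2) (c\<^sup>2)"]) (auto simp: \<mu>_def)
      show "?F \<mu> absolutely_integrable_on ball 0 \<rho>"
        unfolding F by (rule set_integral_diff(1)[OF F1(1) F2(1)])
    qed (use 1 2 in auto)
    then have "integral (ball 0 \<rho>) (?F \<eta>) = integral (ball 0 \<rho>) (?F \<eta>')"
      unfolding F using integral_diff[OF set_lebesgue_integral_eq_integral(1)[OF F1(1)] set_lebesgue_integral_eq_integral(1)[OF F2(1)]]
      by simp
    with F1(2) F2(2) have "norm (2 * (bracket s n clifford_Y p - bracket s n clifford_Y q)) \<le> 2 * e"
      using norm_triangle_ineq4[of "integral (ball 0 \<rho>) (?F \<eta>) + 2 * bracket s n clifford_Y p"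
        "integral (ball 0 \<rho>) (?F \<eta>) + 2 * bracket s n clifford_Y q"]
      by (simp add: algebra_simps)
    then have "2 * norm (bracket s n clifford_Y p - bracket s n clifford_Y q) \<le> 2 * e"
      by (simp only: norm_mult norm_numeral)
    then show ?thesis by simp
  qed
  then have "norm (bracket s n clifford_Y p - bracket s n clifford_Y q) \<le> 0"
    by (rule field_le_epsilon[of _ 0, simplified])
  then show ?thesis by simp
qed

text \<open>Both brackets are linear in the mean and its derivative, and \<open>clifford_J\<close>
  times the second-kind bracket minus \<open>clifford_Y\<close> times the first-kind one eliminates
  the derivative. The coefficient of the mean is then the Wronskian of \<open>clifford_J\<close> and
  \<open>clifford_Y\<close>, which never vanishes, so the mean itself is determined.\<close>

theorem circle_mean_eq:
  assumes s: "s\<^sup>2 = 1"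
  obtains C where "\<And>r. 0 < r \<Longrightarrow> r < \<rho> \<Longrightarrow> r \<noteq> norm x\<^sub>0 \<Longrightarrow>
    circle_mean (s * real n) u r = C * of_real (r ^ n * clifford_J n (\<kappa> * r\<^sup>2))"
proof -
  obtain c where c: "\<And>r. 0 < r \<Longrightarrow> r < \<rho> \<Longrightarrow> r \<noteq> norm x\<^sub>0 \<Longrightarrow> bracket s n clifford_Y r = c"
    by (metis bracket_Y[OF s])
  show ?thesis
  proof (rule that[of "of_real (pi * \<kappa> ^ n) * c"])
    fix r assume r: "0 < r" "r < \<rho>" "r \<noteq> norm x\<^sub>0"
    define t where "t = \<kappa> * r\<^sup>2"
    define m where "m = circle_mean (s * real n) u r"
    have t: "t > 0" using r \<kappa>_pos by (simp add: t_def)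
    let ?J = "\<lambda>n. of_real (clifford_J n t) :: complex" and ?Y = "\<lambda>n. of_real (clifford_Y n t) :: complex"
    have "?J n * c = ?J n * bracket s n clifford_Y r - ?Y n * bracket s n clifford_J r"
      using c[OF r] bracket_J[OF s r] by simp
    also have "\<dots> = of_real (r ^ n * (\<kappa> * r\<^sup>2)) * (?J (Suc n) * ?Y n - ?J n * ?Y (Suc n)) * m"
      unfolding bracket_def t_def[symmetric] m_def[symmetric] by (simp add: t_def algebra_simps)
    finally have e: "?J n * c = of_real (r ^ n * (\<kappa> * r\<^sup>2)) * (?J (Suc n) * ?Y n - ?J n * ?Y (Suc n)) * m" .
    \<comment> \<open>Multiplying by \<open>t ^ n\<close> completes the power
      \<open>t ^ Suc n\<close> of \<open>clifford_wronskian\<close>; it is also the origin of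
      \<open>\<kappa> ^ n\<close> in the constant.\<close>
    have "?J n * c * of_real (t ^ n) = of_real (r ^ n) * of_real (t ^ Suc n * (clifford_J (Suc n) t * clifford_Y n t
        - clifford_J n t * clifford_Y (Suc n) t)) * m"
      unfolding e by (simp add: t_def algebra_simps)
    also have "\<dots> = of_real (r ^ n) * of_real (1 / pi) * m"
      by (simp only: clifford_wronskian[OF t])
    finally have "of_real (r ^ n) * m = of_real pi * (?J n * c * of_real (t ^ n))"
      by simp
    also have "\<dots> = of_real (r ^ n) * (of_real (pi * \<kappa> ^ n) * c * of_real (r ^ n * clifford_J n t))"
      by (simp add: t_def power_mult_distrib power2_eq_square mult_ac)
    finally show "circle_mean (s * real n) u r = of_real (pi * \<kappa> ^ n) * c * of_real (r ^ n * clifford_J n (\<kappa> * r\<^sup>2))"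
      using r by (simp add: t_def m_def)
  qed
qed

end

section \<open>Radial solutions tested against arbitrary smooth functions\<close>

lemma smooth_partial_deriv: "smooth \<phi> \<Longrightarrow> smooth (partial_deriv i \<phi>)"
  unfolding smooth_def
proof
  fix "is" assume "\<forall>is. foldr partial_deriv is \<phi> differentiable_on UNIV"
  then have "foldr partial_deriv (is @ [i]) \<phi> differentiable_on UNIV" by blast
  then show "foldr partial_deriv is (partial_deriv i \<phi>) differentiable_on UNIV" by simp
qed

lemma smooth_has_derivative:
  fixes \<phi> :: "real^2 \<Rightarrow> complex"
  assumes "smooth \<phi>"
  shows "(\<phi> has_derivative (\<lambda>h. h $ 1 *\<^sub>R partial_deriv 1 \<phi> x + h $ 2 *\<^sub>R partial_deriv 2 \<phi> x)) (at x)"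
proof -
  have "foldr partial_deriv [] \<phi> differentiable_on UNIV"
    using assms unfolding smooth_def by blast
  then have d: "(\<phi> has_derivative frechet_derivative \<phi> (at x)) (at x)"
    by (simp add: differentiable_on_def frechet_derivative_works)
  then interpret bounded_linear "frechet_derivative \<phi> (at x)"
    by (rule has_derivative_bounded_linear)
  have "frechet_derivative \<phi> (at x) h = h $ 1 *\<^sub>R partial_deriv 1 \<phi> x + h $ 2 *\<^sub>R partial_deriv 2 \<phi> x" for h
  proof -
    have "h = h $ 1 *\<^sub>R axis 1 1 + h $ 2 *\<^sub>R axis 2 1"
      by (simp add: vec_eq_iff forall_2 axis_def)
    then have "frechet_derivative \<phi> (at x) h = frechet_derivative \<phi> (at x) (h $ 1 *\<^sub>R axis 1 1 + h $ 2 *\<^sub>R axis 2 1)"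
      by (rule arg_cong)
    then show ?thesis
      unfolding partial_deriv_def by (simp only: add scaleR)
  qed
  then have "frechet_derivative \<phi> (at x) = (\<lambda>h. h $ 1 *\<^sub>R partial_deriv 1 \<phi> x + h $ 2 *\<^sub>R partial_deriv 2 \<phi> x)"
    by (rule ext)
  with d show ?thesis by (simp only:)
qed

lemma smooth_continuous:
  fixes \<phi> :: "real^2 \<Rightarrow> complex"
  assumes "smooth \<phi>"
  shows "continuous_on S \<phi>"
  using has_derivative_continuous[OF smooth_has_derivative[OF assms]]
  by (auto intro: continuous_at_imp_continuous_on)

lemma smooth_polar_derivs:
  fixes \<phi> :: "real^2 \<Rightarrow> complex"
  assumes "smooth \<phi>"
  shows "((\<lambda>r. \<phi> (c + polar r \<theta>)) has_vector_derivative
      cos \<theta> *\<^sub>R partial_deriv 1 \<phi> (c + polar r \<theta>) + sin \<theta> *\<^sub>R partial_deriv 2 \<phi> (c + polar r \<theta>)) (at r within T)"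
    and "((\<lambda>\<theta>. \<phi> (c + polar r \<theta>)) has_vector_derivative
      r *\<^sub>R (cos \<theta> *\<^sub>R partial_deriv 2 \<phi> (c + polar r \<theta>) - sin \<theta> *\<^sub>R partial_deriv 1 \<phi> (c + polar r \<theta>))) (at \<theta> within T)"
proof -
  have 1: "((\<lambda>r. c + polar r \<theta>) has_vector_derivative polar 1 \<theta>) (at r within T)"
    using has_vector_derivative_add[OF has_vector_derivative_const polar_has_vector_derivative] by simp
  have 2: "((\<lambda>\<theta>. c + polar r \<theta>) has_vector_derivative (- r * sin \<theta>) *\<^sub>R axis 1 1 + (r * cos \<theta>) *\<^sub>R axis 2 1) (at \<theta> within T)"
    unfolding polar_eq_axis by (auto intro!: derivative_eq_intros simp: has_vector_derivative_def algebra_simps)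
  show "((\<lambda>r. \<phi> (c + polar r \<theta>)) has_vector_derivative
      cos \<theta> *\<^sub>R partial_deriv 1 \<phi> (c + polar r \<theta>) + sin \<theta> *\<^sub>R partial_deriv 2 \<phi> (c + polar r \<theta>)) (at r within T)"
    using vector_derivative_diff_chain_within[OF 1 has_derivative_at_withinI[OF smooth_has_derivative[OF assms]]]
    by (simp add: o_def)
  show "((\<lambda>\<theta>. \<phi> (c + polar r \<theta>)) has_vector_derivative
      r *\<^sub>R (cos \<theta> *\<^sub>R partial_deriv 2 \<phi> (c + polar r \<theta>) - sin \<theta> *\<^sub>R partial_deriv 1 \<phi> (c + polar r \<theta>))) (at \<theta> within T)"
    using vector_derivative_diff_chain_within[OF 2 has_derivative_at_withinI[OF smooth_has_derivative[OF assms]]]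
    by (simp add: o_def axis_def algebra_simps)
qed

lemma partial_deriv_vanish:
  assumes "open U" "\<And>x. x \<in> U \<Longrightarrow> \<phi> x = 0" "x \<in> U"
  shows "partial_deriv i \<phi> x = 0"
proof -
  have "(\<phi> has_derivative (\<lambda>h. 0)) (at x)"
    by (rule has_derivative_transform_within_open[OF has_derivative_const assms(1,3), of 0]) (simp add: assms(2))
  then show ?thesis by (simp add: partial_deriv_eq)
qed

text \<open>Multiplying the Helmholtz operator by a radial solution and averaging over circles gives an
  exact derivative, so only the boundary term at the origin survives.\<close>

lemma weak_radial:
  fixes f g :: "real \<Rightarrow> real" and \<phi> :: "real^2 \<Rightarrow> complex" and m k :: real
  assumes \<phi>: "smooth \<phi>" and supp: "\<And>x. norm (x - c) \<ge> L \<Longrightarrow> \<phi> x = 0 \<and> partial_deriv 1 \<phi> x = 0 \<and> partial_deriv 2 \<phi> x = 0"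
    and L: "L > 0" and m: "cis (m * (2 * pi)) = 1"
    and f: "\<And>r. r > 0 \<Longrightarrow> (f has_real_derivative g r / r) (at r)"
    and g: "\<And>r. r > 0 \<Longrightarrow> (g has_real_derivative (m\<^sup>2 / r - k\<^sup>2 * r) * f r) (at r)"
    and f0: "((\<lambda>r. r * f r) \<longlongrightarrow> 0) (at_right 0)" and g0: "(g \<longlongrightarrow> g0) (at_right 0)"
    and w: "\<And>r \<theta>. r > 0 \<Longrightarrow> w (polar r \<theta>) = of_real (f r) * cis (m * \<theta>)"
  shows "(\<lambda>x. w x * (laplacian \<phi> (c + x) + of_real (k\<^sup>2) * \<phi> (c + x))) absolutely_integrable_on {x. 0 < norm x \<and> norm x < L}"
    and "integral {x. 0 < norm x \<and> norm x < L} (\<lambda>x. w x * (laplacian \<phi> (c + x) + of_real (k\<^sup>2) * \<phi> (c + x)))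
      = of_real g0 * \<phi> c * integral {0..2 * pi} (\<lambda>\<theta>. cis (m * \<theta>))"
proof -
  define \<Phi> where "\<Phi> r \<theta> = \<phi> (c + polar r \<theta>)" for r \<theta>
  define p where "p i r \<theta> = partial_deriv i \<phi> (c + polar r \<theta>)" for i r \<theta>
  define q where "q i j r \<theta> = partial_deriv j (partial_deriv i \<phi>) (c + polar r \<theta>)" for i j r \<theta>
  note s1 = smooth_partial_deriv[OF \<phi>]
  note s2 = smooth_partial_deriv[OF s1]
  have cont: "continuous_on S (\<lambda>z. \<psi> (c + polar (a z) (b z)))"
    if "smooth \<psi>" "continuous_on S a" "continuous_on S b" for \<psi> :: "real^2 \<Rightarrow> complex" and S :: "'z::t2_space set" and a b
    using that by (intro continuous_on_compose2[OF smooth_continuous[of \<psi> UNIV]] continuous_intros) auto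
  have cont\<Phi>: "continuous_on S (\<lambda>z. \<Phi> (a z) (b z))"
    and contp: "continuous_on S (\<lambda>z. p i (a z) (b z))"
    and contq: "continuous_on S (\<lambda>z. q i j (a z) (b z))"
    if "continuous_on S a" "continuous_on S b" for S :: "'z::t2_space set" and a b i j
    unfolding \<Phi>_def p_def q_def by (intro cont \<phi> s1 s2 that)+
  define M where "M r = integral {0..2 * pi} (\<lambda>\<theta>. \<Phi> r \<theta> * cis (m * \<theta>))" for r
  \<comment> \<open>\<open>A\<close> is the derivative of the mean \<open>M\<close>, and
    \<open>N\<close> below that of \<open>r * A r\<close>; \<open>B\<close> is the integrand of
    \<open>N\<close>.\<close>
  define A where "A r = integral {0..2 * pi} (\<lambda>\<theta>. (cos \<theta> *\<^sub>R p 1 r \<theta> + sin \<theta> *\<^sub>R p 2 r \<theta>) * cis (m * \<theta>))" for r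
  define B where "B r \<theta> = cos \<theta> *\<^sub>R p 1 r \<theta> + sin \<theta> *\<^sub>R p 2 r \<theta> + r *\<^sub>R (cos \<theta> *\<^sub>R (cos \<theta> *\<^sub>R q 1 1 r \<theta> + sin \<theta> *\<^sub>R q 1 2 r \<theta>)
      + sin \<theta> *\<^sub>R (cos \<theta> *\<^sub>R q 2 1 r \<theta> + sin \<theta> *\<^sub>R q 2 2 r \<theta>))" for r \<theta>
  define N where "N r = integral {0..2 * pi} (\<lambda>\<theta>. B r \<theta> * cis (m * \<theta>))" for r
  define Lap where "Lap r \<theta> = q 1 1 r \<theta> + q 2 2 r \<theta>" for r \<theta>
  have Mc: "continuous_on T M" for T
    unfolding M_def[abs_def] cbox_interval[symmetric]
    by (intro integral_continuous_on_param) (auto simp: case_prod_unfold intro!: continuous_intros cont\<Phi>)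
  have Ac: "continuous_on T A" for T
    unfolding A_def[abs_def] cbox_interval[symmetric]
    by (intro integral_continuous_on_param) (auto simp: case_prod_unfold intro!: continuous_intros contp)
  have MAc: "isCont M r" "isCont A r" for r
    using Mc[of UNIV] Ac[of UNIV] by (simp_all add: continuous_on_eq_continuous_at)
  have Md: "(M has_vector_derivative A r) (at r)" for r
    unfolding M_def[abs_def] A_def cbox_interval[symmetric]
  proof (rule leibniz_rule_vector_derivative[where U = UNIV])
    fix r \<theta>
    show "((\<lambda>r. \<Phi> r \<theta> * cis (m * \<theta>)) has_vector_derivative (cos \<theta> *\<^sub>R p 1 r \<theta> + sin \<theta> *\<^sub>R p 2 r \<theta>) * cis (m * \<theta>)) (at r)"
      unfolding \<Phi>_def p_def by (intro has_vector_derivative_mult_left smooth_polar_derivs \<phi>)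
    show "(\<lambda>\<theta>. \<Phi> r \<theta> * cis (m * \<theta>)) integrable_on cbox 0 (2 * pi)"
      by (intro integrable_continuous continuous_intros cont\<Phi>)
    show "continuous_on (UNIV \<times> cbox 0 (2 * pi)) (\<lambda>(r, \<theta>). (cos \<theta> *\<^sub>R p 1 r \<theta> + sin \<theta> *\<^sub>R p 2 r \<theta>) * cis (m * \<theta>))"
      unfolding case_prod_unfold by (intro continuous_intros contp)
  qed auto
  have Ad: "((\<lambda>r. of_real r * A r) has_vector_derivative N r) (at r)" for r
  proof -
    have "((\<lambda>r. integral (cbox 0 (2 * pi)) (\<lambda>\<theta>. (r *\<^sub>R (cos \<theta> *\<^sub>R p 1 r \<theta> + sin \<theta> *\<^sub>R p 2 r \<theta>)) * cis (m * \<theta>)))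
        has_vector_derivative integral (cbox 0 (2 * pi)) (\<lambda>\<theta>. B r \<theta> * cis (m * \<theta>))) (at r)"
    proof (rule leibniz_rule_vector_derivative[where U = UNIV])
      fix r \<theta>
      have d: "((\<lambda>r. p i r \<theta>) has_vector_derivative (cos \<theta> *\<^sub>R q i 1 r \<theta> + sin \<theta> *\<^sub>R q i 2 r \<theta>)) (at r)" for i
        unfolding p_def q_def by (intro smooth_polar_derivs s1)
      have "((\<lambda>r. r *\<^sub>R (cos \<theta> *\<^sub>R p 1 r \<theta> + sin \<theta> *\<^sub>R p 2 r \<theta>)) has_vector_derivative
         r *\<^sub>R (cos \<theta> *\<^sub>R (cos \<theta> *\<^sub>R q 1 1 r \<theta> + sin \<theta> *\<^sub>R q 1 2 r \<theta>)
          + sin \<theta> *\<^sub>R (cos \<theta> *\<^sub>R q 2 1 r \<theta> + sin \<theta> *\<^sub>R q 2 2 r \<theta>)) + 1 *\<^sub>R (cos \<theta> *\<^sub>R p 1 r \<theta> + sin \<theta> *\<^sub>R p 2 r \<theta>)) (at r)"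
        by (intro has_vector_derivative_scaleR[OF DERIV_ident] has_vector_derivative_add
            bounded_linear.has_vector_derivative[OF bounded_linear_scaleR_right] d)
      then show "((\<lambda>r. (r *\<^sub>R (cos \<theta> *\<^sub>R p 1 r \<theta> + sin \<theta> *\<^sub>R p 2 r \<theta>)) * cis (m * \<theta>)) has_vector_derivative B r \<theta> * cis (m * \<theta>)) (at r)"
        unfolding B_def by (intro has_vector_derivative_mult_left) (simp add: add_ac)
      show "(\<lambda>\<theta>. (r *\<^sub>R (cos \<theta> *\<^sub>R p 1 r \<theta> + sin \<theta> *\<^sub>R p 2 r \<theta>)) * cis (m * \<theta>)) integrable_on cbox 0 (2 * pi)"
        by (intro integrable_continuous continuous_intros contp)
      show "continuous_on (UNIV \<times> cbox 0 (2 * pi)) (\<lambda>(r, \<theta>). B r \<theta> * cis (m * \<theta>))"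
        unfolding case_prod_unfold B_def by (intro continuous_intros contp contq)
    qed auto
    then show ?thesis
      by (simp add: A_def N_def scaleR_conv_of_real mult.assoc del: of_real_mult)
  qed
  \<comment> \<open>The angular part of the Laplacian is integrated by parts twice over the full
    circle and becomes multiplication by \<open>- m\<^sup>2 / r\<^sup>2\<close>.\<close>
  have lapint: "integral {0..2 * pi} (\<lambda>\<theta>. (r *\<^sub>R Lap r \<theta>) * cis (m * \<theta>)) = N r - of_real (m\<^sup>2 / r) * M r" if r: "r > 0" for r
  proof -
    \<comment> \<open>The boundary expression of both integrations by parts in the angle. It agrees
      at \<open>0\<close> and \<open>2 * pi\<close> since
      \<open>cis (m * (2 * pi)) = 1\<close>.\<close>
    define E where "E \<theta> = (cos \<theta> *\<^sub>R p 2 r \<theta> - sin \<theta> *\<^sub>R p 1 r \<theta>) * cis (m * \<theta>) - (\<i> * of_real (m / r)) * (\<Phi> r \<theta> * cis (m * \<theta>))" for \<theta>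
    define e where "e \<theta> = (r *\<^sub>R Lap r \<theta> - B r \<theta>) * cis (m * \<theta>) + of_real (m\<^sup>2 / r) * (\<Phi> r \<theta> * cis (m * \<theta>))" for \<theta>
    have "(e has_integral (E (2 * pi) - E 0)) {0..2 * pi}"
    proof (rule fundamental_theorem_of_calculus)
      fix \<theta>
      let ?T = "{0..2 * pi}"
      have d: "((\<lambda>\<theta>. p i r \<theta>) has_vector_derivative r *\<^sub>R (cos \<theta> *\<^sub>R q i 2 r \<theta> - sin \<theta> *\<^sub>R q i 1 r \<theta>)) (at \<theta> within ?T)" for i
        unfolding p_def q_def by (intro smooth_polar_derivs s1)
      have d\<Phi>: "((\<lambda>\<theta>. \<Phi> r \<theta>) has_vector_derivative r *\<^sub>R (cos \<theta> *\<^sub>R p 2 r \<theta> - sin \<theta> *\<^sub>R p 1 r \<theta>)) (at \<theta> within ?T)"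
        unfolding p_def \<Phi>_def by (intro smooth_polar_derivs \<phi>)
      have dc: "((\<lambda>\<theta>. cis (m * \<theta>)) has_vector_derivative \<i> * of_real m * cis (m * \<theta>)) (at \<theta> within ?T)"
      proof -
        have "((\<lambda>\<theta>. exp (\<i> * of_real m * of_real \<theta>)) has_vector_derivative \<i> * of_real m * exp (\<i> * of_real m * of_real \<theta>)) (at \<theta> within ?T)"
          by (rule has_vector_derivative_real_field) (auto intro!: derivative_eq_intros)
        then show ?thesis by (simp add: cis_conv_exp mult_ac)
      qed
      have "(E has_vector_derivative
         (cos \<theta> *\<^sub>R p 2 r \<theta> - sin \<theta> *\<^sub>R p 1 r \<theta>) * (\<i> * of_real m * cis (m * \<theta>)) +
         ((cos \<theta> *\<^sub>R (r *\<^sub>R (cos \<theta> *\<^sub>R q 2 2 r \<theta> - sin \<theta> *\<^sub>R q 2 1 r \<theta>)) + (- sin \<theta>) *\<^sub>R p 2 r \<theta>)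
         - (sin \<theta> *\<^sub>R (r *\<^sub>R (cos \<theta> *\<^sub>R q 1 2 r \<theta> - sin \<theta> *\<^sub>R q 1 1 r \<theta>)) + cos \<theta> *\<^sub>R p 1 r \<theta>)) * cis (m * \<theta>)
         - (\<i> * of_real (m / r)) * (\<Phi> r \<theta> * (\<i> * of_real m * cis (m * \<theta>)) + (r *\<^sub>R (cos \<theta> *\<^sub>R p 2 r \<theta> - sin \<theta> *\<^sub>R p 1 r \<theta>)) * cis (m * \<theta>))) (at \<theta> within ?T)"
        unfolding E_def[abs_def]
        by (intro has_vector_derivative_diff has_vector_derivative_mult has_vector_derivative_scaleR has_vector_derivative_mult_right
            d d\<Phi> dc has_field_derivative_at_within[OF DERIV_cos] has_field_derivative_at_within[OF DERIV_sin])
      moreover have "(cos \<theta> *\<^sub>R p 2 r \<theta> - sin \<theta> *\<^sub>R p 1 r \<theta>) * (\<i> * of_real m * cis (m * \<theta>)) +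
         ((cos \<theta> *\<^sub>R (r *\<^sub>R (cos \<theta> *\<^sub>R q 2 2 r \<theta> - sin \<theta> *\<^sub>R q 2 1 r \<theta>)) + (- sin \<theta>) *\<^sub>R p 2 r \<theta>)
         - (sin \<theta> *\<^sub>R (r *\<^sub>R (cos \<theta> *\<^sub>R q 1 2 r \<theta> - sin \<theta> *\<^sub>R q 1 1 r \<theta>)) + cos \<theta> *\<^sub>R p 1 r \<theta>)) * cis (m * \<theta>)
         - (\<i> * of_real (m / r)) * (\<Phi> r \<theta> * (\<i> * of_real m * cis (m * \<theta>)) + (r *\<^sub>R (cos \<theta> *\<^sub>R p 2 r \<theta> - sin \<theta> *\<^sub>R p 1 r \<theta>)) * cis (m * \<theta>)) = e \<theta>"
      proof -
        have cs: "of_real (cos \<theta>) * of_real (cos \<theta>) + of_real (sin \<theta>) * of_real (sin \<theta>) = (1::complex)"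
          by (metis of_real_1 of_real_add of_real_mult power2_eq_square sin_cos_squared_add2)
        have alg: "(C * P2 - S * P1) * (J * M * K) + ((C * (R * (C * Q22 - S * Q21)) + (- S) * P2) - (S * (R * (C * Q12 - S * Q11)) + C * P1)) * K
             - (J * (M / R)) * (F * (J * M * K) + (R * (C * P2 - S * P1)) * K)
            = (R * (Q11 + Q22) - (C * P1 + S * P2 + R * (C * (C * Q11 + S * Q12) + S * (C * Q21 + S * Q22)))) * K + (M\<^sup>2 / R) * (F * K)"
          if "C * C + S * S = 1" "R \<noteq> 0" "J * J = - 1" for C S P1 P2 J M K R Q11 Q12 Q21 Q22 F :: complex
        proof -
          have "J * (M / R) * (F * (J * M * K)) = (J * J) * (M\<^sup>2 / R * (F * K))"
            by (simp add: power2_eq_square mult_ac)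
          then have "J * (M / R) * (F * (J * M * K)) = - (M\<^sup>2 / R) * (F * K)"
            unfolding that(3) by simp
          moreover have "J * (M / R) * ((R * (C * P2 - S * P1)) * K) = (C * P2 - S * P1) * (J * M * K)"
            using that(2) by simp
          moreover have "((C * (R * (C * Q22 - S * Q21)) + (- S) * P2) - (S * (R * (C * Q12 - S * Q11)) + C * P1))
             = R * (Q11 + Q22) - (C * P1 + S * P2 + R * (C * (C * Q11 + S * Q12) + S * (C * Q21 + S * Q22)))"
            using that(1) by algebra
          ultimately show ?thesis by (simp add: distrib_left)
        qed
        show ?thesis
          unfolding e_def Lap_def B_def scaleR_conv_of_real
          using alg[OF cs, of "of_real r" \<i> "p 2 r \<theta>" "p 1 r \<theta>" "of_real m" "cis (m * \<theta>)"] r by simp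
      qed
      ultimately show "(E has_vector_derivative e \<theta>) (at \<theta> within ?T)" by simp
    qed simp
    moreover have "E (2 * pi) = E 0"
    proof -
      have "polar r (2 * pi) = polar r 0" by (simp add: vec_eq_iff forall_2)
      then show ?thesis
        using m by (simp add: E_def p_def \<Phi>_def)
    qed
    ultimately have "integral {0..2 * pi} e = 0" by (simp add: integral_unique)
    moreover have "integral {0..2 * pi} e = integral {0..2 * pi} (\<lambda>\<theta>. (r *\<^sub>R Lap r \<theta>) * cis (m * \<theta>)) - N r + of_real (m\<^sup>2 / r) * M r"
    proof -
      have i1: "(\<lambda>\<theta>. (r *\<^sub>R Lap r \<theta>) * cis (m * \<theta>)) integrable_on {0..2 * pi}"
        unfolding Lap_def by (intro integrable_continuous_real continuous_intros contq)
      have i2: "(\<lambda>\<theta>. B r \<theta> * cis (m * \<theta>)) integrable_on {0..2 * pi}"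
        unfolding B_def by (intro integrable_continuous_real continuous_intros contp contq)
      have i3: "(\<lambda>\<theta>. of_real (m\<^sup>2 / r) * (\<Phi> r \<theta> * cis (m * \<theta>))) integrable_on {0..2 * pi}"
        by (intro integrable_continuous_real continuous_intros cont\<Phi>)
      have "e = (\<lambda>\<theta>. ((r *\<^sub>R Lap r \<theta>) * cis (m * \<theta>) - B r \<theta> * cis (m * \<theta>)) + of_real (m\<^sup>2 / r) * (\<Phi> r \<theta> * cis (m * \<theta>)))"
        by (simp add: e_def[abs_def] left_diff_distrib)
      then show ?thesis
        by (simp only: integral_add[OF integrable_diff[OF i1 i2] i3] integral_diff[OF i1 i2] integral_mult_right N_def M_def)
    qed
    ultimately show ?thesis by (simp add: algebra_simps)
  qed
  define G where "G = (\<lambda>z::real \<times> real. of_real (fst z * f (fst z)) * ((Lap (fst z) (snd z) + of_real (k\<^sup>2) * \<Phi> (fst z) (snd z)) * cis (m * snd z)))"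
  \<comment> \<open>\<open>f\<close> may have a logarithmic singularity at \<open>0\<close>; only
    its product with the Jacobian is continuous there.\<close>
  have rfc: "continuous_on {0..L} (\<lambda>r. r * f r)"
    unfolding continuous_on_eq_continuous_within
  proof
    fix r assume "r \<in> {0..L}"
    show "continuous (at r within {0..L}) (\<lambda>r. r * f r)"
    proof (cases "r = 0")
      case True
      have "((\<lambda>r. r * f r) \<longlongrightarrow> 0) (at 0 within {0..L})"
        using f0 L by (metis at_within_Icc_at_right)
      then show ?thesis using True by (simp add: continuous_within)
    next
      case False
      then have "r > 0" using \<open>r \<in> {0..L}\<close> by simp
      then have "isCont (\<lambda>r. r * f r) r"
        by (intro isCont_mult continuous_ident DERIV_isCont[OF f])
      then show ?thesis
        by (rule continuous_at_imp_continuous_at_within)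
    qed
  qed
  have Gc: "continuous_on (cbox (0, 0) (L, 2 * pi)) G"
    unfolding G_def Lap_def
    by (intro continuous_intros contq cont\<Phi> continuous_on_compose2[OF rfc]) (auto simp: cbox_Pair_eq)
  have Ge: "G (r, \<theta>) = r *\<^sub>R (w (polar r \<theta>) * (laplacian \<phi> (c + polar r \<theta>) + of_real (k\<^sup>2) * \<phi> (c + polar r \<theta>)))"
    if "0 < r" "r < L" for r \<theta>
    unfolding G_def w[OF that(1)] laplacian_def sum_2 Lap_def q_def \<Phi>_def
    by (simp add: scaleR_conv_of_real mult_ac)
  note pol = polar_integral[OF order_refl Gc Ge]
  show "(\<lambda>x. w x * (laplacian \<phi> (c + x) + of_real (k\<^sup>2) * \<phi> (c + x))) absolutely_integrable_on {x. 0 < norm x \<and> norm x < L}"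
    by (rule pol(1))
  \<comment> \<open>Green's formula on the radial interval: since \<open>g = r f'\<close>, the
    expression \<open>f * (r * A) - g * M\<close> is a primitive of the radial integrand. Its value
    at \<open>0\<close> is the limit given by \<open>f0\<close> and \<open>g0\<close> and makes the
    only contribution.\<close>
  define F where "F r = (if r = 0 then - of_real g0 * M 0 else of_real (f r) * (of_real r * A r) - of_real (g r) * M r)" for r
  have "((\<lambda>r. integral {0..2 * pi} (\<lambda>\<theta>. G (r, \<theta>))) has_integral (F L - F 0)) {0..L}"
  proof (rule fundamental_theorem_of_calculus_interior)
    show "continuous_on {0..L} F"
      unfolding continuous_on_eq_continuous_within
    proof
      fix r assume r: "r \<in> {0..L}"
      show "continuous (at r within {0..L}) F"
      proof (cases "r = 0")
        case True
        have 0: "at_right 0 = at 0 within {0..L}"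
          using L by (metis at_within_Icc_at_right)
        have MA: "(M \<longlongrightarrow> M 0) (at_right 0)" "(A \<longlongrightarrow> A 0) (at_right 0)"
          using MAc[of 0] by (simp_all add: isCont_def filterlim_at_split)
        have "((\<lambda>r. of_real (r * f r) * A r - of_real (g r) * M r) \<longlongrightarrow> of_real 0 * A 0 - of_real g0 * M 0) (at_right 0)"
          by (intro tendsto_intros MA f0 g0)
        moreover have "\<forall>\<^sub>F r in at_right 0. of_real (r * f r) * A r - of_real (g r) * M r = F r"
          using eventually_at_right_less[of "0::real"] by eventually_elim (simp add: F_def mult_ac)
        ultimately have "(F \<longlongrightarrow> of_real 0 * A 0 - of_real g0 * M 0) (at_right 0)"
          by (rule Lim_transform_eventually)
        then show ?thesis
          unfolding True continuous_within 0[symmetric] by (simp add: F_def)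
      next
        case False
        then have rp: "r > 0" using r by simp
        have "((\<lambda>r. of_real (f r) * (of_real r * A r) - of_real (g r) * M r) \<longlongrightarrow> F r) (at r)"
          using rp MAc[of r] DERIV_isCont[OF f[OF rp]] DERIV_isCont[OF g[OF rp]]
          unfolding F_def isCont_def by (auto intro!: tendsto_intros)
        moreover have "\<forall>\<^sub>F r in at r. of_real (f r) * (of_real r * A r) - of_real (g r) * M r = F r"
        proof -
          have "\<forall>\<^sub>F r in at r. r \<in> {0<..}"
            by (rule eventually_at_in_open') (use rp in auto)
          then show ?thesis by eventually_elim (simp add: F_def)
        qed
        ultimately have "(F \<longlongrightarrow> F r) (at r)"
          by (rule Lim_transform_eventually)
        then show ?thesis
          by (simp add: continuous_within tendsto_within_subset[of F _ r UNIV])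
      qed
    qed
  next
    fix r assume "r \<in> {0<..<L}"
    then have r: "r > 0" by simp
    have fv: "((\<lambda>r. of_real (f r)) has_vector_derivative of_real (g r / r)) (at r)"
      by (rule has_vector_derivative_of_real[OF f[OF r]])
    have gv: "((\<lambda>r. of_real (g r)) has_vector_derivative of_real ((m\<^sup>2 / r - k\<^sup>2 * r) * f r)) (at r)"
      by (rule has_vector_derivative_of_real[OF g[OF r]])
    have "((\<lambda>r. of_real (f r) * (of_real r * A r) - of_real (g r) * M r) has_vector_derivative
       (of_real (f r) * N r + of_real (g r / r) * (of_real r * A r)
        - (of_real (g r) * A r + of_real ((m\<^sup>2 / r - k\<^sup>2 * r) * f r) * M r))) (at r)"
      by (intro has_vector_derivative_diff has_vector_derivative_mult fv gv Ad Md)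
    moreover have "of_real (f r) * N r + of_real (g r / r) * (of_real r * A r)
        - (of_real (g r) * A r + of_real ((m\<^sup>2 / r - k\<^sup>2 * r) * f r) * M r)
        = integral {0..2 * pi} (\<lambda>\<theta>. G (r, \<theta>))"
    proof -
      have i1: "(\<lambda>\<theta>. (r *\<^sub>R Lap r \<theta>) * cis (m * \<theta>)) integrable_on {0..2 * pi}"
        unfolding Lap_def by (intro integrable_continuous_real continuous_intros contq)
      have i2: "(\<lambda>\<theta>. \<Phi> r \<theta> * cis (m * \<theta>)) integrable_on {0..2 * pi}"
        by (intro integrable_continuous_real continuous_intros cont\<Phi>)
      have "(\<lambda>\<theta>. G (r, \<theta>)) = (\<lambda>\<theta>. of_real (f r) * ((r *\<^sub>R Lap r \<theta>) * cis (m * \<theta>)) + of_real (f r * k\<^sup>2 * r) * (\<Phi> r \<theta> * cis (m * \<theta>)))"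
        by (rule ext) (simp add: G_def scaleR_conv_of_real algebra_simps)
      then have "integral {0..2 * pi} (\<lambda>\<theta>. G (r, \<theta>)) = of_real (f r) * (N r - of_real (m\<^sup>2 / r) * M r) + of_real (f r * k\<^sup>2 * r) * M r"
        by (simp only: integral_add[OF integrable_on_mult_right[OF i1] integrable_on_mult_right[OF i2]]
            integral_mult_right lapint[OF r] M_def[symmetric])
      then show ?thesis using r by (simp add: algebra_simps)
    qed
    ultimately have "((\<lambda>r. of_real (f r) * (of_real r * A r) - of_real (g r) * M r) has_vector_derivative
        integral {0..2 * pi} (\<lambda>\<theta>. G (r, \<theta>))) (at r)" by simp
    then show "(F has_vector_derivative integral {0..2 * pi} (\<lambda>\<theta>. G (r, \<theta>))) (at r)"
      by (rule has_vector_derivative_transform_within_open[of _ _ _ "{0<..}"]) (use r in \<open>auto simp: F_def\<close>)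
  qed (use L in simp)
  moreover have "F L = 0"
  proof -
    have "\<Phi> L \<theta> = 0" "p 1 L \<theta> = 0" "p 2 L \<theta> = 0" for \<theta>
      using supp[of "c + polar L \<theta>"] L by (simp_all add: \<Phi>_def p_def)
    then have "M L = 0" "A L = 0"
      by (simp_all add: M_def A_def)
    then show ?thesis using L by (simp add: F_def)
  qed
  moreover have "M 0 = \<phi> c * integral {0..2 * pi} (\<lambda>\<theta>. cis (m * \<theta>))"
  proof -
    have "polar 0 \<theta> = 0" for \<theta> by (simp add: vec_eq_iff forall_2)
    then show ?thesis by (simp add: M_def \<Phi>_def)
  qed
  ultimately have "integral {0..L} (\<lambda>r. integral {0..2 * pi} (\<lambda>\<theta>. G (r, \<theta>)))
      = of_real g0 * \<phi> c * integral {0..2 * pi} (\<lambda>\<theta>. cis (m * \<theta>))"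
    by (simp add: integral_unique F_def)
  with pol(2) show "integral {x. 0 < norm x \<and> norm x < L} (\<lambda>x. w x * (laplacian \<phi> (c + x) + of_real (k\<^sup>2) * \<phi> (c + x)))
      = of_real g0 * \<phi> c * integral {0..2 * pi} (\<lambda>\<theta>. cis (m * \<theta>))"
    by (rule trans)
qed

subsection \<open>Fourier coefficients on a circle\<close>

lemma cis_add_mult: "cis (a + b) = cis a * cis b"
  by (simp add: cis_mult)

text \<open>The multipliers \<open>g\<close> for which all Fourier coefficients of
  \<open>h * g\<close> vanish are closed under multiplication by \<open>cis (m * \<theta>)\<close>,
  so, starting from \<open>1\<close>, they include all polynomials in the coordinates. By
  Stone-Weierstrass \<open>h\<close> is orthogonal to every continuous real function, in particular
  to its own real and imaginary parts, and its square norm vanishes.\<close>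

lemma circle_fourier_unique:
  assumes q: "continuous_on (sphere 0 R) q" and R: "R > 0"
    and zero: "\<And>n::int. circle_mean (of_int n) q R = 0" and x: "norm x = R"
  shows "q x = 0"
proof -
  define h where "h \<theta> = q (polar R \<theta>)" for \<theta>
  have hc: "continuous_on S h" for S
    unfolding h_def using R by (intro continuous_on_compose2[OF q] continuous_intros) auto
  define Q where "Q g \<longleftrightarrow> continuous_on UNIV g \<and> (\<forall>n::int. integral {0..2 * pi} (\<lambda>\<theta>. h \<theta> * g \<theta> * cis (of_int n * \<theta>)) = 0)"
    for g :: "real \<Rightarrow> complex"
  have Qadd: "Q (\<lambda>\<theta>. g1 \<theta> + g2 \<theta>)" if "Q g1" "Q g2" for g1 g2
  proof -
    have c: "continuous_on S g1" "continuous_on S g2" for S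
      using that continuous_on_subset unfolding Q_def by blast+
    have "integral {0..2 * pi} (\<lambda>\<theta>. h \<theta> * g1 \<theta> * cis (of_int n * \<theta>) + h \<theta> * g2 \<theta> * cis (of_int n * \<theta>)) = 0" for n :: int
      using that by (subst integral_add) (auto simp: Q_def intro!: integrable_continuous_real continuous_intros hc c)
    then show ?thesis
      using c by (auto simp: Q_def algebra_simps intro!: continuous_intros)
  qed
  have Qmul: "Q (\<lambda>\<theta>. a * g \<theta>)" if "Q g" for g a
  proof -
    have "integral {0..2 * pi} (\<lambda>\<theta>. a * (h \<theta> * g \<theta> * cis (of_int n * \<theta>))) = 0" for n :: int
      using that unfolding integral_mult_right by (simp add: Q_def)
    then show ?thesis
      using that by (auto simp: Q_def mult_ac intro!: continuous_intros)
  qed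
  have Qcis: "Q (\<lambda>\<theta>. g \<theta> * cis (of_int m * \<theta>))" if "Q g" for g and m :: int
  proof -
    have "integral {0..2 * pi} (\<lambda>\<theta>. h \<theta> * g \<theta> * cis (of_int (m + n) * \<theta>)) = 0" for n :: int
      using that by (simp only: Q_def)
    then have "integral {0..2 * pi} (\<lambda>\<theta>. h \<theta> * (g \<theta> * cis (of_int m * \<theta>)) * cis (of_int n * \<theta>)) = 0" for n :: int
      by (simp add: distrib_right cis_add_mult mult.assoc)
    then show ?thesis
      using that by (auto simp: Q_def intro!: continuous_intros)
  qed
  have Qpoly: "Q (\<lambda>\<theta>. g \<theta> * of_real (p (polar R \<theta>)))" if "real_polynomial_function p" "Q g" for p g
    using that
  proof (induction arbitrary: g)
    case (linear f)
    note Qg = linear.prems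
    interpret bounded_linear f by fact
    \<comment> \<open>On the circle a linear form is a combination of the two exponentials of
      frequency \<open>\<plusminus>1\<close>.\<close>
    have "of_real (f (polar R \<theta>)) = (of_real R * (of_real (f (axis 1 1)) - \<i> * of_real (f (axis 2 1))) / 2) * cis (of_int 1 * \<theta>)
        + (of_real R * (of_real (f (axis 1 1)) + \<i> * of_real (f (axis 2 1))) / 2) * cis (of_int (- 1) * \<theta>)" for \<theta>
      unfolding polar_eq_axis add scaleR by (simp add: complex_eq_iff field_simps)
    then have "(\<lambda>\<theta>. g \<theta> * of_real (f (polar R \<theta>))) =
        (\<lambda>\<theta>. (of_real R * (of_real (f (axis 1 1)) - \<i> * of_real (f (axis 2 1))) / 2) * (g \<theta> * cis (of_int 1 * \<theta>))
        + (of_real R * (of_real (f (axis 1 1)) + \<i> * of_real (f (axis 2 1))) / 2) * (g \<theta> * cis (of_int (- 1) * \<theta>)))"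
      by (simp add: algebra_simps)
    then show ?case
      by (simp only:) (intro Qadd Qmul Qcis Qg)
  next
    case (const c)
    from Qmul[OF this, of "of_real c"] show ?case by (simp add: mult_ac)
  next
    case (add f f')
    from Qadd[OF add.IH(1)[OF add.prems] add.IH(2)[OF add.prems]] show ?case
      by (simp add: distrib_left)
  next
    case (mult f f')
    from mult.IH(2)[OF mult.IH(1)[OF mult.prems]] show ?case
      by (simp add: mult_ac)
  qed
  have Q1: "Q (\<lambda>\<theta>. 1)"
    using zero by (simp add: Q_def circle_mean_def h_def)
  have "compact (h ` {0..2 * pi})"
    by (rule compact_continuous_image[OF hc compact_Icc])
  then obtain C where C: "\<And>\<theta>. \<theta> \<in> {0..2 * pi} \<Longrightarrow> norm (h \<theta>) \<le> C"
    by (meson bounded_iff compact_imp_bounded image_eqI)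
  have C0: "C \<ge> 0" using order_trans[OF norm_ge_zero C[of 0]] by simp
  have orth: "integral {0..2 * pi} (\<lambda>\<theta>. h \<theta> * of_real (F (polar R \<theta>))) = 0"
    if F: "continuous_on (sphere 0 R) F" for F :: "real^2 \<Rightarrow> real"
  proof -
    have Fc: "continuous_on {0..2 * pi} (\<lambda>\<theta>. F (polar R \<theta>))"
      using R by (intro continuous_on_compose2[OF F] continuous_intros) auto
    have "norm (integral {0..2 * pi} (\<lambda>\<theta>. h \<theta> * of_real (F (polar R \<theta>)))) \<le> e" if e: "e > 0" for e
    proof -
      \<comment> \<open>Keeps the error \<open>C * d * (2 * pi)\<close> below \<open>e\<close>;
        \<open>C + 1\<close> guards against \<open>C = 0\<close>.\<close>
      define d where "d = e / (2 * pi * (C + 1))"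
      have d: "d > 0" using e C0 by (simp add: d_def)
      obtain p where p: "real_polynomial_function p" "\<And>y. y \<in> sphere 0 R \<Longrightarrow> \<bar>F y - p y\<bar> < d"
        by (rule Stone_Weierstrass_real_polynomial_function[OF compact_sphere F d]) blast
      have pc: "continuous_on {0..2 * pi} (\<lambda>\<theta>. p (polar R \<theta>))"
        by (intro continuous_on_compose2[OF continuous_on_polymonial_function[of p UNIV]] continuous_intros)
          (use p(1) in \<open>auto simp: real_polynomial_function_eq\<close>)
      have "integral {0..2 * pi} (\<lambda>\<theta>. h \<theta> * of_real (p (polar R \<theta>))) = 0"
        using Qpoly[OF p(1) Q1] by (auto simp: Q_def dest: spec[of _ 0])
      moreover have i1: "(\<lambda>\<theta>. h \<theta> * of_real (F (polar R \<theta>))) integrable_on {0..2 * pi}"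
        by (intro integrable_continuous_real continuous_intros hc Fc)
      moreover have i2: "(\<lambda>\<theta>. h \<theta> * of_real (p (polar R \<theta>))) integrable_on {0..2 * pi}"
        by (intro integrable_continuous_real continuous_intros hc pc)
      ultimately have "integral {0..2 * pi} (\<lambda>\<theta>. h \<theta> * of_real (F (polar R \<theta>))) =
          integral {0..2 * pi} (\<lambda>\<theta>. h \<theta> * of_real (F (polar R \<theta>)) - h \<theta> * of_real (p (polar R \<theta>)))"
        by (subst integral_diff) auto
      also have "norm \<dots> \<le> C * d * (2 * pi - 0)"
      proof (rule integral_bound)
        show "continuous_on {0..2 * pi} (\<lambda>\<theta>. h \<theta> * of_real (F (polar R \<theta>)) - h \<theta> * of_real (p (polar R \<theta>)))"
          by (intro continuous_intros hc pc Fc)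
        fix \<theta> assume \<theta>: "\<theta> \<in> {0..2 * pi}"
        have "h \<theta> * of_real (F (polar R \<theta>)) - h \<theta> * of_real (p (polar R \<theta>)) = h \<theta> * of_real (F (polar R \<theta>) - p (polar R \<theta>))"
          by (simp add: algebra_simps)
        then show "norm (h \<theta> * of_real (F (polar R \<theta>)) - h \<theta> * of_real (p (polar R \<theta>))) \<le> C * d"
          using mult_mono[OF C[OF \<theta>] less_imp_le[OF p(2)[of "polar R \<theta>"]] C0] R by (simp add: norm_mult del: of_real_diff)
      qed auto
      also have "\<dots> = e * (C / (C + 1))"
        using C0 by (simp add: d_def)
      also have "\<dots> \<le> e * 1"
        using e C0 by (intro mult_left_mono) auto
      finally show ?thesis by simp
    qed
    then have "norm (integral {0..2 * pi} (\<lambda>\<theta>. h \<theta> * of_real (F (polar R \<theta>)))) \<le> 0"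
      by (rule field_le_epsilon[of _ 0, simplified])
    then show ?thesis by simp
  qed
  have o1: "integral {0..2 * pi} (\<lambda>\<theta>. h \<theta> * of_real (Re (h \<theta>))) = 0"
    unfolding h_def by (rule orth[unfolded h_def]) (intro continuous_intros q)
  have o2: "integral {0..2 * pi} (\<lambda>\<theta>. h \<theta> * of_real (Im (h \<theta>))) = 0"
    unfolding h_def by (rule orth[unfolded h_def]) (intro continuous_intros q)
  have "integral {0..2 * pi} (\<lambda>\<theta>. h \<theta> * of_real (Re (h \<theta>)) - \<i> * (h \<theta> * of_real (Im (h \<theta>)))) = 0"
    using o1 o2 by (subst integral_diff) (auto intro!: integrable_continuous_real continuous_intros hc)
  moreover have "h \<theta> * of_real (Re (h \<theta>)) - \<i> * (h \<theta> * of_real (Im (h \<theta>))) = of_real ((norm (h \<theta>))\<^sup>2)" for \<theta>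
    by (simp add: complex_eq_iff cmod_power2) (simp add: power2_eq_square)
  ultimately have "integral {0..2 * pi} (\<lambda>\<theta>. complex_of_real ((norm (h \<theta>))\<^sup>2)) = 0"
    by simp
  moreover have nc: "continuous_on {0..2 * pi} (\<lambda>\<theta>. (norm (h \<theta>))\<^sup>2)"
    by (intro continuous_intros hc)
  ultimately have "integral {0..2 * pi} (\<lambda>\<theta>. (norm (h \<theta>))\<^sup>2) = 0"
    using integral_linear[OF integrable_continuous_real[OF nc] bounded_linear_of_real[where ?'a = complex]]
    unfolding o_def by (simp only: of_real_eq_0_iff)
  then have h0: "\<forall>\<theta>\<in>{0..2 * pi}. (norm (h \<theta>))\<^sup>2 = 0"
    using integral_cbox_eq_0_iff[of 0 "2 * pi" "\<lambda>\<theta>. (norm (h \<theta>))\<^sup>2"] nc pi_gt_zero by simp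
  obtain \<theta> where \<theta>: "0 \<le> \<theta>" "\<theta> < 2 * pi" "x = polar (norm x) \<theta>"
    by (rule polar_cases[of x])
  have "q (polar R \<theta>) = 0"
    using h0 \<theta>(1,2) by (simp add: h_def)
  then have "q (polar (norm x) \<theta>) = 0"
    by (simp only: x)
  then show ?thesis
    by (simp only: \<theta>(3)[symmetric])
qed

subsection \<open>The Robin boundary condition in terms of Fourier coefficients\<close>

text \<open>The radial segment just inside the boundary avoids \<open>x\<^sub>0\<close>, so the
  chain rule within the punctured disk applies to it, and a left neighbourhood of \<open>0\<close>
  already determines the derivative within \<open>{..0}\<close>.\<close>

lemma disk_normal_derivative_eq:
  assumes R: "R > 0" "x\<^sub>0 \<in> ball 0 R" and x: "norm x = R"
    and D: "\<And>x. x \<in> cball 0 R - {x\<^sub>0} \<Longrightarrow> (u has_derivative blinfun_apply (D x)) (at x within cball 0 R - {x\<^sub>0})"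
  shows "disk_normal_derivative R u x = D x (x /\<^sub>R R)"
proof -
  define \<gamma> where "\<gamma> s = x + s *\<^sub>R (x /\<^sub>R R)" for s
  define \<delta> where "\<delta> = R - norm x\<^sub>0"
  have \<delta>: "\<delta> > 0" "\<delta> \<le> R" using R by (auto simp: \<delta>_def)
  let ?T = "{- (\<delta> / 2)..0}"
  have n\<gamma>: "norm (\<gamma> s) = \<bar>R + s\<bar>" for s
  proof -
    have "(R + s) / R = 1 + s / R" using R by (simp add: add_divide_distrib)
    then have "\<gamma> s = ((R + s) / R) *\<^sub>R x"
      by (simp add: \<gamma>_def scaleR_add_left) (simp add: divide_inverse)
    then show ?thesis using x R by simp
  qed
  have sub: "\<gamma> ` ?T \<subseteq> cball 0 R - {x\<^sub>0}"
  proof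
    fix y assume "y \<in> \<gamma> ` ?T"
    then obtain s where s: "s \<in> ?T" "y = \<gamma> s" by blast
    then have "norm y = R + s" using \<delta> n\<gamma>[of s] by auto
    moreover have "s > - \<delta>"
      using s(1) \<delta>(1) unfolding atLeastAtMost_iff by linarith
    then have "R + s > norm x\<^sub>0" by (simp add: \<delta>_def)
    ultimately show "y \<in> cball 0 R - {x\<^sub>0}" using s by auto
  qed
  have "(\<gamma> has_vector_derivative x /\<^sub>R R) (at 0 within ?T)"
    unfolding \<gamma>_def[abs_def] by (auto intro!: derivative_eq_intros)
  moreover have "(u has_derivative D (\<gamma> 0)) (at (\<gamma> 0) within \<gamma> ` ?T)"
    using subsetD[OF sub imageI[of 0 ?T \<gamma>]] \<delta> by (intro has_derivative_subset[OF D sub]) simp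
  ultimately have "((u \<circ> \<gamma>) has_vector_derivative D (\<gamma> 0) (x /\<^sub>R R)) (at 0 within ?T)"
    by (rule vector_derivative_diff_chain_within)
  then have "((\<lambda>s. u (x + s *\<^sub>R (x /\<^sub>R R))) has_vector_derivative D x (x /\<^sub>R R)) (at 0 within ?T)"
    by (simp add: o_def \<gamma>_def)
  moreover have "at (0::real) within ?T = at 0 within {..0}"
    by (rule at_within_nhd[of _ "{- (\<delta> / 2)<..}"]) (use \<delta> in auto)
  ultimately have "((\<lambda>s. u (x + s *\<^sub>R (x /\<^sub>R R))) has_vector_derivative D x (x /\<^sub>R R)) (at 0 within {..0})"
    by simp
  moreover have "{..<0::real} \<subseteq> {..0}" by auto
  then have "at (0::real) within {..0} \<noteq> bot"
    using at_le[of "{..<0::real}" "{..0}" 0] trivial_limit_at_left_real[of "0::real"]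
    by (auto simp: less_imp_le bot_unique)
  ultimately show ?thesis
    unfolding disk_normal_derivative_def by (rule vector_derivative_within[rotated])
qed

text \<open>The boundary expression is continuous on the circle, so
  \<open>circle_fourier_unique\<close> applies. Existence uses the direction from the coefficients
  to the boundary condition, uniqueness the converse.\<close>

lemma robin_iff_fourier:
  assumes R: "R > 0" "x\<^sub>0 \<in> ball 0 R"
    and Dc: "continuous_on (cball 0 R - {x\<^sub>0}) D"
    and D: "\<And>x. x \<in> cball 0 R - {x\<^sub>0} \<Longrightarrow> (u has_derivative blinfun_apply (D x)) (at x within cball 0 R - {x\<^sub>0})"
  shows "(\<forall>x\<in>sphere 0 R. disk_normal_derivative R u x + of_real \<alpha> * u x = 0) \<longleftrightarrow>
    (\<forall>n::int. circle_mean' (of_int n) D R + of_real \<alpha> * circle_mean (of_int n) u R = 0)"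
proof -
  define b where "b x = D x (x /\<^sub>R R) + of_real \<alpha> * u x" for x
  have sub: "sphere 0 R \<subseteq> cball 0 R - {x\<^sub>0}" using R by auto
  have uc: "continuous_on (sphere 0 R) u"
    by (rule continuous_on_subset[OF has_derivative_continuous_on[OF D] sub])
  have Dc': "continuous_on (sphere 0 R) D"
    by (rule continuous_on_subset[OF Dc sub])
  have bc: "continuous_on (sphere 0 R) b"
    unfolding b_def by (intro continuous_intros continuous_on_blinfun_apply2 uc Dc')
  have on_sphere: "disk_normal_derivative R u x + of_real \<alpha> * u x = b x" if "x \<in> sphere 0 R" for x
    using disk_normal_derivative_eq[OF R _ D, of x] that by (simp add: b_def)
  have mean: "circle_mean m b R = circle_mean' m D R + of_real \<alpha> * circle_mean m u R" for m
  proof -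
    have p: "polar R \<theta> /\<^sub>R R = polar 1 \<theta>" for \<theta>
      using R by (simp add: vec_eq_iff forall_2)
    have i1: "(\<lambda>\<theta>. D (polar R \<theta>) (polar 1 \<theta>) * cis (m * \<theta>)) integrable_on {0..2 * pi}"
      using R by (intro integrable_continuous_real continuous_intros continuous_on_blinfun_apply2 continuous_on_compose2[OF Dc']) auto
    have i2: "(\<lambda>\<theta>. of_real \<alpha> * (u (polar R \<theta>) * cis (m * \<theta>))) integrable_on {0..2 * pi}"
      using R by (intro integrable_continuous_real continuous_intros continuous_on_compose2[OF uc]) auto
    have "(\<lambda>\<theta>. b (polar R \<theta>) * cis (m * \<theta>)) =
        (\<lambda>\<theta>. D (polar R \<theta>) (polar 1 \<theta>) * cis (m * \<theta>) + of_real \<alpha> * (u (polar R \<theta>) * cis (m * \<theta>)))"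
      by (rule ext) (simp add: b_def p distrib_right mult.assoc)
    then show ?thesis
      unfolding circle_mean_def circle_mean'_def by (simp only: integral_add[OF i1 i2] integral_mult_right)
  qed
  show ?thesis
  proof
    assume *: "\<forall>x\<in>sphere 0 R. disk_normal_derivative R u x + of_real \<alpha> * u x = 0"
    have "b (polar R \<theta>) = 0" for \<theta>
      using * on_sphere[of "polar R \<theta>"] R by simp
    then show "\<forall>n::int. circle_mean' (of_int n) D R + of_real \<alpha> * circle_mean (of_int n) u R = 0"
      unfolding mean[symmetric] by (simp add: circle_mean_def)
  next
    assume "\<forall>n::int. circle_mean' (of_int n) D R + of_real \<alpha> * circle_mean (of_int n) u R = 0"
    then have "circle_mean (of_int n) b R = 0" for n :: int
      by (simp add: mean)
    then have "b x = 0" if "norm x = R" for x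
      using circle_fourier_unique[OF bc R(1) _ that] by blast
    then show "\<forall>x\<in>sphere 0 R. disk_normal_derivative R u x + of_real \<alpha> * u x = 0"
      using on_sphere by simp
  qed
qed

subsection \<open>Weak solutions\<close>

text \<open>Off the support the function vanishes on an open set, and with it all derivatives. The
  centre \<open>c\<close> is free because the support is later enclosed in a disk about the source
  point.\<close>

lemma test_function_support:
  fixes \<phi> :: "real^2 \<Rightarrow> complex"
  assumes "test_function \<Omega> \<phi>"
  obtains L where "L > 0"
    "\<forall>x. norm (x - c) \<ge> L \<longrightarrow> \<phi> x = 0 \<and> partial_deriv 1 \<phi> x = 0 \<and> partial_deriv 2 \<phi> x = 0 \<and> laplacian \<phi> x = 0"
    "\<forall>x. x \<notin> \<Omega> \<longrightarrow> \<phi> x = 0 \<and> laplacian \<phi> x = 0"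
proof -
  define K where "K = closure {x. \<phi> x \<noteq> 0}"
  have K: "compact K" "K \<subseteq> \<Omega>"
    using assms by (auto simp: test_function_def K_def)
  have op: "open (- K)" by (simp add: K_def open_Compl)
  have z0: "\<phi> x = 0" if "x \<in> - K" for x
    using that closure_subset[of "{x. \<phi> x \<noteq> 0}"] by (auto simp: K_def)
  have z1: "partial_deriv i \<phi> x = 0" if "x \<in> - K" for x i
    by (rule partial_deriv_vanish[OF op z0 that])
  have z2: "laplacian \<phi> x = 0" if "x \<in> - K" for x
    unfolding laplacian_def using partial_deriv_vanish[OF op z1 that] by simp
  obtain L where L: "L > 0" "K \<subseteq> ball c L"
    using bounded_subset_ballD[OF compact_imp_bounded[OF K(1)]] by blast
  have "x \<in> - K" if "norm (x - c) \<ge> L" for x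
    using that L(2) by (auto simp: dist_norm norm_minus_commute)
  moreover have "x \<in> - K" if "x \<notin> \<Omega>" for x
    using that K(2) by blast
  ultimately show ?thesis
    by (intro that[OF L(1)] allI impI conjI z0 z1 z2)
qed

lemma translation_integral:
  fixes F :: "real^2 \<Rightarrow> complex"
  assumes "S \<in> sets lebesgue" "(\<lambda>x. F (c + x)) absolutely_integrable_on S"
  shows "F absolutely_integrable_on (+) c ` S" "integral ((+) c ` S) F = integral S (\<lambda>x. F (c + x))"
proof -
  have d: "((+) c has_derivative (\<lambda>h. h)) (at x within S)" for x
    by (auto intro!: derivative_eq_intros)
  have det: "det (matrix (\<lambda>h::real^2. h)) = 1"
    by (simp add: det_2 matrix_def axis_def)
  have inj: "inj_on ((+) c) S" by (simp add: inj_on_def)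
  show "F absolutely_integrable_on (+) c ` S" "integral ((+) c ` S) F = integral S (\<lambda>x. F (c + x))"
    using change_of_variables_complex[OF assms(1) d inj, of F] assms(2) unfolding det by simp_all
qed

lemma annulus_measurable: "{x::real^2. 0 < norm x \<and> norm x < L} \<in> sets lebesgue"
proof -
  have "{x::real^2. 0 < norm x \<and> norm x < L} = ball 0 L - {0}" by auto
  then show ?thesis by (auto intro: borel_open)
qed

lemma translate_annulus: "(+) c ` {x::real^2. 0 < norm x \<and> norm x < L} = {x. 0 < norm (x - c) \<and> norm (x - c) < L}"
proof -
  have "x \<in> (+) c ` {x. 0 < norm x \<and> norm x < L}" if "0 < norm (x - c) \<and> norm (x - c) < L" for x
    using that by (intro image_eqI[of _ _ "x - c"]) auto
  then show ?thesis by auto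
qed

text \<open>The annulus about \<open>c\<close> need not fit into \<open>\<Omega>\<close>: as the
  test function vanishes off \<open>\<Omega>\<close>, both integrals are compared with the one over
  the whole plane.\<close>

lemma weak_radial_test:
  fixes f g :: "real \<Rightarrow> real" and \<phi> :: "real^2 \<Rightarrow> complex" and m k :: real and c :: "real^2"
  assumes \<phi>: "test_function \<Omega> \<phi>" and m: "cis (m * (2 * pi)) = 1"
    and f: "\<And>r. r > 0 \<Longrightarrow> (f has_real_derivative g r / r) (at r)"
    and g: "\<And>r. r > 0 \<Longrightarrow> (g has_real_derivative (m\<^sup>2 / r - k\<^sup>2 * r) * f r) (at r)"
    and f0: "((\<lambda>r. r * f r) \<longlongrightarrow> 0) (at_right 0)" and g0: "(g \<longlongrightarrow> g0) (at_right 0)"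
    and w: "\<And>r \<theta>. r > 0 \<Longrightarrow> w (polar r \<theta>) = of_real (f r) * cis (m * \<theta>)"
  defines "F \<equiv> \<lambda>x. w (x - c) * (laplacian \<phi> x + of_real (k\<^sup>2) * \<phi> x)"
  shows "F absolutely_integrable_on \<Omega>"
    and "integral \<Omega> F = of_real g0 * \<phi> c * integral {0..2 * pi} (\<lambda>\<theta>. cis (m * \<theta>))"
proof -
  have sm: "smooth \<phi>" using \<phi> by (simp add: test_function_def)
  obtain L where L: "L > 0"
    "\<forall>x. norm (x - c) \<ge> L \<longrightarrow> \<phi> x = 0 \<and> partial_deriv 1 \<phi> x = 0 \<and> partial_deriv 2 \<phi> x = 0 \<and> laplacian \<phi> x = 0"
    "\<forall>x. x \<notin> \<Omega> \<longrightarrow> \<phi> x = 0 \<and> laplacian \<phi> x = 0"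
    by (rule test_function_support[OF \<phi>, of c])
  have supp: "\<phi> x = 0 \<and> partial_deriv 1 \<phi> x = 0 \<and> partial_deriv 2 \<phi> x = 0" if "norm (x - c) \<ge> L" for x
    using L(2) that by blast
  have Fc: "(\<lambda>x. w x * (laplacian \<phi> (c + x) + of_real (k\<^sup>2) * \<phi> (c + x))) = (\<lambda>x. F (c + x))"
    by (simp add: F_def)
  have "(\<lambda>x. w x * (laplacian \<phi> (c + x) + of_real (k\<^sup>2) * \<phi> (c + x))) absolutely_integrable_on {x::real^2. 0 < norm x \<and> norm x < L}"
    by (rule weak_radial(1)[OF sm supp L(1) m f g f0 g0 w])
  moreover have "integral {x::real^2. 0 < norm x \<and> norm x < L} (\<lambda>x. w x * (laplacian \<phi> (c + x) + of_real (k\<^sup>2) * \<phi> (c + x)))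
      = of_real g0 * \<phi> c * integral {0..2 * pi} (\<lambda>\<theta>. cis (m * \<theta>))"
    by (rule weak_radial(2)[OF sm supp L(1) m f g f0 g0 w])
  ultimately have wr: "(\<lambda>x. F (c + x)) absolutely_integrable_on {x::real^2. 0 < norm x \<and> norm x < L}"
    "integral {x::real^2. 0 < norm x \<and> norm x < L} (\<lambda>x. F (c + x)) = of_real g0 * \<phi> c * integral {0..2 * pi} (\<lambda>\<theta>. cis (m * \<theta>))"
    by (simp_all only: Fc)
  have tr: "F absolutely_integrable_on {x. 0 < norm (x - c) \<and> norm (x - c) < L}"
    "integral {x. 0 < norm (x - c) \<and> norm (x - c) < L} F = of_real g0 * \<phi> c * integral {0..2 * pi} (\<lambda>\<theta>. cis (m * \<theta>))"
    using translation_integral[OF annulus_measurable wr(1)] wr(2) unfolding translate_annulus by simp_all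
  have z: "F x = 0" if "x \<in> UNIV - {x. 0 < norm (x - c) \<and> norm (x - c) < L} - {c}" for x
  proof -
    have "norm (x - c) \<ge> L" using that by auto
    then show ?thesis using L(2) by (simp add: F_def)
  qed
  have ext1: "F absolutely_integrable_on UNIV"
    by (rule absolutely_integrable_extend_zero(1)[OF tr(1) subset_UNIV negligible_sing z])
  have ext2: "integral UNIV F = integral {x. 0 < norm (x - c) \<and> norm (x - c) < L} F"
    by (rule absolutely_integrable_extend_zero(2)[OF tr(1) subset_UNIV negligible_sing z])
  have zz: "F x = 0" if "x \<notin> \<Omega>" for x
    using L(3) that by (simp add: F_def)
  have "{x \<in> UNIV - \<Omega>. F x \<noteq> 0} = {}" "{x \<in> \<Omega> - UNIV. F x \<noteq> 0} = {}"
    using zz by auto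
  then have neg: "negligible {x \<in> UNIV - \<Omega>. F x \<noteq> 0}" "negligible {x \<in> \<Omega> - UNIV. F x \<noteq> 0}"
    by (simp_all only: negligible_empty)
  show "F absolutely_integrable_on \<Omega>"
    using ext1 absolutely_integrable_spike_set_eq[OF neg] by blast
  show "integral \<Omega> F = of_real g0 * \<phi> c * integral {0..2 * pi} (\<lambda>\<theta>. cis (m * \<theta>))"
    using ext2 tr(2) integral_spike_set[OF neg] by simp
qed

text \<open>The Bessel equation as a first-order system for \<open>f\<close> and its flux
  \<open>g = r f'\<close>, the form used in \<open>weak_radial\<close>; the recurrence of
  \<open>clifford_seq\<close> supplies the second equation.\<close>

lemma clifford_radial_deriv:
  fixes n :: nat
  assumes z: "clifford_seq z" and \<kappa>: "\<kappa> > 0" and r: "r > 0"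
  defines "f \<equiv> \<lambda>r. r ^ n * z n (\<kappa> * r\<^sup>2)"
    and "g \<equiv> \<lambda>r. real n * r ^ n * z n (\<kappa> * r\<^sup>2) - 2 * \<kappa> * r ^ (n + 2) * z (Suc n) (\<kappa> * r\<^sup>2)"
  shows "(f has_real_derivative g r / r) (at r)"
    and "(g has_real_derivative ((real n)\<^sup>2 / r - 4 * \<kappa> * r) * f r) (at r)"
proof -
  have t: "\<kappa> * r\<^sup>2 > 0" using \<kappa> r by simp
  have zd: "((\<lambda>r. z m (\<kappa> * r\<^sup>2)) has_real_derivative - z (Suc m) (\<kappa> * r\<^sup>2) * (\<kappa> * (2 * r))) (at r)" for m
    by (rule DERIV_chain2[where f = "z m" and g = "\<lambda>r. \<kappa> * r\<^sup>2" and x = r, OF clifford_seq_deriv[OF z t]])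
      (auto intro!: derivative_eq_intros)
  have pd: "((\<lambda>r. r ^ m) has_real_derivative real m * r ^ m / r) (at r)" for m
    by (rule DERIV_cong[OF DERIV_pow]) (use r in \<open>cases m; simp\<close>)
  show "(f has_real_derivative g r / r) (at r)"
    unfolding f_def
    by (rule DERIV_cong[OF DERIV_mult[OF pd zd]])
      (use r in \<open>simp add: g_def field_simps power2_eq_square\<close>)
  have rec: "z n (\<kappa> * r\<^sup>2) = (real n + 1) * z (Suc n) (\<kappa> * r\<^sup>2) - \<kappa> * r\<^sup>2 * z (Suc (Suc n)) (\<kappa> * r\<^sup>2)"
    by (rule clifford_seq_rec[OF z t])
  let ?Z = "z n (\<kappa> * r\<^sup>2)" and ?Z1 = "z (Suc n) (\<kappa> * r\<^sup>2)" and ?Z2 = "z (Suc (Suc n)) (\<kappa> * r\<^sup>2)"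
  have gd: "(g has_real_derivative
     ((real n * (real n * r ^ n / r)) * ?Z + (- ?Z1 * (\<kappa> * (2 * r))) * (real n * r ^ n))
     - ((2 * \<kappa> * (real (n + 2) * r ^ (n + 2) / r)) * ?Z1 + (- ?Z2 * (\<kappa> * (2 * r))) * (2 * \<kappa> * r ^ (n + 2)))) (at r)"
    unfolding g_def by (intro DERIV_diff DERIV_mult DERIV_cmult zd pd)
  have "((real n * (real n * r ^ n / r)) * ?Z + (- ?Z1 * (\<kappa> * (2 * r))) * (real n * r ^ n))
     - ((2 * \<kappa> * (real (n + 2) * r ^ (n + 2) / r)) * ?Z1 + (- ?Z2 * (\<kappa> * (2 * r))) * (2 * \<kappa> * r ^ (n + 2)))
     = (real n)\<^sup>2 / r * r ^ n * ?Z - 4 * \<kappa> * r * r ^ n * ((real n + 1) * ?Z1 - \<kappa> * r\<^sup>2 * ?Z2)"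
    using r by (simp add: power2_eq_square field_simps)
  also have "\<dots> = ((real n)\<^sup>2 / r - 4 * \<kappa> * r) * f r"
    unfolding rec[symmetric] f_def by (simp add: algebra_simps)
  finally show "(g has_real_derivative ((real n)\<^sup>2 / r - 4 * \<kappa> * r) * f r) (at r)"
    using gd by simp
qed

lemma clifford_J_radial_continuous: "isCont (\<lambda>r. clifford_J n (\<kappa> * r\<^sup>2)) r"
  by (rule isCont_o2[OF _ clifford_J_continuous]) (intro continuous_intros)

lemma isCont_at_right: "isCont f (a::real) \<Longrightarrow> f a = b \<Longrightarrow> (f \<longlongrightarrow> b) (at_right a)"
  by (auto simp: isCont_def filterlim_at_split)

text \<open>The flux of a solution of the first kind tends to \<open>0\<close> at the origin, so no
  point source appears.\<close>

lemma entire_weak: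
  fixes n :: nat
  assumes \<phi>: "test_function \<Omega> \<phi>" and k: "k\<^sup>2 = 4 * \<kappa>" and \<kappa>: "\<kappa> > 0" and s: "s\<^sup>2 = 1"
  defines "F \<equiv> \<lambda>x. (zeta s x ^ n * of_real (clifford_J n (\<kappa> * (x \<bullet> x)))) * (laplacian \<phi> x + of_real (k\<^sup>2) * \<phi> x)"
  shows "F absolutely_integrable_on \<Omega>" "integral \<Omega> F = 0"
proof -
  define f where "f = (\<lambda>r. r ^ n * clifford_J n (\<kappa> * r\<^sup>2))"
  define g where "g = (\<lambda>r. real n * r ^ n * clifford_J n (\<kappa> * r\<^sup>2) - 2 * \<kappa> * r ^ (n + 2) * clifford_J (Suc n) (\<kappa> * r\<^sup>2))"
  define w where "w x = zeta s x ^ n * of_real (clifford_J n (\<kappa> * (x \<bullet> x)))" for x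
  have m: "cis (s * real n * (2 * pi)) = 1"
  proof -
    have "polar 1 (2 * pi) = polar 1 0" by (simp add: vec_eq_iff forall_2)
    with zeta_polar[OF s, of 1 "2 * pi" n] zeta_polar[OF s, of 1 0 n] show ?thesis by simp
  qed
  have m2: "(s * real n)\<^sup>2 = (real n)\<^sup>2"
    using s by (simp add: power_mult_distrib)
  note der = clifford_radial_deriv[OF clifford_seq_J \<kappa>, of _ n, folded f_def g_def]
  have f0: "((\<lambda>r. r * f r) \<longlongrightarrow> 0) (at_right 0)"
    unfolding f_def by (rule isCont_at_right) (intro continuous_intros clifford_J_radial_continuous, simp)
  have g0: "(g \<longlongrightarrow> 0) (at_right 0)"
    unfolding g_def by (rule isCont_at_right) (intro continuous_intros clifford_J_radial_continuous, cases n, simp_all)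
  have w: "w (polar r \<theta>) = of_real (f r) * cis (s * real n * \<theta>)" if "r > 0" for r \<theta>
    by (simp add: w_def zeta_polar[OF s] f_def power2_norm_eq_inner[symmetric])
  have F: "F = (\<lambda>x. w (x - 0) * (laplacian \<phi> x + of_real (k\<^sup>2) * \<phi> x))"
    by (simp add: F_def w_def)
  have der2: "(g has_real_derivative ((s * real n)\<^sup>2 / r - k\<^sup>2 * r) * f r) (at r)" if "r > 0" for r
    using der(2)[OF that] by (simp only: m2 k f_def g_def)
  have der1: "(f has_real_derivative g r / r) (at r)" if "r > 0" for r
    using der(1)[OF that] by (simp only: f_def g_def)
  note wt = weak_radial_test[OF \<phi> m der1 der2 f0 g0 w, where c = 0, folded F]
  show "F absolutely_integrable_on \<Omega>"
    by (rule wt(1))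
  have "integral \<Omega> F = of_real 0 * \<phi> 0 * integral {0..2 * pi} (\<lambda>\<theta>. cis (s * real n * \<theta>))"
    by (rule wt(2))
  then show "integral \<Omega> F = 0" by simp
qed

text \<open>\<open>2 / pi\<close> is the limiting flux \<open>r f'(r)\<close> of the second kind in
  order \<open>0\<close>. It is independent of \<open>\<kappa>\<close> and is what produces the
  point source; the other limit makes the logarithm integrable.\<close>

lemma clifford_Y_radial_limits:
  assumes "\<kappa> > 0"
  shows "((\<lambda>r. r * clifford_Y 0 (\<kappa> * r\<^sup>2)) \<longlongrightarrow> 0) (at_right 0)"
    and "((\<lambda>r. - 2 * \<kappa> * r\<^sup>2 * clifford_Y 1 (\<kappa> * r\<^sup>2)) \<longlongrightarrow> 2 / pi) (at_right 0)"
proof -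
  have c: "isCont (\<lambda>r. \<kappa> * r\<^sup>2) 0"
    by (intro continuous_intros)
  have lim0: "((\<lambda>r. \<kappa> * r\<^sup>2) \<longlongrightarrow> 0) (at_right 0)"
    by (rule isCont_at_right[OF c]) simp
  have lim: "filterlim (\<lambda>r. \<kappa> * r\<^sup>2) (at_right 0) (at_right (0::real))"
    by (rule tendsto_imp_filterlim_at_right[OF lim0])
      (use assms in \<open>auto intro: eventually_mono[OF eventually_at_right_less[of "0::real"]]\<close>)
  have "((\<lambda>r. - 2 * (\<kappa> * r\<^sup>2 * clifford_Y 1 (\<kappa> * r\<^sup>2))) \<longlongrightarrow> - 2 * (- 1 / pi)) (at_right 0)"
    by (intro tendsto_mult tendsto_const filterlim_compose[OF tendsto_mult_clifford_Y_1 lim])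
  then show "((\<lambda>r. - 2 * \<kappa> * r\<^sup>2 * clifford_Y 1 (\<kappa> * r\<^sup>2)) \<longlongrightarrow> 2 / pi) (at_right 0)"
    by (simp add: mult.assoc)
  have J: "(clifford_J 0 \<longlongrightarrow> clifford_J 0 0) (at_right 0)" and H: "(clifford_H 0 \<longlongrightarrow> clifford_H 0 0) (at_right 0)"
    by (intro isCont_at_right clifford_J_continuous clifford_H_continuous refl)+
  have t: "((\<lambda>r::real. r) \<longlongrightarrow> 0) (at_right 0)"
    by (simp add: tendsto_ident_at)
  have "((\<lambda>r. ((r * ln \<kappa> + 2 * (r * ln r) + r * (2 * euler_mascheroni)) * clifford_J 0 (\<kappa> * r\<^sup>2) - r * clifford_H 0 (\<kappa> * r\<^sup>2)) / pi)
      \<longlongrightarrow> ((0 * ln \<kappa> + 2 * 0 + 0 * (2 * euler_mascheroni)) * clifford_J 0 0 - 0 * clifford_H 0 0) / pi) (at_right 0)"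
    by (intro tendsto_divide tendsto_diff tendsto_mult tendsto_add tendsto_const t tendsto_mult_ln_at_right_0
        filterlim_compose[OF J lim] filterlim_compose[OF H lim]) simp
  moreover have "\<forall>\<^sub>F r in at_right 0.
      ((r * ln \<kappa> + 2 * (r * ln r) + r * (2 * euler_mascheroni)) * clifford_J 0 (\<kappa> * r\<^sup>2) - r * clifford_H 0 (\<kappa> * r\<^sup>2)) / pi
      = r * clifford_Y 0 (\<kappa> * r\<^sup>2)"
    using eventually_at_right_less[of "0::real"]
  proof eventually_elim
    case (elim r)
    then have "ln (\<kappa> * r\<^sup>2) = ln \<kappa> + 2 * ln r"
      using assms by (simp add: ln_mult ln_realpow)
    then show ?case by (simp add: clifford_Y_def clifford_P_def algebra_simps)
  qed
  ultimately have "((\<lambda>r. r * clifford_Y 0 (\<kappa> * r\<^sup>2)) \<longlongrightarrow>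
      ((0 * ln \<kappa> + 2 * 0 + 0 * (2 * euler_mascheroni)) * clifford_J 0 0 - 0 * clifford_H 0 0) / pi) (at_right 0)"
    by (rule Lim_transform_eventually)
  then show "((\<lambda>r. r * clifford_Y 0 (\<kappa> * r\<^sup>2)) \<longlongrightarrow> 0) (at_right 0)"
    by simp
qed

lemma source_weak:
  fixes c :: "real^2"
  assumes \<phi>: "test_function \<Omega> \<phi>" and k: "k\<^sup>2 = 4 * \<kappa>" and \<kappa>: "\<kappa> > 0"
    and z: "clifford_seq z" and f0: "((\<lambda>r. r * z 0 (\<kappa> * r\<^sup>2)) \<longlongrightarrow> 0) (at_right 0)"
    and g0: "((\<lambda>r. - 2 * \<kappa> * r\<^sup>2 * z 1 (\<kappa> * r\<^sup>2)) \<longlongrightarrow> g0) (at_right 0)"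
  defines "F \<equiv> \<lambda>x. of_real (z 0 (\<kappa> * (norm (x - c))\<^sup>2)) * (laplacian \<phi> x + of_real (k\<^sup>2) * \<phi> x)"
  shows "F absolutely_integrable_on \<Omega>" "integral \<Omega> F = of_real (2 * pi * g0) * \<phi> c"
proof -
  note der = clifford_radial_deriv[OF z \<kappa>, of _ 0]
  have w: "of_real (z 0 (\<kappa> * (norm (polar r \<theta>))\<^sup>2)) = complex_of_real (z 0 (\<kappa> * r\<^sup>2)) * cis (0 * \<theta>)" for r \<theta>
    by simp
  have m: "cis (0 * (2 * pi)) = 1" by simp
  have d1: "((\<lambda>r. z 0 (\<kappa> * r\<^sup>2)) has_real_derivative (- 2 * \<kappa> * r\<^sup>2 * z 1 (\<kappa> * r\<^sup>2)) / r) (at r)" if "r > 0" for r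
    using der(1)[OF that] that by (simp add: power2_eq_square)
  have d2: "((\<lambda>r. - 2 * \<kappa> * r\<^sup>2 * z 1 (\<kappa> * r\<^sup>2)) has_real_derivative (0\<^sup>2 / r - k\<^sup>2 * r) * z 0 (\<kappa> * r\<^sup>2)) (at r)" if "r > 0" for r
    using der(2)[OF that] k by (simp add: power2_eq_square)
  note wt = weak_radial_test[where w = "\<lambda>x. of_real (z 0 (\<kappa> * (norm x)\<^sup>2))" and c = c, OF \<phi> m d1 d2 f0 g0 w, folded F_def]
  show "F absolutely_integrable_on \<Omega>"
    by (rule wt(1))
  have "integral \<Omega> F = of_real g0 * \<phi> c * integral {0..2 * pi} (\<lambda>\<theta>. cis (0 * \<theta>))"
    by (rule wt(2))
  then show "integral \<Omega> F = of_real (2 * pi * g0) * \<phi> c"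
    by (simp add: scaleR_conv_of_real mult_ac)
qed

definition point_source :: "real \<Rightarrow> real^2 \<Rightarrow> real^2 \<Rightarrow> complex" where
  "point_source k c x = \<i> / 4 * hankel1 0 (k * norm (x - c))"

lemma point_source_eq:
  assumes "k > 0" "x \<noteq> c"
  shows "point_source k c x = \<i> / 4 * (of_real (clifford_J 0 (k\<^sup>2 / 4 * (norm (x - c))\<^sup>2)) + \<i> * of_real (clifford_Y 0 (k\<^sup>2 / 4 * (norm (x - c))\<^sup>2)))"
proof -
  have "k * norm (x - c) > 0" using assms by simp
  then show ?thesis
    by (simp add: point_source_def hankel1_def bessel_J_eq bessel_Y_eq cyl_def power_mult_distrib complex_eq_iff)
qed

text \<open>Only the second kind contributes: \<open>2 * pi * (2 / pi) = 4\<close> times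
  \<open>\<i> / 4 * \<i> = - 1 / 4\<close>. The point \<open>c\<close> may lie outside
  \<open>\<Omega>\<close>, where \<open>\<phi> c = 0\<close>; the addition theorem uses this
  case.\<close>

lemma point_source_weak:
  fixes c :: "real^2"
  assumes \<phi>: "test_function \<Omega> \<phi>" and k: "k > 0"
  defines "F \<equiv> \<lambda>x. point_source k c x * (laplacian \<phi> x + of_real (k\<^sup>2) * \<phi> x)"
  shows "F absolutely_integrable_on \<Omega>" "integral \<Omega> F = - \<phi> c"
proof -
  have \<kappa>: "k\<^sup>2 = 4 * (k\<^sup>2 / 4)" "k\<^sup>2 / 4 > 0" using k by simp_all
  define FJ where "FJ x = of_real (clifford_J 0 (k\<^sup>2 / 4 * (norm (x - c))\<^sup>2)) * (laplacian \<phi> x + of_real (k\<^sup>2) * \<phi> x)" for x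
  define FY where "FY x = of_real (clifford_Y 0 (k\<^sup>2 / 4 * (norm (x - c))\<^sup>2)) * (laplacian \<phi> x + of_real (k\<^sup>2) * \<phi> x)" for x
  have J1: "((\<lambda>r. r * clifford_J 0 (k\<^sup>2 / 4 * r\<^sup>2)) \<longlongrightarrow> 0) (at_right 0)"
    by (rule isCont_at_right) (intro continuous_intros clifford_J_radial_continuous, simp)
  have J2: "((\<lambda>r. - 2 * (k\<^sup>2 / 4) * r\<^sup>2 * clifford_J 1 (k\<^sup>2 / 4 * r\<^sup>2)) \<longlongrightarrow> 0) (at_right 0)"
    by (rule isCont_at_right) (intro continuous_intros clifford_J_radial_continuous, simp)
  have J: "FJ absolutely_integrable_on \<Omega>" "integral \<Omega> FJ = 0"
    using source_weak[OF \<phi> \<kappa> clifford_seq_J J1 J2, of c, folded FJ_def] by simp_all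
  have Y: "FY absolutely_integrable_on \<Omega>" "integral \<Omega> FY = 4 * \<phi> c"
    using source_weak[OF \<phi> \<kappa> clifford_seq_Y clifford_Y_radial_limits[OF \<kappa>(2)], of c, folded FY_def] by simp_all
  have eq: "F x = \<i> / 4 * FJ x + (- 1 / 4) * FY x" if "x \<in> \<Omega> - {c}" for x
  proof -
    have ps: "point_source k c x = \<i> / 4 * of_real (clifford_J 0 (k\<^sup>2 / 4 * (norm (x - c))\<^sup>2))
        + (- 1 / 4) * of_real (clifford_Y 0 (k\<^sup>2 / 4 * (norm (x - c))\<^sup>2))"
      using that point_source_eq[OF k, of x c] by (simp add: algebra_simps)
    show ?thesis
      unfolding F_def FJ_def FY_def ps by (simp only: distrib_right mult.assoc)
  qed
  have iJ: "(\<lambda>x. \<i> / 4 * FJ x) absolutely_integrable_on \<Omega>" and iY: "(\<lambda>x. (- 1 / 4) * FY x) absolutely_integrable_on \<Omega>"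
    by (intro set_integrable_mult_right J Y)+
  have sum: "(\<lambda>x. \<i> / 4 * FJ x + (- 1 / 4) * FY x) absolutely_integrable_on \<Omega>"
    by (rule set_integral_add(1)[OF iJ iY])
  show "F absolutely_integrable_on \<Omega>"
    by (rule absolutely_integrable_spike[OF sum negligible_sing eq])
  have "integral \<Omega> F = integral \<Omega> (\<lambda>x. \<i> / 4 * FJ x + (- 1 / 4) * FY x)"
    by (rule sym, rule integral_spike[OF negligible_sing eq])
  also have "\<dots> = integral \<Omega> (\<lambda>x. \<i> / 4 * FJ x) + integral \<Omega> (\<lambda>x. (- 1 / 4) * FY x)"
    by (intro integral_add set_lebesgue_integral_eq_integral(1) iJ iY)
  also have "\<dots> = - \<phi> c"
    by (simp only: integral_mult_right J Y) simp
  finally show "integral \<Omega> F = - \<phi> c" .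
qed

text \<open>The Jacobian turns the integrand into \<open>r * f r\<close>, which extends continuously
  to \<open>0\<close>; a compact set is enclosed in a disk about \<open>c\<close>.\<close>

lemma radial_locally_integrable:
  fixes f :: "real \<Rightarrow> real"
  assumes f: "\<And>r. r > 0 \<Longrightarrow> isCont f r" and f0: "((\<lambda>r. r * f r) \<longlongrightarrow> 0) (at_right 0)" and K: "compact K"
  shows "(\<lambda>x::real^2. complex_of_real (f (norm (x - c)))) absolutely_integrable_on K"
proof -
  obtain L where L: "L > 0" "K \<subseteq> ball c L"
    using bounded_subset_ballD[OF compact_imp_bounded[OF K]] by blast
  define h where "h r = (if r = 0 then 0 else r * f r)" for r :: real
  have hc: "continuous_on {0..L} h"
    unfolding continuous_on_eq_continuous_within
  proof
    fix r assume r: "r \<in> {0..L}"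
    show "continuous (at r within {0..L}) h"
    proof (cases "r = 0")
      case True
      have 0: "at_right 0 = at 0 within {0..L}"
        using L by (metis at_within_Icc_at_right)
      have "\<forall>\<^sub>F r in at_right 0. r * f r = h r"
        using eventually_at_right_less[of "0::real"] by eventually_elim (simp add: h_def)
      from Lim_transform_eventually[OF f0 this] have "(h \<longlongrightarrow> h 0) (at_right 0)"
        by (simp add: h_def[of 0])
      then show ?thesis
        unfolding True continuous_within 0[symmetric] .
    next
      case False
      then have rp: "r > 0" using r by simp
      have 1: "isCont (\<lambda>r. r * f r) r"
        by (intro isCont_mult continuous_ident f rp)
      have "\<forall>\<^sub>F r in nhds r. r \<in> {0<..}"
        by (rule eventually_nhds_in_open) (use rp in auto)
      then have "\<forall>\<^sub>F r in nhds r. h r = r * f r"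
        by eventually_elim (simp add: h_def)
      with 1 have "isCont h r" using isCont_cong by fast
      then show ?thesis by (rule continuous_at_imp_continuous_at_within)
    qed
  qed
  have gc: "continuous_on (cbox (0, 0) (L, 2 * pi)) (\<lambda>z. complex_of_real (h (fst z)))"
    by (intro continuous_intros continuous_on_compose2[OF hc]) (auto simp: cbox_Pair_eq)
  have "(\<lambda>x::real^2. complex_of_real (f (norm x))) absolutely_integrable_on {x. 0 < norm x \<and> norm x < L}"
    by (rule polar_integral(1)[OF order_refl gc]) (auto simp: h_def scaleR_conv_of_real)
  then have "(\<lambda>x. complex_of_real (f (norm (x - c)))) absolutely_integrable_on {x. 0 < norm (x - c) \<and> norm (x - c) < L}"
    using translation_integral(1)[OF annulus_measurable, where F = "\<lambda>x. complex_of_real (f (norm (x - c)))" and c = c]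
    unfolding translate_annulus by simp
  then have "(\<lambda>x. complex_of_real (f (norm (x - c)))) absolutely_integrable_on ball c L"
    by (rule absolutely_integrable_extend_zero(1)[OF _ _ negligible_sing[of c]]) (auto simp: dist_norm norm_minus_commute)
  then show ?thesis
    by (rule set_integrable_subset[OF _ fmeasurableD[OF lmeasurable_compact[OF K]] L(2)])
qed

lemma point_source_locally_integrable:
  assumes k: "k > 0" and K: "compact K"
  shows "point_source k c absolutely_integrable_on K"
proof -
  have \<kappa>: "k\<^sup>2 / 4 > 0" using k by simp
  have J1: "((\<lambda>r. r * clifford_J 0 (k\<^sup>2 / 4 * r\<^sup>2)) \<longlongrightarrow> 0) (at_right 0)"
    by (rule isCont_at_right) (intro continuous_intros clifford_J_radial_continuous, simp)
  have J: "(\<lambda>x. complex_of_real (clifford_J 0 (k\<^sup>2 / 4 * (norm (x - c))\<^sup>2))) absolutely_integrable_on K"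
    by (rule radial_locally_integrable[OF clifford_J_radial_continuous J1 K])
  have Yc: "isCont (\<lambda>r. clifford_Y 0 (k\<^sup>2 / 4 * r\<^sup>2)) r" if "r > 0" for r
    by (rule isCont_o2[OF _ clifford_seq_continuous[OF clifford_seq_Y]])
      (use that \<kappa> in \<open>auto intro!: continuous_intros\<close>)
  have Y: "(\<lambda>x. complex_of_real (clifford_Y 0 (k\<^sup>2 / 4 * (norm (x - c))\<^sup>2))) absolutely_integrable_on K"
    by (rule radial_locally_integrable[OF Yc clifford_Y_radial_limits(1)[OF \<kappa>] K])
  have "(\<lambda>x. \<i> / 4 * complex_of_real (clifford_J 0 (k\<^sup>2 / 4 * (norm (x - c))\<^sup>2))
       + (- 1 / 4) * complex_of_real (clifford_Y 0 (k\<^sup>2 / 4 * (norm (x - c))\<^sup>2))) absolutely_integrable_on K"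
    by (intro set_integral_add(1) set_integrable_mult_right J Y)
  then show ?thesis
    by (rule absolutely_integrable_spike[OF _ negligible_sing[of c]])
      (use point_source_eq[OF k] in \<open>auto simp: algebra_simps\<close>)
qed

subsection \<open>The addition theorem\<close>

lemma integral_cis_int:
  "integral {0..2 * pi} (\<lambda>\<theta>. cis (of_int m * \<theta>)) = (if m = 0 then of_real (2 * pi) else 0)"
proof (cases "m = 0")
  case False
  have "((\<lambda>\<theta>. cis (of_int m * \<theta>)) has_integral
      (cis (of_int m * (2 * pi)) / (\<i> * of_int m) - cis (of_int m * 0) / (\<i> * of_int m))) {0..2 * pi}"
  proof (rule fundamental_theorem_of_calculus)
    fix \<theta>
    have "((\<lambda>\<theta>. exp (\<i> * of_int m * of_real \<theta>) / (\<i> * of_int m)) has_vector_derivative exp (\<i> * of_int m * of_real \<theta>)) (at \<theta> within {0..2 * pi})"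
      by (rule has_vector_derivative_real_field) (use False in \<open>auto intro!: derivative_eq_intros\<close>)
    then show "((\<lambda>\<theta>. cis (of_int m * \<theta>) / (\<i> * of_int m)) has_vector_derivative cis (of_int m * \<theta>)) (at \<theta> within {0..2 * pi})"
      by (simp add: cis_conv_exp mult_ac)
  qed simp
  moreover have "cis (of_int m * (2 * pi)) = 1"
    using cis_multiple_2pi[of "of_int m"] by (simp add: mult_ac)
  ultimately show ?thesis using False by (simp add: integral_unique)
qed (simp add: scaleR_conv_of_real)

text \<open>A \<open>j\<close>-th power of \<open>a + b * cos\<close> is a trigonometric polynomial
  of degree \<open>j\<close> with outermost coefficients \<open>(b / 2) ^ j\<close>. Restricting to
  frequencies of size at least \<open>j\<close> avoids the inner coefficients, which depend on
  \<open>a\<close>.\<close>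

lemma trig_moment:
  assumes "int j \<le> \<bar>m\<bar>"
  shows "integral {0..2 * pi} (\<lambda>\<theta>. of_real ((a + b * cos (\<theta> - \<theta>0)) ^ j) * cis (of_int m * \<theta>)) =
    (if \<bar>m\<bar> = int j then of_real (2 * pi * (b / 2) ^ j) * cis (of_int m * \<theta>0) else 0)"
  using assms
proof (induction j arbitrary: m)
  case 0
  then show ?case using integral_cis_int[of m] by simp
next
  case (Suc j)
  let ?I = "\<lambda>m. integral {0..2 * pi} (\<lambda>\<theta>. of_real ((a + b * cos (\<theta> - \<theta>0)) ^ j) * cis (of_int m * \<theta>))"
  have i: "(\<lambda>\<theta>. of_real ((a + b * cos (\<theta> - \<theta>0)) ^ j) * cis (of_int m * \<theta>)) integrable_on {0..2 * pi}" for m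
    by (intro integrable_continuous_real continuous_intros)
  have cosine: "complex_of_real (cos (\<theta> - \<theta>0)) * cis (of_int m * \<theta>)
      = (cis (- \<theta>0) * cis (of_int (m + 1) * \<theta>) + cis \<theta>0 * cis (of_int (m - 1) * \<theta>)) / 2" for \<theta>
  proof -
    have "complex_of_real (cos d) = (cis d + cis (- d)) / 2" for d
      by (simp add: complex_eq_iff)
    then have "complex_of_real (cos (\<theta> - \<theta>0)) * cis (of_int m * \<theta>)
        = (cis (\<theta> - \<theta>0) + cis (- (\<theta> - \<theta>0))) / 2 * cis (of_int m * \<theta>)"
      by (simp only:)
    also have "\<dots> = (cis (\<theta> - \<theta>0) * cis (of_int m * \<theta>) + cis (- (\<theta> - \<theta>0)) * cis (of_int m * \<theta>)) / 2"
      by (simp only: distrib_right times_divide_eq_left)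
    finally show ?thesis by (simp add: cis_mult algebra_simps)
  qed
  have "integral {0..2 * pi} (\<lambda>\<theta>. of_real ((a + b * cos (\<theta> - \<theta>0)) ^ Suc j) * cis (of_int m * \<theta>))
      = integral {0..2 * pi} (\<lambda>\<theta>. of_real a * (of_real ((a + b * cos (\<theta> - \<theta>0)) ^ j) * cis (of_int m * \<theta>))
          + (of_real (b / 2) * cis (- \<theta>0)) * (of_real ((a + b * cos (\<theta> - \<theta>0)) ^ j) * cis (of_int (m + 1) * \<theta>))
          + (of_real (b / 2) * cis \<theta>0) * (of_real ((a + b * cos (\<theta> - \<theta>0)) ^ j) * cis (of_int (m - 1) * \<theta>)))"
  proof (rule integral_cong)
    fix \<theta>
    have "of_real ((a + b * cos (\<theta> - \<theta>0)) ^ Suc j) * cis (of_int m * \<theta>)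
      = of_real ((a + b * cos (\<theta> - \<theta>0)) ^ j) * (of_real a * cis (of_int m * \<theta>) + of_real b * (of_real (cos (\<theta> - \<theta>0)) * cis (of_int m * \<theta>)))"
      by (simp add: algebra_simps)
    then show "of_real ((a + b * cos (\<theta> - \<theta>0)) ^ Suc j) * cis (of_int m * \<theta>)
      = of_real a * (of_real ((a + b * cos (\<theta> - \<theta>0)) ^ j) * cis (of_int m * \<theta>))
          + (of_real (b / 2) * cis (- \<theta>0)) * (of_real ((a + b * cos (\<theta> - \<theta>0)) ^ j) * cis (of_int (m + 1) * \<theta>))
          + (of_real (b / 2) * cis \<theta>0) * (of_real ((a + b * cos (\<theta> - \<theta>0)) ^ j) * cis (of_int (m - 1) * \<theta>))"
      unfolding cosine by (simp add: distrib_left distrib_right mult_ac add_divide_distrib)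
  qed
  also have "\<dots> = of_real a * ?I m + (of_real (b / 2) * cis (- \<theta>0)) * ?I (m + 1) + (of_real (b / 2) * cis \<theta>0) * ?I (m - 1)"
    by (simp only: integral_add[OF integrable_add[OF integrable_on_mult_right[OF i] integrable_on_mult_right[OF i]] integrable_on_mult_right[OF i]]
        integral_add[OF integrable_on_mult_right[OF i] integrable_on_mult_right[OF i]] integral_mult_right)
  also have "?I m = 0"
    using Suc.IH[of m] Suc.prems by simp
  finally have step: "integral {0..2 * pi} (\<lambda>\<theta>. of_real ((a + b * cos (\<theta> - \<theta>0)) ^ Suc j) * cis (of_int m * \<theta>))
      = (of_real (b / 2) * cis (- \<theta>0)) * ?I (m + 1) + (of_real (b / 2) * cis \<theta>0) * ?I (m - 1)"
    by simp
  consider "m = int (Suc j)" | "m = - int (Suc j)" | "\<bar>m\<bar> > int (Suc j)"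
    using Suc.prems by linarith
  then show ?case
  proof cases
    case 1
    then have "?I (m + 1) = 0" "?I (m - 1) = of_real (2 * pi * (b / 2) ^ j) * cis (of_int (m - 1) * \<theta>0)"
      using Suc.IH[of "m + 1"] Suc.IH[of "m - 1"] by simp_all
    moreover have "cis \<theta>0 * cis (of_int (m - 1) * \<theta>0) = cis (of_int m * \<theta>0)"
      by (simp add: cis_mult algebra_simps)
    ultimately show ?thesis
      unfolding step using 1 by (simp add: mult_ac)
  next
    case 2
    then have "?I (m - 1) = 0" "?I (m + 1) = of_real (2 * pi * (b / 2) ^ j) * cis (of_int (m + 1) * \<theta>0)"
      using Suc.IH[of "m + 1"] Suc.IH[of "m - 1"] by simp_all
    moreover have "cis (- \<theta>0) * cis (of_int (m + 1) * \<theta>0) = cis (of_int m * \<theta>0)"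
      by (simp add: cis_mult algebra_simps)
    ultimately show ?thesis
      unfolding step using 2 by (simp add: mult_ac)
  next
    case 3
    then have "?I (m - 1) = 0" "?I (m + 1) = 0"
      using Suc.IH[of "m + 1"] Suc.IH[of "m - 1"] by simp_all
    then show ?thesis unfolding step using 3 by simp
  qed
qed

text \<open>The \<open>j\<close>-th derivative of \<open>z 0\<close> is
  \<open>(-1) ^ j * z j\<close>. The restriction on \<open>h\<close> keeps the argument in a compact
  interval away from the possible singularity at \<open>0\<close>.\<close>

lemma clifford_taylor:
  assumes z: "clifford_seq z" and T: "T > 0"
  obtains C where "C \<ge> 0" "\<forall>h. \<bar>h\<bar> \<le> T / 2 \<longrightarrow> \<bar>z 0 (T + h) - (\<Sum>j\<le>n. (-1) ^ j * z j T / fact j * h ^ j)\<bar> \<le> C * \<bar>h\<bar> ^ Suc n"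
proof -
  have "continuous_on {T / 2..T + T / 2} (z (Suc n))"
    using T by (intro continuous_at_imp_continuous_on ballI clifford_seq_continuous[OF z]) auto
  then have "bounded (z (Suc n) ` {T / 2..T + T / 2})"
    by (intro compact_imp_bounded compact_continuous_image compact_Icc)
  then obtain B where B: "\<forall>t\<in>{T / 2..T + T / 2}. \<bar>z (Suc n) t\<bar> \<le> B"
    unfolding bounded_iff by auto
  have B0: "B \<ge> 0"
    using B[rule_format, of T] T by (auto intro: order_trans[OF abs_ge_zero])
  show ?thesis
  proof (rule that[of "B / fact (Suc n)"])
    show "B / fact (Suc n) \<ge> 0" using B0 by simp
    show "\<forall>h. \<bar>h\<bar> \<le> T / 2 \<longrightarrow> \<bar>z 0 (T + h) - (\<Sum>j\<le>n. (-1) ^ j * z j T / fact j * h ^ j)\<bar> \<le> B / fact (Suc n) * \<bar>h\<bar> ^ Suc n"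
    proof (intro allI impI)
      fix h assume h: "\<bar>h\<bar> \<le> T / 2"
      show "\<bar>z 0 (T + h) - (\<Sum>j\<le>n. (-1) ^ j * z j T / fact j * h ^ j)\<bar> \<le> B / fact (Suc n) * \<bar>h\<bar> ^ Suc n"
      proof (cases "h = 0")
        case True
        have "(\<Sum>j\<le>n. (-1) ^ j * z j T / fact j * 0 ^ j) = z 0 T"
          by (subst sum.remove[of _ 0]) (auto intro!: sum.neutral)
        then show ?thesis using True by simp
      next
        case False
        have "\<exists>t. (if T + h < T then T + h < t \<and> t < T else T < t \<and> t < T + h) \<and>
            z 0 (T + h) = (\<Sum>m<Suc n. ((-1) ^ m * z m T) / fact m * (T + h - T) ^ m) + ((-1) ^ Suc n * z (Suc n) t) / fact (Suc n) * (T + h - T) ^ Suc n"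
        proof (rule Taylor[where a = "T / 2" and b = "T + T / 2" and diff = "\<lambda>m t. (-1) ^ m * z m t"])
          show "\<forall>m t. m < Suc n \<and> T / 2 \<le> t \<and> t \<le> T + T / 2 \<longrightarrow>
              ((\<lambda>t. (-1) ^ m * z m t) has_real_derivative (-1) ^ Suc m * z (Suc m) t) (at t)"
          proof (intro allI impI)
            fix m t assume "m < Suc n \<and> T / 2 \<le> t \<and> t \<le> T + T / 2"
            then have "t > 0" using T by linarith
            from DERIV_cmult[OF clifford_seq_deriv[OF z this], of "(-1) ^ m" m]
            show "((\<lambda>t. (-1) ^ m * z m t) has_real_derivative (-1) ^ Suc m * z (Suc m) t) (at t)" by simp
          qed
        qed (use h T False in auto)
        then obtain t where t: "if T + h < T then T + h < t \<and> t < T else T < t \<and> t < T + h"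
          "z 0 (T + h) = (\<Sum>m<Suc n. ((-1) ^ m * z m T) / fact m * (T + h - T) ^ m) + ((-1) ^ Suc n * z (Suc n) t) / fact (Suc n) * (T + h - T) ^ Suc n"
          by blast
        then have "z 0 (T + h) - (\<Sum>j\<le>n. (-1) ^ j * z j T / fact j * h ^ j) = ((-1) ^ Suc n * z (Suc n) t) / fact (Suc n) * h ^ Suc n"
          unfolding lessThan_Suc_atMost by simp
        also have "\<bar>\<dots>\<bar> = \<bar>z (Suc n) t\<bar> / fact (Suc n) * \<bar>h\<bar> ^ Suc n"
          by (simp add: abs_mult power_abs)
        also have "\<dots> \<le> B / fact (Suc n) * \<bar>h\<bar> ^ Suc n"
        proof -
          have "t \<in> {T / 2..T + T / 2}"
            using t(1) h T by (auto split: if_splits)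
          then show ?thesis using B by (intro mult_right_mono divide_right_mono) auto
        qed
        finally show ?thesis .
      qed
    qed
  qed
qed

text \<open>By the law of cosines the argument is \<open>T + h\<close> with
  \<open>T = \<kappa> * r0\<^sup>2\<close> and \<open>h\<close> of order \<open>r\<close>, affine in
  the cosine. In the Taylor polynomial of degree \<open>n\<close> only \<open>h ^ n\<close> reaches
  the frequency \<open>n\<close>, giving exactly \<open>r ^ n\<close> times a constant, and the
  remainder is of order \<open>r ^ (n + 1)\<close>.\<close>

lemma clifford_circle_limit:
  assumes z: "clifford_seq z" and \<kappa>: "\<kappa> > 0" and r0: "r0 > 0" and s: "s = 1 \<or> s = - 1"
  shows "((\<lambda>r. integral {0..2 * pi} (\<lambda>\<theta>. of_real (z 0 (\<kappa> * (r0\<^sup>2 + r\<^sup>2 - 2 * r * r0 * cos (\<theta> - \<theta>0)))) * cis (s * real n * \<theta>)) / of_real (r ^ n))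
     \<longlongrightarrow> of_real (2 * pi * (\<kappa> * r0) ^ n / fact n * z n (\<kappa> * r0\<^sup>2)) * cis (s * real n * \<theta>0)) (at_right 0)"
proof -
  define T where "T = \<kappa> * r0\<^sup>2"
  have T: "T > 0" using \<kappa> r0 by (simp add: T_def)
  define h where "h r \<theta> = \<kappa> * r * (r + (- 2 * r0) * cos (\<theta> - \<theta>0))" for r \<theta>
  define m :: int where "m = (if s = 1 then int n else - int n)"
  have m: "s * real n = of_int m" "\<bar>m\<bar> = int n"
    using s by (auto simp: m_def)
  have arg: "\<kappa> * (r0\<^sup>2 + r\<^sup>2 - 2 * r * r0 * cos (\<theta> - \<theta>0)) = T + h r \<theta>" for r \<theta>
    by (simp add: T_def h_def algebra_simps power2_eq_square)
  obtain C where C: "C \<ge> 0" "\<forall>h. \<bar>h\<bar> \<le> T / 2 \<longrightarrow> \<bar>z 0 (T + h) - (\<Sum>j\<le>n. (-1) ^ j * z j T / fact j * h ^ j)\<bar> \<le> C * \<bar>h\<bar> ^ Suc n"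
    by (rule clifford_taylor[OF z T])
  define I where "I r = integral {0..2 * pi} (\<lambda>\<theta>. of_real (z 0 (T + h r \<theta>)) * cis (of_int m * \<theta>))" for r
  define V where "V = of_real (2 * pi * (\<kappa> * r0) ^ n / fact n * z n T) * cis (of_int m * \<theta>0)"
  define P where "P r \<theta> = (\<Sum>j\<le>n. (-1) ^ j * z j T / fact j * h r \<theta> ^ j)" for r \<theta>
  have hb: "\<bar>h r \<theta>\<bar> \<le> \<kappa> * r * (r + 2 * r0)" if "r > 0" for r \<theta>
  proof -
    have "\<bar>r + (- 2 * r0) * cos (\<theta> - \<theta>0)\<bar> \<le> \<bar>r\<bar> + \<bar>(- 2 * r0) * cos (\<theta> - \<theta>0)\<bar>"
      by (rule abs_triangle_ineq)
    also have "\<bar>(- 2 * r0) * cos (\<theta> - \<theta>0)\<bar> = 2 * r0 * \<bar>cos (\<theta> - \<theta>0)\<bar>"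
      using r0 by (simp add: abs_mult)
    also have "\<dots> \<le> 2 * r0 * 1"
      using r0 by (intro mult_left_mono) auto
    finally have "\<bar>r + (- 2 * r0) * cos (\<theta> - \<theta>0)\<bar> \<le> r + 2 * r0" using that by simp
    then have "\<kappa> * r * \<bar>r + (- 2 * r0) * cos (\<theta> - \<theta>0)\<bar> \<le> \<kappa> * r * (r + 2 * r0)"
      using that \<kappa> by (intro mult_left_mono) auto
    then show ?thesis using that \<kappa> by (simp add: h_def abs_mult)
  qed
  have hc: "continuous_on S (h r)" for S r
    unfolding h_def by (intro continuous_intros)
  have PI: "integral {0..2 * pi} (\<lambda>\<theta>. of_real (P r \<theta>) * cis (of_int m * \<theta>)) = of_real (r ^ n) * V" for r
  proof -
    have "integral {0..2 * pi} (\<lambda>\<theta>. of_real (P r \<theta>) * cis (of_int m * \<theta>))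
      = integral {0..2 * pi} (\<lambda>\<theta>. \<Sum>j\<le>n. of_real ((-1) ^ j * z j T / fact j * (\<kappa> * r) ^ j) *
          (of_real ((r + (- 2 * r0) * cos (\<theta> - \<theta>0)) ^ j) * cis (of_int m * \<theta>)))"
      by (simp only: P_def h_def of_real_sum sum_distrib_right power_mult_distrib of_real_mult mult.assoc)
    also have "\<dots> = (\<Sum>j\<le>n. of_real ((-1) ^ j * z j T / fact j * (\<kappa> * r) ^ j) *
          integral {0..2 * pi} (\<lambda>\<theta>. of_real ((r + (- 2 * r0) * cos (\<theta> - \<theta>0)) ^ j) * cis (of_int m * \<theta>)))"
      by (subst integral_sum) (auto intro!: integrable_continuous_real continuous_intros)
    also have "\<dots> = (\<Sum>j\<le>n. if j = n then of_real ((-1) ^ n * z n T / fact n * (\<kappa> * r) ^ n) *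
          (of_real (2 * pi * ((- 2 * r0) / 2) ^ n) * cis (of_int m * \<theta>0)) else 0)"
    proof (rule sum.cong[OF refl])
      fix j assume "j \<in> {..n}"
      then have "int j \<le> \<bar>m\<bar>" using m by simp
      from trig_moment[OF this, of r "- 2 * r0" \<theta>0] show "of_real ((-1) ^ j * z j T / fact j * (\<kappa> * r) ^ j) *
          integral {0..2 * pi} (\<lambda>\<theta>. of_real ((r + (- 2 * r0) * cos (\<theta> - \<theta>0)) ^ j) * cis (of_int m * \<theta>))
         = (if j = n then of_real ((-1) ^ n * z n T / fact n * (\<kappa> * r) ^ n) *
          (of_real (2 * pi * ((- 2 * r0) / 2) ^ n) * cis (of_int m * \<theta>0)) else 0)"
        using m(2) by auto
    qed
    also have "\<dots> = of_real (((-1) ^ n * z n T / fact n * (\<kappa> * r) ^ n) * (2 * pi * ((- 2 * r0) / 2) ^ n)) * cis (of_int m * \<theta>0)"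
      by simp
    \<comment> \<open>The sign of the Taylor coefficient cancels that of \<open>- 2 * r0\<close> in
      the law of cosines.\<close>
    also have "((-1) ^ n * z n T / fact n * (\<kappa> * r) ^ n) * (2 * pi * ((- 2 * r0) / 2) ^ n) = r ^ n * (2 * pi * (\<kappa> * r0) ^ n / fact n * z n T)"
    proof -
      have "((- 2 * r0) / 2) ^ n = (-1) ^ n * r0 ^ n"
        by (simp add: power_mult_distrib[symmetric])
      moreover have "(-1) ^ n * (-1) ^ n = (1::real)"
        by (simp flip: power_mult_distrib)
      ultimately show ?thesis
        by (simp add: power_mult_distrib field_simps)
    qed
    finally show ?thesis by (simp add: V_def)
  qed
  obtain \<delta> where \<delta>: "\<delta> > 0" "\<forall>r. 0 < r \<and> r < \<delta> \<longrightarrow> \<kappa> * r * (r + 2 * r0) \<le> T / 2"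
  proof -
    have "((\<lambda>r. \<kappa> * r * (r + 2 * r0)) \<longlongrightarrow> \<kappa> * 0 * (0 + 2 * r0)) (at_right 0)"
      by (intro tendsto_intros)
    then have "\<forall>\<^sub>F r in at_right 0. \<kappa> * r * (r + 2 * r0) < T / 2"
      by (rule order_tendstoD(2)) (use T in simp)
    then show ?thesis
      using that unfolding eventually_at_right_field by (meson less_imp_le)
  qed
  have bound: "norm (I r / of_real (r ^ n) - V) \<le> 2 * pi * C * (\<kappa> * (r + 2 * r0)) ^ Suc n * r" if r: "0 < r" "r < \<delta>" for r
  proof -
    let ?b = "\<kappa> * r * (r + 2 * r0)"
    have b: "?b \<le> T / 2" using \<delta>(2) r by blast
    have zc: "continuous_on {0..2 * pi} (\<lambda>\<theta>. z 0 (T + h r \<theta>))"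
    proof (rule continuous_on_compose2[of "{0<..}" "z 0"])
      show "continuous_on {0<..} (z 0)"
        by (intro continuous_at_imp_continuous_on ballI clifford_seq_continuous[OF z]) auto
      have "T + h r \<theta> > 0" for \<theta>
        using hb[OF r(1), of \<theta>] b T by (auto simp: abs_le_iff)
      then show "(\<lambda>\<theta>. T + h r \<theta>) ` {0..2 * pi} \<subseteq> {0<..}" by auto
    qed (intro continuous_intros hc)
    have i1: "(\<lambda>\<theta>. of_real (z 0 (T + h r \<theta>)) * cis (of_int m * \<theta>)) integrable_on {0..2 * pi}"
      by (intro integrable_continuous_real continuous_intros zc)
    have i2: "(\<lambda>\<theta>. of_real (P r \<theta>) * cis (of_int m * \<theta>)) integrable_on {0..2 * pi}"
      unfolding P_def by (intro integrable_continuous_real continuous_intros hc)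
    have "I r - of_real (r ^ n) * V = integral {0..2 * pi} (\<lambda>\<theta>. of_real (z 0 (T + h r \<theta>)) * cis (of_int m * \<theta>) - of_real (P r \<theta>) * cis (of_int m * \<theta>))"
      unfolding PI[symmetric] I_def by (rule integral_diff[OF i1 i2, symmetric])
    also have "norm \<dots> \<le> C * ?b ^ Suc n * (2 * pi - 0)"
    proof (rule integral_bound)
      show "continuous_on {0..2 * pi} (\<lambda>\<theta>. of_real (z 0 (T + h r \<theta>)) * cis (of_int m * \<theta>) - of_real (P r \<theta>) * cis (of_int m * \<theta>))"
        unfolding P_def by (intro continuous_intros zc hc)
      fix \<theta>
      have "norm (of_real (z 0 (T + h r \<theta>)) * cis (of_int m * \<theta>) - of_real (P r \<theta>) * cis (of_int m * \<theta>)) = \<bar>z 0 (T + h r \<theta>) - P r \<theta>\<bar>"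
        by (simp flip: left_diff_distrib of_real_diff add: norm_mult)
      also have "\<dots> \<le> C * \<bar>h r \<theta>\<bar> ^ Suc n"
        unfolding P_def using C(2) hb[OF r(1), of \<theta>] b by (meson order_trans)
      also have "\<dots> \<le> C * ?b ^ Suc n"
        using hb[OF r(1), of \<theta>] C(1) by (intro mult_left_mono power_mono) auto
      finally show "norm (of_real (z 0 (T + h r \<theta>)) * cis (of_int m * \<theta>) - of_real (P r \<theta>) * cis (of_int m * \<theta>)) \<le> C * ?b ^ Suc n" .
    qed simp
    finally have "norm (I r - of_real (r ^ n) * V) \<le> (2 * pi * C * (\<kappa> * (r + 2 * r0)) ^ Suc n * r) * r ^ n"
      by (simp add: power_mult_distrib mult_ac)
    moreover have "I r / of_real (r ^ n) - V = (I r - of_real (r ^ n) * V) / of_real (r ^ n)"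
      using r by (simp add: diff_divide_distrib)
    ultimately show ?thesis
      using r by (simp add: norm_divide norm_power pos_divide_le_eq)
  qed
  have lim: "((\<lambda>r. 2 * pi * C * (\<kappa> * (r + 2 * r0)) ^ Suc n * r) \<longlongrightarrow> 2 * pi * C * (\<kappa> * (0 + 2 * r0)) ^ Suc n * 0) (at_right 0)"
    by (intro tendsto_intros)
  have "((\<lambda>r. I r / of_real (r ^ n) - V) \<longlongrightarrow> 0) (at_right 0)"
  proof (rule Lim_null_comparison)
    show "\<forall>\<^sub>F r in at_right 0. norm (I r / of_real (r ^ n) - V) \<le> 2 * pi * C * (\<kappa> * (r + 2 * r0)) ^ Suc n * r"
      unfolding eventually_at_right_field using \<delta>(1) bound by blast
  qed (use lim in simp)
  then have "((\<lambda>r. I r / of_real (r ^ n)) \<longlongrightarrow> V) (at_right 0)"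
    by (simp add: LIM_zero_iff)
  then show ?thesis
    by (simp add: I_def V_def arg m(1) T_def)
qed

text \<open>The gradient of \<open>z 0 (\<kappa> * (norm (x - c))\<^sup>2)\<close> is
  \<open>- 2 * \<kappa> * z 1\<close> times \<open>x - c\<close>, and
  \<open>2 * \<kappa> = k\<^sup>2 / 2\<close>.\<close>

definition source_deriv :: "real \<Rightarrow> real^2 \<Rightarrow> real^2 \<Rightarrow> ((real^2) \<Rightarrow>\<^sub>L complex)" where
  "source_deriv k c x = blinfun_scaleR_left
     (- of_real (k\<^sup>2 / 2) * (\<i> / 4 * (of_real (clifford_J 1 (k\<^sup>2 / 4 * (norm (x - c))\<^sup>2)) + \<i> * of_real (clifford_Y 1 (k\<^sup>2 / 4 * (norm (x - c))\<^sup>2)))))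
     o\<^sub>L blinfun_inner_left (x - c)"

lemma point_source_has_derivative:
  assumes k: "k > 0" and x: "x \<noteq> c"
  shows "(point_source k c has_derivative blinfun_apply (source_deriv k c x)) (at x within S)"
proof -
  define \<kappa> where "\<kappa> = k\<^sup>2 / 4"
  have \<kappa>: "\<kappa> > 0" using k by (simp add: \<kappa>_def)
  have t: "\<kappa> * (norm (x - c))\<^sup>2 > 0" using \<kappa> x by simp
  have arg: "((\<lambda>y. \<kappa> * (norm (y - c))\<^sup>2) has_derivative (\<lambda>h. \<kappa> * (2 * ((x - c) \<bullet> h)))) (at x)"
    unfolding power2_norm_eq_inner by (auto intro!: derivative_eq_intros simp: inner_commute)
  have z: "((\<lambda>y. z 0 (\<kappa> * (norm (y - c))\<^sup>2)) has_derivative (\<lambda>h. \<kappa> * (2 * ((x - c) \<bullet> h)) * - z (Suc 0) (\<kappa> * (norm (x - c))\<^sup>2))) (at x)"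
    if "clifford_seq z" for z
    by (rule DERIV_compose_FDERIV[where f = "z 0", OF clifford_seq_deriv[OF that t] arg])
  let ?u = "\<lambda>y. \<i> / 4 * (complex_of_real (clifford_J 0 (\<kappa> * (norm (y - c))\<^sup>2)) + \<i> * of_real (clifford_Y 0 (\<kappa> * (norm (y - c))\<^sup>2)))"
  have "(?u has_derivative (\<lambda>h. \<i> / 4 * (complex_of_real (\<kappa> * (2 * ((x - c) \<bullet> h)) * - clifford_J (Suc 0) (\<kappa> * (norm (x - c))\<^sup>2))
      + \<i> * of_real (\<kappa> * (2 * ((x - c) \<bullet> h)) * - clifford_Y (Suc 0) (\<kappa> * (norm (x - c))\<^sup>2))))) (at x)"
    by (intro has_derivative_mult_right has_derivative_add has_derivative_of_real z clifford_seq_J clifford_seq_Y)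
  then have "(?u has_derivative blinfun_apply (source_deriv k c x)) (at x)"
  proof (rule has_derivative_eq_rhs)
    have app: "blinfun_apply (source_deriv k c x) h = of_real ((x - c) \<bullet> h) *
        (- of_real (2 * \<kappa>) * (\<i> / 4 * (of_real (clifford_J 1 (\<kappa> * (norm (x - c))\<^sup>2)) + \<i> * of_real (clifford_Y 1 (\<kappa> * (norm (x - c))\<^sup>2)))))" for h
      by (simp add: source_deriv_def \<kappa>_def scaleR_conv_of_real inner_commute)
    show "(\<lambda>h. \<i> / 4 * (complex_of_real (\<kappa> * (2 * ((x - c) \<bullet> h)) * - clifford_J (Suc 0) (\<kappa> * (norm (x - c))\<^sup>2))
      + \<i> * of_real (\<kappa> * (2 * ((x - c) \<bullet> h)) * - clifford_Y (Suc 0) (\<kappa> * (norm (x - c))\<^sup>2)))) = blinfun_apply (source_deriv k c x)"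
      by (rule ext) (simp add: app complex_eq_iff field_simps)
  qed
  then have "(point_source k c has_derivative blinfun_apply (source_deriv k c x)) (at x)"
  proof (rule has_derivative_transform_within_open[where s = "- {c}"])
    show "?u y = point_source k c y" if "y \<in> - {c}" for y
      using that point_source_eq[OF k, of y c] by (simp only: \<kappa>_def) simp
  qed (use x in auto)
  then show ?thesis by (rule has_derivative_at_withinI)
qed

lemma source_deriv_continuous:
  assumes "k > 0" "c \<notin> S"
  shows "continuous_on S (source_deriv k c)"
proof -
  have z: "continuous_on S (\<lambda>x. z 1 (k\<^sup>2 / 4 * (norm (x - c))\<^sup>2))" if "clifford_seq z" for z
  proof (rule continuous_on_compose2[of "{0<..}" "z 1"])
    show "continuous_on {0<..} (z 1)"
      by (intro continuous_at_imp_continuous_on ballI clifford_seq_continuous[OF that]) auto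
    have "k\<^sup>2 / 4 * (norm (x - c))\<^sup>2 > 0" if "x \<in> S" for x
      using that assms by (auto intro!: mult_pos_pos)
    then show "(\<lambda>x. k\<^sup>2 / 4 * (norm (x - c))\<^sup>2) ` S \<subseteq> {0<..}" by auto
  qed (intro continuous_intros)
  show ?thesis
    unfolding source_deriv_def
    by (intro continuous_intros bounded_bilinear.continuous_on[OF bounded_bilinear_blinfun_compose]
        bounded_linear.continuous_on[OF bounded_linear_blinfun_scaleR_left]
        bounded_linear.continuous_on[OF bounded_linear_blinfun_inner_left] z clifford_seq_J clifford_seq_Y)
qed

lemma norm_polar_diff: "(norm (polar r \<theta> - polar r0 \<theta>0))\<^sup>2 = r0\<^sup>2 + r\<^sup>2 - 2 * r * r0 * cos (\<theta> - \<theta>0)"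
proof -
  have "(norm (polar r \<theta> - polar r0 \<theta>0))\<^sup>2 = (r * cos \<theta> - r0 * cos \<theta>0)\<^sup>2 + (r * sin \<theta> - r0 * sin \<theta>0)\<^sup>2"
    by (simp add: power2_norm_vec2)
  also have "\<dots> = r\<^sup>2 * ((cos \<theta>)\<^sup>2 + (sin \<theta>)\<^sup>2) + r0\<^sup>2 * ((cos \<theta>0)\<^sup>2 + (sin \<theta>0)\<^sup>2)
      - 2 * r * r0 * (cos \<theta> * cos \<theta>0 + sin \<theta> * sin \<theta>0)"
    by algebra
  finally show ?thesis by (simp add: cos_diff)
qed

lemma polar_neq: "\<bar>r\<bar> \<noteq> \<bar>r0\<bar> \<Longrightarrow> polar r \<theta> \<noteq> polar r0 \<theta>0"
  using arg_cong[of "polar r \<theta>" "polar r0 \<theta>0" norm] unfolding norm_polar by blast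

text \<open>In the disk of radius \<open>r0\<close> the source sits on the boundary circle, where
  test functions vanish. So it is a source-free weak solution there, and
  \<open>circle_mean_eq\<close> gives the mean up to a constant \<open>C\<close>; dividing by
  \<open>r ^ n\<close> and letting \<open>r\<close> tend to \<open>0\<close> finds \<open>C\<close>
  by \<open>clifford_circle_limit\<close>.\<close>

lemma circle_mean_point_source_inner:
  assumes k: "k > 0" and r0: "r0 > 0" and s: "s = 1 \<or> s = - 1" and r: "0 < r" "r < r0"
  defines "\<kappa> \<equiv> k\<^sup>2 / 4"
  shows "circle_mean (s * real n) (point_source k (polar r0 \<theta>0)) r =
    \<i> * of_real pi / 2 * of_real ((\<kappa> * r0 * r) ^ n * clifford_J n (\<kappa> * r\<^sup>2))
      * (of_real (clifford_J n (\<kappa> * r0\<^sup>2)) + \<i> * of_real (clifford_Y n (\<kappa> * r0\<^sup>2))) * cis (s * real n * \<theta>0)"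
proof -
  define c where "c = polar r0 \<theta>0"
  define u where "u = point_source k c"
  have \<kappa>: "\<kappa> > 0" using k by (simp add: \<kappa>_def)
  have k4: "complex_of_real (4 * \<kappa>) = of_real (k\<^sup>2)" by (simp add: \<kappa>_def)
  have nc: "norm c = r0" using r0 by (simp add: c_def)
  have cn: "c \<notin> ball 0 r0" using nc by simp
  interpret weak_solution r0 \<kappa> c u "source_deriv k c"
  proof
    show "0 < \<kappa>" by (rule \<kappa>)
    show "continuous_on (ball 0 r0 - {c}) (source_deriv k c)"
      by (rule source_deriv_continuous[OF k]) simp
    show "(u has_derivative blinfun_apply (source_deriv k c x)) (at x within ball 0 r0 - {c})" if "x \<in> ball 0 r0 - {c}" for x
      unfolding u_def by (rule point_source_has_derivative[OF k]) (use that in auto)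
    show "(LINT x:ball 0 r0|lebesgue. u x * (laplacian \<phi> x + complex_of_real (4 * \<kappa>) * \<phi> x)) = 0"
      if \<phi>: "test_function (ball 0 r0) \<phi>" for \<phi>
    proof -
      obtain L where L: "L > 0"
        "\<forall>x. norm (x - 0) \<ge> L \<longrightarrow> \<phi> x = 0 \<and> partial_deriv 1 \<phi> x = 0 \<and> partial_deriv 2 \<phi> x = 0 \<and> laplacian \<phi> x = 0"
        "\<forall>x. x \<notin> ball 0 r0 \<longrightarrow> \<phi> x = 0 \<and> laplacian \<phi> x = 0"
        by (rule test_function_support[OF \<phi>, of 0])
      have "\<phi> c = 0" using L(3) cn by blast
      then show ?thesis
        unfolding k4 u_def
        using set_lebesgue_integral_eq_integral(2)[OF point_source_weak(1)[OF \<phi> k, of c]] point_source_weak(2)[OF \<phi> k, of c]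
        by simp
    qed
  qed
  have s2: "s\<^sup>2 = 1" using s by auto
  obtain C where C: "\<And>r. 0 < r \<Longrightarrow> r < r0 \<Longrightarrow> r \<noteq> norm c \<Longrightarrow>
      circle_mean (s * real n) u r = C * of_real (r ^ n * clifford_J n (\<kappa> * r\<^sup>2))"
    using circle_mean_eq[OF s2, of n] by blast
  let ?I = "\<lambda>z r. integral {0..2 * pi} (\<lambda>\<theta>. of_real (z 0 (\<kappa> * (r0\<^sup>2 + r\<^sup>2 - 2 * r * r0 * cos (\<theta> - \<theta>0)))) * cis (s * real n * \<theta>)) :: complex"
  let ?V = "\<lambda>z. complex_of_real (2 * pi * (\<kappa> * r0) ^ n / fact n * z n (\<kappa> * r0\<^sup>2)) * cis (s * real n * \<theta>0)"
  have mean: "circle_mean (s * real n) u r = \<i> / 4 * (?I clifford_J r + \<i> * ?I clifford_Y r)" if r: "0 < r" "r < r0" for r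
  proof -
    have pos: "r0\<^sup>2 + r\<^sup>2 - 2 * r * r0 * cos (\<theta> - \<theta>0) > 0" for \<theta>
      using polar_neq[of r r0 \<theta> \<theta>0] r norm_polar_diff[of r \<theta> r0 \<theta>0, symmetric] by simp
    have zc: "continuous_on {0..2 * pi} (\<lambda>\<theta>. z 0 (\<kappa> * (r0\<^sup>2 + r\<^sup>2 - 2 * r * r0 * cos (\<theta> - \<theta>0))))" if "clifford_seq z" for z
    proof (rule continuous_on_compose2[of "{0<..}" "z 0"])
      show "continuous_on {0<..} (z 0)"
        by (intro continuous_at_imp_continuous_on ballI clifford_seq_continuous[OF that]) auto
      show "(\<lambda>\<theta>. \<kappa> * (r0\<^sup>2 + r\<^sup>2 - 2 * r * r0 * cos (\<theta> - \<theta>0))) ` {0..2 * pi} \<subseteq> {0<..}"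
        using pos \<kappa> by auto
    qed (intro continuous_intros)
    have i: "(\<lambda>\<theta>. of_real (z 0 (\<kappa> * (r0\<^sup>2 + r\<^sup>2 - 2 * r * r0 * cos (\<theta> - \<theta>0)))) * cis (s * real n * \<theta>)) integrable_on {0..2 * pi}"
      if "clifford_seq z" for z
      by (intro integrable_continuous_real continuous_intros zc that)
    have "u (polar r \<theta>) * cis (s * real n * \<theta>) =
        \<i> / 4 * (of_real (clifford_J 0 (\<kappa> * (r0\<^sup>2 + r\<^sup>2 - 2 * r * r0 * cos (\<theta> - \<theta>0)))) * cis (s * real n * \<theta>)
         + \<i> * (of_real (clifford_Y 0 (\<kappa> * (r0\<^sup>2 + r\<^sup>2 - 2 * r * r0 * cos (\<theta> - \<theta>0)))) * cis (s * real n * \<theta>)))" for \<theta>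
    proof -
      have "polar r \<theta> \<noteq> polar r0 \<theta>0" by (rule polar_neq) (use r in auto)
      from point_source_eq[OF k this] have "u (polar r \<theta>) = \<i> / 4 * (of_real (clifford_J 0 (\<kappa> * (r0\<^sup>2 + r\<^sup>2 - 2 * r * r0 * cos (\<theta> - \<theta>0))))
         + \<i> * of_real (clifford_Y 0 (\<kappa> * (r0\<^sup>2 + r\<^sup>2 - 2 * r * r0 * cos (\<theta> - \<theta>0)))))"
        by (simp only: u_def c_def norm_polar_diff \<kappa>_def)
      then show ?thesis
        by (simp only: distrib_right distrib_left mult.assoc)
    qed
    then show ?thesis
      unfolding circle_mean_def
      by (simp only: integral_mult_right integral_add[OF i[OF clifford_seq_J] integrable_on_mult_right[OF i[OF clifford_seq_Y]]])
  qed
  have near: "\<forall>\<^sub>F r in at_right 0. 0 < r \<and> r < r0"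
    unfolding eventually_at_right_field using r0 by blast
  have "((\<lambda>r. \<i> / 4 * (?I clifford_J r / of_real (r ^ n) + \<i> * (?I clifford_Y r / of_real (r ^ n)))) \<longlongrightarrow> \<i> / 4 * (?V clifford_J + \<i> * ?V clifford_Y)) (at_right 0)"
    by (intro tendsto_mult tendsto_add tendsto_const clifford_circle_limit[OF _ \<kappa> r0 s] clifford_seq_J clifford_seq_Y)
  moreover have "\<forall>\<^sub>F r in at_right 0. \<i> / 4 * (?I clifford_J r / of_real (r ^ n) + \<i> * (?I clifford_Y r / of_real (r ^ n))) = C * of_real (clifford_J n (\<kappa> * r\<^sup>2))"
    using near
  proof eventually_elim
    case (elim r)
    have "\<i> / 4 * (?I clifford_J r / of_real (r ^ n) + \<i> * (?I clifford_Y r / of_real (r ^ n))) = circle_mean (s * real n) u r / of_real (r ^ n)"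
    proof -
      have "\<i> / 4 * (X / w + \<i> * (Y / w)) = \<i> / 4 * (X + \<i> * Y) / w" for X Y w :: complex
        by (simp add: add_divide_distrib diff_divide_distrib distrib_left)
      then show ?thesis
        unfolding mean[OF conjunct1[OF elim] conjunct2[OF elim]] .
    qed
    also have "\<dots> = C * of_real (clifford_J n (\<kappa> * r\<^sup>2))"
      using C[of r] elim nc by simp
    finally show ?case .
  qed
  ultimately have "((\<lambda>r. C * of_real (clifford_J n (\<kappa> * r\<^sup>2))) \<longlongrightarrow> \<i> / 4 * (?V clifford_J + \<i> * ?V clifford_Y)) (at_right 0)"
    by (rule Lim_transform_eventually)
  moreover have "((\<lambda>r. C * of_real (clifford_J n (\<kappa> * r\<^sup>2))) \<longlongrightarrow> C * of_real (1 / fact n)) (at_right 0)"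
    by (intro tendsto_mult tendsto_const tendsto_of_real isCont_at_right[OF clifford_J_radial_continuous]) (simp add: clifford_J_0)
  ultimately have "C * of_real (1 / fact n) = \<i> / 4 * (?V clifford_J + \<i> * ?V clifford_Y)"
    using tendsto_unique[OF trivial_limit_at_right_real] by blast
  then have "C * of_real (1 / fact n) * of_real (fact n) = \<i> / 4 * (?V clifford_J + \<i> * ?V clifford_Y) * of_real (fact n)"
    by (rule arg_cong)
  then have "C = \<i> / 4 * (?V clifford_J * of_real (fact n) + \<i> * (?V clifford_Y * of_real (fact n)))"
    by (simp add: distrib_right mult.assoc)
  moreover have "?V z * of_real (fact n) = of_real (2 * pi * (\<kappa> * r0) ^ n) * of_real (z n (\<kappa> * r0\<^sup>2)) * cis (s * real n * \<theta>0)" for z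
    by simp
  ultimately have "C = \<i> / 4 * (of_real (2 * pi * (\<kappa> * r0) ^ n) * of_real (clifford_J n (\<kappa> * r0\<^sup>2)) * cis (s * real n * \<theta>0)
      + \<i> * (of_real (2 * pi * (\<kappa> * r0) ^ n) * of_real (clifford_Y n (\<kappa> * r0\<^sup>2)) * cis (s * real n * \<theta>0)))"
    by (simp only:)
  then have "C = \<i> * of_real pi / 2 * of_real ((\<kappa> * r0) ^ n) * (of_real (clifford_J n (\<kappa> * r0\<^sup>2)) + \<i> * of_real (clifford_Y n (\<kappa> * r0\<^sup>2))) * cis (s * real n * \<theta>0)"
    by (simp add: algebra_simps)
  moreover have "circle_mean (s * real n) u r = C * of_real (r ^ n * clifford_J n (\<kappa> * r\<^sup>2))"
    using C r nc by simp
  ultimately show ?thesis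
    by (simp add: u_def c_def power_mult_distrib mult_ac)
qed

text \<open>Exchanging the two radii leaves the distance, and hence the circle mean, unchanged.\<close>

lemma circle_mean_point_source_outer:
  assumes k: "k > 0" and r0: "0 \<le> r0" and s: "s = 1 \<or> s = - 1" and r: "r0 < r"
  defines "\<kappa> \<equiv> k\<^sup>2 / 4"
  shows "circle_mean (s * real n) (point_source k (polar r0 \<theta>0)) r =
    \<i> * of_real pi / 2 * of_real ((\<kappa> * r * r0) ^ n * clifford_J n (\<kappa> * r0\<^sup>2))
      * (of_real (clifford_J n (\<kappa> * r\<^sup>2)) + \<i> * of_real (clifford_Y n (\<kappa> * r\<^sup>2))) * cis (s * real n * \<theta>0)"
proof (cases "r0 = 0")
  case False
  have "norm (polar r \<theta> - polar r0 \<theta>0) = norm (polar r0 \<theta> - polar r \<theta>0)" for \<theta>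
  proof (rule power2_eq_imp_eq)
    show "(norm (polar r \<theta> - polar r0 \<theta>0))\<^sup>2 = (norm (polar r0 \<theta> - polar r \<theta>0))\<^sup>2"
      unfolding norm_polar_diff by simp
  qed simp_all
  then have "circle_mean (s * real n) (point_source k (polar r0 \<theta>0)) r = circle_mean (s * real n) (point_source k (polar r \<theta>0)) r0"
    by (simp only: circle_mean_def point_source_def)
  then show ?thesis
    using circle_mean_point_source_inner[OF k _ s _ r, of n \<theta>0] False r0 r by (simp add: \<kappa>_def)
next
  \<comment> \<open>The exchange of radii needs \<open>r0 > 0\<close>. With the source at the origin
    the function is radial, and only the mean of order \<open>0\<close> survives.\<close>
  case True
  have p0: "polar 0 \<theta>0 = 0" by (simp add: vec_eq_iff forall_2)
  have u: "point_source k 0 (polar r \<theta>) = \<i> / 4 * (of_real (clifford_J 0 (\<kappa> * r\<^sup>2)) + \<i> * of_real (clifford_Y 0 (\<kappa> * r\<^sup>2)))" for \<theta>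
  proof -
    have "norm (polar r \<theta>) > 0" using r True by simp
    then have "polar r \<theta> \<noteq> 0" unfolding zero_less_norm_iff .
    from point_source_eq[OF k this] show ?thesis
      by (simp only: diff_zero norm_polar power2_abs \<kappa>_def)
  qed
  define m :: int where "m = (if s = 1 then int n else - int n)"
  have m: "s * real n = of_int m" "m = 0 \<longleftrightarrow> n = 0"
    using s by (auto simp: m_def)
  show ?thesis
    unfolding True p0 circle_mean_def u integral_mult_right m(1) integral_cis_int
    using m(2) by (cases "n = 0") (simp_all add: clifford_J_0)
qed

subsection \<open>The regular part\<close>

text \<open>The Weierstrass test is applied to the derivatives in the operator norm, which is the
  uniform estimate that termwise differentiation asks for. One majorant serves both series.\<close>

lemma series_C1:
  fixes f :: "nat \<Rightarrow> 'a::euclidean_space \<Rightarrow> 'b::euclidean_space" and Df :: "nat \<Rightarrow> 'a \<Rightarrow> 'a \<Rightarrow>\<^sub>L 'b"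
  assumes S: "convex S"
    and der: "\<And>n x. x \<in> S \<Longrightarrow> (f n has_derivative blinfun_apply (Df n x)) (at x within S)"
    and cont: "\<And>n. continuous_on S (Df n)"
    and fM: "\<And>n x. x \<in> S \<Longrightarrow> norm (f n x) \<le> M n" and DM: "\<And>n x. x \<in> S \<Longrightarrow> norm (Df n x) \<le> M n"
    and M: "summable M"
  shows "continuous_on S (\<lambda>x. \<Sum>n. Df n x)"
    and "x \<in> S \<Longrightarrow> ((\<lambda>x. \<Sum>n. f n x) has_derivative blinfun_apply (\<Sum>n. Df n x)) (at x within S)"
proof -
  have uD: "uniform_limit S (\<lambda>N x. \<Sum>n<N. Df n x) (\<lambda>x. \<Sum>n. Df n x) sequentially"
    using DM M by (rule Weierstrass_m_test)
  show "continuous_on S (\<lambda>x. \<Sum>n. Df n x)"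
    by (rule uniform_limit_theorem[OF _ uD]) (auto intro!: always_eventually continuous_on_sum cont)
  assume x: "x \<in> S"
  have fs: "(\<lambda>n. f n y) sums (\<Sum>n. f n y)" if "y \<in> S" for y
    by (rule summable_sums, rule summable_comparison_test'[OF M, of 0], rule fM[OF that])
  have "\<exists>g. \<forall>y\<in>S. (\<lambda>n. f n y) sums (g y) \<and> (g has_derivative blinfun_apply (\<Sum>n. Df n y)) (at y within S)"
  proof (rule has_derivative_series[OF S der])
    fix e :: real assume e: "e > 0"
    have "\<forall>\<^sub>F N in sequentially. \<forall>y\<in>S. dist (\<Sum>n<N. Df n y) (\<Sum>n. Df n y) < e"
      using uniform_limitD[OF uD e] .
    then show "\<forall>\<^sub>F N in sequentially. \<forall>y\<in>S. \<forall>h. norm ((\<Sum>i<N. blinfun_apply (Df i y) h) - blinfun_apply (\<Sum>n. Df n y) h) \<le> e * norm h"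
    proof eventually_elim
      case (elim N)
      show ?case
      proof (intro ballI allI)
        fix y h assume "y \<in> S"
        have "norm ((\<Sum>i<N. blinfun_apply (Df i y) h) - blinfun_apply (\<Sum>n. Df n y) h) = norm (blinfun_apply ((\<Sum>i<N. Df i y) - (\<Sum>n. Df n y)) h)"
          by (simp add: blinfun.diff_left blinfun.sum_left)
        also have "\<dots> \<le> norm ((\<Sum>i<N. Df i y) - (\<Sum>n. Df n y)) * norm h"
          by (rule norm_blinfun)
        also have "\<dots> \<le> e * norm h"
          using elim \<open>y \<in> S\<close> by (intro mult_right_mono) (auto simp: dist_norm less_imp_le)
        finally show "norm ((\<Sum>i<N. blinfun_apply (Df i y) h) - blinfun_apply (\<Sum>n. Df n y) h) \<le> e * norm h" .
      qed
    qed
  qed (use x fs[OF x] in auto)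
  then obtain g where g0: "\<forall>y\<in>S. (\<lambda>n. f n y) sums (g y) \<and> (g has_derivative blinfun_apply (\<Sum>n. Df n y)) (at y within S)"
    by (rule exE)
  have "g y = (\<Sum>n. f n y)" if "y \<in> S" for y
    using bspec[OF g0 that] by (simp only: sums_iff)
  then have e: "(\<Sum>n. f n y) = g y" if "y \<in> S" for y
    using that by simp
  show "((\<lambda>x. \<Sum>n. f n x) has_derivative blinfun_apply (\<Sum>n. Df n x)) (at x within S)"
    by (rule has_derivative_transform[OF x e conjunct2[OF bspec[OF g0 x]]])
qed

text \<open>The second formal derivative of the geometric series has coefficients
  \<open>(n + 1) * (n + 2)\<close>, which dominate.\<close>

lemma summable_quadratic_power:
  assumes "0 \<le> q" "q < (1::real)"
  shows "summable (\<lambda>n. (real n + 1)\<^sup>2 * q ^ n)"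
proof -
  have s0: "summable (\<lambda>n. (\<lambda>_. 1) n * x ^ n)" if "norm x < 1" for x :: real
    using that by (simp add: summable_geometric)
  have s1: "summable (\<lambda>n. diffs (\<lambda>_. 1) n * x ^ n)" if "norm x < 1" for x :: real
    by (rule termdiff_converges[OF that s0])
  have "summable (\<lambda>n. diffs (diffs (\<lambda>_. 1)) n * q ^ n)"
    by (rule termdiff_converges[of _ 1, OF _ s1]) (use assms in auto)
  then have "summable (\<lambda>n. (real n + 1) * (real n + 2) * q ^ n)"
    by (simp add: diffs_def algebra_simps)
  then show ?thesis
  proof (rule summable_comparison_test')
    fix n
    have "(real n + 1)\<^sup>2 \<le> (real n + 1) * (real n + 2)"
      by (simp add: power2_eq_square)
    then show "norm ((real n + 1)\<^sup>2 * q ^ n) \<le> (real n + 1) * (real n + 2) * q ^ n"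
      using assms by (simp add: mult_right_mono)
  qed
qed

lemma norm_zeta:
  assumes "s = 1 \<or> s = - 1"
  shows "norm (zeta s x) = norm x"
proof -
  have "(norm (zeta s x))\<^sup>2 = (norm x)\<^sup>2"
    using assms by (auto simp: zeta_def cmod_power2 power2_norm_vec2)
  then show ?thesis by simp
qed

lemma bounded_linear_zeta: "bounded_linear (zeta s)"
  using has_derivative_bounded_linear[OF zeta_has_derivative] .

text \<open>Convergence depends only on the growth of the coefficients, so \<open>\<beta>\<close>
  stays abstract here and becomes the ratio of Robin traces in \<open>robin_part\<close>. The base
  \<open>(2 / (k * R))\<^sup>2\<close> is the reciprocal of \<open>(k * R)\<^sup>2 / 4\<close>, the
  argument of the Clifford functions at the boundary.\<close>

locale regular_part =
  fixes k R r0 \<theta>0 :: real and \<beta> :: "nat \<Rightarrow> complex" and C :: real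
  assumes k: "k > 0" and R: "R > 0" and r0: "0 \<le> r0" "r0 < R"
    and \<beta>: "\<And>n. norm (\<beta> n) \<le> C * (real n + 1) * (fact n)\<^sup>2 * (2 / (k * R)) ^ (2 * n)"
begin

definition "\<kappa> = k\<^sup>2 / 4"

text \<open>The orders \<open>n\<close> and \<open>-n\<close> of the series are combined into one term; as they coincide for
  \<open>n = 0\<close>, that term is halved.\<close>

definition coef :: "nat \<Rightarrow> complex" where
  "coef n = (if n = 0 then 1 / 2 else 1) * \<beta> n * of_real ((k * r0 / 2) ^ n * clifford_J n (\<kappa> * r0\<^sup>2)) * of_real ((k / 2) ^ n)"

definition angular :: "nat \<Rightarrow> real^2 \<Rightarrow> complex" where
  "angular n x = cis (- (real n * \<theta>0)) * zeta 1 x ^ n + cis (real n * \<theta>0) * zeta (- 1) x ^ n"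

definition trm :: "nat \<Rightarrow> real^2 \<Rightarrow> complex" where
  "trm n x = coef n * (angular n x * of_real (clifford_J n (\<kappa> * (x \<bullet> x))))"

definition trm_deriv :: "nat \<Rightarrow> real^2 \<Rightarrow> ((real^2) \<Rightarrow>\<^sub>L complex)" where
  "trm_deriv n x =
     (blinfun_mult_right (coef n * of_real (clifford_J n (\<kappa> * (x \<bullet> x))) * (of_nat n * cis (- (real n * \<theta>0)) * zeta 1 x ^ (n - 1))) o\<^sub>L Blinfun (zeta 1))
     + (blinfun_mult_right (coef n * of_real (clifford_J n (\<kappa> * (x \<bullet> x))) * (of_nat n * cis (real n * \<theta>0) * zeta (- 1) x ^ (n - 1))) o\<^sub>L Blinfun (zeta (- 1)))
     + (blinfun_scaleR_left (coef n * angular n x * of_real (- 2 * \<kappa> * clifford_J (Suc n) (\<kappa> * (x \<bullet> x)))) o\<^sub>L blinfun_inner_left x)"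

definition regular :: "real^2 \<Rightarrow> complex" where
  "regular x = (\<Sum>n. trm n x)"

definition regular_deriv :: "real^2 \<Rightarrow> ((real^2) \<Rightarrow>\<^sub>L complex)" where
  "regular_deriv x = (\<Sum>n. trm_deriv n x)"

lemma \<kappa>_pos: "\<kappa> > 0" using k by (simp add: \<kappa>_def)

lemma C_nonneg: "C \<ge> 0"
  using \<beta>[of 0] by (auto intro: order_trans[OF norm_ge_zero])

text \<open>\<open>clifford_J n (\<kappa> * r0\<^sup>2)\<close> takes one of the two factorials, and
  the powers combine to \<open>(2 / (k * R))\<^sup>2 * (k * r0 / 2) * (k / 2) = r0 /
  R\<^sup>2\<close>. The other factorial and one power of \<open>R\<close> are settled by the factor
  that depends on \<open>x\<close>.\<close>

lemma coef_bound: "norm (coef n) \<le> C * exp (\<kappa> * r0\<^sup>2) * (real n + 1) * fact n * (r0 / R\<^sup>2) ^ n"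
proof -
  have J: "\<bar>clifford_J n (\<kappa> * r0\<^sup>2)\<bar> \<le> exp (\<kappa> * r0\<^sup>2) / fact n"
    using clifford_J_bound[of n "\<kappa> * r0\<^sup>2"] \<kappa>_pos by simp
  have "norm (coef n) \<le> 1 * norm (\<beta> n) * ((k * r0 / 2) ^ n * \<bar>clifford_J n (\<kappa> * r0\<^sup>2)\<bar>) * (k / 2) ^ n"
  proof -
    have "norm (coef n) = norm (if n = 0 then 1 / 2 else 1 :: complex) * norm (\<beta> n) * ((k * r0 / 2) ^ n * \<bar>clifford_J n (\<kappa> * r0\<^sup>2)\<bar>) * (k / 2) ^ n"
      unfolding coef_def norm_mult norm_of_real abs_mult using k r0 by simp
    then show ?thesis
      using k r0 by (auto intro!: mult_right_mono)
  qed
  also have "\<dots> \<le> 1 * (C * (real n + 1) * (fact n)\<^sup>2 * (2 / (k * R)) ^ (2 * n)) * ((k * r0 / 2) ^ n * (exp (\<kappa> * r0\<^sup>2) / fact n)) * (k / 2) ^ n"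
    using k r0 R C_nonneg by (intro mult_right_mono mult_mono mult_left_mono J \<beta>) auto
  also have "\<dots> = C * exp (\<kappa> * r0\<^sup>2) * (real n + 1) * fact n * ((2 / (k * R))\<^sup>2 * (k * r0 / 2) * (k / 2)) ^ n"
    unfolding power_mult_distrib[of "(2 / (k * R))\<^sup>2 * (k * r0 / 2)"] power_mult_distrib[of "(2 / (k * R))\<^sup>2"] power_mult[symmetric]
    by (simp add: power2_eq_square[of "fact n"])
  also have "(2 / (k * R))\<^sup>2 * (k * r0 / 2) * (k / 2) = r0 / R\<^sup>2"
    using k R by (simp add: power2_eq_square)
  finally show ?thesis .
qed

lemma norm_angular: "norm (angular n x) \<le> 2 * norm x ^ n"
proof -
  have "norm (angular n x) \<le> norm (cis (- (real n * \<theta>0)) * zeta 1 x ^ n) + norm (cis (real n * \<theta>0) * zeta (- 1) x ^ n)"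
    unfolding angular_def by (rule norm_triangle_ineq)
  then show ?thesis by (simp add: norm_mult norm_power norm_zeta)
qed

lemma clifford_J_disk_bound: "x \<in> cball 0 R \<Longrightarrow> \<bar>clifford_J n (\<kappa> * (x \<bullet> x))\<bar> \<le> exp (\<kappa> * R\<^sup>2) / fact n"
proof -
  assume "x \<in> cball 0 R"
  then have "x \<bullet> x \<le> R\<^sup>2" by (simp add: power2_norm_eq_inner[symmetric] power_mono)
  then have "exp \<bar>\<kappa> * (x \<bullet> x)\<bar> \<le> exp (\<kappa> * R\<^sup>2)"
    using \<kappa>_pos by simp
  then show ?thesis
    using clifford_J_bound[of n "\<kappa> * (x \<bullet> x)"] by (meson divide_right_mono fact_ge_zero order_trans)
qed

text \<open>The bracket collects what a term and its derivative need: \<open>1\<close> for the term,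
  \<open>1 / R\<close> from differentiating the power of \<open>zeta\<close>,
  \<open>2 * \<kappa> * R\<close> from the radial factor. The second \<open>real n + 1\<close> pays
  for the exponent that differentiation brings down.\<close>

definition majorant :: "nat \<Rightarrow> real" where
  "majorant n = 2 * C * exp (\<kappa> * r0\<^sup>2) * exp (\<kappa> * R\<^sup>2) * (1 + 1 / R + 2 * \<kappa> * R) * ((real n + 1)\<^sup>2 * (r0 / R) ^ n)"

lemma summable_majorant: "summable majorant"
  unfolding majorant_def[abs_def] using R r0
  by (intro summable_mult summable_quadratic_power) auto

lemma majorant_ge:
  assumes "0 \<le> X" "X \<le> 2 * exp (\<kappa> * R\<^sup>2) / fact n * R ^ n * ((real n + 1) * (1 + 1 / R + 2 * \<kappa> * R))"
  shows "norm (coef n) * X \<le> majorant n"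
proof -
  have "norm (coef n) * X \<le> (C * exp (\<kappa> * r0\<^sup>2) * (real n + 1) * fact n * (r0 / R\<^sup>2) ^ n) *
     (2 * exp (\<kappa> * R\<^sup>2) / fact n * R ^ n * ((real n + 1) * (1 + 1 / R + 2 * \<kappa> * R)))"
    using assms C_nonneg r0 by (intro mult_mono coef_bound) auto
  also have "\<dots> = 2 * C * exp (\<kappa> * r0\<^sup>2) * exp (\<kappa> * R\<^sup>2) * (1 + 1 / R + 2 * \<kappa> * R) * ((real n + 1)\<^sup>2 * ((r0 / R\<^sup>2) ^ n * R ^ n))"
    by (simp add: power2_eq_square)
  also have "(r0 / R\<^sup>2) ^ n * R ^ n = (r0 / R) ^ n"
    using R by (simp add: power_mult_distrib[symmetric] power2_eq_square)
  finally show ?thesis by (simp only: majorant_def)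
qed

lemma trm_bound:
  assumes x: "x \<in> cball 0 R"
  shows "norm (trm n x) \<le> majorant n"
proof -
  have nx: "norm x \<le> R" using x by simp
  have "norm (angular n x * of_real (clifford_J n (\<kappa> * (x \<bullet> x)))) \<le> (2 * R ^ n) * (exp (\<kappa> * R\<^sup>2) / fact n)"
    unfolding norm_mult norm_of_real
    using norm_angular[of n x] power_mono[OF nx norm_ge_zero, of n] R
    by (intro mult_mono clifford_J_disk_bound[OF x]) auto
  also have "\<dots> = 2 * exp (\<kappa> * R\<^sup>2) / fact n * R ^ n * 1"
    by simp
  also have "\<dots> \<le> 2 * exp (\<kappa> * R\<^sup>2) / fact n * R ^ n * ((real n + 1) * (1 + 1 / R + 2 * \<kappa> * R))"
  proof (rule mult_left_mono)
    have "1 * 1 \<le> (real n + 1) * (1 + 1 / R + 2 * \<kappa> * R)"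
      using R \<kappa>_pos by (intro mult_mono) auto
    then show "1 \<le> (real n + 1) * (1 + 1 / R + 2 * \<kappa> * R)" by simp
  qed (use R in simp)
  finally show ?thesis
    unfolding trm_def norm_mult[of "coef n"] by (intro majorant_ge) auto
qed

lemma trm_deriv_apply:
  "blinfun_apply (trm_deriv n x) h = coef n * (
     (cis (- (real n * \<theta>0)) * (of_nat n * zeta 1 x ^ (n - 1) * zeta 1 h) + cis (real n * \<theta>0) * (of_nat n * zeta (- 1) x ^ (n - 1) * zeta (- 1) h))
       * of_real (clifford_J n (\<kappa> * (x \<bullet> x)))
     + angular n x * of_real (- clifford_J (Suc n) (\<kappa> * (x \<bullet> x)) * \<kappa> * (2 * (x \<bullet> h))))"
  by (simp add: trm_deriv_def blinfun.add_left bounded_linear_Blinfun_apply[OF bounded_linear_zeta] scaleR_conv_of_real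
      inner_commute algebra_simps)

lemma trm_has_derivative: "(trm n has_derivative blinfun_apply (trm_deriv n x)) (at x within S)"
proof -
  have J: "((\<lambda>x::real^2. complex_of_real (clifford_J n (\<kappa> * (x \<bullet> x)))) has_derivative
      (\<lambda>h. of_real (- clifford_J (Suc n) (\<kappa> * (x \<bullet> x)) * \<kappa> * (2 * (x \<bullet> h))))) (at x)"
  proof (rule radial_has_derivative)
    show "((\<lambda>t. clifford_J n (\<kappa> * t)) has_real_derivative - clifford_J (Suc n) (\<kappa> * t) * \<kappa>) (at t)" for t
      by (rule DERIV_chain2[where f = "clifford_J n" and g = "\<lambda>t. \<kappa> * t" and x = t, OF clifford_J_deriv])
        (auto intro!: derivative_eq_intros)
  qed
  have A: "(angular n has_derivative (\<lambda>h. cis (- (real n * \<theta>0)) * (of_nat n * zeta 1 x ^ (n - 1) * zeta 1 h)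
      + cis (real n * \<theta>0) * (of_nat n * zeta (- 1) x ^ (n - 1) * zeta (- 1) h))) (at x)"
    unfolding angular_def[abs_def] by (intro has_derivative_add has_derivative_mult_right zeta_power_has_derivative)
  have "(trm n has_derivative (\<lambda>h. coef n * (angular n x * of_real (- clifford_J (Suc n) (\<kappa> * (x \<bullet> x)) * \<kappa> * (2 * (x \<bullet> h)))
     + (cis (- (real n * \<theta>0)) * (of_nat n * zeta 1 x ^ (n - 1) * zeta 1 h)
      + cis (real n * \<theta>0) * (of_nat n * zeta (- 1) x ^ (n - 1) * zeta (- 1) h)) * of_real (clifford_J n (\<kappa> * (x \<bullet> x)))))) (at x)"
    unfolding trm_def[abs_def] by (intro has_derivative_mult_right has_derivative_mult A J)
  then have "(trm n has_derivative blinfun_apply (trm_deriv n x)) (at x)"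
    by (rule has_derivative_eq_rhs) (rule ext, simp only: trm_deriv_apply add.commute)
  then show ?thesis by (rule has_derivative_at_withinI)
qed

lemma trm_deriv_bound:
  assumes x: "x \<in> cball 0 R"
  shows "norm (trm_deriv n x) \<le> majorant n"
proof (rule norm_blinfun_bound)
  have nx: "norm x \<le> R" using x by simp
  let ?e = "exp (\<kappa> * R\<^sup>2) / fact n"
  have C: "\<bar>clifford_J (Suc n) (\<kappa> * (x \<bullet> x))\<bar> \<le> ?e"
  proof -
    have "exp (\<kappa> * R\<^sup>2) / fact (Suc n) \<le> ?e"
      by (intro divide_left_mono) (auto intro: fact_mono)
    then show ?thesis using clifford_J_disk_bound[OF x, of "Suc n"] by linarith
  qed
  \<comment> \<open>The exponent \<open>n - 1\<close> is truncated at \<open>n = 0\<close>, where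
    both sides vanish.\<close>
  have pw: "real n * norm x ^ (n - 1) \<le> real n * (R ^ n / R)"
  proof (cases n)
    case (Suc m)
    then show ?thesis
      using R power_mono[OF nx norm_ge_zero, of m] by (simp add: mult_left_mono)
  qed simp
  fix h :: "real^2"
  let ?X = "2 * (real n * (R ^ n / R)) * ?e + 2 * R ^ n * (?e * \<kappa> * (2 * R))"
  have "norm (blinfun_apply (trm_deriv n x) h) \<le> norm (coef n) * (?X * norm h)"
    unfolding trm_deriv_apply norm_mult[of "coef n"]
  proof (rule mult_left_mono)
    have 1: "norm (cis (- (real n * \<theta>0)) * (of_nat n * zeta 1 x ^ (n - 1) * zeta 1 h) + cis (real n * \<theta>0) * (of_nat n * zeta (- 1) x ^ (n - 1) * zeta (- 1) h))
       \<le> 2 * (real n * (R ^ n / R)) * norm h"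
    proof -
      have "norm (cis (- (real n * \<theta>0)) * (of_nat n * zeta 1 x ^ (n - 1) * zeta 1 h) + cis (real n * \<theta>0) * (of_nat n * zeta (- 1) x ^ (n - 1) * zeta (- 1) h))
        \<le> norm (cis (- (real n * \<theta>0)) * (of_nat n * zeta 1 x ^ (n - 1) * zeta 1 h)) + norm (cis (real n * \<theta>0) * (of_nat n * zeta (- 1) x ^ (n - 1) * zeta (- 1) h))"
        by (rule norm_triangle_ineq)
      also have "\<dots> = 2 * (real n * norm x ^ (n - 1)) * norm h"
        by (simp add: norm_mult norm_power norm_zeta)
      also have "\<dots> \<le> 2 * (real n * (R ^ n / R)) * norm h"
        by (rule mult_right_mono[OF mult_left_mono[OF pw]]) auto
      finally show ?thesis .
    qed
    have 2: "\<bar>- clifford_J (Suc n) (\<kappa> * (x \<bullet> x)) * \<kappa> * (2 * (x \<bullet> h))\<bar> \<le> ?e * \<kappa> * (2 * R) * norm h"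
    proof -
      have "\<bar>x \<bullet> h\<bar> \<le> R * norm h"
        using Cauchy_Schwarz_ineq2[of x h] mult_right_mono[OF nx norm_ge_zero, of h] by linarith
      then have "\<bar>clifford_J (Suc n) (\<kappa> * (x \<bullet> x))\<bar> * \<kappa> * (2 * \<bar>x \<bullet> h\<bar>) \<le> ?e * \<kappa> * (2 * (R * norm h))"
        using \<kappa>_pos C by (intro mult_mono) auto
      then show ?thesis using \<kappa>_pos by (simp add: abs_mult mult_ac)
    qed
    have "norm ((cis (- (real n * \<theta>0)) * (of_nat n * zeta 1 x ^ (n - 1) * zeta 1 h) + cis (real n * \<theta>0) * (of_nat n * zeta (- 1) x ^ (n - 1) * zeta (- 1) h))
       * of_real (clifford_J n (\<kappa> * (x \<bullet> x)))
     + angular n x * of_real (- clifford_J (Suc n) (\<kappa> * (x \<bullet> x)) * \<kappa> * (2 * (x \<bullet> h))))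
     \<le> (2 * (real n * (R ^ n / R)) * norm h) * ?e + (2 * R ^ n) * (?e * \<kappa> * (2 * R) * norm h)"
    proof (rule order_trans[OF norm_triangle_ineq add_mono])
      show "norm ((cis (- (real n * \<theta>0)) * (of_nat n * zeta 1 x ^ (n - 1) * zeta 1 h) + cis (real n * \<theta>0) * (of_nat n * zeta (- 1) x ^ (n - 1) * zeta (- 1) h))
       * of_real (clifford_J n (\<kappa> * (x \<bullet> x)))) \<le> (2 * (real n * (R ^ n / R)) * norm h) * ?e"
        unfolding norm_mult[of _ "of_real (clifford_J n (\<kappa> * (x \<bullet> x)))"] norm_of_real
        using R by (intro mult_mono 1 clifford_J_disk_bound[OF x]) auto
      show "norm (angular n x * of_real (- clifford_J (Suc n) (\<kappa> * (x \<bullet> x)) * \<kappa> * (2 * (x \<bullet> h)))) \<le> (2 * R ^ n) * (?e * \<kappa> * (2 * R) * norm h)"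
        unfolding norm_mult[of "angular n x"] norm_of_real
        using norm_angular[of n x] power_mono[OF nx norm_ge_zero, of n] R
        by (intro mult_mono 2) auto
    qed
    then show "norm ((cis (- (real n * \<theta>0)) * (of_nat n * zeta 1 x ^ (n - 1) * zeta 1 h) + cis (real n * \<theta>0) * (of_nat n * zeta (- 1) x ^ (n - 1) * zeta (- 1) h))
       * of_real (clifford_J n (\<kappa> * (x \<bullet> x)))
     + angular n x * of_real (- clifford_J (Suc n) (\<kappa> * (x \<bullet> x)) * \<kappa> * (2 * (x \<bullet> h)))) \<le> ?X * norm h"
      by (simp add: algebra_simps)
  qed simp
  also have "\<dots> = (norm (coef n) * ?X) * norm h" by simp
  also have "\<dots> \<le> majorant n * norm h"
  proof (intro mult_right_mono majorant_ge)
    show "0 \<le> ?X" using R \<kappa>_pos by (intro add_nonneg_nonneg mult_nonneg_nonneg) auto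
    have "?X = 2 * exp (\<kappa> * R\<^sup>2) / fact n * R ^ n * (real n * (1 / R) + 2 * \<kappa> * R)"
      using R by (simp add: field_simps)
    also have "\<dots> \<le> 2 * exp (\<kappa> * R\<^sup>2) / fact n * R ^ n * ((real n + 1) * (1 + 1 / R + 2 * \<kappa> * R))"
    proof (rule mult_left_mono)
      have "real n * (1 / R) + 1 * (2 * \<kappa> * R) \<le> (real n + 1) * (1 + 1 / R) + (real n + 1) * (2 * \<kappa> * R)"
        using R \<kappa>_pos by (intro add_mono mult_mono) auto
      then show "real n * (1 / R) + 2 * \<kappa> * R \<le> (real n + 1) * (1 + 1 / R + 2 * \<kappa> * R)"
        by (simp add: algebra_simps)
    qed (use R in simp)
    finally show "?X \<le> 2 * exp (\<kappa> * R\<^sup>2) / fact n * R ^ n * ((real n + 1) * (1 + 1 / R + 2 * \<kappa> * R))" .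
  qed auto
  finally show "norm (blinfun_apply (trm_deriv n x) h) \<le> majorant n * norm h" .
next
  show "0 \<le> majorant n"
    using trm_bound[of 0 n] R by (auto intro: order_trans[OF norm_ge_zero])
qed

lemma trm_deriv_continuous: "continuous_on S (trm_deriv n)"
proof -
  have J: "continuous_on S (\<lambda>x. clifford_J m (\<kappa> * (x \<bullet> x)))" for m
    by (rule continuous_on_compose2[of UNIV "clifford_J m"])
      (auto intro!: continuous_intros continuous_at_imp_continuous_on clifford_J_continuous)
  have Z: "continuous_on S (zeta s)" for s
    unfolding zeta_def[abs_def] by (intro continuous_intros)
  show ?thesis
    unfolding trm_deriv_def[abs_def] angular_def
    by (intro continuous_intros bounded_bilinear.continuous_on[OF bounded_bilinear_blinfun_compose]
        bounded_linear.continuous_on[OF bounded_linear_blinfun_scaleR_left]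
        bounded_linear.continuous_on[OF bounded_linear_blinfun_mult_right]
        bounded_linear.continuous_on[OF bounded_linear_blinfun_inner_left] J Z)
qed

lemma regular_C1:
  "continuous_on (cball 0 R) regular_deriv"
  "x \<in> cball 0 R \<Longrightarrow> (regular has_derivative blinfun_apply (regular_deriv x)) (at x within cball 0 R)"
  unfolding regular_def[abs_def] regular_deriv_def[abs_def]
  using series_C1[where S = "cball 0 R" and f = trm and Df = trm_deriv and M = majorant,
      OF convex_cball trm_has_derivative trm_deriv_continuous trm_bound trm_deriv_bound summable_majorant]
  by auto

lemma regular_uniform: "uniform_limit (cball 0 R) (\<lambda>N x. \<Sum>n<N. trm n x) regular sequentially"
  unfolding regular_def[abs_def] by (rule Weierstrass_m_test[OF trm_bound summable_majorant])

lemma trm_continuous: "continuous_on S (trm n)"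
  using has_derivative_continuous_on[OF trm_has_derivative] .

lemma angular_polar: "angular n (polar r \<theta>) = of_real (r ^ n) * (cis (real n * (\<theta> - \<theta>0)) + cis (- (real n * (\<theta> - \<theta>0))))"
proof -
  have "cis (- (real n * \<theta>0)) * cis (real n * \<theta>) = cis (real n * (\<theta> - \<theta>0))"
    "cis (real n * \<theta>0) * cis (- (real n * \<theta>)) = cis (- (real n * (\<theta> - \<theta>0)))"
    by (simp_all add: cis_mult algebra_simps)
  moreover have "a * (z * b) + c * (z * d) = z * (a * b + c * d)" for a b c d z :: complex
    by (simp add: algebra_simps)
  ultimately show ?thesis
    unfolding angular_def using zeta_polar[of 1 r \<theta> n] zeta_polar[of "-1" r \<theta> n] by simp
qed

text \<open>For \<open>n = 0\<close> both exponentials have frequency zero and contribute; the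
  resulting factor \<open>2\<close> is undone by the \<open>1 / 2\<close> in
  \<open>coef\<close>.\<close>

lemma circle_mean_trm:
  fixes m :: int
  shows "circle_mean (of_int m) (trm n) r = (if \<bar>m\<bar> = int n then
    of_real (2 * pi) * \<beta> n * of_real ((k * r0 / 2) ^ n * clifford_J n (\<kappa> * r0\<^sup>2)) * of_real ((k * r / 2) ^ n * clifford_J n (\<kappa> * r\<^sup>2)) * cis (of_int m * \<theta>0) else 0)"
proof -
  define c where "c = coef n * of_real (r ^ n * clifford_J n (\<kappa> * r\<^sup>2))"
  have ip: "polar r \<theta> \<bullet> polar r \<theta> = r\<^sup>2" for \<theta>
    by (simp add: power2_norm_eq_inner[symmetric])
  have "trm n (polar r \<theta>) * cis (of_int m * \<theta>) =
      (c * cis (- (real n * \<theta>0))) * cis (of_int (m + int n) * \<theta>) + (c * cis (real n * \<theta>0)) * cis (of_int (m - int n) * \<theta>)" for \<theta>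
  proof -
    have "cis (real n * (\<theta> - \<theta>0)) * cis (of_int m * \<theta>) = cis (- (real n * \<theta>0)) * cis (of_int (m + int n) * \<theta>)"
      "cis (- (real n * (\<theta> - \<theta>0))) * cis (of_int m * \<theta>) = cis (real n * \<theta>0) * cis (of_int (m - int n) * \<theta>)"
      by (simp_all add: cis_mult algebra_simps)
    moreover have "trm n (polar r \<theta>) * cis (of_int m * \<theta>) = c * (cis (real n * (\<theta> - \<theta>0)) * cis (of_int m * \<theta>))
       + c * (cis (- (real n * (\<theta> - \<theta>0))) * cis (of_int m * \<theta>))"
      unfolding trm_def angular_polar ip c_def by (simp add: algebra_simps)
    ultimately show ?thesis by (simp only: mult.assoc)
  qed
  moreover have i: "(\<lambda>\<theta>. a * cis (of_int j * \<theta>)) integrable_on {0..2 * pi}" for a and j :: int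
    by (intro integrable_continuous_real continuous_intros)
  ultimately have "circle_mean (of_int m) (trm n) r =
      (c * cis (- (real n * \<theta>0))) * (if m + int n = 0 then of_real (2 * pi) else 0)
      + (c * cis (real n * \<theta>0)) * (if m - int n = 0 then of_real (2 * pi) else 0)"
    unfolding circle_mean_def by (simp only: integral_add[OF i i] integral_mult_right integral_cis_int)
  also have "\<dots> = (if \<bar>m\<bar> = int n then (if n = 0 then 2 else 1) * (c * cis (of_int m * \<theta>0)) * of_real (2 * pi) else 0)"
  proof -
    consider "m = int n" "n = 0" | "m = int n" "n \<noteq> 0" | "m = - int n" "n \<noteq> 0" | "\<bar>m\<bar> \<noteq> int n" by linarith
    then show ?thesis by cases auto
  qed
  also have "(if n = 0 then 2 else 1) * (c * cis (of_int m * \<theta>0)) * of_real (2 * pi)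
     = of_real (2 * pi) * \<beta> n * of_real ((k * r0 / 2) ^ n * clifford_J n (\<kappa> * r0\<^sup>2)) * of_real ((k * r / 2) ^ n * clifford_J n (\<kappa> * r\<^sup>2)) * cis (of_int m * \<theta>0)"
    by (auto simp: c_def coef_def power_mult_distrib power_divide mult_ac)
  finally show ?thesis .
qed

text \<open>Uniform convergence on the closed disk permits termwise integration, and orthogonality
  leaves one term, so the integrals of the partial sums are constant as soon as they include order
  \<open>n\<close>.\<close>

lemma circle_mean_regular:
  fixes m :: int
  assumes r: "0 \<le> r" "r \<le> R"
  defines "n \<equiv> nat \<bar>m\<bar>"
  shows "circle_mean (of_int m) regular r =
    of_real (2 * pi) * \<beta> n * of_real ((k * r0 / 2) ^ n * clifford_J n (\<kappa> * r0\<^sup>2)) * of_real ((k * r / 2) ^ n * clifford_J n (\<kappa> * r\<^sup>2)) * cis (of_int m * \<theta>0)"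
proof -
  let ?v = "of_real (2 * pi) * \<beta> n * of_real ((k * r0 / 2) ^ n * clifford_J n (\<kappa> * r0\<^sup>2)) * of_real ((k * r / 2) ^ n * clifford_J n (\<kappa> * r\<^sup>2)) * cis (of_int m * \<theta>0)"
  have on_disk: "polar r \<theta> \<in> cball 0 R" for \<theta> using r by simp
  have "uniform_limit (cbox 0 (2 * pi)) (\<lambda>N \<theta>. (\<Sum>i<N. trm i (polar r \<theta>)) * cis (of_int m * \<theta>)) (\<lambda>\<theta>. regular (polar r \<theta>) * cis (of_int m * \<theta>)) sequentially"
  proof (rule uniform_limitI)
    fix e :: real assume "e > 0"
    from uniform_limitD[OF regular_uniform this]
    have "\<forall>\<^sub>F N in sequentially. \<forall>x\<in>cball 0 R. dist (\<Sum>n<N. trm n x) (regular x) < e" .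
    then show "\<forall>\<^sub>F N in sequentially. \<forall>\<theta>\<in>cbox 0 (2 * pi). dist ((\<Sum>i<N. trm i (polar r \<theta>)) * cis (of_int m * \<theta>)) (regular (polar r \<theta>) * cis (of_int m * \<theta>)) < e"
    proof eventually_elim
      case (elim N)
      show ?case
      proof
        fix \<theta>
        have "dist ((\<Sum>i<N. trm i (polar r \<theta>)) * cis (of_int m * \<theta>)) (regular (polar r \<theta>) * cis (of_int m * \<theta>)) = dist (\<Sum>i<N. trm i (polar r \<theta>)) (regular (polar r \<theta>))"
          unfolding dist_norm left_diff_distrib[symmetric] norm_mult by simp
        then show "dist ((\<Sum>i<N. trm i (polar r \<theta>)) * cis (of_int m * \<theta>)) (regular (polar r \<theta>) * cis (of_int m * \<theta>)) < e"
          using elim on_disk by simp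
      qed
    qed
  qed
  moreover have c: "continuous_on {0..2 * pi} (\<lambda>\<theta>. trm i (polar r \<theta>))" for i
    by (intro continuous_on_compose2[OF trm_continuous[of UNIV]] continuous_intros) auto
  have "continuous_on (cbox 0 (2 * pi)) (\<lambda>\<theta>. (\<Sum>i<N. trm i (polar r \<theta>)) * cis (of_int m * \<theta>))" for N
    using c by (intro continuous_intros) auto
  ultimately obtain I J where IJ: "\<And>N. ((\<lambda>\<theta>. (\<Sum>i<N. trm i (polar r \<theta>)) * cis (of_int m * \<theta>)) has_integral I N) (cbox 0 (2 * pi))"
    "((\<lambda>\<theta>. regular (polar r \<theta>) * cis (of_int m * \<theta>)) has_integral J) (cbox 0 (2 * pi))" "I \<longlonglongrightarrow> J"
    by (rule uniform_limit_integral_cbox) auto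
  have "I N = ?v" if "N > n" for N
  proof -
    have i: "(\<lambda>\<theta>. trm i (polar r \<theta>) * cis (of_int m * \<theta>)) integrable_on {0..2 * pi}" for i
      by (intro integrable_continuous_real continuous_intros c)
    have "I N = integral {0..2 * pi} (\<lambda>\<theta>. \<Sum>i<N. trm i (polar r \<theta>) * cis (of_int m * \<theta>))"
      using integral_unique[OF IJ(1)[of N]] by (simp add: sum_distrib_right)
    also have "\<dots> = (\<Sum>i<N. circle_mean (of_int m) (trm i) r)"
      unfolding circle_mean_def by (rule integral_sum) (auto intro: i)
    also have "\<dots> = (\<Sum>i<N. if i = n then ?v else 0)"
      unfolding circle_mean_trm by (rule sum.cong) (auto simp: n_def)
    also have "\<dots> = ?v"
      using that by simp
    finally show ?thesis .
  qed
  then have "I \<longlonglongrightarrow> ?v"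
    by (intro tendsto_eventually eventually_sequentiallyI[of "Suc n"]) auto
  with IJ(3) have "J = ?v"
    using LIMSEQ_unique by blast
  then show ?thesis
    using integral_unique[OF IJ(2)] by (simp add: circle_mean_def)
qed

end

subsection \<open>Robin traces\<close>

lemma bessel_J_has_derivative:
  assumes "x > 0"
  shows "(bessel_J n has_real_derivative of_int n / x * bessel_J n x - bessel_J (n + 1) x) (at x)"
proof -
  have "bessel_J m = cyl clifford_J m" for m
    by (rule ext) (rule bessel_J_eq)
  then show ?thesis
    using cyl_deriv[OF clifford_seq_J assms, of n] by simp
qed

lemma bessel_Y_has_derivative:
  assumes "x > 0"
  shows "(bessel_Y n has_real_derivative of_int n / x * bessel_Y n x - bessel_Y (n + 1) x) (at x)"
proof (rule has_field_derivative_transform_within_open[where S = "{0<..}"])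
  show "(cyl clifford_Y n has_real_derivative of_int n / x * bessel_Y n x - bessel_Y (n + 1) x) (at x)"
    using cyl_deriv[OF clifford_seq_Y assms, of n] by (simp add: bessel_Y_eq assms)
qed (use assms in \<open>auto simp: bessel_Y_eq\<close>)

lemma hankel1_eq: "hankel1 n x = of_real (bessel_J n x) + \<i> * of_real (bessel_Y n x)"
  by (simp add: hankel1_def Complex_eq)

lemma scaled_has_vector_derivative:
  assumes "k > 0" "r > 0"
    and "(f has_real_derivative of_int n / (k * r) * f (k * r) - g (k * r)) (at (k * r))"
  shows "((\<lambda>r. complex_of_real (f (k * r))) has_vector_derivative
    of_real (of_int n / r * f (k * r) - k * g (k * r))) (at r)"
proof -
  have "((\<lambda>r. f (k * r)) has_real_derivative (of_int n / (k * r) * f (k * r) - g (k * r)) * k) (at r)"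
    by (rule DERIV_chain2[where g = "\<lambda>r. k * r" and x = r, OF assms(3)]) (auto intro!: derivative_eq_intros)
  moreover have "(of_int n / (k * r) * f (k * r) - g (k * r)) * k = of_int n / r * f (k * r) - k * g (k * r)"
    using assms(1,2) by (simp add: field_simps)
  ultimately have "((\<lambda>r. f (k * r)) has_vector_derivative of_int n / r * f (k * r) - k * g (k * r)) (at r)"
    by (simp add: has_real_derivative_iff_has_vector_derivative)
  from bounded_linear.has_vector_derivative[OF bounded_linear_of_real this] show ?thesis .
qed

lemma bessel_J_has_vector_derivative:
  assumes "k > 0" "r > 0"
  shows "((\<lambda>r. complex_of_real (bessel_J n (k * r))) has_vector_derivative
    of_real (of_int n / r * bessel_J n (k * r) - k * bessel_J (n + 1) (k * r))) (at r)"
  using assms by (intro scaled_has_vector_derivative bessel_J_has_derivative) auto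

lemma hankel1_has_vector_derivative:
  assumes "k > 0" "r > 0"
  shows "((\<lambda>r. hankel1 n (k * r)) has_vector_derivative
    of_real (of_int n / r) * hankel1 n (k * r) - of_real k * hankel1 (n + 1) (k * r)) (at r)"
proof -
  have "((\<lambda>r. complex_of_real (bessel_Y n (k * r))) has_vector_derivative
    of_real (of_int n / r * bessel_Y n (k * r) - k * bessel_Y (n + 1) (k * r))) (at r)"
    using assms by (intro scaled_has_vector_derivative bessel_Y_has_derivative) auto
  from has_vector_derivative_add[OF bessel_J_has_vector_derivative[OF assms, of n] has_vector_derivative_mult_right[OF this, of \<i>]]
  show ?thesis
    by (simp add: hankel1_eq algebra_simps)
qed

lemma robin_trace_bessel_J:
  assumes "k > 0" "R > 0"
  shows "robin_trace \<alpha> R (\<lambda>r. of_real (bessel_J n (k * r)))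
    = of_real ((\<alpha> + of_int n / R) * bessel_J n (k * R) - k * bessel_J (n + 1) (k * R))"
  unfolding robin_trace_def vector_derivative_at[OF bessel_J_has_vector_derivative[OF assms, of n]]
  by (simp add: algebra_simps)

lemma robin_trace_hankel1:
  assumes "k > 0" "R > 0"
  shows "robin_trace \<alpha> R (\<lambda>r. hankel1 n (k * r))
    = of_real (\<alpha> + of_int n / R) * hankel1 n (k * R) - of_real k * hankel1 (n + 1) (k * R)"
  unfolding robin_trace_def vector_derivative_at[OF hankel1_has_vector_derivative[OF assms, of n]]
  by (simp add: algebra_simps)

lemma bessel_J_uminus: "bessel_J (- int n) x = (- 1) ^ n * bessel_J (int n) x"
  by (simp add: bessel_J_def)

lemma hankel1_uminus: "hankel1 (- int n) x = (- 1) ^ n * hankel1 (int n) x"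
  by (simp add: hankel1_eq bessel_J_uminus) (simp add: bessel_Y_def algebra_simps)

lemma robin_trace_mult_left:
  assumes "(f has_vector_derivative f') (at R)"
  shows "robin_trace \<alpha> R (\<lambda>r. c * f r) = c * robin_trace \<alpha> R f"
  unfolding robin_trace_def vector_derivative_at[OF assms]
    vector_derivative_at[OF has_vector_derivative_mult_right[OF assms, of c]]
  by (simp add: algebra_simps)

text \<open>The sign is common to both kinds, so the ratio of the traces depends only on the
  absolute value of the order.\<close>

lemma robin_trace_uminus:
  assumes "k > 0" "R > 0"
  shows "robin_trace \<alpha> R (\<lambda>r. of_real (bessel_J (- int n) (k * r))) = (- 1) ^ n * robin_trace \<alpha> R (\<lambda>r. of_real (bessel_J (int n) (k * r)))"
    and "robin_trace \<alpha> R (\<lambda>r. hankel1 (- int n) (k * r)) = (- 1) ^ n * robin_trace \<alpha> R (\<lambda>r. hankel1 (int n) (k * r))"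
  using robin_trace_mult_left[OF bessel_J_has_vector_derivative[OF assms, of "int n"], of \<alpha> "(- 1) ^ n"]
    robin_trace_mult_left[OF hankel1_has_vector_derivative[OF assms, of "int n"], of \<alpha> "(- 1) ^ n"]
  by (simp_all add: bessel_J_uminus hankel1_uminus)

text \<open>The Robin trace of order \<open>n\<close> without its factor
  \<open>(k * R / 2) ^ n\<close>. Here \<open>T = (k * R)\<^sup>2 / 4\<close>, so that
  \<open>k * (k * R / 2) = 2 / R * T\<close>.\<close>

definition clifford_trace :: "real \<Rightarrow> real \<Rightarrow> (nat \<Rightarrow> real \<Rightarrow> real) \<Rightarrow> nat \<Rightarrow> real \<Rightarrow> real" where
  "clifford_trace \<alpha> R z n T = (\<alpha> + real n / R) * z n T - 2 / R * T * z (Suc n) T"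

lemma cyl_nat: "cyl z (int n) x = (x / 2) ^ n * z n (x\<^sup>2 / 4)"
  by (simp add: cyl_def)

lemma cyl_nat_Suc: "cyl z (int n + 1) x = (x / 2) ^ Suc n * z (Suc n) (x\<^sup>2 / 4)"
  using cyl_nat[of z "Suc n" x] by (simp add: add.commute)

lemma cyl_trace:
  assumes "R > 0"
  shows "(\<alpha> + of_int (int n) / R) * cyl z (int n) (k * R) - k * cyl z (int n + 1) (k * R)
    = (k * R / 2) ^ n * clifford_trace \<alpha> R z n ((k * R)\<^sup>2 / 4)"
  unfolding cyl_nat cyl_nat_Suc clifford_trace_def
  using assms by (simp add: field_simps power2_eq_square)

text \<open>The factor \<open>(k * R / 2) ^ n\<close> cancels in the quotient, and the real part
  \<open>J\<close> of the Hankel function splits off the \<open>1\<close>.\<close>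

lemma robin_trace_ratio:
  assumes "k > 0" "R > 0" "clifford_trace \<alpha> R clifford_J n ((k * R)\<^sup>2 / 4) \<noteq> 0"
  shows "robin_trace \<alpha> R (\<lambda>r. hankel1 (int n) (k * r)) / robin_trace \<alpha> R (\<lambda>r. of_real (bessel_J (int n) (k * r)))
    = 1 + \<i> * of_real (clifford_trace \<alpha> R clifford_Y n ((k * R)\<^sup>2 / 4) / clifford_trace \<alpha> R clifford_J n ((k * R)\<^sup>2 / 4))"
proof -
  let ?a = "(k * R / 2) ^ n" and ?J = "clifford_trace \<alpha> R clifford_J n ((k * R)\<^sup>2 / 4)" and ?Y = "clifford_trace \<alpha> R clifford_Y n ((k * R)\<^sup>2 / 4)"
  have kR: "k * R > 0" using assms by simp
  have Y: "(\<alpha> + of_int (int n) / R) * bessel_Y (int n) (k * R) - k * bessel_Y (int n + 1) (k * R) = ?a * ?Y"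
    unfolding bessel_Y_eq[OF kR] cyl_trace[OF assms(2)] ..
  have J': "(\<alpha> + of_int (int n) / R) * bessel_J (int n) (k * R) - k * bessel_J (int n + 1) (k * R) = ?a * ?J"
    unfolding bessel_J_eq cyl_trace[OF assms(2)] ..
  have J: "robin_trace \<alpha> R (\<lambda>r. of_real (bessel_J (int n) (k * r))) = of_real (?a * ?J)"
    unfolding robin_trace_bessel_J[OF assms(1,2)] J' ..
  have "robin_trace \<alpha> R (\<lambda>r. hankel1 (int n) (k * r)) =
      of_real ((\<alpha> + of_int (int n) / R) * bessel_J (int n) (k * R) - k * bessel_J (int n + 1) (k * R))
      + \<i> * of_real ((\<alpha> + of_int (int n) / R) * bessel_Y (int n) (k * R) - k * bessel_Y (int n + 1) (k * R))"
    unfolding robin_trace_hankel1[OF assms(1,2)] unfolding hankel1_eq by (simp add: algebra_simps)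
  then have H: "robin_trace \<alpha> R (\<lambda>r. hankel1 (int n) (k * r)) = of_real (?a * ?J) + \<i> * of_real (?a * ?Y)"
    unfolding Y J' .
  show ?thesis
  proof -
    have "(of_real (a * j) + \<i> * of_real (a * y)) / of_real (a * j) = 1 + \<i> * of_real (y / j)"
      if "a \<noteq> 0" "j \<noteq> 0" for a j y :: real
      using that by (simp add: field_simps)
    from this[of ?a ?J ?Y] show ?thesis
      unfolding H J using assms(3) kR by fastforce
  qed
qed

section \<open>Growth of the ratio of Robin traces\<close>

lemma power_le_exp_fact: "(T::real) \<ge> 0 \<Longrightarrow> T ^ n \<le> exp T * fact n"
proof -
  assume T: "T \<ge> 0"
  have s: "(\<lambda>n. T ^ n /\<^sub>R fact n) sums exp T" by (rule exp_converges)
  have "T ^ n /\<^sub>R fact n \<le> (\<Sum>n. T ^ n /\<^sub>R fact n)"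
    using sum_le_suminf[OF sums_summable[OF s], of "{n}"] T by simp
  then show ?thesis
    unfolding sums_unique[OF s, symmetric] by (simp add: field_simps)
qed

lemma clifford_P_bound:
  assumes "T > 0"
  shows "0 \<le> clifford_P n T" "clifford_P n T \<le> exp T * fact n / T ^ n"
proof -
  show "0 \<le> clifford_P n T"
    unfolding clifford_P_def using assms by (intro sum_nonneg) auto
  have s: "(\<lambda>n. T ^ n /\<^sub>R fact n) sums exp T" by (rule exp_converges)
  have "clifford_P n T \<le> (\<Sum>p<n. (fact n / T ^ n) * (T ^ p /\<^sub>R fact p))"
    unfolding clifford_P_def
  proof (rule sum_mono)
    fix p assume "p \<in> {..<n}"
    have "fact (n - 1 - p) * (T ^ p / (fact p * T ^ n)) \<le> fact n * (T ^ p / (fact p * T ^ n))"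
      using assms by (intro mult_right_mono fact_mono) auto
    then show "fact (n - 1 - p) / fact p * T ^ p / T ^ n \<le> (fact n / T ^ n) * (T ^ p /\<^sub>R fact p)"
      by (simp add: field_simps)
  qed
  also have "\<dots> = (fact n / T ^ n) * (\<Sum>p<n. T ^ p /\<^sub>R fact p)"
    by (simp only: sum_distrib_left)
  also have "\<dots> \<le> (fact n / T ^ n) * exp T"
    using sum_le_suminf[OF sums_summable[OF s], of "{..<n}"] assms sums_unique[OF s]
    by (intro mult_left_mono) auto
  finally show "clifford_P n T \<le> exp T * fact n / T ^ n" by (simp add: mult.commute)
qed

text \<open>\<open>?F\<close> bounds \<open>clifford_P\<close>. By
  \<open>T ^ n \<le> exp T * fact n\<close> it is at least \<open>1\<close> and therefore absorbs
  the two other parts, which stay bounded in \<open>n\<close>.\<close>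

lemma clifford_Y_bound:
  assumes "T > 0"
  shows "\<bar>clifford_Y n T\<bar> \<le> (\<bar>ln T + 2 * euler_mascheroni\<bar> * exp T + 1 + 2 * exp T) * (exp T * fact n / T ^ n)"
proof -
  let ?L = "\<bar>ln T + 2 * euler_mascheroni\<bar>" and ?F = "exp T * fact n / T ^ n"
  have F: "1 \<le> ?F"
    using power_le_exp_fact[of T n] assms by simp
  have J: "\<bar>clifford_J n T\<bar> \<le> exp T * ?F"
  proof -
    have "exp T / fact n \<le> exp T * 1"
      by (simp add: field_simps)
    also have "\<dots> \<le> exp T * ?F" using F by (intro mult_left_mono) auto
    finally show ?thesis using clifford_J_bound[of n T] assms by simp
  qed
  have H: "\<bar>clifford_H n T\<bar> \<le> 2 * exp T * ?F"
    using clifford_H_bound[of n T] mult_left_mono[OF F, of "2 * exp T"] assms by simp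
  have "\<bar>clifford_Y n T\<bar> \<le> \<bar>(ln T + 2 * euler_mascheroni) * clifford_J n T - clifford_P n T - clifford_H n T\<bar> / 1"
    unfolding clifford_Y_def abs_divide using pi_gt3 by (intro divide_left_mono) auto
  also have "\<dots> \<le> ?L * \<bar>clifford_J n T\<bar> + \<bar>clifford_P n T\<bar> + \<bar>clifford_H n T\<bar>"
  proof -
    have "\<bar>a - b - c\<bar> / 1 \<le> \<bar>a\<bar> + \<bar>b\<bar> + \<bar>c\<bar>" for a b c :: real unfolding div_by_1 by linarith
    then show ?thesis unfolding abs_mult[symmetric] .
  qed
  also have "\<dots> \<le> ?L * (exp T * ?F) + ?F + 2 * exp T * ?F"
    using clifford_P_bound[OF assms, of n] J H by (intro add_mono mult_left_mono) auto
  also have "\<dots> = (?L * exp T + 1 + 2 * exp T) * ?F"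
    by (simp add: algebra_simps)
  finally show ?thesis .
qed

text \<open>Mean value theorem between \<open>0\<close> and \<open>T\<close>, starting from
  \<open>fact n * clifford_J n 0 = 1\<close>; the derivative has order \<open>n + 1\<close>, and its
  bound gains the factor \<open>1 / (n + 1)\<close>.\<close>

lemma clifford_J_close:
  assumes "T > 0"
  shows "\<bar>fact n * clifford_J n T - 1\<bar> \<le> T * exp T / (real n + 1)"
proof -
  obtain z where z: "0 < z" "z < T" "clifford_J n T - clifford_J n 0 = (T - 0) * (- clifford_J (Suc n) z)"
    using MVT2[OF assms, of "clifford_J n" "\<lambda>t. - clifford_J (Suc n) t"] clifford_J_deriv by blast
  have "\<bar>clifford_J (Suc n) z\<bar> \<le> exp T / fact (Suc n)"
  proof -
    have "exp \<bar>z\<bar> / fact (Suc n) \<le> exp T / fact (Suc n)"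
      using z by (intro divide_right_mono) auto
    then show ?thesis using clifford_J_bound[of "Suc n" z] by linarith
  qed
  then have "fact n * (T * \<bar>clifford_J (Suc n) z\<bar>) \<le> fact n * (T * (exp T / fact (Suc n)))"
    using assms by (intro mult_left_mono) auto
  also have "\<dots> = T * exp T / (real n + 1)"
  proof -
    have "f * (T * (E / (q * f))) = T * E / q" if "f \<noteq> 0" for f q E :: real
      using that by (cases "q = 0") (simp_all add: field_simps)
    then show ?thesis by (simp add: add.commute)
  qed
  finally have "fact n * (T * \<bar>clifford_J (Suc n) z\<bar>) \<le> T * exp T / (real n + 1)" .
  moreover have "fact n * clifford_J n T - 1 = - (fact n * (T * clifford_J (Suc n) z))"
  proof -
    have "clifford_J n T = 1 / fact n - T * clifford_J (Suc n) z"
      using z(3) by (simp add: clifford_J_0)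
    then show ?thesis by (simp add: right_diff_distrib)
  qed
  ultimately show ?thesis
    using assms by (simp add: abs_mult)
qed

text \<open>For large \<open>n\<close> the part with \<open>real n / R\<close>, where
  \<open>fact n * clifford_J n T\<close> is close to \<open>1\<close>, outweighs the other one, so
  \<open>fact n\<close> times the trace is at least \<open>1\<close>. The finitely many remaining
  orders only enlarge \<open>K\<close>.\<close>

lemma clifford_trace_J_lower:
  assumes "T > 0" "R > 0" "\<alpha> > 0" and nz: "\<And>n. clifford_trace \<alpha> R clifford_J n T \<noteq> 0"
  obtains K where "\<And>n. \<bar>1 / clifford_trace \<alpha> R clifford_J n T\<bar> \<le> K * fact n" "K > 0"
proof -
  let ?f = "\<lambda>n. 1 / (fact n * clifford_trace \<alpha> R clifford_J n T)"
  have ev: "\<forall>\<^sub>F n in sequentially. norm (?f n) \<le> 1"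
  proof -
    \<comment> \<open>The first threshold gives \<open>fact n * clifford_J n T \<ge> 1 / 2\<close>;
      the second makes \<open>real n / (2 * R)\<close> exceed the bound of the subtracted part by
      \<open>1\<close>.\<close>
    have "\<forall>\<^sub>F n in sequentially. real n \<ge> max (2 * T * exp T) (2 * R * (1 + 2 / R * T * exp T))"
      using filterlim_real_sequentially unfolding filterlim_at_top by (rule spec)
    then show ?thesis
    proof eventually_elim
      case (elim n)
      have "T * exp T / (real n + 1) \<le> 1 / 2"
        using elim by (simp add: field_simps)
      then have 1: "fact n * clifford_J n T \<ge> 1 / 2"
        using clifford_J_close[OF assms(1), of n] by linarith
      have 2: "fact n * \<bar>clifford_J (Suc n) T\<bar> \<le> exp T"
      proof -
        have "fact n * \<bar>clifford_J (Suc n) T\<bar> \<le> fact n * (exp T / fact (Suc n))"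
          using clifford_J_bound[of "Suc n" T] assms by (intro mult_left_mono) auto
        also have "\<dots> \<le> fact (Suc n) * (exp T / fact (Suc n))"
          by (intro mult_right_mono fact_mono) (auto simp del: fact_Suc)
        also have "\<dots> = exp T" by (simp del: fact_Suc)
        finally show ?thesis .
      qed
      have "1 + 2 / R * T * exp T \<le> (real n / R) * (1 / 2)"
        using elim assms by (simp add: field_simps)
      also have "\<dots> \<le> (\<alpha> + real n / R) * (fact n * clifford_J n T)"
        using 1 assms by (intro mult_mono) auto
      finally have 3: "1 + 2 / R * T * exp T \<le> (\<alpha> + real n / R) * (fact n * clifford_J n T)" .
      have "2 / R * T * (fact n * clifford_J (Suc n) T) \<le> 2 / R * T * exp T"
        using 2 assms abs_ge_self[of "clifford_J (Suc n) T"]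
        by (intro mult_left_mono) (auto intro: order_trans[OF mult_left_mono])
      with 3 have "1 \<le> (\<alpha> + real n / R) * (fact n * clifford_J n T) - 2 / R * T * (fact n * clifford_J (Suc n) T)"
        by linarith
      also have "\<dots> = fact n * clifford_trace \<alpha> R clifford_J n T"
        unfolding clifford_trace_def by (simp add: algebra_simps)
      finally have "1 \<le> fact n * clifford_trace \<alpha> R clifford_J n T" .
      then show ?case by (simp add: divide_le_eq)
    qed
  qed
  have "Bseq ?f" by (rule BfunI[OF ev])
  then obtain K where K: "K > 0" "\<forall>n. norm (?f n) \<le> K" by (rule BseqE)
  have "\<bar>1 / clifford_trace \<alpha> R clifford_J n T\<bar> \<le> K * fact n" for n
  proof -
    have "\<bar>1 / clifford_trace \<alpha> R clifford_J n T\<bar> = norm (?f n) * fact n"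
      by (simp add: abs_mult)
    also have "\<dots> \<le> K * fact n" using K(2) by (intro mult_right_mono) auto
    finally show ?thesis .
  qed
  then show thesis using that K(1) by blast
qed

text \<open>One factorial and the power of \<open>T\<close> come from \<open>clifford_Y\<close>, the
  other factorial from the reciprocal trace of \<open>clifford_J\<close>. The factor
  \<open>real n + 1\<close> comes from \<open>real n / R\<close> in the Robin operator and from the
  step to \<open>fact (Suc n)\<close>.\<close>

lemma clifford_trace_ratio_bound:
  assumes "T > 0" "R > 0" "\<alpha> > 0" and nz: "\<And>n. clifford_trace \<alpha> R clifford_J n T \<noteq> 0"
  obtains C where "\<And>n. norm (1 + \<i> * of_real (clifford_trace \<alpha> R clifford_Y n T / clifford_trace \<alpha> R clifford_J n T))
    \<le> C * (real n + 1) * (fact n)\<^sup>2 / T ^ n"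
proof -
  obtain K where K: "\<And>n. \<bar>1 / clifford_trace \<alpha> R clifford_J n T\<bar> \<le> K * fact n" "K > 0"
    using clifford_trace_J_lower[OF assms] by blast
  define M where "M = (\<bar>ln T + 2 * euler_mascheroni\<bar> * exp T + 1 + 2 * exp T) * exp T"
  have M: "M > 0" "\<bar>clifford_Y n T\<bar> \<le> M * fact n / T ^ n" for n
    using clifford_Y_bound[OF assms(1), of n] unfolding M_def
    by (auto simp only: mult.assoc times_divide_eq_right intro!: mult_pos_pos add_nonneg_pos) auto
  have Y: "\<bar>clifford_trace \<alpha> R clifford_Y n T\<bar> \<le> M * (\<alpha> + 3 / R) * (real n + 1) * fact n / T ^ n" for n
  proof -
    let ?F = "M * fact n / T ^ n"
    have F: "?F \<ge> 0" using M assms by simp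
    have "\<bar>clifford_trace \<alpha> R clifford_Y n T\<bar> \<le> (\<alpha> + real n / R) * \<bar>clifford_Y n T\<bar> + 2 / R * T * \<bar>clifford_Y (Suc n) T\<bar>"
      unfolding clifford_trace_def using assms
      by (intro order_trans[OF abs_triangle_ineq4]) (simp add: abs_mult)
    also have "\<dots> \<le> (\<alpha> + real n / R) * ?F + 2 / R * T * (M * fact (Suc n) / T ^ Suc n)"
      using assms by (intro add_mono mult_left_mono M) auto
    also have "2 / R * T * (M * fact (Suc n) / T ^ Suc n) = (2 / R * (real n + 1)) * ?F"
      using assms by (simp add: field_simps)
    also have "(\<alpha> + real n / R) * ?F + (2 / R * (real n + 1)) * ?F = (\<alpha> + real n / R + 2 / R * (real n + 1)) * ?F"
      by (simp only: distrib_right)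
    also have "\<dots> \<le> ((\<alpha> + 3 / R) * (real n + 1)) * ?F"
    proof (rule mult_right_mono[OF _ F])
      have "(\<alpha> + 3 / R) * (real n + 1) - (\<alpha> + real n / R + 2 / R * (real n + 1)) = \<alpha> * real n + 1 / R"
        using assms by (simp add: field_simps)
      also have "\<dots> \<ge> 0" using assms by simp
      finally show "\<alpha> + real n / R + 2 / R * (real n + 1) \<le> (\<alpha> + 3 / R) * (real n + 1)" by simp
    qed
    finally show ?thesis by (simp add: mult_ac)
  qed
  show thesis
  proof (rule that)
    fix n
    let ?q = "clifford_trace \<alpha> R clifford_Y n T / clifford_trace \<alpha> R clifford_J n T"
    let ?F = "(real n + 1) * (fact n)\<^sup>2 / T ^ n"
    have q: "\<bar>?q\<bar> \<le> (M * (\<alpha> + 3 / R) * K) * ?F"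
    proof -
      have "\<bar>?q\<bar> = \<bar>clifford_trace \<alpha> R clifford_Y n T\<bar> * \<bar>1 / clifford_trace \<alpha> R clifford_J n T\<bar>"
        by (simp add: abs_mult)
      also have "\<dots> \<le> (M * (\<alpha> + 3 / R) * (real n + 1) * fact n / T ^ n) * (K * fact n)"
        using M assms by (intro mult_mono Y K) auto
      finally show ?thesis by (simp add: power2_eq_square mult_ac)
    qed
    \<comment> \<open>The real summand \<open>1\<close> is absorbed as well, again by
      \<open>T ^ n \<le> exp T * fact n\<close>.\<close>
    have one: "1 \<le> exp T * ?F"
    proof -
      have "1 * T ^ n \<le> ((real n + 1) * fact n) * (exp T * fact n)"
        using power_le_exp_fact[of T n] assms fact_ge_1[of n, where 'a = real]
        by (intro mult_mono) (auto intro: order_trans[OF _ mult_mono[of 1 _ 1]])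
      then show ?thesis using assms by (simp add: power2_eq_square field_simps)
    qed
    have "norm (1 + \<i> * of_real ?q) \<le> norm (1::complex) + norm (\<i> * of_real ?q)"
      by (rule norm_triangle_ineq)
    also have "\<dots> = 1 + \<bar>?q\<bar>"
      unfolding norm_mult norm_of_real by simp
    also have "\<dots> \<le> exp T * ?F + (M * (\<alpha> + 3 / R) * K) * ?F"
      by (rule add_mono[OF one q])
    also have "\<dots> = (exp T + M * (\<alpha> + 3 / R) * K) * ?F"
      by (simp only: distrib_right)
    also have "\<dots> = (exp T + M * (\<alpha> + 3 / R) * K) * (real n + 1) * (fact n)\<^sup>2 / T ^ n"
      by (simp only: mult.assoc times_divide_eq_right)
    finally show "norm (1 + \<i> * of_real ?q) \<le> (exp T + M * (\<alpha> + 3 / R) * K) * (real n + 1) * (fact n)\<^sup>2 / T ^ n" .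
  qed
qed

subsection \<open>Local integrability\<close>

lemma continuous_absolutely_integrable_compact:
  fixes f :: "'a::euclidean_space \<Rightarrow> complex"
  assumes K: "compact K" and f: "continuous_on K f" and g: "g absolutely_integrable_on K"
  shows "(\<lambda>x. g x * f x) absolutely_integrable_on K"
proof -
  have Ks: "K \<in> sets lebesgue"
    using lmeasurable_compact[OF K] by (rule fmeasurableD)
  have bl: "bilinear (\<lambda>a b :: complex. a * b)"
    using bilinear_conv_bounded_bilinear bounded_bilinear_mult by blast
  have "(\<lambda>x. f x * g x) absolutely_integrable_on K"
    by (rule absolutely_integrable_bounded_measurable_product[OF bl continuous_imp_measurable_on_sets_lebesgue[OF f Ks] Ks
          compact_imp_bounded[OF compact_continuous_image[OF f K]] g])
  then show ?thesis by (simp only: mult.commute)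
qed

lemma continuous_locally_integrable:
  fixes f :: "real^2 \<Rightarrow> complex"
  assumes "continuous_on \<Omega> f"
  shows "f locally_integrable_on \<Omega>"
  unfolding locally_integrable_on_def
proof (intro allI impI)
  fix K assume K: "compact K \<and> K \<subseteq> \<Omega>"
  have "(\<lambda>x. 1 * f x) absolutely_integrable_on K"
    by (rule continuous_absolutely_integrable_compact)
      (use K lmeasurable_compact[of K] in \<open>auto intro: continuous_on_subset[OF assms] absolutely_integrable_on_const\<close>)
  then show "f absolutely_integrable_on K" by simp
qed

lemma laplacian_continuous:
  fixes \<phi> :: "real^2 \<Rightarrow> complex"
  assumes "smooth \<phi>"
  shows "continuous_on S (laplacian \<phi>)"
proof -
  have "continuous_on S (partial_deriv i (partial_deriv i \<phi>))" for i
    by (rule smooth_continuous[OF smooth_partial_deriv[OF smooth_partial_deriv[OF assms]]])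
  then have "continuous_on S (\<lambda>x. \<Sum>i\<in>UNIV. partial_deriv i (partial_deriv i \<phi>) x)"
    by (rule continuous_on_sum)
  then show ?thesis
    unfolding laplacian_def[abs_def] .
qed

lemma laplacian_vanish:
  fixes \<phi> :: "real^2 \<Rightarrow> complex"
  assumes "x \<notin> closure {x. \<phi> x \<noteq> 0}"
  shows "\<phi> x = 0" "laplacian \<phi> x = 0"
proof -
  let ?U = "- closure {x. \<phi> x \<noteq> 0}"
  have U: "open ?U" by (intro open_Compl closed_closure)
  have z: "\<phi> y = 0" if "y \<in> ?U" for y
    using that closure_subset[of "{x. \<phi> x \<noteq> 0}"] by blast
  show "\<phi> x = 0" by (rule z[OF iffD2[OF Compl_iff assms]])
  have 1: "partial_deriv i \<phi> y = 0" if "y \<in> ?U" for i y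
    by (rule partial_deriv_vanish[OF U z that])
  have "partial_deriv i (partial_deriv i \<phi>) x = 0" for i
    by (rule partial_deriv_vanish[OF U 1 iffD2[OF Compl_iff assms]])
  then show "laplacian \<phi> x = 0"
    by (simp add: laplacian_def)
qed

text \<open>The Lebesgue integral of a non-integrable function is \<open>0\<close> by convention, so
  weak equations may be subtracted only after integrability is known. It follows from local
  integrability because the other factor is continuous with compact support.\<close>

lemma weak_integrand_integrable:
  fixes u :: "real^2 \<Rightarrow> complex"
  assumes u: "u locally_integrable_on \<Omega>" and \<phi>: "test_function \<Omega> \<phi>"
  shows "(\<lambda>x. u x * (laplacian \<phi> x + c * \<phi> x)) absolutely_integrable_on \<Omega>"
proof -
  let ?K = "closure {x. \<phi> x \<noteq> 0}"
  have K: "compact ?K" "?K \<subseteq> \<Omega>" and s: "smooth \<phi>"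
    using \<phi> by (auto simp: test_function_def)
  have "(\<lambda>x. u x * (laplacian \<phi> x + c * \<phi> x)) absolutely_integrable_on ?K"
  proof (rule continuous_absolutely_integrable_compact[OF K(1)])
    show "continuous_on ?K (\<lambda>x. laplacian \<phi> x + c * \<phi> x)"
      using laplacian_continuous[OF s] smooth_continuous[OF s] by (intro continuous_on_add continuous_on_mult_left)
    show "u absolutely_integrable_on ?K"
      using u K by (simp add: locally_integrable_on_def)
  qed
  then show ?thesis
  proof (rule absolutely_integrable_extend_zero(1)[OF _ K(2) negligible_empty])
    fix x assume "x \<in> \<Omega> - ?K - {}"
    then have "x \<notin> ?K" by (elim DiffE)
    from laplacian_vanish[OF this] show "u x * (laplacian \<phi> x + c * \<phi> x) = 0"
      by (simp only: mult_zero_right add_0_right)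
  qed
qed

context regular_part
begin

subsection \<open>The series over the integers\<close>

lemma bessel_J_nat_scaled: "bessel_J (int n) (k * r) = (k * r / 2) ^ n * clifford_J n (\<kappa> * r\<^sup>2)"
proof -
  have "(k * r)\<^sup>2 / 4 = \<kappa> * r\<^sup>2" by (simp add: \<kappa>_def power_mult_distrib)
  then show ?thesis by (simp add: bessel_J_eq cyl_nat)
qed

lemma trm_polar:
  "trm n (polar r \<theta>) = (if n = 0 then 1 / 2 else 1) * (\<beta> n * of_real (bessel_J (int n) (k * r0)) * of_real (bessel_J (int n) (k * r)))
     * (cis (real n * (\<theta> - \<theta>0)) + cis (- (real n * (\<theta> - \<theta>0))))"
proof -
  have ip: "polar r \<theta> \<bullet> polar r \<theta> = r\<^sup>2"
    by (simp add: power2_norm_eq_inner[symmetric])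
  have "(k / 2) ^ n * (r ^ n * c) = (k * r / 2) ^ n * c" for c
    by (simp add: power_mult_distrib power_divide)
  then have e: "complex_of_real ((k / 2) ^ n) * (of_real (r ^ n) * of_real c) = of_real ((k * r / 2) ^ n * c)" for c
    by (simp only: of_real_mult[symmetric])
  define p q z where pqz: "p = complex_of_real ((k / 2) ^ n)" "q = complex_of_real (r ^ n)" "z = complex_of_real (clifford_J n (\<kappa> * r\<^sup>2))"
  have "a * b * d * p * (q * E * z) = a * (b * d * (p * (q * z))) * E" for a b d E :: complex
    by (simp add: mult_ac)
  then show ?thesis
    unfolding trm_def coef_def angular_polar ip bessel_J_nat_scaled e[symmetric] pqz[symmetric] .
qed

text \<open>A sum over the integers is unconditional, so absolute convergence is shown for the
  halves \<open>n \<ge> 0\<close> and \<open>n < 0\<close> separately. The sign of a negative order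
  occurs in both Bessel factors and cancels.\<close>

lemma regular_has_sum:
  fixes b :: "int \<Rightarrow> complex"
  assumes r: "0 \<le> r" "r \<le> R" and b: "\<And>n. b (int n) = \<beta> n" "\<And>n. b (- int n) = \<beta> n"
  shows "((\<lambda>n. b n * of_real (bessel_J n (k * r0)) * of_real (bessel_J n (k * r)) * exp (\<i> * of_int n * of_real (\<theta> - \<theta>0)))
    has_sum regular (polar r \<theta>)) UNIV" (is "(?f has_sum _) UNIV")
proof -
  define A where "A n = \<beta> n * of_real (bessel_J (int n) (k * r0)) * of_real (bessel_J (int n) (k * r))" for n
  define t where "t = \<theta> - \<theta>0"
  have ex: "exp (\<i> * of_int n * of_real t) = cis (of_int n * t)" for n
    by (simp add: cis_conv_exp mult_ac)
  have f1: "?f (int n) = A n * cis (real n * t)" for n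
    unfolding t_def[symmetric] ex by (simp add: A_def b)
  have f2: "?f (- int n) = A n * cis (- (real n * t))" for n
  proof -
    have "(- 1) ^ n * ((- 1) ^ n * x) = x" for x :: complex
      by (cases "even n") simp_all
    from this[of "b * x * y * z" for b x y z]
    have "b * ((- 1) ^ n * x) * ((- 1) ^ n * y) * z = b * x * y * z" for b x y z :: complex
      by (simp only: mult_ac)
    then show ?thesis
      unfolding t_def[symmetric] ex by (simp add: A_def b bessel_J_uminus)
  qed
  have disk: "polar r \<theta> \<in> cball 0 R" for \<theta> using r by simp
  \<comment> \<open>At the angle \<open>\<theta>0\<close> the two exponentials add up to
    \<open>2\<close>, so \<open>trm_bound\<close> there bounds the coefficient itself.\<close>
  have A_le: "norm (A n) \<le> majorant n" for n
  proof (cases "n = 0")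
    case False
    then have "2 * norm (A n) \<le> majorant n"
      using trm_bound[OF disk[of \<theta>0], of n] unfolding trm_polar A_def[symmetric] by (simp add: norm_mult)
    then show ?thesis using norm_ge_zero[of "A n"] by linarith
  qed (use trm_bound[OF disk[of \<theta>0], of 0] in \<open>simp add: trm_polar A_def norm_mult\<close>)
  have T: "trm n (polar r \<theta>) = (if n = 0 then 1 / 2 else 1) * A n * (cis (real n * t) + cis (- (real n * t)))" for n
    unfolding trm_polar A_def t_def ..
  have s1: "summable (\<lambda>n. norm (A n * cis (real n * t)))"
    by (rule summable_comparison_test'[OF summable_majorant, of 0]) (simp add: norm_mult A_le)
  have s2: "summable (\<lambda>n. norm (A (Suc n) * cis (- (real (Suc n) * t))))"
    by (rule summable_comparison_test'[OF iffD2[OF summable_Suc_iff summable_majorant], of 0])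
      (simp only: norm_mult norm_cis mult_1_right real_norm_def abs_norm_cancel A_le)
  let ?S1 = "\<Sum>n. A n * cis (real n * t)" and ?S2 = "\<Sum>n. A (Suc n) * cis (- (real (Suc n) * t))"
  have "(\<lambda>n. ?f (int n)) = (\<lambda>n. A n * cis (real n * t))" "(\<lambda>n. ?f (- int (Suc n))) = (\<lambda>n. A (Suc n) * cis (- (real (Suc n) * t)))"
    unfolding f1 f2 by simp_all
  then have h: "((\<lambda>n. ?f (int n)) has_sum ?S1) UNIV" "((\<lambda>n. ?f (- int (Suc n))) has_sum ?S2) UNIV"
    using norm_summable_imp_has_sum[OF s1 summable_sums[OF summable_norm_cancel[OF s1]]]
      norm_summable_imp_has_sum[OF s2 summable_sums[OF summable_norm_cancel[OF s2]]] by simp_all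
  have h1: "(?f has_sum ?S1) (range int)"
    by (rule iffD2[OF has_sum_reindex]) (use h(1) in \<open>simp_all add: comp_def\<close>)
  have h2: "(?f has_sum ?S2) (range (\<lambda>n. - int (Suc n)))"
    by (rule iffD2[OF has_sum_reindex]) (use h(2) in \<open>simp_all add: comp_def inj_def\<close>)
  have "(?f has_sum (?S1 + ?S2)) (range int \<union> range (\<lambda>n. - int (Suc n)))"
    by (rule has_sum_Un_disjoint[OF h1 h2]) auto
  moreover have "range int \<union> range (\<lambda>n. - int (Suc n)) = UNIV"
  proof -
    have "x \<in> range int \<union> range (\<lambda>n. - int (Suc n))" for x
      by (cases x) auto
    then show ?thesis by blast
  qed
  moreover have "?S1 + ?S2 = regular (polar r \<theta>)"
  proof -
    have c1: "summable (\<lambda>n. A n * cis (real n * t))" and c2: "summable (\<lambda>n. A (Suc n) * cis (- (real (Suc n) * t)))"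
      by (rule summable_norm_cancel, fact s1) (rule summable_norm_cancel, fact s2)
    have c1': "summable (\<lambda>n. A (Suc n) * cis (real (Suc n) * t))"
      by (rule iffD2[OF summable_Suc_iff c1])
    have sm: "summable (\<lambda>n. trm n (polar r \<theta>))"
      using trm_bound[OF disk] by (intro summable_comparison_test'[OF summable_majorant, of 0])
    have "regular (polar r \<theta>) = trm 0 (polar r \<theta>) + (\<Sum>n. trm (Suc n) (polar r \<theta>))"
      unfolding regular_def suminf_split_head[OF sm] by simp
    also have "trm 0 (polar r \<theta>) = A 0"
      unfolding T by simp
    also have "(\<Sum>n. trm (Suc n) (polar r \<theta>)) = (\<Sum>n. A (Suc n) * cis (real (Suc n) * t) + A (Suc n) * cis (- (real (Suc n) * t)))"
      unfolding T by (simp add: distrib_left)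
    also have "\<dots> = (\<Sum>n. A (Suc n) * cis (real (Suc n) * t)) + ?S2"
      by (rule suminf_add[OF c1' c2, symmetric])
    also have "A 0 + ((\<Sum>n. A (Suc n) * cis (real (Suc n) * t)) + ?S2) = ?S1 + ?S2"
      using suminf_split_head[OF c1] by simp
    finally show ?thesis ..
  qed
  ultimately show ?thesis by simp
qed

text \<open>Each term solves the equation by \<open>entire_weak\<close>. The partial sums are
  bounded by the sum of the majorant, so dominated convergence carries the vanishing integrals to
  the limit.\<close>

lemma regular_weak:
  assumes \<phi>: "test_function (ball 0 R) \<phi>"
  defines "F \<equiv> \<lambda>x. regular x * (laplacian \<phi> x + of_real (k\<^sup>2) * \<phi> x)"
  shows "F absolutely_integrable_on ball 0 R" "integral (ball 0 R) F = 0"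
proof -
  let ?L = "\<lambda>x. laplacian \<phi> x + of_real (k\<^sup>2) * \<phi> x"
  have "continuous_on (ball 0 R) regular"
    by (rule continuous_on_subset[of "cball 0 R"])
      (auto intro!: continuous_on_subset[OF has_derivative_continuous_on[OF regular_C1(2)]])
  then show "F absolutely_integrable_on ball 0 R"
    unfolding F_def by (intro weak_integrand_integrable[OF _ \<phi>] continuous_locally_integrable)
  have k4: "k\<^sup>2 = 4 * \<kappa>" by (simp add: \<kappa>_def)
  have term_weak: "(\<lambda>x. trm n x * ?L x) integrable_on ball 0 R \<and> integral (ball 0 R) (\<lambda>x. trm n x * ?L x) = 0" for n
  proof -
    let ?E = "\<lambda>s x. (zeta s x ^ n * of_real (clifford_J n (\<kappa> * (x \<bullet> x)))) * ?L x"
    have E: "?E s integrable_on ball 0 R" "integral (ball 0 R) (?E s) = 0" if "s\<^sup>2 = 1" for s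
      using entire_weak[OF \<phi> k4 \<kappa>_pos that, of n] by (auto intro: set_lebesgue_integral_eq_integral(1))
    have e: "trm n x * ?L x = (coef n * cis (- (real n * \<theta>0))) * ?E 1 x + (coef n * cis (real n * \<theta>0)) * ?E (- 1) x" for x
      by (simp add: trm_def angular_def algebra_simps)
    have i: "(\<lambda>x. (coef n * cis (- (real n * \<theta>0))) * ?E 1 x) integrable_on ball 0 R" "(\<lambda>x. (coef n * cis (real n * \<theta>0)) * ?E (- 1) x) integrable_on ball 0 R"
      by (rule integrable_on_mult_right, rule E(1), simp)+
    have z: "integral (ball 0 R) (?E 1) = 0" "integral (ball 0 R) (?E (- 1)) = 0"
      by (rule E(2), simp)+
    show ?thesis
      unfolding e integral_add[OF i] integral_mult_right z using integrable_add[OF i] by simp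
  qed
  define B where "B = (\<Sum>n. majorant n)"
  have maj: "0 \<le> majorant n" for n
    using trm_bound[of 0 n] R by (auto intro: order_trans[OF norm_ge_zero])
  have "(\<lambda>x. 1 * ?L x) absolutely_integrable_on ball 0 R"
    by (intro weak_integrand_integrable[OF _ \<phi>] continuous_locally_integrable continuous_intros)
  then have L: "(\<lambda>x. norm (?L x)) integrable_on ball 0 R"
    by (simp add: absolutely_integrable_on_def)
  have int: "(\<lambda>x. \<Sum>n<N. trm n x * ?L x) integrable_on ball 0 R" for N
    using term_weak by (intro integrable_sum) auto
  have "(\<lambda>N. integral (ball 0 R) (\<lambda>x. \<Sum>n<N. trm n x * ?L x)) \<longlonglongrightarrow> integral (ball 0 R) F"
  proof (rule dominated_convergence(2)[OF int])
    show "(\<lambda>x. B * norm (?L x)) integrable_on ball 0 R"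
      using L by (rule integrable_on_mult_right)
    fix x :: "real^2" assume "x \<in> ball 0 R"
    then have x: "x \<in> cball 0 R" by simp
    show "norm (\<Sum>n<N. trm n x * ?L x) \<le> B * norm (?L x)" for N
    proof -
      have "norm (\<Sum>n<N. trm n x) \<le> (\<Sum>n<N. majorant n)"
        using trm_bound[OF x] by (intro sum_norm_le)
      also have "\<dots> \<le> B"
        unfolding B_def using maj by (intro sum_le_suminf summable_majorant) auto
      finally show ?thesis
        unfolding sum_distrib_right[symmetric] norm_mult by (intro mult_right_mono) auto
    qed
    have "(\<lambda>n. trm n x) sums regular x"
      unfolding regular_def using trm_bound[OF x]
      by (intro summable_sums summable_comparison_test'[OF summable_majorant, of 0])
    then have "(\<lambda>N. (\<Sum>n<N. trm n x) * ?L x) \<longlonglongrightarrow> F x"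
      unfolding F_def sums_def by (intro tendsto_mult tendsto_const)
    then show "(\<lambda>N. \<Sum>n<N. trm n x * ?L x) \<longlonglongrightarrow> F x"
      by (simp only: sum_distrib_right)
  qed
  moreover have "integral (ball 0 R) (\<lambda>x. \<Sum>n<N. trm n x * ?L x) = 0" for N
    using term_weak by (subst integral_sum) auto
  ultimately show "integral (ball 0 R) F = 0"
    using LIMSEQ_unique[OF _ tendsto_const] by simp
qed

end

subsection \<open>Existence\<close>

text \<open>The two functions are compared only to the left of \<open>R\<close>; a one-sided
  derivative on a nondegenerate interval is still unique.\<close>

lemma has_vector_derivative_left_unique:
  fixes f :: "real \<Rightarrow> complex"
  assumes "a < R" "(f has_vector_derivative f') (at R within {a..R})" "(g has_vector_derivative g') (at R)"
    and "\<And>r. r \<in> {a..R} \<Longrightarrow> f r = g r"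
  shows "f' = g'"
proof -
  have R: "R \<in> {a..R}" using assms(1) by simp
  have "(f has_vector_derivative g') (at R within {a..R})"
    by (rule has_vector_derivative_transform[OF R _ has_vector_derivative_at_within[OF assms(3)]]) (rule assms(4))
  with assms(1,2) R show ?thesis
    using vector_derivative_unique_within_closed_interval[of a R R f f' g'] by simp
qed

locale robin_part = regular_part +
  fixes \<alpha> :: real
  assumes trace_J: "robin_trace \<alpha> R (\<lambda>r. of_real (bessel_J (int n) (k * r))) \<noteq> 0"
    and \<beta>_eq: "\<beta> n = robin_trace \<alpha> R (\<lambda>r. hankel1 (int n) (k * r)) / robin_trace \<alpha> R (\<lambda>r. of_real (bessel_J (int n) (k * r)))"
begin

abbreviation "x\<^sub>0 \<equiv> polar r0 \<theta>0"

definition "green x = point_source k x\<^sub>0 x - \<i> / 4 * regular x"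

definition "green_deriv x = source_deriv k x\<^sub>0 x - (blinfun_mult_right (\<i> / 4) o\<^sub>L regular_deriv x)"

lemma green_deriv:
  "continuous_on (cball 0 R - {x\<^sub>0}) green_deriv"
  "x \<in> cball 0 R - {x\<^sub>0} \<Longrightarrow> (green has_derivative blinfun_apply (green_deriv x)) (at x within cball 0 R - {x\<^sub>0})"
proof -
  have "continuous_on (cball 0 R - {x\<^sub>0}) regular_deriv"
    using regular_C1(1) by (rule continuous_on_subset) auto
  then show "continuous_on (cball 0 R - {x\<^sub>0}) green_deriv"
    unfolding green_deriv_def[abs_def]
    by (intro continuous_on_diff source_deriv_continuous k bounded_bilinear.continuous_on[OF bounded_bilinear_blinfun_compose] continuous_on_const) auto
  assume x: "x \<in> cball 0 R - {x\<^sub>0}"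
  then have "(regular has_derivative blinfun_apply (regular_deriv x)) (at x within cball 0 R - {x\<^sub>0})"
    by (intro has_derivative_subset[OF regular_C1(2)]) auto
  then have "(green has_derivative (\<lambda>h. blinfun_apply (source_deriv k x\<^sub>0 x) h - \<i> / 4 * blinfun_apply (regular_deriv x) h)) (at x within cball 0 R - {x\<^sub>0})"
    unfolding green_def[abs_def] using x
    by (intro has_derivative_diff has_derivative_mult_right point_source_has_derivative k) auto
  then show "(green has_derivative blinfun_apply (green_deriv x)) (at x within cball 0 R - {x\<^sub>0})"
    by (rule has_derivative_eq_rhs) (simp add: green_deriv_def fun_eq_iff blinfun.diff_left)
qed

lemma regular_continuous: "continuous_on (cball 0 R) regular"
  using has_derivative_continuous_on[OF regular_C1(2)] .

lemma green_helmholtz: "helmholtz_point_source (ball 0 R) k x\<^sub>0 green"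
  unfolding helmholtz_point_source_def
proof (intro conjI allI impI)
  show loc: "green locally_integrable_on ball 0 R"
    unfolding locally_integrable_on_def
  proof (intro allI impI)
    fix K :: "(real^2) set" assume K: "compact K \<and> K \<subseteq> ball 0 R"
    then have 1: "point_source k x\<^sub>0 absolutely_integrable_on K"
      by (intro point_source_locally_integrable k) simp
    have "(\<lambda>x. \<i> / 4 * regular x) locally_integrable_on ball 0 R"
      by (intro continuous_locally_integrable continuous_on_mult_left continuous_on_subset[OF regular_continuous]) auto
    then have 2: "(\<lambda>x. \<i> / 4 * regular x) absolutely_integrable_on K"
      using K by (simp add: locally_integrable_on_def)
    show "green absolutely_integrable_on K"
      unfolding green_def[abs_def] by (rule set_integral_diff(1)[OF 1 2])
  qed
  fix \<phi> :: "real^2 \<Rightarrow> complex" assume \<phi>: "test_function (ball 0 R) \<phi>"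
  let ?L = "\<lambda>x. laplacian \<phi> x + of_real (k\<^sup>2) * \<phi> x"
  have i: "(\<lambda>x. point_source k x\<^sub>0 x * ?L x) integrable_on ball 0 R" "(\<lambda>x. regular x * ?L x) integrable_on ball 0 R"
    using point_source_weak(1)[OF \<phi> k] regular_weak(1)[OF \<phi>] by (auto intro: set_lebesgue_integral_eq_integral(1))
  have "(LINT x:ball 0 R|lebesgue. green x * ?L x) = integral (ball 0 R) (\<lambda>x. green x * ?L x)"
    by (rule set_lebesgue_integral_eq_integral(2)[OF weak_integrand_integrable[OF loc \<phi>]])
  also have "\<dots> = integral (ball 0 R) (\<lambda>x. point_source k x\<^sub>0 x * ?L x - \<i> / 4 * (regular x * ?L x))"
    by (simp only: green_def left_diff_distrib mult.assoc)
  also have "\<dots> = - \<phi> x\<^sub>0 - \<i> / 4 * 0"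
    unfolding integral_diff[OF i(1) integrable_on_mult_right[OF i(2)]] integral_mult_right
      point_source_weak(2)[OF \<phi> k] regular_weak(2)[OF \<phi>] ..
  finally show "(LINT x:ball 0 R|lebesgue. green x * ?L x) = - \<phi> x\<^sub>0" by simp
qed

text \<open>Beyond the radius of the source, the source and the regular part share the factor that
  depends on \<open>r0\<close> and \<open>\<theta>0\<close>; what remains is a purely radial
  function to which the Robin operator can be applied.\<close>

lemma circle_mean_green:
  fixes m :: int
  assumes r: "r0 < r" "r \<le> R"
  defines "n \<equiv> nat \<bar>m\<bar>"
  shows "circle_mean (of_int m) green r = (\<i> * of_real pi / 2 * of_real (bessel_J (int n) (k * r0)) * cis (of_int m * \<theta>0))
    * (hankel1 (int n) (k * r) - \<beta> n * of_real (bessel_J (int n) (k * r)))"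
proof -
  define s :: real where "s = (if m < 0 then - 1 else 1)"
  have s: "s = 1 \<or> s = - 1" "s * real n = of_int m"
    by (auto simp: s_def n_def)
  have r': "0 \<le> r" "k * r > 0" using r r0 k by auto
  have pow: "(\<kappa> * r * r0) ^ n = (k * r / 2) ^ n * (k * r0 / 2) ^ n"
    unfolding power_mult_distrib[symmetric] by (simp add: \<kappa>_def power2_eq_square mult_ac)
  have Y: "bessel_Y (int n) (k * r) = (k * r / 2) ^ n * clifford_Y n (\<kappa> * r\<^sup>2)"
  proof -
    have "(k * r)\<^sup>2 / 4 = \<kappa> * r\<^sup>2" by (simp add: \<kappa>_def power_mult_distrib)
    then show ?thesis by (simp add: bessel_Y_eq[OF r'(2)] cyl_nat)
  qed
  have ps: "circle_mean (of_int m) (point_source k x\<^sub>0) r = (\<i> * of_real pi / 2 * of_real (bessel_J (int n) (k * r0)) * cis (of_int m * \<theta>0)) * hankel1 (int n) (k * r)"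
    using circle_mean_point_source_outer[OF k r0(1) s(1) r(1), of n \<theta>0]
    unfolding s(2) \<kappa>_def[symmetric] pow bessel_J_nat_scaled hankel1_eq Y
    by (simp add: algebra_simps)
  have c: "continuous_on {0..2 * pi} (\<lambda>\<theta>. point_source k x\<^sub>0 (polar r \<theta>))" "continuous_on {0..2 * pi} (\<lambda>\<theta>. regular (polar r \<theta>))"
  proof -
    have psc: "continuous_on (- {x\<^sub>0}) (point_source k x\<^sub>0)"
      by (rule has_derivative_continuous_on) (rule point_source_has_derivative[OF k], simp)
    have ne: "polar r \<theta> \<noteq> x\<^sub>0" for \<theta>
    proof
      assume "polar r \<theta> = x\<^sub>0"
      then have "norm (polar r \<theta>) = norm x\<^sub>0" by (rule arg_cong)
      then show False using r r0 by simp
    qed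
    show "continuous_on {0..2 * pi} (\<lambda>\<theta>. point_source k x\<^sub>0 (polar r \<theta>))"
      by (rule continuous_on_compose2[OF psc]) (auto intro!: continuous_intros dest: ne[THEN notE, OF sym])
    show "continuous_on {0..2 * pi} (\<lambda>\<theta>. regular (polar r \<theta>))"
      using r r' by (intro continuous_on_compose2[OF regular_continuous] continuous_intros) auto
  qed
  have i: "(\<lambda>\<theta>. point_source k x\<^sub>0 (polar r \<theta>) * cis (of_int m * \<theta>)) integrable_on {0..2 * pi}"
    "(\<lambda>\<theta>. \<i> / 4 * (regular (polar r \<theta>) * cis (of_int m * \<theta>))) integrable_on {0..2 * pi}"
    using c by (auto intro!: integrable_continuous_real continuous_intros)
  have "circle_mean (of_int m) green r = circle_mean (of_int m) (point_source k x\<^sub>0) r - \<i> / 4 * circle_mean (of_int m) regular r"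
    unfolding circle_mean_def integral_mult_right[symmetric] integral_diff[OF i, symmetric]
    by (simp add: green_def algebra_simps)
  then show ?thesis
    unfolding ps circle_mean_regular[OF r'(1) r(2), of m, folded n_def] bessel_J_nat_scaled[symmetric]
    by (simp add: algebra_simps)
qed

lemma green_robin: "robin_green_function R k \<alpha> x\<^sub>0 green"
proof -
  have x0: "x\<^sub>0 \<in> ball 0 R" using r0 by simp
  have "circle_mean' (of_int m) green_deriv R + of_real \<alpha> * circle_mean (of_int m) green R = 0" for m :: int
  proof -
    define n where "n = nat \<bar>m\<bar>"
    define c where "c = \<i> * of_real pi / 2 * of_real (bessel_J (int n) (k * r0)) * cis (of_int m * \<theta>0)"
    \<comment> \<open>The midpoint keeps all circles with radius in \<open>{a..R}\<close> away from
      the source, so the mean is differentiable from the left up to \<open>R\<close>.\<close>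
    define a where "a = (r0 + R) / 2"
    have a: "r0 < a" "a < R" using r0 by (auto simp: a_def)
    let ?h = "\<lambda>r. hankel1 (int n) (k * r)" and ?j = "\<lambda>r. complex_of_real (bessel_J (int n) (k * r))"
    have eq: "circle_mean (of_int m) green r = c * (?h r - \<beta> n * ?j r)" if "r \<in> {a..R}" for r
      using circle_mean_green[of r m] that a by (simp add: c_def n_def)
    have "polar r \<theta> \<in> cball 0 R - {x\<^sub>0}" if "r \<in> {a..R}" for r \<theta>
    proof -
      have "norm (polar r \<theta>) \<noteq> norm x\<^sub>0" using that a r0 by simp
      then have "polar r \<theta> \<noteq> x\<^sub>0" by (rule contrapos_nn) (rule arg_cong)
      then show ?thesis using that a r0 by simp
    qed
    then have d: "(circle_mean (of_int m) green has_vector_derivative circle_mean' (of_int m) green_deriv R) (at R within {a..R})"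
      using a by (intro circle_mean_has_vector_derivative[OF green_deriv(2) green_deriv(1)]) auto
    have h: "(?h has_vector_derivative vector_derivative ?h (at R)) (at R)" and j: "(?j has_vector_derivative vector_derivative ?j (at R)) (at R)"
      using hankel1_has_vector_derivative[OF k R, of "int n"] bessel_J_has_vector_derivative[OF k R, of "int n"]
      by (simp_all add: vector_derivative_at)
    have d': "circle_mean' (of_int m) green_deriv R = c * (vector_derivative ?h (at R) - \<beta> n * vector_derivative ?j (at R))"
      by (rule has_vector_derivative_left_unique[OF a(2) d _ eq])
        (intro has_vector_derivative_mult_right has_vector_derivative_diff h j)
    have "R \<in> {a..R}" using a by simp
    note eqR = eq[OF this]
    have "circle_mean' (of_int m) green_deriv R + of_real \<alpha> * circle_mean (of_int m) green R
        = c * (robin_trace \<alpha> R ?h - \<beta> n * robin_trace \<alpha> R ?j)"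
      unfolding d' eqR robin_trace_def by (simp add: algebra_simps)
    also have "\<dots> = 0"
      using trace_J[of n] by (simp add: \<beta>_eq)
    finally show ?thesis .
  qed
  then have "\<forall>x\<in>sphere 0 R. disk_normal_derivative R green x + of_real \<alpha> * green x = 0"
    using robin_iff_fourier[OF R x0 green_deriv] by blast
  moreover have "C1_on (cball 0 R - {x\<^sub>0}) green"
    unfolding C1_on_def using green_deriv by blast
  ultimately show ?thesis
    unfolding robin_green_function_def using green_helmholtz by blast
qed

end

subsection \<open>Uniqueness\<close>

text \<open>The means vanish for all radii other than \<open>0\<close> and
  \<open>norm x\<^sub>0\<close>. The excluded origin and circle have measure zero, while the set
  where the difference is nonzero is open, so it is empty by continuity.\<close>

theorem robin_green_function_unique:
  assumes k: "k > 0" and R: "R > 0" and x\<^sub>0: "x\<^sub>0 \<in> ball 0 R"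
    and J: "\<And>n. robin_trace \<alpha> R (\<lambda>r. of_real (bessel_J (int n) (k * r))) \<noteq> 0"
    and G: "robin_green_function R k \<alpha> x\<^sub>0 G" and H: "robin_green_function R k \<alpha> x\<^sub>0 H"
    and x: "x \<in> cball 0 R - {x\<^sub>0}"
  shows "G x = H x"
proof -
  let ?S = "cball 0 R - {x\<^sub>0}"
  define \<kappa> where "\<kappa> = k\<^sup>2 / 4"
  have "\<exists>DG. continuous_on ?S DG \<and> (\<forall>x\<in>?S. (G has_derivative blinfun_apply (DG x)) (at x within ?S))"
    using G unfolding robin_green_function_def C1_on_def by (rule conjunct1)
  then obtain DG where DG: "continuous_on ?S DG \<and> (\<forall>x\<in>?S. (G has_derivative blinfun_apply (DG x)) (at x within ?S))"
    by (rule exE)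
  have "\<exists>DH. continuous_on ?S DH \<and> (\<forall>x\<in>?S. (H has_derivative blinfun_apply (DH x)) (at x within ?S))"
    using H unfolding robin_green_function_def C1_on_def by (rule conjunct1)
  then obtain DH where DH: "continuous_on ?S DH \<and> (\<forall>x\<in>?S. (H has_derivative blinfun_apply (DH x)) (at x within ?S))"
    by (rule exE)
  define w where "w x = G x - H x" for x
  define D where "D x = DG x - DH x" for x
  have Dc: "continuous_on ?S D"
    unfolding D_def[abs_def] using DG DH by (intro continuous_on_diff) auto
  have D: "(w has_derivative blinfun_apply (D x)) (at x within ?S)" if "x \<in> ?S" for x
  proof -
    have "(w has_derivative (\<lambda>h. blinfun_apply (DG x) h - blinfun_apply (DH x) h)) (at x within ?S)"
      unfolding w_def[abs_def] using DG DH that by (intro has_derivative_diff) auto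
    then show ?thesis
      by (rule has_derivative_eq_rhs) (simp add: D_def fun_eq_iff blinfun.diff_left)
  qed
  have wc: "continuous_on ?S w"
    by (rule has_derivative_continuous_on[OF D])
  interpret weak_solution R \<kappa> x\<^sub>0 w D
  proof
    show "\<kappa> > 0" using k by (simp add: \<kappa>_def)
    show "continuous_on (ball 0 R - {x\<^sub>0}) D"
      by (rule continuous_on_subset[OF Dc]) auto
    show "(w has_derivative blinfun_apply (D x)) (at x within ball 0 R - {x\<^sub>0})" if "x \<in> ball 0 R - {x\<^sub>0}" for x
      by (rule has_derivative_subset[OF D]) (use that in auto)
    fix \<phi> :: "real^2 \<Rightarrow> complex" assume \<phi>: "test_function (ball 0 R) \<phi>"
    let ?L = "\<lambda>x. laplacian \<phi> x + of_real (k\<^sup>2) * \<phi> x"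
    have hG: "G locally_integrable_on ball 0 R" "(LINT x:ball 0 R|lebesgue. G x * ?L x) = - \<phi> x\<^sub>0"
      and hH: "H locally_integrable_on ball 0 R" "(LINT x:ball 0 R|lebesgue. H x * ?L x) = - \<phi> x\<^sub>0"
      using G H \<phi> by (simp_all add: robin_green_function_def helmholtz_point_source_def)
    have "(LINT x:ball 0 R|lebesgue. G x * ?L x - H x * ?L x) = 0"
      unfolding set_integral_diff(2)[OF weak_integrand_integrable[OF hG(1) \<phi>] weak_integrand_integrable[OF hH(1) \<phi>]] hG(2) hH(2)
      by simp
    moreover have "4 * \<kappa> = k\<^sup>2" by (simp add: \<kappa>_def)
    ultimately show "(LINT x:ball 0 R|lebesgue. w x * (laplacian \<phi> x + of_real (4 * \<kappa>) * \<phi> x)) = 0"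
      by (simp only: w_def left_diff_distrib)
  qed
  have fourier: "circle_mean' (of_int m) D R + of_real \<alpha> * circle_mean (of_int m) w R = 0" for m :: int
  proof -
    have xS: "x \<in> ?S" if "x \<in> sphere 0 R" for x
      using that x\<^sub>0 by auto
    have fG: "circle_mean' (of_int m) DG R + of_real \<alpha> * circle_mean (of_int m) G R = 0"
      and fH: "circle_mean' (of_int m) DH R + of_real \<alpha> * circle_mean (of_int m) H R = 0"
      using G H robin_iff_fourier[OF R x\<^sub>0, of DG G \<alpha>] robin_iff_fourier[OF R x\<^sub>0, of DH H \<alpha>] DG DH
      by (simp_all add: robin_green_function_def)
    have pS: "polar R \<theta> \<in> ?S" for \<theta>
      by (rule xS) (use R in simp)
    have "continuous_on ?S G" "continuous_on ?S H"
      using DG DH by (auto intro: has_derivative_continuous_on)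
    then have c: "continuous_on {0..2 * pi} (\<lambda>\<theta>. G (polar R \<theta>))" "continuous_on {0..2 * pi} (\<lambda>\<theta>. H (polar R \<theta>))"
      using pS by (auto intro!: continuous_on_compose2[of ?S] continuous_intros)
    have c': "continuous_on {0..2 * pi} (\<lambda>\<theta>. DG (polar R \<theta>))" "continuous_on {0..2 * pi} (\<lambda>\<theta>. DH (polar R \<theta>))"
      using pS DG DH by (auto intro!: continuous_on_compose2[of ?S] continuous_intros)
    have i: "(\<lambda>\<theta>. G (polar R \<theta>) * cis (of_int m * \<theta>)) integrable_on {0..2 * pi}" "(\<lambda>\<theta>. H (polar R \<theta>) * cis (of_int m * \<theta>)) integrable_on {0..2 * pi}"
      using c by (auto intro!: integrable_continuous_real continuous_intros)
    have i': "(\<lambda>\<theta>. DG (polar R \<theta>) (polar 1 \<theta>) * cis (of_int m * \<theta>)) integrable_on {0..2 * pi}" "(\<lambda>\<theta>. DH (polar R \<theta>) (polar 1 \<theta>) * cis (of_int m * \<theta>)) integrable_on {0..2 * pi}"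
      using c' by (auto intro!: integrable_continuous_real continuous_intros blinfun.continuous_on)
    have a: "circle_mean (of_int m) w R = circle_mean (of_int m) G R - circle_mean (of_int m) H R"
      unfolding circle_mean_def integral_diff[OF i, symmetric] by (simp add: w_def left_diff_distrib)
    have b: "circle_mean' (of_int m) D R = circle_mean' (of_int m) DG R - circle_mean' (of_int m) DH R"
      unfolding circle_mean'_def integral_diff[OF i', symmetric] by (simp add: D_def blinfun.diff_left left_diff_distrib)
    have "circle_mean' (of_int m) D R + of_real \<alpha> * circle_mean (of_int m) w R
      = (circle_mean' (of_int m) DG R + of_real \<alpha> * circle_mean (of_int m) G R) - (circle_mean' (of_int m) DH R + of_real \<alpha> * circle_mean (of_int m) H R)"
      unfolding a b by (simp add: algebra_simps)
    then show ?thesis unfolding fG fH by simp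
  qed
  have off: "polar r \<theta> \<in> ?S" if "0 < r" "r \<le> R" "r \<noteq> norm x\<^sub>0" for r \<theta>
  proof -
    have "norm (polar r \<theta>) \<noteq> norm x\<^sub>0" using that by simp
    then have "polar r \<theta> \<noteq> x\<^sub>0" by (rule contrapos_nn) (rule arg_cong)
    then show ?thesis using that by simp
  qed
  have mean: "circle_mean (of_int m) w r = 0" if r: "0 < r" "r \<le> R" "r \<noteq> norm x\<^sub>0" for m :: int and r
  proof -
    define n where "n = nat \<bar>m\<bar>"
    define s :: real where "s = (if m < 0 then - 1 else 1)"
    have s: "s\<^sup>2 = 1" "s * real n = of_int m"
      by (auto simp: s_def n_def)
    let ?j = "\<lambda>r. complex_of_real (bessel_J (int n) (k * r))"
    obtain C where C: "\<And>r. 0 < r \<Longrightarrow> r < R \<Longrightarrow> r \<noteq> norm x\<^sub>0 \<Longrightarrow>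
        circle_mean (of_int m) w r = C * of_real (r ^ n * clifford_J n (\<kappa> * r\<^sup>2))"
      using circle_mean_eq[OF s(1), of n] unfolding s(2) by blast
    define c where "c = C / of_real ((k / 2) ^ n)"
    have Cj: "C * of_real (r ^ n * clifford_J n (\<kappa> * r\<^sup>2)) = c * ?j r" for r
    proof -
      have e: "(k * r)\<^sup>2 / 4 = \<kappa> * r\<^sup>2" by (simp add: \<kappa>_def power_mult_distrib)
      have j: "?j r = of_real ((k / 2) ^ n) * of_real (r ^ n * clifford_J n (\<kappa> * r\<^sup>2))"
        unfolding bessel_J_eq cyl_nat e by (simp add: power_mult_distrib power_divide)
      have p: "complex_of_real ((k / 2) ^ n) \<noteq> 0" using k by simp
      have "C * z = C / p * (p * z)" if "p \<noteq> 0" for p z :: complex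
        using that by simp
      from this[OF p] show ?thesis unfolding j c_def .
    qed
    define a where "a = (norm x\<^sub>0 + R) / 2"
    have a: "norm x\<^sub>0 < a" "a < R" "0 < a" using x\<^sub>0 R norm_ge_zero[of x\<^sub>0] by (auto simp: a_def simp del: norm_ge_zero)
    have pS: "polar r \<theta> \<in> ?S" if "r \<in> {a..R}" for r \<theta>
      using that a by (intro off) auto
    have jc: "continuous_on {a..R} ?j"
      using a k by (intro continuous_at_imp_continuous_on ballI has_vector_derivative_continuous[OF bessel_J_has_vector_derivative]) auto
    \<comment> \<open>\<open>circle_mean_eq\<close> covers radii below \<open>R\<close> only;
      continuity extends the identity to \<open>R\<close>, where the Robin condition is
      imposed.\<close>
    have eq: "circle_mean (of_int m) w r = c * ?j r" if "r \<in> {a..R}" for r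
    proof -
      have cm: "continuous_on {a..R} (circle_mean (of_int m) w)"
        by (rule continuous_on_circle_mean[OF wc pS])
      have cl: "closure {a..<R} = {a..R}"
        using a by (intro closure_atLeastLessThan)
      have "continuous_on (closure {a..<R}) (\<lambda>r. circle_mean (of_int m) w r - c * ?j r)"
        unfolding cl by (intro continuous_on_diff continuous_on_mult_left cm jc)
      then have "circle_mean (of_int m) w r - c * ?j r = 0"
        by (rule continuous_constant_on_closure) (use that a C Cj in \<open>auto simp: cl\<close>)
      then show ?thesis by simp
    qed
    have d: "(circle_mean (of_int m) w has_vector_derivative circle_mean' (of_int m) D R) (at R within {a..R})"
      using a by (intro circle_mean_has_vector_derivative[OF D Dc pS]) auto
    have j: "(?j has_vector_derivative vector_derivative ?j (at R)) (at R)"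
      using bessel_J_has_vector_derivative[OF k R, of "int n"] by (simp add: vector_derivative_at)
    have d': "circle_mean' (of_int m) D R = c * vector_derivative ?j (at R)"
      by (rule has_vector_derivative_left_unique[OF a(2) d _ eq]) (intro has_vector_derivative_mult_right j)
    have "R \<in> {a..R}" using a by simp
    note eqR = eq[OF this]
    have "c * robin_trace \<alpha> R ?j = 0"
      using fourier[of m] unfolding d' eqR robin_trace_def by (simp add: algebra_simps)
    then have "c = 0" using J[of n] by simp
    show ?thesis
    proof (cases "r = R")
      case True
      then show ?thesis using eq[of R] a \<open>c = 0\<close> by simp
    next
      case False
      then have "circle_mean (of_int m) w r = c * ?j r"
        using C[of r] r Cj[of r] by simp
      then show ?thesis using \<open>c = 0\<close> by simp
    qed
  qed
  have zero: "w y = 0" if "y \<in> cball 0 R" "norm y \<noteq> 0" "norm y \<noteq> norm x\<^sub>0" for y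
  proof (rule circle_fourier_unique[where R = "norm y"])
    show "continuous_on (sphere 0 (norm y)) w"
      by (rule continuous_on_subset[OF wc]) (use that in auto)
    show "norm y > 0" using that(2) by simp
    show "circle_mean (of_int m) w (norm y) = 0" for m :: int
      by (rule mean) (use that in auto)
  qed simp
  have inside: "{y \<in> ball 0 R - {x\<^sub>0}. w y \<noteq> 0} = {}"
  proof (rule ccontr)
    assume ne: "{y \<in> ball 0 R - {x\<^sub>0}. w y \<noteq> 0} \<noteq> {}"
    have "continuous_on (ball 0 R - {x\<^sub>0}) w"
      by (rule continuous_on_subset[OF wc]) auto
    then have "open ((ball 0 R - {x\<^sub>0}) \<inter> w -` (- {0}))"
      by (rule continuous_open_preimage) auto
    moreover have "(ball 0 R - {x\<^sub>0}) \<inter> w -` (- {0}) = {y \<in> ball 0 R - {x\<^sub>0}. w y \<noteq> 0}"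
      by blast
    ultimately have "open {y \<in> ball 0 R - {x\<^sub>0}. w y \<noteq> 0}"
      by (rule back_subst)
    then have "\<not> negligible {y \<in> ball 0 R - {x\<^sub>0}. w y \<noteq> 0}"
      using ne by (rule open_not_negligible)
    moreover have "{y \<in> ball 0 R - {x\<^sub>0}. w y \<noteq> 0} \<subseteq> sphere 0 0 \<union> sphere 0 (norm x\<^sub>0)"
      using zero by force
    ultimately show False
      using negligible_subset[OF negligible_Un[OF negligible_sphere negligible_sphere]] by blast
  qed
  have "w x = 0"
  proof (cases "norm x = R")
    case True
    have "norm x\<^sub>0 < R" using x\<^sub>0 by simp
    with True R show ?thesis using x by (intro zero) auto
  next
    case False
    then have "x \<in> ball 0 R - {x\<^sub>0}" using x by simp
    then show ?thesis using inside by blast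
  qed
  then show ?thesis by (simp add: w_def)
qed

text \<open>Existence is stated on its own so that the formula for every Green's function is not
  vacuous, and summability because \<open>\<Sum>\<^sub>\<infinity>\<close> of a non-summable family
  is \<open>0\<close> by convention. That no \<open>BJ n\<close> vanishes means that
  \<open>k\<^sup>2\<close> is not a Robin eigenvalue of the negative Laplacian on the disk.\<close>

theorem theorem1:
  fixes R k \<alpha> r\<^sub>0 \<theta>\<^sub>0 :: real and x\<^sub>0 :: "real ^ 2"
  defines "BJ \<equiv> \<lambda>n. robin_trace \<alpha> R (\<lambda>r. of_real (bessel_J n (k * r)))"
    and "BH \<equiv> \<lambda>n. robin_trace \<alpha> R (\<lambda>r. hankel1 n (k * r))"
  assumes "R > 0" and "k > 0" and "\<alpha> > 0"
    and "x\<^sub>0 \<in> ball 0 R" and "r\<^sub>0 \<ge> 0" and "x\<^sub>0 = polar r\<^sub>0 \<theta>\<^sub>0"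
    and "\<forall>n. BJ n \<noteq> 0"
  shows
    "(\<forall>n. BJ n = of_real ((\<alpha> + of_int n / R) * bessel_J n (k * R) - k * bessel_J (n + 1) (k * R))) \<and>
     (\<forall>n. BH n = of_real (\<alpha> + of_int n / R) * hankel1 n (k * R) - of_real k * hankel1 (n + 1) (k * R)) \<and>
     (\<exists>G. robin_green_function R k \<alpha> x\<^sub>0 G) \<and>
     (\<forall>G. robin_green_function R k \<alpha> x\<^sub>0 G \<longrightarrow>
        (\<forall>r \<theta>. 0 \<le> r \<and> r \<le> R \<and> polar r \<theta> \<noteq> x\<^sub>0 \<longrightarrow>
           (\<lambda>n. BH n / BJ n * of_real (bessel_J n (k * r\<^sub>0)) * of_real (bessel_J n (k * r))
                * exp (\<i> * of_int n * of_real (\<theta> - \<theta>\<^sub>0))) summable_on UNIV \<and>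
           G (polar r \<theta>) =
             \<i> / 4 * hankel1 0 (k * norm (polar r \<theta> - x\<^sub>0))
             - \<i> / 4 * (\<Sum>\<^sub>\<infinity>n. BH n / BJ n * of_real (bessel_J n (k * r\<^sub>0)) * of_real (bessel_J n (k * r))
                * exp (\<i> * of_int n * of_real (\<theta> - \<theta>\<^sub>0)))))"
proof -
  let ?T = "(k * R)\<^sup>2 / 4"
  note R = \<open>R > 0\<close> and k = \<open>k > 0\<close>
  have T: "?T > 0" using R k by simp
  have nz: "clifford_trace \<alpha> R clifford_J n ?T \<noteq> 0" for n
  proof
    assume z: "clifford_trace \<alpha> R clifford_J n ?T = 0"
    have "BJ (int n) = 0"
      unfolding BJ_def robin_trace_bessel_J[OF k R] unfolding bessel_J_eq cyl_trace[OF R] z by simp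
    then show False using \<open>\<forall>n. BJ n \<noteq> 0\<close> by blast
  qed
  define b where "b n = BH n / BJ n" for n
  have ratio: "b (int n) = 1 + \<i> * of_real (clifford_trace \<alpha> R clifford_Y n ?T / clifford_trace \<alpha> R clifford_J n ?T)" for n
    unfolding b_def BH_def BJ_def by (rule robin_trace_ratio[OF k R nz])
  have b_minus: "b (- int n) = b (int n)" for n
    unfolding b_def BH_def BJ_def robin_trace_uminus[OF k R] by simp
  obtain C where C: "\<And>n. norm (b (int n)) \<le> C * (real n + 1) * (fact n)\<^sup>2 / ?T ^ n"
    using clifford_trace_ratio_bound[OF T R \<open>\<alpha> > 0\<close> nz] unfolding ratio by blast
  have r0: "r\<^sub>0 < R"
    using \<open>x\<^sub>0 \<in> ball 0 R\<close> \<open>r\<^sub>0 \<ge> 0\<close> unfolding \<open>x\<^sub>0 = polar r\<^sub>0 \<theta>\<^sub>0\<close> by simp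
  interpret robin_part k R r\<^sub>0 \<theta>\<^sub>0 "\<lambda>n. b (int n)" C \<alpha>
  proof
    fix n
    have "(2 / (k * R)) ^ (2 * n) = 1 / ?T ^ n"
      using R k by (simp add: power_mult power_divide power_mult_distrib)
    then show "norm (b (int n)) \<le> C * (real n + 1) * (fact n)\<^sup>2 * (2 / (k * R)) ^ (2 * n)"
      using C[of n] by simp
    show "robin_trace \<alpha> R (\<lambda>r. of_real (bessel_J (int n) (k * r))) \<noteq> 0"
      using \<open>\<forall>n. BJ n \<noteq> 0\<close> unfolding BJ_def by blast
    show "b (int n) = robin_trace \<alpha> R (\<lambda>r. hankel1 (int n) (k * r)) / robin_trace \<alpha> R (\<lambda>r. of_real (bessel_J (int n) (k * r)))"
      unfolding b_def BH_def BJ_def ..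
  qed (fact R k r0 \<open>r\<^sub>0 \<ge> 0\<close>)+
  have formula: "(\<lambda>n. b n * of_real (bessel_J n (k * r\<^sub>0)) * of_real (bessel_J n (k * r)) * exp (\<i> * of_int n * of_real (\<theta> - \<theta>\<^sub>0))) summable_on UNIV \<and>
      G (polar r \<theta>) = \<i> / 4 * hankel1 0 (k * norm (polar r \<theta> - x\<^sub>0))
        - \<i> / 4 * (\<Sum>\<^sub>\<infinity>n. b n * of_real (bessel_J n (k * r\<^sub>0)) * of_real (bessel_J n (k * r)) * exp (\<i> * of_int n * of_real (\<theta> - \<theta>\<^sub>0)))"
    if G: "robin_green_function R k \<alpha> x\<^sub>0 G" and r: "0 \<le> r" "r \<le> R" "polar r \<theta> \<noteq> x\<^sub>0" for G r \<theta>
  proof -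
    have p: "polar r \<theta> \<in> cball 0 R - {x\<^sub>0}" using r by simp
    have eq: "G (polar r \<theta>) = green (polar r \<theta>)"
      by (rule robin_green_function_unique[OF k R \<open>x\<^sub>0 \<in> ball 0 R\<close> trace_J G _ p])
        (unfold \<open>x\<^sub>0 = polar r\<^sub>0 \<theta>\<^sub>0\<close>, rule green_robin)
    have sum: "((\<lambda>n. b n * of_real (bessel_J n (k * r\<^sub>0)) * of_real (bessel_J n (k * r)) * exp (\<i> * of_int n * of_real (\<theta> - \<theta>\<^sub>0))) has_sum regular (polar r \<theta>)) UNIV"
      by (rule regular_has_sum[OF r(1,2) refl b_minus])
    show ?thesis
      unfolding eq green_def point_source_def infsumI[OF sum] \<open>x\<^sub>0 = polar r\<^sub>0 \<theta>\<^sub>0\<close>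
      using has_sum_imp_summable[OF sum] by simp
  qed
  show ?thesis
  proof (intro conjI allI impI)
    show "BJ n = of_real ((\<alpha> + of_int n / R) * bessel_J n (k * R) - k * bessel_J (n + 1) (k * R))" for n
      unfolding BJ_def by (rule robin_trace_bessel_J[OF k R])
    show "BH n = of_real (\<alpha> + of_int n / R) * hankel1 n (k * R) - of_real k * hankel1 (n + 1) (k * R)" for n
      unfolding BH_def by (rule robin_trace_hankel1[OF k R])
    show "\<exists>G. robin_green_function R k \<alpha> x\<^sub>0 G"
      unfolding \<open>x\<^sub>0 = polar r\<^sub>0 \<theta>\<^sub>0\<close> using green_robin by blast
  next
    fix G r \<theta>
    assume "robin_green_function R k \<alpha> x\<^sub>0 G" "0 \<le> r \<and> r \<le> R \<and> polar r \<theta> \<noteq> x\<^sub>0"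
    then show "(\<lambda>n. BH n / BJ n * of_real (bessel_J n (k * r\<^sub>0)) * of_real (bessel_J n (k * r))
                * exp (\<i> * of_int n * of_real (\<theta> - \<theta>\<^sub>0))) summable_on UNIV"
      "G (polar r \<theta>) = \<i> / 4 * hankel1 0 (k * norm (polar r \<theta> - x\<^sub>0))
             - \<i> / 4 * (\<Sum>\<^sub>\<infinity>n. BH n / BJ n * of_real (bessel_J n (k * r\<^sub>0)) * of_real (bessel_J n (k * r))
                * exp (\<i> * of_int n * of_real (\<theta> - \<theta>\<^sub>0)))"
      using formula[of G r \<theta>] unfolding b_def by blast+
  qed
qed

end
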